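(* (1) Consider all graphings of the form $$\mathbf C_T^{\oplus(\lambda_i)_i}:=\bigoplus_{i=1}^k\lambda_i\mathbf C_T,\qquad k\ge 1,\ \lambda_i>0,\ \sum_{i=1}^k\lambda_i=1,$$ where $T$ is an ergodic invertible measure-preserving transformation of an infinite standard probability space $(X,\mu)$. All of these graphings (for varying $T$, $(X,\mu)$, $k$ and $(\lambda_i)$) are mutually local-global equivalent, and $$\mathrm{Aut}\left(\mathbf C_T^{\oplus(\lambda_i)_i}\right)\cong \mathrm{Aut}^{\pm}(T)\wr \mathrm{Aut}(\lambda_i)_{1\le i\le k},\qquad \mathrm{Aut}^{\pm}(T):=\{S\in\mathrm{Aut}(X,\mu)\ :\ STS^{-1}=T^{\pm1}\}.$$ (2) In particular, all graphings $$\mathbb G_a^{\oplus(\lambda_i)_i}:=\bigoplus_{i=1}^k\lambda_i\mathbb G_a,\qquad k\ge 1,\ \lambda_i>0,\ \sum_{i=1}^k\lambda_i=1,$$ where $\mathbb G$ is an infinite metrizable compact group and $a\in\mathbb G$ is a topological generator, are mutually local-global equivalent, and $$\mathrm{Aut}\left(\mathbb G_a^{\oplus(\lambda_i)_i}\right)\cong(\mathbb G\rtimes\mathbb Z/2)\wr\mathrm{Aut}(\lambda_i)_{1\le i\le k},$$ with $\mathbb Z/2$ acting on the (necessarily abelian) group $\mathbb G$ by inversion $g\mapsto g^{-1}$. (3) Two automorphism groups as in (2), say for data $(\mathbb G,a,(\lambda_i)_{1\le i\le k})$ and $(\mathbb G',a',(\lambda'_i)_{1\le i\le k'})$, are non-isomorphic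 as abstract groups whenever $\mathbb G_0^{k}$ and $(\mathbb G'_0)^{k'}$ are non-isomorphic as abstract groups, where $\mathbb G_0$ denotes the identity component of $\mathbb G$. This happens, for instance, when $\mathbb G=\mathbb G'=\mathbb T^d$ is a fixed finite-dimensional torus ($d\ge 1$) and $k\ne k'$.
   Context: Standard probability space: a complete probability space isomorphic (mod null sets) to an interval with Lebesgue measure together with at most countably many point masses. It is infinite if it does not reduce, modulo null sets, to finitely many atoms. $\mathrm{Aut}(X,\mu)$ is the group of invertible measure-preserving transformations of $(X,\mu)$, identified when they agree almost everywhere. Graphing: a tuple $\Gamma=(V,\mathcal B,E,\mu)$ where $(V,\mathcal B,\mu)$ is a standard probability space and $E\subseteq V\times V$ is a Borel symmetric edge set making $(V,E)$ a loopless graph of bounded degree, such that for all $A,B\in\mathcal B$, $\int_A \sharp(x\to B)\,d\mu(x)=\int_B\sharp(y\to A)\,d\mu(y)$, where $\sharp(x\to B)$ is the number of edges from $x$ to points of $B$. The edge measure $\eta_\Gamma$ on $V\times V$ is determined by $\eta_\Gamma(A\times B)=\int_A\sharp(x\to B)\,d\mu(x)$. Automorphism of a graphing $\Gamma$: an automorphism of the measure algebra of $(\mathcal B,\mu)$ (equivalently, a $\mu$-preserving automorphism $\varphi$ of $V$, modulo null sets) with $(\varphi\times\varphi)_*\eta_\Gamma=\eta_\Gamma$. These form the group $\mathrm{Aut}(\Gamma)$. The symbol $\cong$ means isomorphism of abstract groups. $\mathbf C_T$: for an invertible measure-preserving $T$ on a standard probability space $(X,\mu)$ with $T\ne T^{-1}$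 almost everywhere (automatic for ergodic $T$ on an infinite space), $\mathbf C_T$ is the graphing on $(X,\mu)$ with edges joining $x$ and $Tx$ (after discarding a null set if necessary). $\mathbb G_a$: for a compact metrizable group $\mathbb G$ with Haar probability measure and $a\in\mathbb G$ with $a^2\neq 1$, $\mathbb G_a$ is the graphing on $\mathbb G$ with edges joining $g$ and $ag$. That is, $\mathbb G_a=\mathbf C_T$ for $T=$ left translation by $a$. An element $a$ is a topological generator if the powers of $a$ are dense in $\mathbb G$. Convex combination: for graphings $\Gamma_i=(V_i,\mathcal B_i,E_i,\mu_i)$ and weights $\lambda_i$ with sum $1$, $\bigoplus_i\lambda_i\Gamma_i$ is the disjoint union of the graphs, with measure $\sum_i\lambda_i\mu_i$ on $\bigsqcup_i V_i$. Wreath product: $\mathrm{Aut}(\lambda_i)_{1\le i\le k}$ is the group of permutations $\sigma$ of $\{1,\dots,k\}$ with $\lambda_{\sigma(i)}=\lambda_i$ for all $i$, and for a group $H$, $H\wr \mathrm{Aut}(\lambda_i)_{1\le i\le k}:=H^k\rtimes\mathrm{Aut}(\lambda_i)_{1\le i\le k}$, with the permutation group permuting the $k$ factors. Local-global equivalence: for a graphing $\Gamma$ and integers $r\ge 0$, $m\ge 1$, every measurable coloring $f:V\to\{1,\dots,m\}$ gives a probability distribution on the (finite) set of isomorphism classes of rooted $m$-colored graphs of radius $\le r$ with the relevant degree bound, namely the law of the colored $r$-neighborhood of a $\mu$-random vertex, rooted at that vertex. Let $Q_{\Gamma,r,m}$ be the set of all distributions so obtained as $f$ varies. Two graphings $\Gamma_1,\Gamma_2$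 are local-global equivalent (written $\Gamma_1\approx\Gamma_2$) if $Q_{\Gamma_1,r,m}$ and $Q_{\Gamma_2,r,m}$ have the same closure for all $r,m$. *)

theory Defs
  imports "HOL-Probability.Probability" "HOL-Algebra.Sym_Groups" "HOL-Algebra.Product_Groups"
begin

section \<open>Standard probability spaces and their automorphism groups\<close>

definition interval_with_atoms :: "real \<Rightarrow> (nat \<Rightarrow> real) \<Rightarrow> (real + nat) measure" where
  "interval_with_atoms c p =
     measure_of ({0..c} <+> {n. p n > 0})
       {A <+> B | A B. A \<in> sets lebesgue \<and> A \<subseteq> {0..c} \<and> B \<subseteq> {n. p n > 0}}
       (\<lambda>C. emeasure lebesgue (Inl -` C) + (\<Sum>n. ennreal (p n) * indicator (Inr -` C) n))"

definition isomorphic_mod_null :: "'a measure \<Rightarrow> 'b measure \<Rightarrow> bool" where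
  "isomorphic_mod_null M N \<longleftrightarrow>
     (\<exists>X\<in>sets M. \<exists>Y\<in>sets N. \<exists>f g.
        space M - X \<in> null_sets M \<and> space N - Y \<in> null_sets N \<and>
        f \<in> measurable (restrict_space M X) (restrict_space N Y) \<and>
        g \<in> measurable (restrict_space N Y) (restrict_space M X) \<and>
        (\<forall>x\<in>X. g (f x) = x) \<and> (\<forall>y\<in>Y. f (g y) = y) \<and>
        distr (restrict_space M X) (restrict_space N Y) f = restrict_space N Y)"

definition standard_prob_space :: "'a measure \<Rightarrow> bool" where
  "standard_prob_space M \<longleftrightarrow>
     prob_space M \<and> complete_measure M \<and>
     (\<exists>c p. isomorphic_mod_null M (interval_with_atoms c p))"

definition finitely_many_atoms :: "'a measure \<Rightarrow> bool" where
  "finitely_many_atoms M \<longleftrightarrow> (\<exists>F. finite F \<and> (AE x in M. x \<in> F))"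

text \<open>A transformation is represented by a measurable map that is invertible only up to null
  sets. Elements of the automorphism group are the classes of such maps under almost everywhere
  equality.\<close>

definition inv_mpt :: "'a measure \<Rightarrow> ('a \<Rightarrow> 'a) \<Rightarrow> bool" where
  "inv_mpt M T \<longleftrightarrow>
     T \<in> measurable M M \<and> distr M M T = M \<and>
     (\<exists>S. S \<in> measurable M M \<and> distr M M S = M \<and>
          (AE x in M. S (T x) = x) \<and> (AE x in M. T (S x) = x))"

definition aut_class :: "'a measure \<Rightarrow> ('a \<Rightarrow> 'a) \<Rightarrow> ('a \<Rightarrow> 'a) set" where
  "aut_class M T = {S. inv_mpt M S \<and> (AE x in M. S x = T x)}"

definition aut_group :: "'a measure \<Rightarrow> ('a \<Rightarrow> 'a) set monoid" where
  "aut_group M =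
     \<lparr>carrier = {aut_class M T | T. inv_mpt M T},
      monoid.mult = (\<lambda>A B. \<Union>S\<in>A. \<Union>T\<in>B. aut_class M (S \<circ> T)),
      one = aut_class M id\<rparr>"

definition aut_pm :: "'a measure \<Rightarrow> ('a \<Rightarrow> 'a) \<Rightarrow> ('a \<Rightarrow> 'a) set monoid" where
  "aut_pm M T = (let A = aut_group M; t = aut_class M T in
     A\<lparr>carrier := {s \<in> carrier A. s \<otimes>\<^bsub>A\<^esub> t \<otimes>\<^bsub>A\<^esub> inv\<^bsub>A\<^esub> s = t \<or>
                                  s \<otimes>\<^bsub>A\<^esub> t \<otimes>\<^bsub>A\<^esub> inv\<^bsub>A\<^esub> s = inv\<^bsub>A\<^esub> t}\<rparr>)"

definition ergodic :: "'a measure \<Rightarrow> ('a \<Rightarrow> 'a) \<Rightarrow> bool" where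
  "ergodic M T \<longleftrightarrow>
     (\<forall>A\<in>sets M. (AE x in M. T x \<in> A \<longleftrightarrow> x \<in> A) \<longrightarrow> measure M A = 0 \<or> measure M A = 1)"

definition ergodic_system :: "'a measure \<Rightarrow> ('a \<Rightarrow> 'a) \<Rightarrow> bool" where
  "ergodic_system M T \<longleftrightarrow>
     standard_prob_space M \<and> \<not> finitely_many_atoms M \<and> inv_mpt M T \<and> ergodic M T"

section \<open>Graphings\<close>

record 'v graphing =
  vmeasure :: "'v measure"
  edges :: "('v \<times> 'v) set"

definition edges_to :: "'v graphing \<Rightarrow> 'v \<Rightarrow> 'v set \<Rightarrow> nat" where
  "edges_to \<Gamma> x B = card {y \<in> B. (x, y) \<in> edges \<Gamma>}"

text \<open>Borel means membership in the product sigma-algebra, which is not completed: an edge set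
  of bounded degree is a null set of the product measure, so membership in the completion would
  be no condition. The integrals in the definition presuppose that the counting functions are
  measurable; this is made explicit, as the integral operator also accepts
  non-measurable functions.\<close>

definition is_graphing :: "'v graphing \<Rightarrow> bool" where
  "is_graphing \<Gamma> \<longleftrightarrow> (let M = vmeasure \<Gamma>; V = space M; E = edges \<Gamma> in
     standard_prob_space M \<and>
     E \<in> sets (M \<Otimes>\<^sub>M M) \<and> sym E \<and> irrefl E \<and>
     (\<exists>D. \<forall>x\<in>V. finite (E `` {x}) \<and> card (E `` {x}) \<le> D) \<and>
     (\<forall>B\<in>sets M. (\<lambda>x. edges_to \<Gamma> x B) \<in> measurable M (count_space UNIV)) \<and>
     (\<forall>A\<in>sets M. \<forall>B\<in>sets M.
        (\<integral>\<^sup>+x\<in>A. of_nat (edges_to \<Gamma> x B) \<partial>M) = (\<integral>\<^sup>+y\<in>B. of_nat (edges_to \<Gamma> y A) \<partial>M)))"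

definition edge_measure :: "'v graphing \<Rightarrow> ('v \<times> 'v) measure" where
  "edge_measure \<Gamma> = (let M = vmeasure \<Gamma> in
     THE \<eta>. sets \<eta> = sets (M \<Otimes>\<^sub>M M) \<and>
       (\<forall>A\<in>sets M. \<forall>B\<in>sets M.
          emeasure \<eta> (A \<times> B) = (\<integral>\<^sup>+x\<in>A. of_nat (edges_to \<Gamma> x B) \<partial>M)))"

definition aut_graphing :: "'v graphing \<Rightarrow> ('v \<Rightarrow> 'v) set monoid" where
  "aut_graphing \<Gamma> = (let M = vmeasure \<Gamma> in
     (aut_group M)\<lparr>carrier :=
        {aut_class M \<phi> | \<phi>. inv_mpt M \<phi> \<and>
           distr (edge_measure \<Gamma>) (M \<Otimes>\<^sub>M M) (map_prod \<phi> \<phi>) = edge_measure \<Gamma>}\<rparr>)"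

text \<open>The graphing of a transformation \<open>T\<close>, with vertices restricted to the set \<open>X\<close>. A set \<open>X\<close>
  whose complement is null may be used when this is a graphing. Since \<open>T\<close> is only defined up to
  null sets, some choices of \<open>X\<close> may fail this, for instance when \<open>X\<close> contains fixed points.\<close>

definition cycle_graphing :: "'a measure \<Rightarrow> ('a \<Rightarrow> 'a) \<Rightarrow> 'a set \<Rightarrow> 'a graphing" where
  "cycle_graphing M T X =
     \<lparr>vmeasure = restrict_space M X, edges = {(x, y) \<in> X \<times> X. y = T x \<or> x = T y}\<rparr>"

definition admissible :: "'a measure \<Rightarrow> ('a \<Rightarrow> 'a) \<Rightarrow> 'a set \<Rightarrow> bool" where
  "admissible M T X \<longleftrightarrow>
     X \<in> sets M \<and> space M - X \<in> null_sets M \<and> is_graphing (cycle_graphing M T X)"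

definition weights :: "nat \<Rightarrow> (nat \<Rightarrow> real) \<Rightarrow> bool" where
  "weights k lam \<longleftrightarrow> k \<ge> 1 \<and> (\<forall>i\<in>{1..k}. lam i > 0) \<and> (\<Sum>i=1..k. lam i) = 1"

definition convex_measure ::
    "nat \<Rightarrow> (nat \<Rightarrow> real) \<Rightarrow> (nat \<Rightarrow> 'v measure) \<Rightarrow> (nat \<times> 'v) measure" where
  "convex_measure k lam M =
     measure_of (SIGMA i:{1..k}. space (M i))
       {A. A \<subseteq> (SIGMA i:{1..k}. space (M i)) \<and> (\<forall>i\<in>{1..k}. Pair i -` A \<in> sets (M i))}
       (\<lambda>A. \<Sum>i=1..k. ennreal (lam i) * emeasure (M i) (Pair i -` A))"

definition convex_combination ::
    "nat \<Rightarrow> (nat \<Rightarrow> real) \<Rightarrow> (nat \<Rightarrow> 'v graphing) \<Rightarrow> (nat \<times> 'v) graphing" where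
  "convex_combination k lam \<Gamma> =
     \<lparr>vmeasure = convex_measure k lam (\<lambda>i. vmeasure (\<Gamma> i)),
      edges = {((i, x), (i, y)) | i x y. i \<in> {1..k} \<and> (x, y) \<in> edges (\<Gamma> i)}\<rparr>"

section \<open>Local-global equivalence\<close>

record 'v rooted_colored_graph =
  rverts :: "'v set"
  redges :: "('v \<times> 'v) set"
  rroot :: 'v
  rcolor :: "'v \<Rightarrow> nat"

definition rcg_isomorphic :: "'v rooted_colored_graph \<Rightarrow> 'w rooted_colored_graph \<Rightarrow> bool" where
  "rcg_isomorphic G H \<longleftrightarrow>
     (\<exists>h. bij_betw h (rverts G) (rverts H) \<and> h (rroot G) = rroot H \<and>
        (\<forall>x\<in>rverts G. rcolor H (h x) = rcolor G x) \<and>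
        (\<forall>x\<in>rverts G. \<forall>y\<in>rverts G. (h x, h y) \<in> redges H \<longleftrightarrow> (x, y) \<in> redges G))"

definition colored_ball ::
    "'v graphing \<Rightarrow> ('v \<Rightarrow> nat) \<Rightarrow> nat \<Rightarrow> 'v \<Rightarrow> 'v rooted_colored_graph" where
  "colored_ball \<Gamma> f r v = (let B = {u. \<exists>n\<le>r. (v, u) \<in> edges \<Gamma> ^^ n} in
     \<lparr>rverts = B, redges = edges \<Gamma> \<inter> B \<times> B, rroot = v, rcolor = f\<rparr>)"

text \<open>The isomorphism class of a finite graph is represented by the set of all graphs on sets of
  natural numbers isomorphic to it.\<close>

definition ball_class ::
    "'v graphing \<Rightarrow> ('v \<Rightarrow> nat) \<Rightarrow> nat \<Rightarrow> 'v \<Rightarrow> nat rooted_colored_graph set" where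
  "ball_class \<Gamma> f r v = {H. rcg_isomorphic (colored_ball \<Gamma> f r v) H}"

definition Q_set ::
    "'v graphing \<Rightarrow> nat \<Rightarrow> nat \<Rightarrow> (nat rooted_colored_graph set \<Rightarrow> real) set" where
  "Q_set \<Gamma> r m = (let M = vmeasure \<Gamma> in
     {(\<lambda>c. measure M {v \<in> space M. ball_class \<Gamma> f r v = c}) | f.
        f \<in> measurable M (count_space {1..m})})"

text \<open>The closures are taken in the product topology. The distributions of a graphing with
  degrees at most \<open>D\<close> vanish outside the finitely many classes with degree bound \<open>D\<close>, so
  this is the closure in a finite-dimensional simplex.\<close>

definition local_global_equivalent :: "'v graphing \<Rightarrow> 'w graphing \<Rightarrow> bool" where
  "local_global_equivalent \<Gamma> \<Delta> \<longleftrightarrow>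
     (\<forall>r. \<forall>m\<ge>1. closure (Q_set \<Gamma> r m) = closure (Q_set \<Delta> r m))"

section \<open>Wreath products\<close>

definition semidirect_product ::
    "('n, 'x) monoid_scheme \<Rightarrow> ('q, 'y) monoid_scheme \<Rightarrow> ('q \<Rightarrow> 'n \<Rightarrow> 'n) \<Rightarrow> ('n \<times> 'q) monoid" where
  "semidirect_product N Q \<theta> =
     \<lparr>carrier = carrier N \<times> carrier Q,
      monoid.mult = (\<lambda>(n, q) (n', q'). (n \<otimes>\<^bsub>N\<^esub> \<theta> q n', q \<otimes>\<^bsub>Q\<^esub> q')),
      one = (\<one>\<^bsub>N\<^esub>, \<one>\<^bsub>Q\<^esub>)\<rparr>"

definition weight_aut :: "nat \<Rightarrow> (nat \<Rightarrow> real) \<Rightarrow> (nat \<Rightarrow> nat) monoid" where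
  "weight_aut k lam =
     (sym_group k)\<lparr>carrier := {\<sigma> \<in> carrier (sym_group k). \<forall>i\<in>{1..k}. lam (\<sigma> i) = lam i}\<rparr>"

definition group_power :: "('h, 'x) monoid_scheme \<Rightarrow> nat \<Rightarrow> (nat \<Rightarrow> 'h) monoid" where
  "group_power H k = product_group {1..k} (\<lambda>_. H)"

definition wreath ::
    "('h, 'x) monoid_scheme \<Rightarrow> nat \<Rightarrow> (nat \<Rightarrow> real) \<Rightarrow> ((nat \<Rightarrow> 'h) \<times> (nat \<Rightarrow> nat)) monoid" where
  "wreath H k lam =
     semidirect_product (group_power H k) (weight_aut k lam)
       (\<lambda>\<sigma> f. \<lambda>i\<in>{1..k}. f (inv_into UNIV \<sigma> i))"

section \<open>Compact groups\<close>

definition compact_metrizable_group :: "'g monoid \<Rightarrow> 'g topology \<Rightarrow> bool" where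
  "compact_metrizable_group G \<tau> \<longleftrightarrow>
     group G \<and> topspace \<tau> = carrier G \<and> compact_space \<tau> \<and> metrizable_space \<tau> \<and>
     continuous_map (prod_topology \<tau> \<tau>) \<tau> (\<lambda>(x, y). x \<otimes>\<^bsub>G\<^esub> y) \<and>
     continuous_map \<tau> \<tau> (\<lambda>x. inv\<^bsub>G\<^esub> x)"

definition haar_prob :: "'g monoid \<Rightarrow> 'g topology \<Rightarrow> 'g measure \<Rightarrow> bool" where
  "haar_prob G \<tau> \<mu> \<longleftrightarrow>
     prob_space \<mu> \<and> space \<mu> = topspace \<tau> \<and>
     sets \<mu> = sigma_sets (topspace \<tau>) {U. openin \<tau> U} \<and>
     (\<forall>g\<in>carrier G. distr \<mu> \<mu> (\<lambda>x. g \<otimes>\<^bsub>G\<^esub> x) = \<mu>)"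

definition topological_generator :: "'g monoid \<Rightarrow> 'g topology \<Rightarrow> 'g \<Rightarrow> bool" where
  "topological_generator G \<tau> a \<longleftrightarrow>
     a \<in> carrier G \<and> \<tau> closure_of (range (\<lambda>n::int. a [^]\<^bsub>G\<^esub> n)) = topspace \<tau>"

definition monothetic_data :: "'g monoid \<Rightarrow> 'g topology \<Rightarrow> 'g measure \<Rightarrow> 'g \<Rightarrow> bool" where
  "monothetic_data G \<tau> \<mu> a \<longleftrightarrow>
     compact_metrizable_group G \<tau> \<and> infinite (carrier G) \<and> haar_prob G \<tau> \<mu> \<and>
     topological_generator G \<tau> a"

text \<open>The Haar measure on the Borel sets is completed, since standard probability spaces are
  complete.\<close>

definition group_graphing :: "'g monoid \<Rightarrow> 'g measure \<Rightarrow> 'g \<Rightarrow> 'g graphing" where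
  "group_graphing G \<mu> a = cycle_graphing (completion \<mu>) (\<lambda>g. a \<otimes>\<^bsub>G\<^esub> g) (carrier G)"

definition inversion_extension :: "'g monoid \<Rightarrow> ('g \<times> int) monoid" where
  "inversion_extension G =
     semidirect_product G (integer_mod_group 2) (\<lambda>e g. if e = 0 then g else inv\<^bsub>G\<^esub> g)"

definition identity_component :: "'g monoid \<Rightarrow> 'g topology \<Rightarrow> 'g monoid" where
  "identity_component G \<tau> = G\<lparr>carrier := connected_component_of_set \<tau> \<one>\<^bsub>G\<^esub>\<rparr>"

definition circle_group :: "complex monoid" where
  "circle_group = \<lparr>carrier = sphere 0 1, monoid.mult = (*), one = 1\<rparr>"

definition torus_group :: "nat \<Rightarrow> (nat \<Rightarrow> complex) monoid" where
  "torus_group d = product_group {..<d} (\<lambda>_. circle_group)"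

definition torus_topology :: "nat \<Rightarrow> (nat \<Rightarrow> complex) topology" where
  "torus_topology d = product_topology (\<lambda>_. top_of_set (sphere 0 1)) {..<d}"

end

theory Submission
  imports Defs "HOL-Algebra.Multiplicative_Group"
begin

text \<open>All graphings in question are, up to null sets, disjoint unions of the graphings of one free
  ergodic transformation \<open>T\<close>, with a real function separating the points of a conull invariant set.

  For local-global equivalence, a colouring of one graphing yields shift invariant statistics
  of coloured words along orbits. Cutting the base of a Rokhlin tower of the other transformation
  into pieces indexed by words reproduces these statistics up to \<open>\<epsilon>\<close>, in the same way on
  every component.

  An automorphism \<open>\<phi>\<close> preserves adjacency almost everywhere, so \<open>\<phi> (T x)\<close> is \<open>T (\<phi> x)\<close> or
  \<open>T\<inverse> (\<phi> x)\<close>. The index of the component containing \<open>\<phi> x\<close> and the choice of the sign are invariant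
  under \<open>T\<close>, hence constant on each component; this gives the wreath product.

  For a translation of a monothetic group, invariance under the generator determines the Haar
  measure, which gives ergodicity. A map \<open>S\<close> commuting with the translation up to sign differs from
  the identity or the inversion by an invariant, hence constant, function.

  The identity component of a monothetic group consists of the infinitely divisible elements, and
  the infinitely divisible elements of the wreath product are those of the base group with trivial
  sign. So the wreath product determines the power of the identity component. Powers of tori
  are distinguished by the number of elements of order two.\<close>

section \<open>Automorphism groups of measure spaces\<close>

text \<open>Every graphing passes through the locale \<open>ergodic_graph\<close>: a conull
  invariant set \<open>G\<close> on which \<open>T\<close> is free with inverse \<open>S\<close>,
  and a real function \<open>u\<close> injective on \<open>G\<close>. The function \<open>u\<close>
  is forced by the edge sigma-algebra, the uncompleted product, in which the graph of a measurable
  map may fail to be measurable; \<open>u\<close> turns an equation between points into an equation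
  between measurable real functions. It also makes group-valued invariants accessible to ergodicity,
  which yields constancy of real functions. The second obstacle is that maps are inverted only
  almost everywhere and that a vertex set may contain a null set of points with irregular edges.
  Group elements are therefore handled through chosen representatives compared almost everywhere.
  The sign of an automorphism is invariant because of injectivity: a change of sign between a point
  and its successor would fold the orbit back onto itself. The third part works because infinite
  divisibility depends on the multiplication alone, so it is visible to abstract isomorphisms
  although the identity component is a topological object.\<close>

lemma inv_mptD:
  assumes "inv_mpt M T"
  shows "T \<in> measurable M M" "distr M M T = M"
  using assms by (auto simp: inv_mpt_def)

text \<open>Preimages of null sets are null; the form with bare measure preservation is the one
  applied to iterates.\<close>

lemma mpt_AE:
  assumes "T \<in> measurable M M" "distr M M T = M" "AE x in M. P x"
  shows "AE x in M. P (T x)"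
  by (rule AE_distrD[OF assms(1)]) (simp only: assms(2,3))

lemma inv_mpt_AE: "inv_mpt M T \<Longrightarrow> AE x in M. P x \<Longrightarrow> AE x in M. P (T x)"
  using mpt_AE by (blast dest: inv_mptD)

lemma inv_mpt_inverse:
  assumes "inv_mpt M T"
  obtains S where "inv_mpt M S" "AE x in M. S (T x) = x" "AE x in M. T (S x) = x"
  using assms unfolding inv_mpt_def by blast

lemma inv_mptI:
  assumes "T \<in> measurable M M" "distr M M T = M" "S \<in> measurable M M" "distr M M S = M"
    "AE x in M. S (T x) = x" "AE x in M. T (S x) = x"
  shows "inv_mpt M T"
  using assms unfolding inv_mpt_def by blast

lemma inv_mpt_id: "inv_mpt M id"
  by (rule inv_mptI[where S=id]) (auto simp: id_def distr_id2)

lemma inv_mpt_comp: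
  assumes S: "inv_mpt M S" and T: "inv_mpt M T"
  shows "inv_mpt M (S \<circ> T)"
proof -
  obtain S' where S': "inv_mpt M S'" "AE x in M. S' (S x) = x" "AE x in M. S (S' x) = x"
    using S inv_mpt_inverse by blast
  obtain T' where T': "inv_mpt M T'" "AE x in M. T' (T x) = x" "AE x in M. T (T' x) = x"
    using T inv_mpt_inverse by blast
  note m = inv_mptD[OF S] inv_mptD[OF T] inv_mptD[OF S'(1)] inv_mptD[OF T'(1)]
  show ?thesis
  proof (rule inv_mptI[where S="T' \<circ> S'"])
    show "S \<circ> T \<in> measurable M M" "T' \<circ> S' \<in> measurable M M"
      using m by (auto intro: measurable_comp)
    show "distr M M (S \<circ> T) = M" "distr M M (T' \<circ> S') = M"
      using m by (auto simp flip: distr_distr)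
    show "AE x in M. (T' \<circ> S') ((S \<circ> T) x) = x"
      using inv_mpt_AE[OF T S'(2)] T'(2) by eventually_elim simp
    show "AE x in M. (S \<circ> T) ((T' \<circ> S') x) = x"
      using inv_mpt_AE[OF S'(1) T'(3)] S'(3) by eventually_elim simp
  qed
qed

text \<open>A modification on a null set keeps the same inverse modulo null sets. This justifies
  redefining \<open>T\<close> as the identity off a good set.\<close>

lemma inv_mpt_cong_AE:
  assumes "inv_mpt M T" "T' \<in> measurable M M" "AE x in M. T' x = T x"
  shows "inv_mpt M T'"
proof -
  obtain S where S: "inv_mpt M S" "AE x in M. S (T x) = x" "AE x in M. T (S x) = x"
    using assms inv_mpt_inverse by blast
  have "distr M M T' = distr M M T"
    using assms inv_mptD by (intro distr_cong_AE) auto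
  moreover have "AE x in M. S (T' x) = x" using assms(3) S(2) by eventually_elim simp
  moreover have "AE x in M. T' (S x) = x"
    using inv_mpt_AE[OF S(1) assms(3)] S(3) by eventually_elim simp
  ultimately show ?thesis
    using assms inv_mptD S(1) by (intro inv_mptI[where S=S]) auto
qed

lemma aut_class_self: "inv_mpt M T \<Longrightarrow> T \<in> aut_class M T"
  by (simp add: aut_class_def)

lemma aut_class_eq_iff:
  assumes "inv_mpt M S"
  shows "aut_class M S = aut_class M T \<longleftrightarrow> (AE x in M. S x = T x)"
proof
  assume "aut_class M S = aut_class M T"
  then show "AE x in M. S x = T x" using aut_class_self[OF assms] by (auto simp: aut_class_def)
next
  assume e: "AE x in M. S x = T x"
  have "(AE x in M. f x = S x) \<longleftrightarrow> (AE x in M. f x = T x)" for f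
  proof
    assume "AE x in M. f x = S x"
    then show "AE x in M. f x = T x" using e by eventually_elim simp
  next
    assume "AE x in M. f x = T x"
    then show "AE x in M. f x = S x" using e by eventually_elim simp
  qed
  then show "aut_class M S = aut_class M T" by (auto simp: aut_class_def)
qed

text \<open>The product is a union over all pairs of representatives. Other representatives change
  \<open>S \<circ> T\<close> on a null set only, because the exceptional set of the left factor is
  pulled back along the measure-preserving right factor; so all sets in the union coincide.\<close>

lemma aut_class_mult:
  assumes S: "inv_mpt M S" and T: "inv_mpt M T"
  shows "aut_class M S \<otimes>\<^bsub>aut_group M\<^esub> aut_class M T = aut_class M (S \<circ> T)"
proof -
  have "aut_class M (S' \<circ> T') = aut_class M (S \<circ> T)"
    if "S' \<in> aut_class M S" "T' \<in> aut_class M T" for S' T'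
  proof -
    have i: "inv_mpt M S'" "inv_mpt M T'" and e: "AE x in M. S' x = S x" "AE x in M. T' x = T x"
      using that by (auto simp: aut_class_def)
    have "AE x in M. (S' \<circ> T') x = (S \<circ> T) x"
      using inv_mpt_AE[OF i(2) e(1)] e(2) by eventually_elim simp
    then show ?thesis using i by (simp add: aut_class_eq_iff inv_mpt_comp)
  qed
  then have "(\<Union>S'\<in>aut_class M S. \<Union>T'\<in>aut_class M T. aut_class M (S' \<circ> T')) =
      (\<Union>S'\<in>aut_class M S. \<Union>T'\<in>aut_class M T. aut_class M (S \<circ> T))"
    by (intro SUP_cong refl)
  also have "\<dots> = aut_class M (S \<circ> T)"
    using aut_class_self[OF S] aut_class_self[OF T] by blast
  finally show ?thesis by (simp add: aut_group_def)
qed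

lemma aut_group_carrier: "carrier (aut_group M) = {aut_class M T | T. inv_mpt M T}"
  by (simp add: aut_group_def)

lemma aut_group_one: "\<one>\<^bsub>aut_group M\<^esub> = aut_class M id"
  by (simp add: aut_group_def)

lemma group_aut_group: "group (aut_group M)"
proof (rule groupI)
  show "x \<otimes>\<^bsub>aut_group M\<^esub> y \<in> carrier (aut_group M)"
    if "x \<in> carrier (aut_group M)" "y \<in> carrier (aut_group M)" for x y
    using that by (auto simp: aut_group_carrier aut_class_mult intro!: inv_mpt_comp)
  show "\<one>\<^bsub>aut_group M\<^esub> \<in> carrier (aut_group M)"
    by (auto simp: aut_group_carrier aut_group_one inv_mpt_id)
  show "x \<otimes>\<^bsub>aut_group M\<^esub> y \<otimes>\<^bsub>aut_group M\<^esub> z = x \<otimes>\<^bsub>aut_group M\<^esub> (y \<otimes>\<^bsub>aut_group M\<^esub> z)"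
    if "x \<in> carrier (aut_group M)" "y \<in> carrier (aut_group M)" "z \<in> carrier (aut_group M)" for x y z
    using that by (auto simp: aut_group_carrier aut_class_mult inv_mpt_comp comp_assoc)
  show "\<one>\<^bsub>aut_group M\<^esub> \<otimes>\<^bsub>aut_group M\<^esub> x = x" if "x \<in> carrier (aut_group M)" for x
    using that by (auto simp: aut_group_carrier aut_class_mult inv_mpt_id aut_group_one)
  show "\<exists>y\<in>carrier (aut_group M). y \<otimes>\<^bsub>aut_group M\<^esub> x = \<one>\<^bsub>aut_group M\<^esub>"
    if x: "x \<in> carrier (aut_group M)" for x
  proof -
    obtain T where T: "inv_mpt M T" "x = aut_class M T" using x by (auto simp: aut_group_carrier)
    obtain S where S: "inv_mpt M S" "AE x in M. S (T x) = x" using inv_mpt_inverse[OF T(1)] by blast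
    have "aut_class M (S \<circ> T) = aut_class M id"
      using S(2) by (subst aut_class_eq_iff) (auto intro: inv_mpt_comp S T)
    then show ?thesis
      using S(1) T by (intro bexI[of _ "aut_class M S"])
        (auto simp: aut_group_carrier aut_class_mult aut_group_one)
  qed
qed

lemma aut_group_inv:
  assumes "inv_mpt M T" "inv_mpt M S" "AE x in M. S (T x) = x"
  shows "inv\<^bsub>aut_group M\<^esub> aut_class M T = aut_class M S"
proof -
  interpret group "aut_group M" by (rule group_aut_group)
  have "aut_class M S \<otimes>\<^bsub>aut_group M\<^esub> aut_class M T = \<one>\<^bsub>aut_group M\<^esub>"
    using assms by (simp add: aut_class_mult aut_group_one aut_class_eq_iff inv_mpt_comp)
  then show ?thesis
    using assms by (intro inv_equality) (auto simp: aut_group_carrier)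
qed

text \<open>Conjugation is rewritten as a commutation relation of \<open>s\<close> with
  \<open>T\<close> and with \<open>T\<close> or its inverse \<open>S\<close>, which can be tested
  pointwise almost everywhere without an inverse of \<open>s\<close>.\<close>

lemma aut_pm_carrier:
  assumes T: "inv_mpt M T" and S: "inv_mpt M S" "AE x in M. S (T x) = x"
  shows "carrier (aut_pm M T) = {aut_class M s | s. inv_mpt M s \<and>
     ((AE x in M. s (T x) = T (s x)) \<or> (AE x in M. s (T x) = S (s x)))}"
proof -
  interpret A: group "aut_group M" by (rule group_aut_group)
  let ?c = "aut_class M"
  have conj: "?c s \<otimes>\<^bsub>aut_group M\<^esub> ?c T \<otimes>\<^bsub>aut_group M\<^esub> inv\<^bsub>aut_group M\<^esub> ?c s = ?c Q
      \<longleftrightarrow> (AE x in M. s (T x) = Q (s x))" if s: "inv_mpt M s" and Q: "inv_mpt M Q" for s Q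
  proof -
    have c: "?c s \<in> carrier (aut_group M)" "?c T \<in> carrier (aut_group M)" "?c Q \<in> carrier (aut_group M)"
      using s T Q by (auto simp: aut_group_carrier)
    have "?c s \<otimes>\<^bsub>aut_group M\<^esub> ?c T \<otimes>\<^bsub>aut_group M\<^esub> inv\<^bsub>aut_group M\<^esub> ?c s = ?c Q \<longleftrightarrow>
      ?c s \<otimes>\<^bsub>aut_group M\<^esub> ?c T = ?c Q \<otimes>\<^bsub>aut_group M\<^esub> ?c s"
      using c by (metis A.inv_closed A.inv_solve_right A.m_closed)
    also have "\<dots> \<longleftrightarrow> (AE x in M. s (T x) = Q (s x))"
      using s T Q by (simp add: aut_class_mult aut_class_eq_iff inv_mpt_comp)
    finally show ?thesis .
  qed
  show ?thesis
    unfolding aut_pm_def Let_def using conj[OF _ T] conj[OF _ S(1)]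
    by (auto simp: aut_group_inv[OF T S] aut_group_carrier)
qed

lemma aut_pm_mult: "(\<otimes>\<^bsub>aut_pm M T\<^esub>) = (\<otimes>\<^bsub>aut_group M\<^esub>)"
  by (simp add: aut_pm_def Let_def)

section \<open>Isomorphisms of structures closed under multiplication\<close>

text \<open>What inverting an isomorphism requires of its source; for \<open>aut_pm\<close> and for
  divisible parts it is the property that gets established.\<close>

definition mult_closed :: "('a, 'x) monoid_scheme \<Rightarrow> bool" where
  "mult_closed W \<longleftrightarrow> (\<forall>x\<in>carrier W. \<forall>y\<in>carrier W. x \<otimes>\<^bsub>W\<^esub> y \<in> carrier W)"

lemma iso_sym_closed:
  assumes "mult_closed G" "G \<cong> H"
  shows "H \<cong> G"
proof -
  obtain h where h: "h \<in> hom G H" "bij_betw h (carrier G) (carrier H)"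
    using assms by (auto simp: is_iso_def Group.iso_def)
  let ?g = "inv_into (carrier G) h"
  have b: "bij_betw ?g (carrier H) (carrier G)" using h by (simp add: bij_betw_inv_into)
  have "?g (x \<otimes>\<^bsub>H\<^esub> y) = ?g x \<otimes>\<^bsub>G\<^esub> ?g y" if "x \<in> carrier H" "y \<in> carrier H" for x y
  proof -
    have g: "?g x \<in> carrier G" "?g y \<in> carrier G" using b that by (auto simp: bij_betw_def)
    have "h (?g x \<otimes>\<^bsub>G\<^esub> ?g y) = x \<otimes>\<^bsub>H\<^esub> y"
      using h g that by (simp add: hom_mult f_inv_into_f bij_betw_def)
    then show ?thesis
      using assms(1) g h(2) by (auto simp: mult_closed_def bij_betw_def intro!: inv_into_f_eq)
  qed
  then have "?g \<in> Group.iso H G" using b by (auto simp: Group.iso_def hom_def bij_betw_def)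
  then show ?thesis by (rule is_isoI)
qed

text \<open>Isomorphisms onto groups of classes are obtained from maps into representatives that
  are multiplicative only almost everywhere.\<close>

lemma class_iso:
  assumes "\<And>w. w \<in> carrier W \<Longrightarrow> inv_mpt C (F w)"
    and "\<And>w w'. w \<in> carrier W \<Longrightarrow> w' \<in> carrier W \<Longrightarrow> AE x in C. F (w \<otimes>\<^bsub>W\<^esub> w') x = F w (F w' x)"
    and "\<And>w w'. w \<in> carrier W \<Longrightarrow> w' \<in> carrier W \<Longrightarrow> AE x in C. F w x = F w' x \<Longrightarrow> w = w'"
    and "mult_closed W"
    and "carrier H = (\<lambda>w. aut_class C (F w)) ` carrier W"
    and "(\<otimes>\<^bsub>H\<^esub>) = (\<otimes>\<^bsub>aut_group C\<^esub>)"
  shows "W \<cong> H"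
proof (rule is_isoI)
  show "(\<lambda>w. aut_class C (F w)) \<in> Group.iso W H"
    unfolding iso_iff
  proof (intro conjI)
    show "(\<lambda>w. aut_class C (F w)) \<in> hom W H"
      unfolding hom_def using assms(1,2,4,5,6)
      by (auto simp: aut_class_mult mult_closed_def aut_class_eq_iff)
    show "inj_on (\<lambda>w. aut_class C (F w)) (carrier W)"
      using assms(3) by (intro inj_onI) (simp add: assms(1) aut_class_eq_iff)
  qed (use assms(5) in auto)
qed

text \<open>Conjugation by a product is iterated conjugation, and conjugation commutes with
  inversion, so two elements sending \<open>t\<close> to \<open>t\<close> or to its inverse compose
  to another such element.\<close>

lemma (in group) mult_closed_conj_pm:
  assumes t: "t \<in> carrier G"
  shows "mult_closed (G\<lparr>carrier := {s \<in> carrier G. s \<otimes> t \<otimes> inv s = t \<or> s \<otimes> t \<otimes> inv s = inv t}\<rparr>)"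
proof -
  have conj: "(s \<otimes> r) \<otimes> t \<otimes> inv (s \<otimes> r) = s \<otimes> (r \<otimes> t \<otimes> inv r) \<otimes> inv s" if "s \<in> carrier G" "r \<in> carrier G" for s r
    using that t by (simp add: inv_mult_group m_assoc)
  have cinv: "s \<otimes> inv t \<otimes> inv s = inv (s \<otimes> t \<otimes> inv s)" if "s \<in> carrier G" for s
    using that t by (simp add: inv_mult_group m_assoc)
  show ?thesis
    unfolding mult_closed_def using t by (auto simp: conj cinv)
qed

lemma mult_closed_aut_pm:
  assumes "inv_mpt M T" shows "mult_closed (aut_pm M T)"
proof -
  have "aut_class M T \<in> carrier (aut_group M)" using assms by (auto simp: aut_group_carrier)
  then show ?thesis
    unfolding aut_pm_def Let_def using group.mult_closed_conj_pm[OF group_aut_group] by blast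
qed

section \<open>Wreath products\<close>

lemma wreath_carrier:
  "carrier (wreath H k lam) = (\<Pi>\<^sub>E i\<in>{1..k}. carrier H) \<times> {\<sigma>. \<sigma> permutes {1..k} \<and> (\<forall>i\<in>{1..k}. lam (\<sigma> i) = lam i)}"
  by (simp add: wreath_def semidirect_product_def group_power_def weight_aut_def sym_group_def)

lemma wreath_mult:
  "(f, \<sigma>) \<otimes>\<^bsub>wreath H k lam\<^esub> (g, \<tau>) = (\<lambda>i\<in>{1..k}. f i \<otimes>\<^bsub>H\<^esub> g (inv_into UNIV \<sigma> i), \<sigma> \<circ> \<tau>)"
  by (auto simp: wreath_def semidirect_product_def group_power_def weight_aut_def sym_group_def)

lemma wreath_one: "\<one>\<^bsub>wreath H k lam\<^esub> = (\<lambda>i\<in>{1..k}. \<one>\<^bsub>H\<^esub>, id)"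
  by (simp add: wreath_def semidirect_product_def group_power_def weight_aut_def sym_group_def)

lemma perm_inv_in: "\<sigma> permutes A \<Longrightarrow> i \<in> A \<Longrightarrow> inv_into UNIV \<sigma> i \<in> A"
  by (simp add: permutes_inv permutes_in_image)

lemma mult_closed_wreath:
  assumes "mult_closed H"
  shows "mult_closed (wreath H k lam)"
  unfolding mult_closed_def
proof (clarify, unfold wreath_mult)
  fix f \<sigma> g \<tau>
  assume a: "(f, \<sigma>) \<in> carrier (wreath H k lam)" "(g, \<tau>) \<in> carrier (wreath H k lam)"
  then have p: "\<sigma> permutes {1..k}" "\<tau> permutes {1..k}" and fg: "f \<in> (\<Pi>\<^sub>E i\<in>{1..k}. carrier H)" "g \<in> (\<Pi>\<^sub>E i\<in>{1..k}. carrier H)"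
    and l: "\<And>i. i \<in> {1..k} \<Longrightarrow> lam (\<sigma> i) = lam i" "\<And>i. i \<in> {1..k} \<Longrightarrow> lam (\<tau> i) = lam i"
    unfolding wreath_carrier by blast+
  have "f i \<otimes>\<^bsub>H\<^esub> g (inv_into UNIV \<sigma> i) \<in> carrier H" if "i \<in> {1..k}" for i
    using assms PiE_mem[OF fg(1) that] PiE_mem[OF fg(2) perm_inv_in[OF p(1) that]]
    by (simp add: mult_closed_def)
  moreover have "lam ((\<sigma> \<circ> \<tau>) i) = lam i" if "i \<in> {1..k}" for i
    using l that permutes_in_image[OF p(2)] by simp
  ultimately show "(\<lambda>i\<in>{1..k}. f i \<otimes>\<^bsub>H\<^esub> g (inv_into UNIV \<sigma> i), \<sigma> \<circ> \<tau>) \<in> carrier (wreath H k lam)"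
    unfolding wreath_carrier using permutes_compose[OF p(2,1)]
    by (auto simp only: mem_Sigma_iff mem_Collect_eq restrict_PiE_iff)
qed

lemma wreath_cong:
  assumes "H \<cong> H'"
  shows "wreath H k lam \<cong> wreath H' k lam"
proof -
  obtain h where h: "h \<in> hom H H'" "bij_betw h (carrier H) (carrier H')"
    using assms by (auto simp: is_iso_def Group.iso_def)
  let ?g = "inv_into (carrier H) h"
  have gh: "?g (h x) = x" "h x \<in> carrier H'" if "x \<in> carrier H" for x
    using that h by (auto simp: bij_betw_def)
  have hg: "h (?g x) = x" "?g x \<in> carrier H" if "x \<in> carrier H'" for x
    using that h by (auto simp: bij_betw_def f_inv_into_f inv_into_into)
  let ?h = "\<lambda>(f, \<sigma>). (\<lambda>i\<in>{1..k}. h (f i), \<sigma>)" and ?g' = "\<lambda>(f, \<sigma>). (\<lambda>i\<in>{1..k}. ?g (f i), \<sigma>)"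
  have "bij_betw ?h (carrier (wreath H k lam)) (carrier (wreath H' k lam))"
    unfolding wreath_carrier
  proof (rule bij_betw_byWitness[where f'="?g'"])
    have "(\<lambda>i\<in>{1..k}. ?g ((\<lambda>i\<in>{1..k}. h (f i)) i)) = f" if "f \<in> (\<Pi>\<^sub>E i\<in>{1..k}. carrier H)" for f
      using that gh by (intro ext) (simp add: PiE_iff extensional_def restrict_def)
    then show "\<forall>x\<in>(\<Pi>\<^sub>E i\<in>{1..k}. carrier H) \<times> {\<sigma>. \<sigma> permutes {1..k} \<and> (\<forall>i\<in>{1..k}. lam (\<sigma> i) = lam i)}. ?g' (?h x) = x"
      by (intro ballI) (elim SigmaE, simp only: prod.case)
    have "(\<lambda>i\<in>{1..k}. h ((\<lambda>i\<in>{1..k}. ?g (f i)) i)) = f" if "f \<in> (\<Pi>\<^sub>E i\<in>{1..k}. carrier H')" for f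
      using that hg by (intro ext) (simp add: PiE_iff extensional_def restrict_def)
    then show "\<forall>x\<in>(\<Pi>\<^sub>E i\<in>{1..k}. carrier H') \<times> {\<sigma>. \<sigma> permutes {1..k} \<and> (\<forall>i\<in>{1..k}. lam (\<sigma> i) = lam i)}. ?h (?g' x) = x"
      by (intro ballI) (elim SigmaE, simp only: prod.case)
  qed (use gh hg in \<open>force simp: PiE_iff\<close>)+
  moreover have "?h \<in> hom (wreath H k lam) (wreath H' k lam)"
    unfolding hom_def
  proof (intro CollectI conjI ballI)
    show "?h \<in> carrier (wreath H k lam) \<rightarrow> carrier (wreath H' k lam)"
      unfolding wreath_carrier using gh by (force simp: PiE_iff)
    fix x y assume xy: "x \<in> carrier (wreath H k lam)" "y \<in> carrier (wreath H k lam)"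
    obtain f \<sigma> g \<tau> where [simp]: "x = (f, \<sigma>)" "y = (g, \<tau>)" by (metis prod.exhaust)
    have p: "\<sigma> permutes {1..k}" and fg: "f \<in> (\<Pi>\<^sub>E i\<in>{1..k}. carrier H)" "g \<in> (\<Pi>\<^sub>E i\<in>{1..k}. carrier H)"
      using xy unfolding wreath_carrier by auto
    have "h (f i \<otimes>\<^bsub>H\<^esub> g (inv_into UNIV \<sigma> i)) = h (f i) \<otimes>\<^bsub>H'\<^esub> h (g (inv_into UNIV \<sigma> i))"
      if "i \<in> {1..k}" for i
      using PiE_mem[OF fg(1) that] PiE_mem[OF fg(2) perm_inv_in[OF p that]] h by (simp add: hom_mult)
    then show "?h (x \<otimes>\<^bsub>wreath H k lam\<^esub> y) = ?h x \<otimes>\<^bsub>wreath H' k lam\<^esub> ?h y"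
      using perm_inv_in[OF p] by (simp add: wreath_mult restrict_def fun_eq_iff)
  qed
  ultimately show ?thesis by (auto simp: is_iso_def Group.iso_def)
qed

lemma group_wreath:
  assumes "group H"
  shows "group (wreath H k lam)"
proof -
  interpret H: group H by fact
  let ?W = "wreath H k lam"
  have cl: "mult_closed ?W" by (rule mult_closed_wreath) (auto simp: mult_closed_def)
  show ?thesis
  proof (rule groupI)
    show "x \<otimes>\<^bsub>?W\<^esub> y \<in> carrier ?W" if "x \<in> carrier ?W" "y \<in> carrier ?W" for x y
      using cl that by (auto simp: mult_closed_def)
    show "\<one>\<^bsub>?W\<^esub> \<in> carrier ?W" by (auto simp: wreath_one wreath_carrier permutes_id)
    fix x y z assume x: "x \<in> carrier ?W" and y: "y \<in> carrier ?W" and z: "z \<in> carrier ?W"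
    obtain f \<sigma> g \<tau> h \<rho> where [simp]: "x = (f, \<sigma>)" "y = (g, \<tau>)" "z = (h, \<rho>)" by (metis prod.exhaust)
    have p: "\<sigma> permutes {1..k}" "\<tau> permutes {1..k}" using x y by (auto simp: wreath_carrier)
    have i: "inv_into UNIV (\<sigma> \<circ> \<tau>) j = inv_into UNIV \<tau> (inv_into UNIV \<sigma> j)" for j
      using p by (simp add: o_inv_distrib permutes_bij)
    have c: "f i \<in> carrier H" "g i \<in> carrier H" "h i \<in> carrier H" if "i \<in> {1..k}" for i
      using x y z that unfolding wreath_carrier by auto
    have "f i \<otimes>\<^bsub>H\<^esub> g (inv_into UNIV \<sigma> i) \<otimes>\<^bsub>H\<^esub> h (inv_into UNIV (\<sigma> \<circ> \<tau>) i)
      = f i \<otimes>\<^bsub>H\<^esub> (g (inv_into UNIV \<sigma> i) \<otimes>\<^bsub>H\<^esub> h (inv_into UNIV \<tau> (inv_into UNIV \<sigma> i)))"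
      if "i \<in> {1..k}" for i
      using c[OF that] c[OF perm_inv_in[OF p(1) that]]
        c[OF perm_inv_in[OF p(2) perm_inv_in[OF p(1) that]]] i by (simp add: H.m_assoc)
    then show "x \<otimes>\<^bsub>?W\<^esub> y \<otimes>\<^bsub>?W\<^esub> z = x \<otimes>\<^bsub>?W\<^esub> (y \<otimes>\<^bsub>?W\<^esub> z)"
      using perm_inv_in[OF p(1)] by (simp add: wreath_mult comp_assoc restrict_def fun_eq_iff)
  next
    fix x assume x: "x \<in> carrier ?W"
    obtain f \<sigma> where [simp]: "x = (f, \<sigma>)" by (metis prod.exhaust)
    have p: "\<sigma> permutes {1..k}" and f: "f \<in> (\<Pi>\<^sub>E i\<in>{1..k}. carrier H)"
      and l: "\<And>i. i \<in> {1..k} \<Longrightarrow> lam (\<sigma> i) = lam i"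
      using x unfolding wreath_carrier by auto
    show "\<one>\<^bsub>?W\<^esub> \<otimes>\<^bsub>?W\<^esub> x = x"
      using f by (auto simp: wreath_mult wreath_one PiE_iff fun_eq_iff extensional_def inv_id)
    have q: "lam (inv_into UNIV \<sigma> i) = lam i" if "i \<in> {1..k}" for i
      using l[OF perm_inv_in[OF p that]] by (simp add: permutes_inverses[OF p])
    \<comment> \<open>Coordinate \<open>i\<close> of the product of \<open>?y\<close> and
      \<open>x\<close> pairs the entry of \<open>?y\<close> with \<open>f (\<sigma> i)\<close>,
      which dictates the reindexing by \<open>\<sigma>\<close>.\<close>
    let ?y = "(\<lambda>i\<in>{1..k}. inv\<^bsub>H\<^esub> f (\<sigma> i), inv_into UNIV \<sigma>)"
    have fc: "f (\<sigma> i) \<in> carrier H" if "i \<in> {1..k}" for i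
      using f that permutes_in_image[OF p, of i] by (intro PiE_mem[OF f]) simp
    have "?y \<in> carrier ?W"
      unfolding wreath_carrier using q fc permutes_inv[OF p] by simp
    moreover have "?y \<otimes>\<^bsub>?W\<^esub> x = \<one>\<^bsub>?W\<^esub>"
      using fc by (auto simp: wreath_mult wreath_one permutes_inv_inv[OF p]
        permutes_inv_o[OF p] fun_eq_iff)
    ultimately show "\<exists>y\<in>carrier ?W. y \<otimes>\<^bsub>?W\<^esub> x = \<one>\<^bsub>?W\<^esub>" by blast
  qed
qed

section \<open>Convex combinations of measures\<close>

context
  fixes k :: nat and lam :: "nat \<Rightarrow> real" and M :: "nat \<Rightarrow> 'v measure"
  assumes w: "weights k lam"
begin

text \<open>\<open>convex_measure\<close> is built by \<open>measure_of\<close>, which generates a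
  sigma-algebra from the given family; as the family already is one, the measurable sets are known
  exactly.\<close>

lemma sigma_algebra_convex:
  "sigma_algebra (SIGMA i:{1..k}. space (M i))
     {A. A \<subseteq> (SIGMA i:{1..k}. space (M i)) \<and> (\<forall>i\<in>{1..k}. Pair i -` A \<in> sets (M i))}"
  (is "sigma_algebra ?\<Omega> ?A")
  unfolding sigma_algebra_iff2
proof (intro conjI allI impI ballI)
  fix s assume s: "s \<in> ?A"
  have "Pair i -` (?\<Omega> - s) = space (M i) - Pair i -` s" if "i \<in> {1..k}" for i
    using that by auto
  then show "?\<Omega> - s \<in> ?A" using s by auto
next
  fix A :: "nat \<Rightarrow> (nat \<times> 'v) set" assume A: "range A \<subseteq> ?A"
  have "Pair i -` (\<Union>n. A n) = (\<Union>n. Pair i -` A n)" for i by auto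
  then show "(\<Union>n. A n) \<in> ?A" using A by (auto intro!: sets.countable_UN)
qed auto

lemma space_convex: "space (convex_measure k lam M) = (SIGMA i:{1..k}. space (M i))"
  unfolding convex_measure_def by (rule space_measure_of) auto

lemma sets_convex: "sets (convex_measure k lam M) =
    {A. A \<subseteq> (SIGMA i:{1..k}. space (M i)) \<and> (\<forall>i\<in>{1..k}. Pair i -` A \<in> sets (M i))}"
  unfolding convex_measure_def
  using sigma_algebra.sets_measure_of_eq[OF sigma_algebra_convex] by simp

lemma emeasure_convex:
  assumes A: "A \<in> sets (convex_measure k lam M)"
  shows "emeasure (convex_measure k lam M) A = (\<Sum>i=1..k. ennreal (lam i) * emeasure (M i) (Pair i -` A))"
  unfolding convex_measure_def
proof (rule emeasure_measure_of_sigma[OF sigma_algebra_convex])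
  show "countably_additive {A. A \<subseteq> (SIGMA i:{1..k}. space (M i)) \<and> (\<forall>i\<in>{1..k}. Pair i -` A \<in> sets (M i))}
     (\<lambda>A. \<Sum>i=1..k. ennreal (lam i) * emeasure (M i) (Pair i -` A))" (is "countably_additive ?A ?f")
    unfolding countably_additive_def
  proof (intro allI impI)
    fix A :: "nat \<Rightarrow> (nat \<times> 'v) set"
    assume A: "range A \<subseteq> ?A" "disjoint_family A"
    have "(\<Sum>n. ?f (A n)) = (\<Sum>i=1..k. \<Sum>n. ennreal (lam i) * emeasure (M i) (Pair i -` A n))"
      by (rule suminf_sum) auto
    also have "\<dots> = (\<Sum>i=1..k. ennreal (lam i) * emeasure (M i) (\<Union>n. Pair i -` A n))"
    proof (rule sum.cong[OF refl])
      fix i assume i: "i \<in> {1..k}"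
      have "(\<Sum>n. emeasure (M i) (Pair i -` A n)) = emeasure (M i) (\<Union>n. Pair i -` A n)"
      proof (rule suminf_emeasure)
        show "disjoint_family (\<lambda>n. Pair i -` A n)"
          using A(2) unfolding disjoint_family_on_def by blast
      qed (use A i in auto)
      then show "(\<Sum>n. ennreal (lam i) * emeasure (M i) (Pair i -` A n)) =
          ennreal (lam i) * emeasure (M i) (\<Union>n. Pair i -` A n)"
        by simp
    qed
    also have "\<dots> = ?f (\<Union>n. A n)" by (simp add: vimage_UN)
    finally show "(\<Sum>n. ?f (A n)) = ?f (\<Union>n. A n)" .
  qed
  show "positive {A. A \<subseteq> (SIGMA i:{1..k}. space (M i)) \<and> (\<forall>i\<in>{1..k}. Pair i -` A \<in> sets (M i))}
     (\<lambda>A. \<Sum>i=1..k. ennreal (lam i) * emeasure (M i) (Pair i -` A))"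
    by (auto simp: positive_def)
qed (use A sets_convex in auto)

text \<open>All weights are positive, so no component can hide mass: the weighted sum vanishes only
  if every fibre is null.\<close>

lemma null_sets_convex:
  "A \<in> null_sets (convex_measure k lam M) \<longleftrightarrow>
     A \<subseteq> (SIGMA i:{1..k}. space (M i)) \<and> (\<forall>i\<in>{1..k}. Pair i -` A \<in> null_sets (M i))"
proof -
  have "ennreal (lam i) \<noteq> 0" if "i \<in> {1..k}" for i
  proof -
    have "0 < lam i" using w that by (simp add: weights_def)
    then show ?thesis by (simp add: not_le)
  qed
  then have z: "(\<Sum>i=1..k. ennreal (lam i) * emeasure (M i) (Pair i -` A)) = 0 \<longleftrightarrow>
      (\<forall>i\<in>{1..k}. emeasure (M i) (Pair i -` A) = 0)"
    by (simp only: sum_eq_0_iff[OF finite_atLeastAtMost] mult_eq_0_iff) blast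
  show ?thesis
  proof (cases "A \<in> sets (convex_measure k lam M)")
    case True
    then have "A \<in> null_sets (convex_measure k lam M) \<longleftrightarrow> (\<forall>i\<in>{1..k}. emeasure (M i) (Pair i -` A) = 0)"
      using z emeasure_convex[OF True] by (simp only: null_sets_def mem_Collect_eq simp_thms)
    then show ?thesis using True unfolding sets_convex null_sets_def by blast
  next
    case False
    then show ?thesis unfolding null_sets_def sets_convex by blast
  qed
qed

text \<open>Reduces almost-everywhere statements on the disjoint union to its components, which is
  how the later arguments reach ergodicity of the single component.\<close>

lemma AE_convex:
  "(AE v in convex_measure k lam M. P v) \<longleftrightarrow> (\<forall>i\<in>{1..k}. AE x in M i. P (i, x))"
proof
  assume "AE v in convex_measure k lam M. P v"
  then obtain N where N: "{v \<in> space (convex_measure k lam M). \<not> P v} \<subseteq> N"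
      "N \<in> null_sets (convex_measure k lam M)"
    unfolding eventually_ae_filter by blast
  show "\<forall>i\<in>{1..k}. AE x in M i. P (i, x)"
  proof
    fix i assume i: "i \<in> {1..k}"
    show "AE x in M i. P (i, x)"
    proof (rule AE_I')
      show "Pair i -` N \<in> null_sets (M i)" using N(2) i by (simp add: null_sets_convex)
      have "(i, x) \<in> N" if "x \<in> space (M i)" "\<not> P (i, x)" for x
        using that i by (intro subsetD[OF N(1)]) (simp add: space_convex)
      then show "{x \<in> space (M i). \<not> P (i, x)} \<subseteq> Pair i -` N" by auto
    qed
  qed
next
  assume "\<forall>i\<in>{1..k}. AE x in M i. P (i, x)"
  then have "\<forall>i\<in>{1..k}. \<exists>N. {x \<in> space (M i). \<not> P (i, x)} \<subseteq> N \<and> N \<in> null_sets (M i)"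
    unfolding eventually_ae_filter by blast
  then obtain N where N: "\<And>i. i \<in> {1..k} \<Longrightarrow> {x \<in> space (M i). \<not> P (i, x)} \<subseteq> N i"
      "\<And>i. i \<in> {1..k} \<Longrightarrow> N i \<in> null_sets (M i)"
    by metis
  have v: "Pair i -` (SIGMA i:{1..k}. N i) = N i" if "i \<in> {1..k}" for i using that by auto
  have "(SIGMA i:{1..k}. N i) \<in> null_sets (convex_measure k lam M)"
    unfolding null_sets_convex using N(2) sets.sets_into_space v by fastforce
  then show "AE v in convex_measure k lam M. P v"
  proof (rule AE_I', intro subsetI)
    fix v assume "v \<in> {v \<in> space (convex_measure k lam M). \<not> P v}"
    then obtain i x where "v = (i, x)" "i \<in> {1..k}" "x \<in> space (M i)" "\<not> P (i, x)"
      unfolding space_convex by blast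
    then show "v \<in> (SIGMA i:{1..k}. N i)" using subsetD[OF N(1)] by blast
  qed
qed

lemma measurable_convex_iff:
  "f \<in> measurable (convex_measure k lam M) N \<longleftrightarrow> (\<forall>i\<in>{1..k}. (\<lambda>x. f (i, x)) \<in> measurable (M i) N)"
proof -
  have v: "Pair i -` (f -` A \<inter> space (convex_measure k lam M)) = (\<lambda>x. f (i, x)) -` A \<inter> space (M i)"
    if "i \<in> {1..k}" for i A using that by (auto simp: space_convex)
  have s: "f -` A \<inter> space (convex_measure k lam M) \<subseteq> (SIGMA i:{1..k}. space (M i))" for A
    by (auto simp: space_convex)
  show ?thesis
  proof
    assume f: "f \<in> measurable (convex_measure k lam M) N"
    show "\<forall>i\<in>{1..k}. (\<lambda>x. f (i, x)) \<in> measurable (M i) N"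
    proof (intro ballI measurableI)
      fix i x assume "i \<in> {1..k}" "x \<in> space (M i)"
      then show "f (i, x) \<in> space N" using measurable_space[OF f] by (simp add: space_convex)
    next
      fix i A assume i: "i \<in> {1..k}" and "A \<in> sets N"
      then show "(\<lambda>x. f (i, x)) -` A \<inter> space (M i) \<in> sets (M i)"
        using measurable_sets[OF f, of A] unfolding v[OF i, symmetric] sets_convex by blast
    qed
  next
    assume f: "\<forall>i\<in>{1..k}. (\<lambda>x. f (i, x)) \<in> measurable (M i) N"
    show "f \<in> measurable (convex_measure k lam M) N"
    proof (rule measurableI)
      fix y assume "y \<in> space (convex_measure k lam M)"
      then obtain i x where y: "y = (i, x)" "i \<in> {1..k}" "x \<in> space (M i)"
        unfolding space_convex by blast
      then show "f y \<in> space N" using measurable_space[OF bspec[OF f y(2)] y(3)] by simp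
    next
      fix A assume A: "A \<in> sets N"
      have "Pair i -` (f -` A \<inter> space (convex_measure k lam M)) \<in> sets (M i)" if "i \<in> {1..k}" for i
        unfolding v[OF that] using measurable_sets[OF bspec[OF f that] A] .
      then show "f -` A \<inter> space (convex_measure k lam M) \<in> sets (convex_measure k lam M)"
        unfolding sets_convex using s[of A] by (intro CollectI conjI ballI)
    qed
  qed
qed

lemma measurable_Pair_convex:
  assumes "i \<in> {1..k}" "g \<in> measurable N (M i)"
  shows "(\<lambda>x. (i, g x)) \<in> measurable N (convex_measure k lam M)"
proof (rule measurableI)
  fix x assume "x \<in> space N" then show "(i, g x) \<in> space (convex_measure k lam M)"
    using assms measurable_space[OF assms(2)] by (auto simp: space_convex)
next
  fix A assume A: "A \<in> sets (convex_measure k lam M)"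
  have "(\<lambda>x. (i, g x)) -` A \<inter> space N = g -` (Pair i -` A) \<inter> space N" by auto
  then show "(\<lambda>x. (i, g x)) -` A \<inter> space N \<in> sets N"
    using assms A by (auto simp: sets_convex intro: measurable_sets)
qed

lemma prob_space_convex:
  assumes "\<And>i. i \<in> {1..k} \<Longrightarrow> prob_space (M i)"
  shows "prob_space (convex_measure k lam M)"
proof
  let ?C = "convex_measure k lam M"
  have v: "Pair i -` space ?C = space (M i)" if "i \<in> {1..k}" for i using that by (auto simp: space_convex)
  have "emeasure ?C (space ?C) = (\<Sum>i=1..k. ennreal (lam i))"
    using v prob_space.emeasure_space_1[OF assms] by (simp add: emeasure_convex)
  also have "\<dots> = 1" using w by (subst sum_ennreal) (auto simp: weights_def less_imp_le)
  finally show "emeasure ?C (space ?C) = 1" .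
qed

lemma measure_convex:
  assumes "\<And>i. i \<in> {1..k} \<Longrightarrow> prob_space (M i)" "A \<in> sets (convex_measure k lam M)"
  shows "measure (convex_measure k lam M) A = (\<Sum>i=1..k. lam i * measure (M i) (Pair i -` A))"
proof -
  have l: "lam i \<ge> 0" if "i \<in> {1..k}" for i using w that by (auto simp: weights_def less_imp_le)
  have f: "finite_measure (M i)" if "i \<in> {1..k}" for i
    using assms(1)[OF that] by (simp add: prob_space.finite_measure)
  have "emeasure (convex_measure k lam M) A = (\<Sum>i=1..k. ennreal (lam i) * ennreal (measure (M i) (Pair i -` A)))"
    unfolding emeasure_convex[OF assms(2)]
    by (intro sum.cong refl) (simp add: finite_measure.emeasure_eq_measure[OF f])
  also have "\<dots> = (\<Sum>i=1..k. ennreal (lam i * measure (M i) (Pair i -` A)))"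
    by (intro sum.cong refl) (simp add: l ennreal_mult)
  also have "\<dots> = ennreal (\<Sum>i=1..k. lam i * measure (M i) (Pair i -` A))"
    using l by (intro sum_ennreal) auto
  finally have "measure (convex_measure k lam M) A = enn2real (ennreal (\<Sum>i=1..k. lam i * measure (M i) (Pair i -` A)))"
    by (simp only: measure_def)
  moreover have "0 \<le> (\<Sum>i=1..k. lam i * measure (M i) (Pair i -` A))" using l by (intro sum_nonneg) auto
  ultimately show ?thesis by (simp only: enn2real_ennreal)
qed

end

section \<open>Ergodic graphings\<close>

lemma mpt_emeasure:
  assumes "T \<in> measurable M M" "distr M M T = M" "A \<in> sets M"
  shows "T -` A \<inter> space M \<in> sets M" "measure M (T -` A \<inter> space M) = measure M A"
proof -
  show "T -` A \<inter> space M \<in> sets M" using assms by (auto intro: measurable_sets)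
  show "measure M (T -` A \<inter> space M) = measure M A"
    using assms(2,3) measure_distr[OF assms(1,3)] by simp
qed

lemma mpt_funpow:
  assumes T: "T \<in> measurable M M" "distr M M T = M"
  shows "(T ^^ n) \<in> measurable M M" "distr M M (T ^^ n) = M"
proof -
  have "(T ^^ n) \<in> measurable M M \<and> distr M M (T ^^ n) = M"
  proof (induction n)
    case 0 show ?case by (simp add: id_def distr_id2)
  next
    case (Suc n)
    then have "distr M M (T \<circ> T ^^ n) = M" using T by (simp only: distr_distr[symmetric])
    then show ?case using measurable_comp[OF conjunct1[OF Suc] T(1)] by (simp only: funpow.simps)
  qed
  then show "(T ^^ n) \<in> measurable M M" "distr M M (T ^^ n) = M" by auto
qed

lemma (in prob_space) ergodic_dichotomy:
  assumes erg: "ergodic M T" and A: "A \<in> sets M" "AE x in M. T x \<in> A \<longleftrightarrow> x \<in> A"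
  shows "(AE x in M. x \<in> A) \<or> (AE x in M. x \<notin> A)"
proof -
  have "prob A = 0 \<or> prob A = 1" using erg A unfolding ergodic_def by blast
  then show ?thesis
  proof
    assume "prob A = 0"
    then have "A \<in> null_sets M" using A(1) by (intro null_setsI) (simp_all add: emeasure_eq_measure)
    then show ?thesis using AE_not_in by blast
  next
    assume "prob A = 1" then show ?thesis using A(1) by (simp add: AE_in_set_eq_1)
  qed
qed

text \<open>An invariant function has invariant sublevel sets, each of them null or conull. The
  rational levels determine the cut of the constant.\<close>

lemma (in prob_space) ergodic_constant:
  fixes v :: "'a \<Rightarrow> real"
  assumes erg: "ergodic M T" and T: "T \<in> measurable M M"
    and v: "v \<in> borel_measurable M" "AE x in M. v (T x) = v x"
  obtains c where "AE x in M. v x = c"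
proof -
  define P where "P q \<longleftrightarrow> (AE x in M. v x \<le> of_rat q)" for q
  have "AE x in M. P q \<longleftrightarrow> v x \<le> of_rat q" for q
  proof -
    let ?A = "{x \<in> space M. v x \<le> of_rat q}"
    have "AE x in M. T x \<in> ?A \<longleftrightarrow> x \<in> ?A"
      using v(2) AE_space by eventually_elim (use measurable_space[OF T] in auto)
    moreover have "?A \<in> sets M" using v(1) by measurable
    ultimately consider "AE x in M. x \<in> ?A" | "AE x in M. x \<notin> ?A" using ergodic_dichotomy[OF erg] by blast
    then show ?thesis
    proof cases
      case 1
      then have "AE x in M. v x \<le> of_rat q" by eventually_elim simp
      then show ?thesis unfolding P_def by simp
    next
      case 2
      then have n: "AE x in M. \<not> v x \<le> of_rat q" using AE_space by eventually_elim simp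
      have "\<not> P q"
      proof
        assume "P q"
        then have "AE x in M. False" unfolding P_def using n by eventually_elim simp
        then show False by simp
      qed
      then show ?thesis using n by simp
    qed
  qed
  then have all: "AE x in M. \<forall>q. P q \<longleftrightarrow> v x \<le> of_rat q" by (simp add: AE_all_countable)
  \<comment> \<open>A countable intersection of conull sets in a probability space is nonempty, so
    some point realises the common cut; its value is the constant.\<close>
  have "\<exists>x0. \<forall>q. P q \<longleftrightarrow> v x0 \<le> of_rat q"
  proof (rule ccontr)
    assume n: "\<nexists>x0. \<forall>q. P q \<longleftrightarrow> v x0 \<le> of_rat q"
    have "AE x in M. False" using all by eventually_elim (use n in blast)
    then show False by simp
  qed
  then obtain x0 where x0: "\<forall>q. P q \<longleftrightarrow> v x0 \<le> of_rat q" by blast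
  have eq: "a \<le> b" if "\<forall>q. P q \<longleftrightarrow> a \<le> of_rat q" "\<forall>q. P q \<longleftrightarrow> b \<le> of_rat q" for a b :: real
  proof (rule ccontr)
    assume "\<not> a \<le> b"
    then obtain q where "b < of_rat q" "of_rat q < a" using of_rat_dense[of b a] by auto
    then show False using that by (meson less_imp_le not_le)
  qed
  have "AE x in M. v x = v x0" using all by eventually_elim (rule antisym; rule eq; (assumption | rule x0))
  then show ?thesis by (rule that)
qed

text \<open>The set \<open>G\<close> carries all orbit arguments; the edges at points outside
  \<open>G\<close> are arbitrary. The function \<open>u\<close> replaces the diagonal when equality
  of points has to be measurable. Completeness makes a set measurable as soon as it agrees almost
  everywhere with a measurable one.\<close>

locale ergodic_graph = prob_space R + complete_measure R for R :: "'a measure" +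
  fixes E :: "('a \<times> 'a) set" and T S :: "'a \<Rightarrow> 'a" and G :: "'a set" and u :: "'a \<Rightarrow> real"
  assumes T: "T \<in> measurable R R" "distr R R T = R"
    and S: "S \<in> measurable R R" "distr R R S = R"
    and G_sets: "G \<in> sets R" and AE_G: "AE x in R. x \<in> G"
    and TG: "\<And>x. x \<in> G \<Longrightarrow> T x \<in> G" and SG: "\<And>x. x \<in> G \<Longrightarrow> S x \<in> G"
    and ST: "\<And>x. x \<in> G \<Longrightarrow> S (T x) = x" and TS: "\<And>x. x \<in> G \<Longrightarrow> T (S x) = x"
    and aperiodic: "\<And>x n. x \<in> G \<Longrightarrow> n > 0 \<Longrightarrow> (T ^^ n) x \<noteq> x"
    and edges_G: "\<And>x. x \<in> G \<Longrightarrow> E `` {x} = {T x, S x}"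
    and erg: "ergodic R T"
    and u: "u \<in> borel_measurable R" and inj_u: "inj_on u G"
begin

lemma G_space: "x \<in> G \<Longrightarrow> x \<in> space R"
  using sets.sets_into_space[OF G_sets] by auto

lemma TG_n: "x \<in> G \<Longrightarrow> (T ^^ n) x \<in> G"
  by (induction n) (auto simp: TG)

lemma SG_n: "x \<in> G \<Longrightarrow> (S ^^ n) x \<in> G"
  by (induction n) (auto simp: SG)

lemma ST_n: "x \<in> G \<Longrightarrow> (S ^^ n) ((T ^^ n) x) = x"
proof (induction n arbitrary: x)
  case (Suc n)
  have "(S ^^ Suc n) ((T ^^ Suc n) x) = (S ^^ n) (S (T ((T ^^ n) x)))" by (simp add: funpow_swap1)
  then show ?case using Suc by (simp add: ST TG_n)
qed simp

lemma TS_n: "x \<in> G \<Longrightarrow> (T ^^ n) ((S ^^ n) x) = x"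
proof (induction n arbitrary: x)
  case (Suc n)
  have "(T ^^ Suc n) ((S ^^ Suc n) x) = (T ^^ n) (T (S ((S ^^ n) x)))" by (simp add: funpow_swap1)
  then show ?case using Suc by (simp add: TS SG_n)
qed simp

lemma T_n_inj:
  assumes "x \<in> G" "y \<in> G" "(T ^^ n) x = (T ^^ n) y" shows "x = y"
  using assms ST_n by metis

lemma T_n_eq_iff:
  assumes x: "x \<in> G" shows "(T ^^ a) x = (T ^^ b) x \<longleftrightarrow> a = b"
proof -
  have "a \<ge> b" if e: "(T ^^ a) x = (T ^^ b) x" for a b
  proof (rule ccontr)
    assume "\<not> a \<ge> b"
    then obtain d where d: "b = a + d" "d > 0" by (metis less_imp_add_positive not_le)
    have "(T ^^ a) ((T ^^ d) x) = (T ^^ a) x" using e d by (simp add: funpow_add)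
    then show False using T_n_inj[OF TG_n[OF x] x] aperiodic[OF x d(2)] by blast
  qed
  then show ?thesis by (metis le_antisym)
qed

lemmas T_n_meas = mpt_funpow[OF T] and S_n_meas = mpt_funpow[OF S]

lemma prob_G_Int: "A \<in> sets R \<Longrightarrow> prob (A \<inter> G) = prob A"
  using AE_G G_sets by (intro finite_measure_eq_AE) auto

lemma prob_T_n:
  assumes "A \<in> sets R"
  shows "{x \<in> G. (T ^^ n) x \<in> A} \<in> sets R" "prob {x \<in> G. (T ^^ n) x \<in> A} = prob A"
proof -
  have e: "{x \<in> G. (T ^^ n) x \<in> A} = ((T ^^ n) -` A \<inter> space R) \<inter> G" using G_space by auto
  show "{x \<in> G. (T ^^ n) x \<in> A} \<in> sets R" "prob {x \<in> G. (T ^^ n) x \<in> A} = prob A"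
    unfolding e using mpt_emeasure[OF T_n_meas assms] G_sets by (auto simp: prob_G_Int)
qed

lemma prob_S_n:
  assumes "A \<in> sets R"
  shows "{x \<in> G. (S ^^ n) x \<in> A} \<in> sets R" "prob {x \<in> G. (S ^^ n) x \<in> A} = prob A"
proof -
  have e: "{x \<in> G. (S ^^ n) x \<in> A} = ((S ^^ n) -` A \<inter> space R) \<inter> G" using G_space by auto
  show "{x \<in> G. (S ^^ n) x \<in> A} \<in> sets R" "prob {x \<in> G. (S ^^ n) x \<in> A} = prob A"
    unfolding e using mpt_emeasure[OF S_n_meas assms] G_sets by (auto simp: prob_G_Int)
qed

section \<open>Absence of atoms and sets of prescribed measure\<close>

lemma singleton_sets:
  assumes "y \<in> G" shows "{y} \<in> sets R"
proof -
  have "{y} = (u -` {u y} \<inter> space R) \<inter> G" using assms inj_u G_space by (auto simp: inj_on_def)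
  also have "\<dots> \<in> sets R" using u G_sets by (auto intro!: measurable_sets)
  finally show ?thesis .
qed

text \<open>The points of an infinite orbit all have the same mass, so this mass vanishes.\<close>

lemma prob_singleton:
  assumes y: "y \<in> G" shows "prob {y} = 0"
proof (rule ccontr)
  assume "prob {y} \<noteq> 0"
  then have pos: "prob {y} > 0" by (simp add: zero_less_measure_iff)
  then obtain N where N: "1 < real N * prob {y}" using reals_Archimedean3 by blast
  have "prob {(T ^^ n) y} = prob {y}" for n
  proof -
    have "{x \<in> G. (T ^^ n) x \<in> {(T ^^ n) y}} = {y}" using y T_n_inj by auto
    then show ?thesis using prob_T_n[OF singleton_sets[OF TG_n[OF y]]] by metis
  qed
  then have "real N * prob {y} = (\<Sum>n<N. prob {(T ^^ n) y})" by simp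
  also have "\<dots> = prob (\<Union>n<N. {(T ^^ n) y})"
    using y by (intro finite_measure_finite_Union[symmetric])
      (auto simp: singleton_sets TG_n disjoint_family_on_def T_n_eq_iff)
  also have "\<dots> \<le> 1" by simp
  finally show False using N by simp
qed

text \<open>A level of \<open>u\<close> meets \<open>G\<close> in at most one point, and points are
  null; this makes the distribution of \<open>u\<close> continuous.\<close>

lemma prob_level: "prob {x \<in> G. u x = t} = 0"
proof (cases "\<exists>y\<in>G. u y = t")
  case True
  then obtain y where y: "y \<in> G" "u y = t" by blast
  then have "{x \<in> G. u x = t} = {y}" using inj_u by (auto simp: inj_on_def)
  then show ?thesis using prob_singleton y by simp
next
  case False
  then have "{x \<in> G. u x = t} = {}" by auto
  then show ?thesis by (simp only: measure_empty)
qed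

text \<open>\<open>A\<close> is cut off from \<open>B\<close> by a threshold for \<open>u\<close>.
  The distribution function of \<open>u\<close> on \<open>B\<close> is continuous because levels are
  null, so it takes every value strictly between its limits \<open>0\<close> and
  \<open>prob B\<close>.\<close>

lemma subset_of_measure:
  assumes B: "B \<in> sets R" and c: "0 \<le> c" "c \<le> prob B"
  obtains A where "A \<in> sets R" "A \<subseteq> B" "prob A = c"
proof -
  \<comment> \<open>A distribution function may fail to attain its two limits at a finite threshold,
    so the extreme values are treated apart.\<close>
  consider "c = 0" | "c = prob B" | "0 < c" "c < prob B" using c by linarith
  then show ?thesis
  proof cases
    case 1 then show ?thesis using that[of "{}"] by simp
  next
    case 2 then show ?thesis using that[of B] B by simp
  next
    case 3
    let ?B = "restrict_space R B" and ?D = "distr (restrict_space R B) borel u"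
    have spB: "space ?B = B" using sets.sets_into_space[OF B] by (auto simp: space_restrict_space)
    have uB: "u \<in> borel_measurable ?B" using u by (rule measurable_restrict_space1)
    have finB: "finite_measure ?B" using B by (intro finite_measure_restrict_space) auto
    interpret D: finite_borel_measure ?D
      using finite_measure.finite_measure_distr[OF finB uB]
      by (simp add: finite_borel_measure_def finite_borel_measure_axioms_def)
    have m: "measure ?D X = prob (B \<inter> (u -` X \<inter> space R))" if X: "X \<in> sets borel" for X
    proof -
      have "measure ?D X = measure ?B (u -` X \<inter> B)" using measure_distr[OF uB X] spB by simp
      also have "\<dots> = prob (u -` X \<inter> B)"
        using B by (intro measure_restrict_space) auto
      also have "u -` X \<inter> B = B \<inter> (u -` X \<inter> space R)" using sets.sets_into_space[OF B] by auto
      finally show ?thesis .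
    qed
    have z: "measure ?D {t} = 0" for t
    proof -
      have sets: "B \<inter> (u -` {t} \<inter> space R) \<in> sets R" using B u by (auto intro!: measurable_sets)
      have "prob (B \<inter> (u -` {t} \<inter> space R)) = prob ((B \<inter> (u -` {t} \<inter> space R)) \<inter> G)"
        using prob_G_Int[OF sets] by simp
      also have "\<dots> \<le> prob {x \<in> G. u x = t}"
      proof (rule finite_measure_mono)
        have "{x \<in> G. u x = t} = (u -` {t} \<inter> space R) \<inter> G" using G_space by auto
        then show "{x \<in> G. u x = t} \<in> sets R" using u G_sets by (auto intro!: measurable_sets)
      qed auto
      also have "\<dots> = 0" by (rule prob_level)
      finally show ?thesis using m[of "{t}"] by (simp add: measure_le_0_iff)
    qed
    have spD: "measure ?D (space ?D) = prob B"
      using m[of UNIV] sets.sets_into_space[OF B] by (simp add: Int_absorb2)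
    have cont: "isCont (cdf ?D) t" for t using D.isCont_cdf z by simp
    have "\<forall>\<^sub>F t in at_bot. cdf ?D t < c"
      using D.cdf_lim_at_bot 3(1) by (rule order_tendstoD)
    then obtain a where a: "cdf ?D a < c" by (metis eventually_at_bot_linorder order_refl)
    have "\<forall>\<^sub>F t in at_top. cdf ?D t > c"
      using D.cdf_lim_at_top 3(2) spD by (intro order_tendstoD) auto
    then obtain b where b: "cdf ?D b > c" by (metis eventually_at_top_linorder order_refl)
    have "a \<le> b" using D.cdf_nondecreasing[of b a] a b by (meson linorder_le_cases order.strict_trans not_le)
    then obtain t where "cdf ?D t = c"
      using IVT[of "cdf ?D" a c b] a b cont by auto
    then have "prob (B \<inter> (u -` {..t} \<inter> space R)) = c" using m[of "{..t}"] by (simp add: cdf_def)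
    then show ?thesis
      using that[of "B \<inter> (u -` {..t} \<inter> space R)"] B u by (auto intro!: measurable_sets)
  qed
qed

text \<open>The pieces are cut one after another from what remains of \<open>B\<close>.\<close>

lemma partition_of_measures:
  assumes "finite I" "B \<in> sets R" "\<And>i. i \<in> I \<Longrightarrow> 0 \<le> p i" "(\<Sum>i\<in>I. p i) \<le> prob B"
  shows "\<exists>D. disjoint_family_on D I \<and> (\<forall>i\<in>I. D i \<in> sets R \<and> D i \<subseteq> B \<and> prob (D i) = p i)"
  using assms
proof (induction I arbitrary: B rule: finite_induct)
  case empty then show ?case by (auto simp: disjoint_family_on_def)
next
  case (insert i I)
  have "0 \<le> sum p I" using insert.prems by (intro sum_nonneg) auto
  then have "p i \<le> prob B" using insert by simp
  then obtain A where A: "A \<in> sets R" "A \<subseteq> B" "prob A = p i"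
    using subset_of_measure[of B "p i"] insert.prems by auto
  have "(\<Sum>i\<in>I. p i) \<le> prob (B - A)"
    using insert A by (simp add: finite_measure_Diff)
  then obtain D where D: "disjoint_family_on D I" "\<forall>i\<in>I. D i \<in> sets R \<and> D i \<subseteq> B - A \<and> prob (D i) = p i"
    using insert.IH[of "B - A"] insert.prems A(1) by auto
  show ?case
  proof (intro exI conjI)
    show "disjoint_family_on (D(i := A)) (insert i I)"
      using D insert.hyps by (fastforce simp: disjoint_family_on_def)
    show "\<forall>j\<in>insert i I. (D(i := A)) j \<in> sets R \<and> (D(i := A)) j \<subseteq> B \<and> prob ((D(i := A)) j) = p j"
      using D A insert.hyps by auto
  qed
qed

text \<open>The points whose forward orbit meets \<open>A\<close> form a set \<open>H\<close> whose
  preimage lies in \<open>H\<close> and has the same measure, so \<open>H\<close> is invariant up to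
  a null set. It contains \<open>A\<close>, and ergodicity makes it conull.\<close>

lemma AE_hits:
  assumes A: "A \<in> sets R" "prob A > 0"
  shows "AE x in R. \<exists>n. (T ^^ n) x \<in> A"
proof -
  define H where "H = (\<Union>n. (T ^^ n) -` A \<inter> space R)"
  have H: "H \<in> sets R" unfolding H_def using A T_n_meas by (auto intro: measurable_sets)
  have TH: "T -` H \<inter> space R \<subseteq> H"
  proof
    fix x assume x: "x \<in> T -` H \<inter> space R"
    then obtain n where "(T ^^ n) (T x) \<in> A" by (auto simp: H_def)
    then have "(T ^^ Suc n) x \<in> A" by (simp add: funpow_swap1)
    then show "x \<in> H" using x unfolding H_def by blast
  qed
  have "prob (H - (T -` H \<inter> space R)) = 0"
    using mpt_emeasure[OF T H] H TH by (subst finite_measure_Diff) auto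
  then have "H - (T -` H \<inter> space R) \<in> null_sets R"
    using H mpt_emeasure(1)[OF T H] by (intro null_setsI) (simp_all only: emeasure_eq_measure ennreal_0 sets.Diff)
  then have "AE x in R. x \<notin> H - (T -` H \<inter> space R)" by (rule AE_not_in)
  then have "AE x in R. T x \<in> H \<longleftrightarrow> x \<in> H"
    using AE_space by eventually_elim (use TH in auto)
  then have "prob H = 0 \<or> prob H = 1" using erg H by (auto simp: ergodic_def)
  moreover have "(T ^^ 0) -` A \<inter> space R \<subseteq> H" unfolding H_def by blast
  then have "A \<subseteq> H" using sets.sets_into_space[OF A(1)] by auto
  then have "prob A \<le> prob H" using H by (rule finite_measure_mono)
  ultimately have "prob H = 1" using A by auto
  then have "AE x in R. x \<in> H" using H prob_Collect_eq_1[of "\<lambda>x. x \<in> H"] sets.sets_into_space[OF H]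
    by (simp add: Int_absorb1 Int_def[symmetric] AE_in_set_eq_1)
  then show ?thesis by eventually_elim (auto simp: H_def)
qed

end

section \<open>Colourings with prescribed local statistics\<close>

definition orbit_word :: "('a \<Rightarrow> 'a) \<Rightarrow> ('a \<Rightarrow> nat) \<Rightarrow> nat \<Rightarrow> 'a \<Rightarrow> nat list" where
  "orbit_word T f n x = map (\<lambda>j. f ((T ^^ j) x)) [0..<n]"

definition words :: "nat \<Rightarrow> nat \<Rightarrow> nat list set" where
  "words m n = {w. set w \<subseteq> {1..m} \<and> length w = n}"

lemma finite_words: "finite (words m n)"
  unfolding words_def by (rule finite_lists_length_eq) simp

lemma length_orbit_word [simp]: "length (orbit_word T f n x) = n"
  by (simp add: orbit_word_def)

lemma nth_orbit_word [simp]: "j < n \<Longrightarrow> orbit_word T f n x ! j = f ((T ^^ j) x)"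
  by (simp add: orbit_word_def)

lemma take_drop_orbit_word:
  assumes "j + L \<le> n"
  shows "take L (drop j (orbit_word T f n x)) = orbit_word T f L ((T ^^ j) x)"
  using assms by (intro nth_equalityI) (auto simp: funpow_add add.commute)

context ergodic_graph
begin

text \<open>\<open>h\<close> is the waiting time until the orbit enters a small set
  \<open>A\<close>; it drops by one at each step. Taking as base the points with \<open>h\<close>
  congruent to \<open>n - 1\<close> modulo \<open>n\<close> leaves room for \<open>n - 1\<close>
  further steps before \<open>A\<close> is passed and gives the \<open>n\<close> levels distinct
  residues of \<open>h\<close>.\<close>

lemma rokhlin:
  assumes n: "n > 0" and \<epsilon>: "\<epsilon> > 0"
  obtains B where "B \<in> sets R" "B \<subseteq> G" "real n * prob B \<ge> 1 - \<epsilon>"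
    "\<And>x y i j. x \<in> B \<Longrightarrow> y \<in> B \<Longrightarrow> i < n \<Longrightarrow> j < n \<Longrightarrow> (T ^^ i) x = (T ^^ j) y \<Longrightarrow> i = j"
proof -
  have pG: "prob G = 1" using AE_G G_sets by (simp add: AE_in_set_eq_1)
  \<comment> \<open>The \<open>n\<close> translates of \<open>A\<close> cover what the tower misses,
    so their total mass \<open>n * a\<close> has to stay below \<open>\<epsilon>\<close>; the cap
    \<open>1\<close> ensures that a set of measure \<open>a\<close> exists.\<close>
  define a where "a = min 1 (\<epsilon> / n)"
  have a: "0 < a" "a \<le> 1" "real n * a \<le> \<epsilon>" using n \<epsilon> by (auto simp: a_def min_def field_simps)
  obtain A where A: "A \<in> sets R" "A \<subseteq> G" "prob A = a"
    using subset_of_measure[OF G_sets, of a] a pG by auto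
  define H where "H = {x \<in> G. \<exists>j. (T ^^ j) x \<in> A}"
  define h where "h x = (LEAST j. (T ^^ j) x \<in> A)" for x
  have hit: "(T ^^ h x) x \<in> A" if "x \<in> H" for x
    using that unfolding H_def h_def by (auto intro: LeastI)
  have before: "(T ^^ j) x \<notin> A" if "j < h x" for x j
    using that not_less_Least unfolding h_def by blast
  have h_eq: "h x = j" if "(T ^^ j) x \<in> A" "\<And>i. i < j \<Longrightarrow> (T ^^ i) x \<notin> A" for x j
    unfolding h_def using that by (intro Least_equality) (auto simp: not_less[symmetric])
  have fwd: "(T ^^ j) x \<in> H" "h ((T ^^ j) x) = h x - j" if x: "x \<in> H" "j \<le> h x" for x j
  proof -
    have e: "(T ^^ i) ((T ^^ j) x) = (T ^^ (i + j)) x" for i by (simp add: funpow_add)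
    have l: "(T ^^ (h x - j)) ((T ^^ j) x) \<in> A" unfolding e using hit x by simp
    have "x \<in> G" using x by (simp add: H_def)
    then show "(T ^^ j) x \<in> H" using l TG_n unfolding H_def by blast
    show "h ((T ^^ j) x) = h x - j" by (rule h_eq[OF l]) (use before e in auto)
  qed
  \<comment> \<open>Going backwards, the waiting time grows by one per step as long as no point of
    \<open>A\<close> is met.\<close>
  have bwd: "(S ^^ r) x \<in> H" "h ((S ^^ r) x) = h x + r"
    if x: "x \<in> H" and r: "\<And>i. 1 \<le> i \<Longrightarrow> i \<le> r \<Longrightarrow> (S ^^ i) x \<notin> A" for x r
  proof -
    have G: "x \<in> G" using x by (simp add: H_def)
    have e: "(T ^^ (i + r)) ((S ^^ r) x) = (T ^^ i) x" for i by (simp add: funpow_add TS_n G)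
    have e': "(T ^^ i) ((S ^^ r) x) = (S ^^ (r - i)) x" if "i < r" for i
    proof -
      have "(S ^^ r) x = (S ^^ i) ((S ^^ (r - i)) x)" using that by (metis funpow_add le_add_diff_inverse less_imp_le o_apply)
      then show ?thesis using G by (simp add: TS_n SG_n)
    qed
    have l: "(T ^^ (h x + r)) ((S ^^ r) x) \<in> A" using e hit x by simp
    then show "(S ^^ r) x \<in> H" using G SG_n unfolding H_def by blast
    show "h ((S ^^ r) x) = h x + r"
    proof (rule h_eq[OF l])
      fix i assume i: "i < h x + r"
      show "(T ^^ i) ((S ^^ r) x) \<notin> A"
      proof (cases "i < r")
        case True then show ?thesis using e'[OF True] r[of "r - i"] by simp
      next
        case False
        then have "(T ^^ i) ((S ^^ r) x) = (T ^^ (i - r)) x" using e[of "i - r"] by simp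
        then show ?thesis using before[of "i - r" x] i False by simp
      qed
    qed
  qed
  have lev: "{x \<in> H. h x = j} \<in> sets R" for j
  proof -
    have "{x \<in> H. h x = j} = {x \<in> G. (T ^^ j) x \<in> A} - (\<Union>i<j. {x \<in> G. (T ^^ i) x \<in> A})"
    proof (rule subset_antisym; rule subsetI)
      fix x assume "x \<in> {x \<in> H. h x = j}"
      then show "x \<in> {x \<in> G. (T ^^ j) x \<in> A} - (\<Union>i<j. {x \<in> G. (T ^^ i) x \<in> A})"
        using hit[of x] before[of _ x] unfolding H_def by blast
    next
      fix x assume x: "x \<in> {x \<in> G. (T ^^ j) x \<in> A} - (\<Union>i<j. {x \<in> G. (T ^^ i) x \<in> A})"
      then have "h x = j" by (intro h_eq) blast+
      then show "x \<in> {x \<in> H. h x = j}" using x unfolding H_def by blast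
    qed
    then show ?thesis using prob_T_n(1)[OF A(1)] by auto
  qed
  define B where "B = {x \<in> H. h x mod n = n - 1}"
  have B: "B \<in> sets R"
  proof -
    have "B = (\<Union>j\<in>{j. j mod n = n - 1}. {x \<in> H. h x = j})" unfolding B_def by auto
    then show ?thesis using lev by (auto intro!: sets.countable_UN'')
  qed
  \<comment> \<open>Base points have \<open>h x\<close> at least \<open>n - 1\<close>, so the
    truncated subtraction \<open>h x - j\<close> is a genuine one on every level.\<close>
  have mod_h: "h ((T ^^ j) x) mod n = n - 1 - j" if "x \<in> B" "j < n" for x j
  proof -
    have x: "x \<in> H" "h x mod n = n - 1" using that by (auto simp: B_def)
    have "n * (h x div n) + (n - 1) = h x" using x(2) by (metis mult_div_mod_eq)
    then have "h x - j = (n - 1 - j) + n * (h x div n)" "j \<le> h x" using that(2) by linarith+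
    then show ?thesis using fwd(2)[OF x(1), of j] n by simp
  qed
  \<comment> \<open>Walking back to the nearest point with base residue either meets no point of
    \<open>A\<close>, and then \<open>x\<close> lies in the tower, or it shows that \<open>x\<close>
    comes fewer than \<open>n\<close> steps after a visit to \<open>A\<close>.\<close>
  have "H \<subseteq> (\<Union>r<n. {x \<in> G. (S ^^ r) x \<in> B}) \<union> (\<Union>r<n. {x \<in> G. (S ^^ r) x \<in> A})"
  proof
    fix x assume x: "x \<in> H"
    then have G: "x \<in> G" by (simp add: H_def)
    define r where "r = n - 1 - h x mod n"
    have m: "h x mod n < n" using n by simp
    have r: "r < n" using n by (simp add: r_def)
    show "x \<in> (\<Union>r<n. {x \<in> G. (S ^^ r) x \<in> B}) \<union> (\<Union>r<n. {x \<in> G. (S ^^ r) x \<in> A})"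
    proof (cases "\<exists>i. 1 \<le> i \<and> i \<le> r \<and> (S ^^ i) x \<in> A")
      case True
      then obtain i where "i < n" "(S ^^ i) x \<in> A" using r le_less_trans by blast
      then show ?thesis using G by blast
    next
      case False
      then have b: "(S ^^ r) x \<in> H" "h ((S ^^ r) x) = h x + r" using bwd[OF x, of r] by blast+
      have "h x + r = (n - 1) + n * (h x div n)"
        using m mult_div_mod_eq[of n "h x"] unfolding r_def by linarith
      then have "(h x + r) mod n = n - 1" using n by (simp only: mod_mult_self2 mod_less diff_less zero_less_one)
      then have "(S ^^ r) x \<in> B" using b by (simp add: B_def)
      then show ?thesis using G r by blast
    qed
  qed
  moreover have "prob H = 1"
  proof -
    have "AE x in R. x \<in> H" using AE_hits[of A] A a AE_G unfolding H_def by auto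
    moreover have "H \<in> sets R"
    proof -
      have "H = (\<Union>j. {x \<in> G. (T ^^ j) x \<in> A})" unfolding H_def by auto
      then show ?thesis using prob_T_n(1)[OF A(1)] by auto
    qed
    ultimately show ?thesis by (simp add: AE_in_set_eq_1)
  qed
  moreover have s: "(\<Union>r<n. {x \<in> G. (S ^^ r) x \<in> X}) \<in> sets R"
      "prob (\<Union>r<n. {x \<in> G. (S ^^ r) x \<in> X}) \<le> real n * prob X" if X: "X \<in> sets R" for X
  proof -
    show "(\<Union>r<n. {x \<in> G. (S ^^ r) x \<in> X}) \<in> sets R" using prob_S_n[OF X] by auto
    have "prob (\<Union>r<n. {x \<in> G. (S ^^ r) x \<in> X}) \<le> (\<Sum>r<n. prob {x \<in> G. (S ^^ r) x \<in> X})"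
      using prob_S_n[OF X] by (intro finite_measure_subadditive_finite) auto
    then show "prob (\<Union>r<n. {x \<in> G. (S ^^ r) x \<in> X}) \<le> real n * prob X"
      using prob_S_n(2)[OF X] by simp
  qed
  ultimately have "1 \<le> prob ((\<Union>r<n. {x \<in> G. (S ^^ r) x \<in> B}) \<union> (\<Union>r<n. {x \<in> G. (S ^^ r) x \<in> A}))"
    using finite_measure_mono[of H] s(1)[OF A(1)] s(1)[OF B] by fastforce
  also have "\<dots> \<le> real n * prob B + real n * prob A"
    using measure_Un_le[OF s(1)[OF B] s(1)[OF A(1)]] s(2)[OF A(1)] s(2)[OF B] by linarith
  finally have "real n * prob B \<ge> 1 - \<epsilon>" using a A(3) by simp
  moreover have "B \<subseteq> G" unfolding B_def H_def by auto
  moreover have "i = j" if "x \<in> B" "y \<in> B" "i < n" "j < n" "(T ^^ i) x = (T ^^ j) y" for x y i j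
    using mod_h[of x i] mod_h[of y j] that by simp
  ultimately show ?thesis using that B by blast
qed

section \<open>Statistics of colour words along orbits\<close>

lemma orbit_word_in_words:
  assumes "g \<in> measurable R (count_space {1..m})" "x \<in> G"
  shows "orbit_word T g n x \<in> words m n"
  using measurable_space[OF assms(1) G_space[OF TG_n[OF assms(2)]]]
  by (auto simp: words_def orbit_word_def)

lemma orbit_word_sets:
  assumes g: "g \<in> measurable R (count_space {1..m})" and C: "C \<subseteq> words m n"
  shows "{x \<in> G. orbit_word T g n x \<in> C} \<in> sets R"
proof -
  have "{x \<in> G. orbit_word T g n x = w} \<in> sets R" if "w \<in> words m n" for w
  proof -
    have l: "length w = n" using that by (simp add: words_def)
    have "{x \<in> G. orbit_word T g n x = w} = G \<inter> (\<Inter>j<n. {x \<in> G. (T ^^ j) x \<in> g -` {w ! j} \<inter> space R})" if "n > 0"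
      using l that G_space TG_n by (auto simp: list_eq_iff_nth_eq)
    moreover have "g -` {w ! j} \<inter> space R \<in> sets R" if "j < n" for j
    proof (rule measurable_sets[OF g])
      have "w ! j \<in> set w" using that l by simp
      then show "{w ! j} \<in> sets (count_space {1..m})"
        using \<open>w \<in> words m n\<close> by (auto simp: words_def simp del: nth_mem)
    qed
    then have "{x \<in> G. (T ^^ j) x \<in> g -` {w ! j} \<inter> space R} \<in> sets R" if "j < n" for j
      using prob_T_n(1) that by blast
    then have "G \<inter> (\<Inter>j<n. {x \<in> G. (T ^^ j) x \<in> g -` {w ! j} \<inter> space R}) \<in> sets R" if "n > 0"
      using that G_sets by (intro sets.Int sets.finite_INT) auto
    \<comment> \<open>Length zero would give an empty intersection and is treated apart.\<close>
    moreover have "{x \<in> G. orbit_word T g n x = w} = G" if "n = 0" using l that by (auto simp: orbit_word_def)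
    ultimately show ?thesis using G_sets by (cases "n = 0") auto
  qed
  moreover have "{x \<in> G. orbit_word T g n x \<in> C} = (\<Union>w\<in>C. {x \<in> G. orbit_word T g n x = w})" by auto
  ultimately show ?thesis using C finite_subset[OF C finite_words] by (auto intro!: sets.finite_UN)
qed

lemma prob_orbit_word_sum:
  assumes g: "g \<in> measurable R (count_space {1..m})" and C: "C \<subseteq> words m n"
  shows "prob {x \<in> G. orbit_word T g n x \<in> C} = (\<Sum>w\<in>C. prob {x \<in> G. orbit_word T g n x = w})"
proof -
  have "{x \<in> G. orbit_word T g n x \<in> C} = (\<Union>w\<in>C. {x \<in> G. orbit_word T g n x = w})" by auto
  moreover have "prob (\<Union>w\<in>C. {x \<in> G. orbit_word T g n x = w}) = (\<Sum>w\<in>C. prob {x \<in> G. orbit_word T g n x = w})"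
    using C orbit_word_sets[OF g, of "{_}"] finite_subset[OF C finite_words]
    by (intro finite_measure_finite_Union) (auto simp: disjoint_family_on_def)
  ultimately show ?thesis by simp
qed

lemma prob_orbit_word_words:
  assumes g: "g \<in> measurable R (count_space {1..m})"
  shows "prob {x \<in> G. orbit_word T g n x \<in> words m n} = 1"
proof -
  have "{x \<in> G. orbit_word T g n x \<in> words m n} = G" using orbit_word_in_words[OF g] by auto
  then show ?thesis using AE_G G_sets by (simp add: AE_in_set_eq_1)
qed

text \<open>The window at position \<open>j\<close> in the word of \<open>x\<close> is the word of
  \<open>(T ^^ j) x\<close>, and \<open>T ^^ j\<close> preserves the measure. This is the
  consistency condition that \<open>coloring\<close> asks of word statistics.\<close>

lemma orbit_word_marginal:
  assumes g: "g \<in> measurable R (count_space {1..m})" and jL: "j + L \<le> n" and v: "v \<in> words m L"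
  shows "(\<Sum>w | w \<in> words m n \<and> take L (drop j w) = v. prob {x \<in> G. orbit_word T g n x = w})
     = prob {x \<in> G. orbit_word T g L x = v}"
proof -
  have "(\<Sum>w | w \<in> words m n \<and> take L (drop j w) = v. prob {x \<in> G. orbit_word T g n x = w}) =
      prob {x \<in> G. orbit_word T g n x \<in> {w \<in> words m n. take L (drop j w) = v}}"
    using prob_orbit_word_sum[OF g, of "{w \<in> words m n. take L (drop j w) = v}" n] by simp
  also have "{x \<in> G. orbit_word T g n x \<in> {w \<in> words m n. take L (drop j w) = v}} =
      {x \<in> G. (T ^^ j) x \<in> {x \<in> G. orbit_word T g L x \<in> {v}}}"
    using orbit_word_in_words[OF g] TG_n by (auto simp: take_drop_orbit_word[OF jL])
  also have "prob \<dots> = prob {x \<in> G. orbit_word T g L x \<in> {v}}"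
    using orbit_word_sets[OF g, of "{v}"] v by (intro prob_T_n) auto
  finally show ?thesis by simp
qed

text \<open>A colouring realising given word statistics up to \<open>\<epsilon>\<close>: the base of a Rokhlin tower
  is cut into pieces indexed by words, and each word is written along the tower over its piece.\<close>

lemma coloring:
  fixes \<nu> :: "nat \<Rightarrow> nat list \<Rightarrow> real"
  assumes m: "m \<ge> 1" and L: "L > 0" and \<epsilon>: "\<epsilon> > 0"
    and \<nu>0: "\<And>n w. 0 \<le> \<nu> n w" and \<nu>1: "\<And>n. (\<Sum>w\<in>words m n. \<nu> n w) = 1"
    and marg: "\<And>n j v. j + L \<le> n \<Longrightarrow> v \<in> words m L \<Longrightarrow>
      (\<Sum>w | w \<in> words m n \<and> take L (drop j w) = v. \<nu> n w) = \<nu> L v"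
  obtains g where "g \<in> measurable R (count_space {1..m})"
    "\<And>C. C \<subseteq> words m L \<Longrightarrow> \<bar>prob {x \<in> G. orbit_word T g L x \<in> C} - (\<Sum>v\<in>C. \<nu> L v)\<bar> \<le> \<epsilon>"
proof -
  obtain n0 :: nat where n0: "2 * real L / \<epsilon> < real n0" using reals_Archimedean2 by blast
  \<comment> \<open>Of the \<open>n\<close> levels at most \<open>L\<close> cannot start a full
    window; \<open>n\<close> is large enough that this costs a share of at most
    \<open>\<epsilon> / 2\<close>, the other half being allowed for the part outside the
    tower.\<close>
  define n where "n = n0 + L + 1"
  have n: "n > 0" "L \<le> n" by (auto simp: n_def)
  have "2 * real L / \<epsilon> \<le> real n" using n0 by (simp add: n_def)
  then have Ln: "real L / n \<le> \<epsilon> / 2" using \<epsilon> n by (simp add: field_simps)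
  obtain B where B: "B \<in> sets R" "B \<subseteq> G" "real n * prob B \<ge> 1 - \<epsilon> / 2"
    "\<And>x y i j. x \<in> B \<Longrightarrow> y \<in> B \<Longrightarrow> i < n \<Longrightarrow> j < n \<Longrightarrow> (T ^^ i) x = (T ^^ j) y \<Longrightarrow> i = j"
    using rokhlin[OF n(1), of "\<epsilon> / 2"] \<epsilon> by auto
  have "(\<Sum>w\<in>words m n. \<nu> n w * prob B) = prob B" by (simp add: \<nu>1 flip: sum_distrib_right)
  then obtain D where D: "disjoint_family_on D (words m n)"
      "\<And>w. w \<in> words m n \<Longrightarrow> D w \<in> sets R \<and> D w \<subseteq> B \<and> prob (D w) = \<nu> n w * prob B"
    using partition_of_measures[OF finite_words B(1), of m n "\<lambda>w. \<nu> n w * prob B"] \<nu>0 by auto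
  define K where "K = {..<n} \<times> words m n"
  have finK: "finite K" by (simp add: K_def finite_words)
  \<comment> \<open>\<open>t (j, w)\<close> is level \<open>j\<close> of the column over the base
    piece \<open>D w\<close>, described by going back \<open>j\<close> steps.\<close>
  define t where "t q = {x \<in> G. (S ^^ fst q) x \<in> D (snd q)}" for q :: "nat \<times> nat list"
  have t_sets: "t q \<in> sets R" and t_prob: "prob (t q) = \<nu> n (snd q) * prob B" if "q \<in> K" for q
    using prob_S_n[of "D (snd q)" "fst q"] D(2)[of "snd q"] that unfolding t_def K_def by auto
  have t_unique: "q = q'" if q: "q \<in> K" "q' \<in> K" "x \<in> t q" "x \<in> t q'" for q q' x
  proof -
    have G: "x \<in> G" using q by (simp add: t_def)
    have d: "(S ^^ fst q) x \<in> D (snd q)" "(S ^^ fst q') x \<in> D (snd q')" using q by (auto simp: t_def)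
    have k: "fst q < n" "fst q' < n" "snd q \<in> words m n" "snd q' \<in> words m n" using q by (auto simp: K_def)
    have b: "(S ^^ fst q) x \<in> B" "(S ^^ fst q') x \<in> B" using d D(2) k by blast+
    have f: "fst q = fst q'" using B(4)[OF b k(1,2)] G by (simp add: TS_n)
    moreover have "snd q = snd q'"
      using D(1) d k f unfolding disjoint_family_on_def by (metis disjoint_iff)
    ultimately show ?thesis by (simp add: prod_eq_iff)
  qed
  \<comment> \<open>Level \<open>j\<close> of the column of \<open>w\<close> receives letter
    \<open>j\<close> of \<open>w\<close>. The colour \<open>1\<close> off the tower is legitimate
    because \<open>m \<ge> 1\<close>.\<close>
  define g where "g x = (if \<exists>q\<in>K. x \<in> t q then (let q = SOME q. q \<in> K \<and> x \<in> t q in snd q ! fst q) else 1)" for x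
  have g_eq: "g x = snd q ! fst q" if "q \<in> K" "x \<in> t q" for x q
  proof -
    have "(SOME q. q \<in> K \<and> x \<in> t q) = q"
    proof (rule some_equality)
      fix q' assume "q' \<in> K \<and> x \<in> t q'"
      then show "q' = q" using t_unique[of q' q x] that by blast
    qed (use that in blast)
    then show ?thesis using that unfolding g_def by auto
  qed
  have g_range: "snd q ! fst q \<in> {1..m}" if "q \<in> K" for q
  proof -
    have "fst q < length (snd q)" "set (snd q) \<subseteq> {1..m}" using that by (auto simp: K_def words_def)
    then show ?thesis by (meson nth_mem subsetD)
  qed
  have g: "g \<in> measurable R (count_space {1..m})"
    unfolding measurable_count_space_eq2[OF finite_atLeastAtMost]
  proof (intro conjI ballI Pi_I)
    fix x show "g x \<in> {1..m}"
      using g_eq g_range m by (cases "\<exists>q\<in>K. x \<in> t q") (fastforce, simp add: g_def)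
  next
    fix a
    have "g -` {a} \<inter> space R = (\<Union>q\<in>{q\<in>K. snd q ! fst q = a}. t q) \<union>
        (if a = 1 then space R - (\<Union>q\<in>K. t q) else {})" (is "?l = ?r")
    proof (rule Set.set_eqI)
      fix x
      have tG: "x \<in> space R" if "x \<in> t q" for q using that G_space by (simp add: t_def)
      show "x \<in> ?l \<longleftrightarrow> x \<in> ?r"
      proof (cases "\<exists>q\<in>K. x \<in> t q")
        case True
        then obtain q where q: "q \<in> K" "x \<in> t q" by blast
        have "x \<in> ?r \<longleftrightarrow> (\<exists>q'\<in>K. x \<in> t q' \<and> snd q' ! fst q' = a)"
        proof -
          have xK: "x \<in> (\<Union>q\<in>K. t q)" using q by blast
          have "x \<in> ?r \<longleftrightarrow> x \<in> (\<Union>q\<in>{q\<in>K. snd q ! fst q = a}. t q)"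
            by (cases "a = 1") (simp_all only: if_True if_False Un_iff Diff_iff xK simp_thms empty_iff)
          also have "\<dots> \<longleftrightarrow> (\<exists>q'\<in>K. x \<in> t q' \<and> snd q' ! fst q' = a)" by blast
          finally show ?thesis .
        qed
        also have "\<dots> \<longleftrightarrow> snd q ! fst q = a"
        proof
          assume "\<exists>q'\<in>K. x \<in> t q' \<and> snd q' ! fst q' = a"
          then obtain q' where q': "q' \<in> K" "x \<in> t q'" "snd q' ! fst q' = a" by blast
          show "snd q ! fst q = a" using q'(3) t_unique[OF q(1) q'(1) q(2) q'(2)] by simp
        qed (use q in blast)
        finally have "x \<in> ?r \<longleftrightarrow> snd q ! fst q = a" .
        then show ?thesis using g_eq[OF q] tG[OF q(2)] by simp
      next
        case False
        then have "g x = 1" by (simp add: g_def)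
        then show ?thesis using False by auto
      qed
    qed
    also have "\<dots> \<in> sets R" using finK t_sets by (auto intro!: sets.finite_UN)
    finally show "g -` {a} \<inter> space R \<in> sets R" .
  qed
  \<comment> \<open>\<open>n - L + 1\<close> is the number of levels from which a window of length
    \<open>L\<close> still fits into the tower, so \<open>\<kappa>\<close> is the mass of the points
    whose window is read off a single column.\<close>
  define \<kappa> where "\<kappa> = real (n - L + 1) * prob B"
  have \<kappa>: "\<kappa> \<ge> 1 - \<epsilon>"
  proof -
    have "1 - \<epsilon> \<le> (1 - real L / n) * (1 - \<epsilon> / 2)"
    proof -
      have "0 \<le> real L / n * (\<epsilon> / 2)" using \<epsilon> by simp
      have "(1 - y) * (1 - \<epsilon> / 2) = 1 - y - \<epsilon> / 2 + y * (\<epsilon> / 2)" for y :: real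
        by (simp add: field_simps)
      from this[of "real L / n"] show ?thesis using Ln \<open>0 \<le> real L / n * (\<epsilon> / 2)\<close> by linarith
    qed
    also have "\<dots> \<le> (1 - real L / n) * (real n * prob B)"
      using n B(3) by (intro mult_left_mono) (auto simp: field_simps)
    also have "\<dots> = real (n - L) * prob B" using n by (simp add: field_simps of_nat_diff)
    also have "\<dots> \<le> \<kappa>" unfolding \<kappa>_def by (intro mult_right_mono) auto
    finally show ?thesis .
  qed
  have lower: "prob {x \<in> G. orbit_word T g L x \<in> C} \<ge> \<kappa> * (\<Sum>v\<in>C. \<nu> L v)" if C: "C \<subseteq> words m L" for C
  proof -
    \<comment> \<open>A pair in \<open>Z\<close> is a level and a column whose window reads a word
      of \<open>C\<close>; by the marginal condition every level with a full window contributes the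
      same mass.\<close>
    define Z where "Z = (SIGMA j:{..n - L}. {w \<in> words m n. take L (drop j w) \<in> C})"
    have marg': "(\<Sum>w | w \<in> words m n \<and> take L (drop j w) \<in> C. \<nu> n w) = (\<Sum>v\<in>C. \<nu> L v)" if "j \<le> n - L" for j
    proof -
      have "(\<Sum>w | w \<in> words m n \<and> take L (drop j w) \<in> C. \<nu> n w) =
          (\<Sum>v\<in>C. \<Sum>w | w \<in> {w \<in> words m n. take L (drop j w) \<in> C} \<and> take L (drop j w) = v. \<nu> n w)"
        using finite_words finite_subset[OF C finite_words] by (subst sum.group) auto
      also have "\<dots> = (\<Sum>v\<in>C. \<nu> L v)"
      proof (rule sum.cong[OF refl])
        fix v assume v: "v \<in> C"
        have "{w. w \<in> {w \<in> words m n. take L (drop j w) \<in> C} \<and> take L (drop j w) = v} =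
            {w. w \<in> words m n \<and> take L (drop j w) = v}" using v by auto
        then show "(\<Sum>w | w \<in> {w \<in> words m n. take L (drop j w) \<in> C} \<and> take L (drop j w) = v. \<nu> n w) = \<nu> L v"
          using marg[of j n v] that v C n by auto
      qed
      finally show ?thesis .
    qed
    have sumZ: "(\<Sum>q\<in>Z. \<nu> n (snd q) * prob B) = \<kappa> * (\<Sum>v\<in>C. \<nu> L v)"
    proof -
      have "(\<Sum>q\<in>Z. \<nu> n (snd q) * prob B) =
          (\<Sum>j\<le>n - L. \<Sum>w | w \<in> words m n \<and> take L (drop j w) \<in> C. \<nu> n w * prob B)"
        unfolding Z_def by (subst sum.Sigma) (auto simp: finite_words case_prod_unfold)
      also have "\<dots> = (\<Sum>j\<le>n - L. (\<Sum>v\<in>C. \<nu> L v) * prob B)"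
        by (intro sum.cong refl) (simp add: marg' flip: sum_distrib_right)
      finally show ?thesis by (simp add: \<kappa>_def algebra_simps)
    qed
    show ?thesis
    proof -
      have ZK: "Z \<subseteq> K" using n L unfolding Z_def K_def by auto
      have "(\<Sum>q\<in>Z. \<nu> n (snd q) * prob B) = (\<Sum>q\<in>Z. prob (t q))"
        using ZK t_prob by (intro sum.cong) auto
      also have "\<dots> = prob (\<Union>q\<in>Z. t q)"
      proof (intro finite_measure_finite_Union[symmetric] finite_subset[OF ZK finK])
        show "disjoint_family_on t Z"
          unfolding disjoint_family_on_def using ZK t_unique by blast
      qed (use ZK t_sets in blast)
      also have "\<dots> \<le> prob {x \<in> G. orbit_word T g L x \<in> C}"
      proof (rule finite_measure_mono)
        show "(\<Union>q\<in>Z. t q) \<subseteq> {x \<in> G. orbit_word T g L x \<in> C}"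
        proof
          fix x assume "x \<in> (\<Union>q\<in>Z. t q)"
          then obtain j w where z: "(j, w) \<in> Z" "x \<in> t (j, w)" by auto
          then have jw: "j + L \<le> n" "w \<in> words m n" "take L (drop j w) \<in> C"
            using n by (auto simp: Z_def)
          have x: "x \<in> G" "(S ^^ j) x \<in> D w" using z by (auto simp: t_def)
          have lw: "length w = n" using jw by (simp add: words_def)
          have "orbit_word T g L x = take L (drop j w)"
          proof (rule nth_equalityI)
            fix l assume "l < length (orbit_word T g L x)"
            then have l: "l < L" by simp
            have "(S ^^ (j + l)) ((T ^^ l) x) = (S ^^ j) x" using x by (simp add: funpow_add ST_n)
            then have "(T ^^ l) x \<in> t (j + l, w)" using x TG_n by (simp add: t_def)
            moreover have "(j + l, w) \<in> K" using l jw by (simp add: K_def)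
            ultimately have "g ((T ^^ l) x) = w ! (j + l)" using g_eq by fastforce
            then show "orbit_word T g L x ! l = take L (drop j w) ! l" using l jw lw by simp
          qed (use jw lw in simp)
          then show "x \<in> {x \<in> G. orbit_word T g L x \<in> C}" using x jw by simp
        qed
      qed (use orbit_word_sets[OF g C] in auto)
      finally show ?thesis using sumZ by simp
    qed
  qed
  have lower': "prob {x \<in> G. orbit_word T g L x \<in> C} \<ge> (\<Sum>v\<in>C. \<nu> L v) - \<epsilon>" if C: "C \<subseteq> words m L" for C
  proof -
    have s: "0 \<le> (\<Sum>v\<in>C. \<nu> L v)" "(\<Sum>v\<in>C. \<nu> L v) \<le> 1"
      using \<nu>0 sum_mono2[OF finite_words C, of "\<nu> L"] \<nu>1[of L] by (auto intro: sum_nonneg)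
    have "(\<Sum>v\<in>C. \<nu> L v) - \<epsilon> \<le> (1 - \<epsilon>) * (\<Sum>v\<in>C. \<nu> L v)" using s \<epsilon> by (simp add: algebra_simps)
    also have "\<dots> \<le> \<kappa> * (\<Sum>v\<in>C. \<nu> L v)" using \<kappa> s by (intro mult_right_mono) auto
    finally show ?thesis using lower[OF C] by linarith
  qed
  \<comment> \<open>The upper bound for \<open>C\<close> is the lower bound for its complement in
    \<open>words m L\<close>.\<close>
  have "\<bar>prob {x \<in> G. orbit_word T g L x \<in> C} - (\<Sum>v\<in>C. \<nu> L v)\<bar> \<le> \<epsilon>" if C: "C \<subseteq> words m L" for C
  proof -
    have "prob {x \<in> G. orbit_word T g L x \<in> C} + prob {x \<in> G. orbit_word T g L x \<in> words m L - C} = 1"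
      using prob_orbit_word_words[OF g, of L] prob_orbit_word_sum[OF g order_refl, of L]
        prob_orbit_word_sum[OF g C] prob_orbit_word_sum[OF g Diff_subset, of L C]
        sum.subset_diff[OF C finite_words, of "\<lambda>w. prob {x \<in> G. orbit_word T g L x = w}"] by linarith
    moreover have "(\<Sum>v\<in>C. \<nu> L v) + (\<Sum>v\<in>words m L - C. \<nu> L v) = 1"
      using \<nu>1[of L] sum.subset_diff[OF C finite_words, of "\<nu> L"] by simp
    ultimately show ?thesis using lower'[OF C] lower'[of "words m L - C"] by auto
  qed
  then show ?thesis using that g by blast
qed

end

section \<open>Local-global equivalence\<close>

text \<open>\<open>rcg_isomorphic\<close> says nothing about the root being a vertex, and the
  inverse bijection controls the root only when it is one.\<close>

lemma rcg_isomorphic_sym: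
  assumes "rcg_isomorphic A B"
    "rroot A \<in> rverts A"
  shows "rcg_isomorphic B A"
proof -
  obtain h where h: "bij_betw h (rverts A) (rverts B)" "h (rroot A) = rroot B"
    "\<And>x. x \<in> rverts A \<Longrightarrow> rcolor B (h x) = rcolor A x"
    "\<And>x y. x \<in> rverts A \<Longrightarrow> y \<in> rverts A \<Longrightarrow> (h x, h y) \<in> redges B \<longleftrightarrow> (x, y) \<in> redges A"
    using assms unfolding rcg_isomorphic_def by blast
  let ?g = "inv_into (rverts A) h"
  have g: "?g y \<in> rverts A" "h (?g y) = y" if "y \<in> rverts B" for y
    using that h(1) by (auto simp: bij_betw_def inv_into_into f_inv_into_f)
  show ?thesis
    unfolding rcg_isomorphic_def
  proof (intro exI conjI ballI)
    show "bij_betw ?g (rverts B) (rverts A)" using h(1) by (rule bij_betw_inv_into)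
    show "?g (rroot B) = rroot A"
      using h(1,2) assms(2) by (metis bij_betw_inv_into_left)
    show "rcolor A (?g x) = rcolor B x" if "x \<in> rverts B" for x using g[OF that] h(3) by metis
    show "(?g x, ?g y) \<in> redges A \<longleftrightarrow> (x, y) \<in> redges B" if "x \<in> rverts B" "y \<in> rverts B" for x y
      using g[OF that(1)] g[OF that(2)] h(4) by metis
  qed
qed

lemma rcg_isomorphic_trans:
  assumes "rcg_isomorphic A B" "rcg_isomorphic B C"
  shows "rcg_isomorphic A C"
proof -
  obtain h where h: "bij_betw h (rverts A) (rverts B)" "h (rroot A) = rroot B"
    "\<And>x. x \<in> rverts A \<Longrightarrow> rcolor B (h x) = rcolor A x"
    "\<And>x y. x \<in> rverts A \<Longrightarrow> y \<in> rverts A \<Longrightarrow> (h x, h y) \<in> redges B \<longleftrightarrow> (x, y) \<in> redges A"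
    using assms unfolding rcg_isomorphic_def by blast
  obtain g where g: "bij_betw g (rverts B) (rverts C)" "g (rroot B) = rroot C"
    "\<And>x. x \<in> rverts B \<Longrightarrow> rcolor C (g x) = rcolor B x"
    "\<And>x y. x \<in> rverts B \<Longrightarrow> y \<in> rverts B \<Longrightarrow> (g x, g y) \<in> redges C \<longleftrightarrow> (x, y) \<in> redges B"
    using assms unfolding rcg_isomorphic_def by blast
  have "h x \<in> rverts B" if "x \<in> rverts A" for x using h(1) that by (auto simp: bij_betw_def)
  then show ?thesis
    unfolding rcg_isomorphic_def using h g
    by (intro exI[of _ "g \<circ> h"]) (auto intro: bij_betw_trans)
qed

text \<open>Model of the ball about \<open>(T ^^ r) x\<close>: vertex \<open>a\<close> stands for
  \<open>(T ^^ a) x\<close>. The centre is shifted to \<open>r\<close> so that only forward iterates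
  with natural exponents occur.\<close>

definition path_graph :: "nat \<Rightarrow> nat list \<Rightarrow> nat rooted_colored_graph" where
  "path_graph r w = \<lparr>rverts = {..2 * r},
     redges = {(a, b). a \<le> 2 * r \<and> b \<le> 2 * r \<and> (b = Suc a \<or> a = Suc b)}, rroot = r, rcolor = (!) w\<rparr>"

definition path_class :: "nat \<Rightarrow> nat list \<Rightarrow> nat rooted_colored_graph set" where
  "path_class r w = {H. rcg_isomorphic (path_graph r w) H}"

section \<open>Balls as coloured paths\<close>

context ergodic_graph
begin

text \<open>Backward neighbours are expressed by forward iterates, and freeness reduces equality of
  iterates to equality of exponents.\<close>

lemma edge_iff:
  assumes "x \<in> G"
  shows "((T ^^ a) x, (T ^^ b) x) \<in> E \<longleftrightarrow> b = Suc a \<or> a = Suc b"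
proof -
  have "((T ^^ a) x, (T ^^ b) x) \<in> E \<longleftrightarrow> (T ^^ b) x \<in> {T ((T ^^ a) x), S ((T ^^ a) x)}"
    using edges_G[OF TG_n[OF assms]] by auto
  also have "\<dots> \<longleftrightarrow> (T ^^ b) x = (T ^^ Suc a) x \<or> (T ^^ Suc b) x = (T ^^ a) x"
    using assms TS[OF TG_n] ST[OF TG_n] by (auto simp: TG_n) metis+
  also have "\<dots> \<longleftrightarrow> b = Suc a \<or> a = Suc b"
    using T_n_eq_iff[OF assms] by metis
  finally show ?thesis .
qed

lemma neighbour:
  assumes "x \<in> G" "(x, y) \<in> E"
  shows "y \<in> G" "y = T x \<or> y = S x"
proof -
  have "y \<in> {T x, S x}" using assms edges_G[OF assms(1)] by auto
  then show "y \<in> G" "y = T x \<or> y = S x" using assms TG SG by auto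
qed

context
  fixes k lam and \<Gamma> :: "'a graphing"
  assumes w: "weights k lam" and \<Gamma>: "vmeasure \<Gamma> = R" "edges \<Gamma> = E"
begin

abbreviation (input) "CC \<equiv> convex_combination k lam (\<lambda>_. \<Gamma>)"

lemma vmeasure_CC: "vmeasure CC = convex_measure k lam (\<lambda>_. R)"
  by (simp add: convex_combination_def \<Gamma>)

lemma edges_CC: "((i, x), v) \<in> edges CC \<longleftrightarrow> i \<in> {1..k} \<and> (\<exists>y. v = (i, y) \<and> (x, y) \<in> E)"
  by (auto simp: convex_combination_def \<Gamma>)

lemma ball_verts:
  assumes x: "x \<in> G" and i: "i \<in> {1..k}"
  shows "{v. \<exists>n\<le>r. ((i, (T ^^ r) x), v) \<in> edges CC ^^ n} = (\<lambda>a. (i, (T ^^ a) x)) ` {..2 * r}"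
proof -
  \<comment> \<open>After \<open>n\<close> steps the exponent differs from \<open>r\<close> by at
    most \<open>n\<close>. With fewer than \<open>r\<close> steps taken it is positive, so a
    backward step stays in the forward orbit of \<open>x\<close>.\<close>
  have 1: "\<exists>a. v = (i, (T ^^ a) x) \<and> r - n \<le> a \<and> a \<le> r + n"
    if "((i, (T ^^ r) x), v) \<in> edges CC ^^ n" "n \<le> r" for n v
    using that
  proof (induction n arbitrary: v)
    case 0 then show ?case by auto
  next
    case (Suc n)
    from Suc.prems obtain v' where v': "((i, (T ^^ r) x), v') \<in> edges CC ^^ n" "(v', v) \<in> edges CC"
      by auto
    then obtain a where a: "v' = (i, (T ^^ a) x)" "r - n \<le> a" "a \<le> r + n"
      using Suc.IH[OF v'(1)] Suc.prems(2) by auto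
    obtain y where y: "v = (i, y)" "((T ^^ a) x, y) \<in> E" using v'(2) a(1) by (auto simp: edges_CC)
    have "a > 0" using a(2) Suc.prems by simp
    then obtain b where b: "a = Suc b" by (cases a) auto
    have "S ((T ^^ a) x) = (T ^^ b) x" using b x ST[OF TG_n[OF x]] by simp
    then have "y = (T ^^ Suc a) x \<or> y = (T ^^ b) x" using neighbour(2)[OF TG_n[OF x] y(2)] by auto
    then show ?case
    proof
      assume "y = (T ^^ Suc a) x"
      then show ?thesis using y a by (intro exI[of _ "Suc a"]) auto
    next
      assume "y = (T ^^ b) x"
      then show ?thesis using y a b by (intro exI[of _ b]) auto
    qed
  qed
  have step: "((i, (T ^^ a) x), (i, (T ^^ b) x)) \<in> edges CC" if "b = Suc a \<or> a = Suc b" for a b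
    using edge_iff[OF x] i that by (simp add: edges_CC)
  have up: "((i, (T ^^ r) x), (i, (T ^^ (r + n)) x)) \<in> edges CC ^^ n" for n
  proof (induction n)
    case (Suc n)
    have "((i, (T ^^ (r + n)) x), (i, (T ^^ (r + Suc n)) x)) \<in> edges CC" by (intro step) auto
    then show ?case using Suc by (intro relpow_Suc_I[of _ "(i, (T ^^ (r + n)) x)"]) auto
  qed simp
  have down: "((i, (T ^^ r) x), (i, (T ^^ (r - n)) x)) \<in> edges CC ^^ n" if "n \<le> r" for n
    using that
  proof (induction n)
    case (Suc n)
    then have "((i, (T ^^ (r - n)) x), (i, (T ^^ (r - Suc n)) x)) \<in> edges CC" by (intro step) auto
    then show ?case using Suc by (intro relpow_Suc_I[of _ "(i, (T ^^ (r - n)) x)"]) auto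
  qed simp
  show ?thesis
  proof (intro subset_antisym subsetI)
    fix v assume "v \<in> {v. \<exists>n\<le>r. ((i, (T ^^ r) x), v) \<in> edges CC ^^ n}"
    then obtain n where "n \<le> r" "((i, (T ^^ r) x), v) \<in> edges CC ^^ n" by blast
    then show "v \<in> (\<lambda>a. (i, (T ^^ a) x)) ` {..2 * r}" using 1[of v n] by force
  next
    fix v assume "v \<in> (\<lambda>a. (i, (T ^^ a) x)) ` {..2 * r}"
    then obtain a where a: "a \<le> 2 * r" "v = (i, (T ^^ a) x)" by auto
    show "v \<in> {v. \<exists>n\<le>r. ((i, (T ^^ r) x), v) \<in> edges CC ^^ n}"
    proof (cases "a \<ge> r")
      case True
      then have "((i, (T ^^ r) x), v) \<in> edges CC ^^ (a - r)" "a - r \<le> r" using up[of "a - r"] a by auto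
      then show ?thesis by blast
    next
      case False
      then have "((i, (T ^^ r) x), v) \<in> edges CC ^^ (r - a)" "r - a \<le> r" using down[of "r - a"] a by auto
      then show ?thesis by blast
    qed
  qed
qed

text \<open>Freeness makes the ball a genuine path, so its coloured isomorphism type is that of the
  path carrying the word that starts \<open>r\<close> steps before the root.\<close>

lemma ball_class_path:
  assumes x: "x \<in> G" and i: "i \<in> {1..k}"
  shows "ball_class CC f r (i, (T ^^ r) x) = path_class r (orbit_word T (\<lambda>x. f (i, x)) (2 * r + 1) x)"
    (is "_ = path_class r ?w")
proof -
  let ?b = "colored_ball CC f r (i, (T ^^ r) x)"
  have "rcg_isomorphic (path_graph r ?w) ?b"
    unfolding rcg_isomorphic_def
  proof (intro exI[of _ "\<lambda>a. (i, (T ^^ a) x)"] conjI ballI)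
    have "inj_on (\<lambda>a. (i, (T ^^ a) x)) {..2 * r}" using T_n_eq_iff[OF x] by (auto simp: inj_on_def)
    then show "bij_betw (\<lambda>a. (i, (T ^^ a) x)) (rverts (path_graph r ?w)) (rverts ?b)"
      by (simp add: bij_betw_def path_graph_def colored_ball_def Let_def ball_verts[OF x i])
  next
    fix a b assume "a \<in> rverts (path_graph r ?w)" "b \<in> rverts (path_graph r ?w)"
    then show "((i, (T ^^ a) x), (i, (T ^^ b) x)) \<in> redges ?b \<longleftrightarrow> (a, b) \<in> redges (path_graph r ?w)"
      using i by (simp add: path_graph_def colored_ball_def Let_def ball_verts[OF x i] edges_CC edge_iff[OF x])
  qed (auto simp: path_graph_def colored_ball_def Let_def)
  note ab = this
  have ba: "rcg_isomorphic ?b (path_graph r ?w)"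
    by (rule rcg_isomorphic_sym[OF ab]) (simp add: path_graph_def)
  show ?thesis
    unfolding ball_class_def path_class_def
    by (blast intro: rcg_isomorphic_trans[OF ab] rcg_isomorphic_trans[OF ba])
qed

text \<open>The root is moved back by \<open>S ^^ r\<close>, which preserves the measure, so that
  statistics of balls become statistics of words.\<close>

lemma measure_ball_class:
  assumes f: "f \<in> measurable (vmeasure CC) (count_space {1..m})"
  shows "measure (vmeasure CC) {v \<in> space (vmeasure CC). ball_class CC f r v = c} =
    (\<Sum>i=1..k. lam i * prob {x \<in> G. orbit_word T (\<lambda>x. f (i, x)) (2 * r + 1) x \<in>
        {w \<in> words m (2 * r + 1). path_class r w = c}})"
proof -
  let ?L = "2 * r + 1"
  let ?A = "{v \<in> space (vmeasure CC). ball_class CC f r v = c}"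
  let ?W = "{w \<in> words m ?L. path_class r w = c}"
  let ?X = "\<lambda>i. {x \<in> G. orbit_word T (\<lambda>x. f (i, x)) ?L x \<in> ?W}"
  let ?Y = "\<lambda>i. {x \<in> G. (S ^^ r) x \<in> ?X i}"
  have fi: "(\<lambda>x. f (i, x)) \<in> measurable R (count_space {1..m})" if "i \<in> {1..k}" for i
    using f that unfolding vmeasure_CC measurable_convex_iff[OF w] by blast
  have X: "?X i \<in> sets R" if "i \<in> {1..k}" for i
    using orbit_word_sets[OF fi[OF that], of ?W ?L] by auto
  have ae: "AE x in R. x \<in> ?Y i \<longleftrightarrow> x \<in> Pair i -` ?A" if i: "i \<in> {1..k}" for i
    using AE_G
  proof eventually_elim
    fix x assume x: "x \<in> G"
    have "ball_class CC f r (i, x) = path_class r (orbit_word T (\<lambda>x. f (i, x)) ?L ((S ^^ r) x))"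
      using ball_class_path[OF SG_n[OF x] i, of f r r] TS_n[OF x] by simp
    moreover have "orbit_word T (\<lambda>x. f (i, x)) ?L ((S ^^ r) x) \<in> words m ?L"
      by (rule orbit_word_in_words[OF fi[OF i] SG_n[OF x]])
    ultimately show "x \<in> ?Y i \<longleftrightarrow> x \<in> Pair i -` ?A"
      using x SG_n[OF x] G_space[OF x] i by (auto simp: vmeasure_CC space_convex[OF w])
  qed
  have Ai: "Pair i -` ?A \<in> sets R" "prob (Pair i -` ?A) = prob (?X i)" if i: "i \<in> {1..k}" for i
  proof -
    have "Pair i -` ?A \<subseteq> space R" by (auto simp: vmeasure_CC space_convex[OF w])
    \<comment> \<open>Outside \<open>G\<close> the balls are arbitrary; measurability follows from
      completeness, by agreement almost everywhere with \<open>?Y i\<close>.\<close>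
    then show s: "Pair i -` ?A \<in> sets R"
      using in_sets_AE[OF ae[OF i] prob_S_n(1)[OF X[OF i]]] by blast
    have "prob (Pair i -` ?A) = prob (?Y i)"
      using ae[OF i] s prob_S_n(1)[OF X[OF i]] by (intro finite_measure_eq_AE) auto
    then show "prob (Pair i -` ?A) = prob (?X i)" using prob_S_n(2)[OF X[OF i]] by simp
  qed
  have "?A \<in> sets (convex_measure k lam (\<lambda>_. R))"
    unfolding sets_convex[OF w] using Ai by (auto simp: vmeasure_CC space_convex[OF w])
  then have "measure (vmeasure CC) ?A = (\<Sum>i=1..k. lam i * prob (Pair i -` ?A))"
    unfolding vmeasure_CC by (intro measure_convex[OF w]) (auto intro: prob_space_axioms)
  then show ?thesis using Ai(2) by simp
qed

end

end

text \<open>Uniform approximation over all classes gives convergence in each coordinate, which is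
  convergence in the product topology.\<close>

lemma closure_pointwise:
  fixes q :: "'c \<Rightarrow> real"
  assumes "\<And>\<epsilon>. \<epsilon> > 0 \<Longrightarrow> \<exists>p\<in>Q. \<forall>c. \<bar>p c - q c\<bar> \<le> \<epsilon>"
  shows "q \<in> closure Q"
proof -
  have "\<exists>p\<in>Q. \<forall>c. \<bar>p c - q c\<bar> \<le> inverse (real (Suc n))" for n by (rule assms) simp
  then obtain p where p: "\<And>n. p n \<in> Q" "\<And>n c. \<bar>p n c - q c\<bar> \<le> inverse (real (Suc n))" by metis
  have "(\<lambda>n. p n c) \<longlonglongrightarrow> q c" for c
  proof -
    have "(\<lambda>n. p n c - q c) \<longlonglongrightarrow> 0"
      by (rule Lim_null_comparison[OF _ LIMSEQ_inverse_real_of_nat]) (use p(2)[of _ c] in auto)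
    then show ?thesis by (simp add: LIM_zero_iff)
  qed
  then have "limitin (product_topology (\<lambda>_. euclidean) UNIV) p q sequentially"
    by (simp add: limitin_componentwise)
  then have "p \<longlonglongrightarrow> q" unfolding euclidean_product_topology by simp
  then show ?thesis
    using subsetD[OF closure_subset p(1)]
    by (intro Lim_in_closed_set[of "closure Q" p sequentially]) auto
qed

text \<open>The mixture \<open>\<nu>\<close> of the word statistics of the components is again
  consistent under shifts, so one colouring \<open>g\<close> of \<open>R'\<close> imitates it. With
  \<open>g\<close> used on every component the weights \<open>lam'\<close> sum to one and
  disappear.\<close>

lemma Q_set_closure:
  fixes R :: "'a measure" and R' :: "'b measure"
  assumes A: "ergodic_graph R E T S G u" and B: "ergodic_graph R' E' T' S' G' u'"
    and \<Gamma>: "vmeasure \<Gamma> = R" "edges \<Gamma> = E" and \<Delta>: "vmeasure \<Delta> = R'" "edges \<Delta> = E'"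
    and w: "weights k lam" "weights k' lam'" and m: "m \<ge> 1"
  shows "Q_set (convex_combination k lam (\<lambda>_. \<Gamma>)) r m \<subseteq> closure (Q_set (convex_combination k' lam' (\<lambda>_. \<Delta>)) r m)"
proof
  let ?C = "convex_combination k lam (\<lambda>_. \<Gamma>)" and ?D = "convex_combination k' lam' (\<lambda>_. \<Delta>)"
  interpret A: ergodic_graph R E T S G u by fact
  interpret B: ergodic_graph R' E' T' S' G' u' by fact
  fix q assume "q \<in> Q_set ?C r m"
  then obtain f where f: "f \<in> measurable (vmeasure ?C) (count_space {1..m})"
    and q: "q = (\<lambda>c. measure (vmeasure ?C) {v \<in> space (vmeasure ?C). ball_class ?C f r v = c})"
    unfolding Q_set_def Let_def by blast
  define L where "L = 2 * r + 1"
  then have L: "L > 0" by simp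
  have fi: "(\<lambda>x. f (i, x)) \<in> measurable R (count_space {1..m})" if "i \<in> {1..k}" for i
    using f that unfolding A.vmeasure_CC[OF w(1) \<Gamma>] measurable_convex_iff[OF w(1)] by blast
  have l: "lam i \<ge> 0" if "i \<in> {1..k}" for i using w(1) that by (auto simp: weights_def less_imp_le)
  define \<nu> where "\<nu> n v = (\<Sum>i=1..k. lam i * A.prob {x \<in> G. orbit_word T (\<lambda>x. f (i, x)) n x = v})" for n v
  have \<nu>_sum: "(\<Sum>v\<in>C. \<nu> n v) = (\<Sum>i=1..k. lam i * A.prob {x \<in> G. orbit_word T (\<lambda>x. f (i, x)) n x \<in> C})"
    if C: "C \<subseteq> words m n" for n C
  proof -
    have "(\<Sum>v\<in>C. \<nu> n v) = (\<Sum>i=1..k. lam i * (\<Sum>v\<in>C. A.prob {x \<in> G. orbit_word T (\<lambda>x. f (i, x)) n x = v}))"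
      unfolding \<nu>_def sum_distrib_left by (rule sum.swap)
    also have "\<dots> = (\<Sum>i=1..k. lam i * A.prob {x \<in> G. orbit_word T (\<lambda>x. f (i, x)) n x \<in> C})"
      by (intro sum.cong refl) (simp add: A.prob_orbit_word_sum[OF fi C])
    finally show ?thesis .
  qed
  have \<nu>0: "0 \<le> \<nu> n v" for n v unfolding \<nu>_def using l by (intro sum_nonneg) auto
  have \<nu>1: "(\<Sum>v\<in>words m n. \<nu> n v) = 1" for n
  proof -
    have "(\<Sum>v\<in>words m n. \<nu> n v) = (\<Sum>i=1..k. lam i)"
      unfolding \<nu>_sum[OF order_refl] by (intro sum.cong refl) (simp add: A.prob_orbit_word_words[OF fi])
    then show ?thesis using w(1) by (simp add: weights_def)
  qed
  have marg: "(\<Sum>w | w \<in> words m n \<and> take L (drop j w) = v. \<nu> n w) = \<nu> L v"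
    if "j + L \<le> n" "v \<in> words m L" for n j v
  proof -
    have "(\<Sum>w | w \<in> words m n \<and> take L (drop j w) = v. \<nu> n w) =
       (\<Sum>i=1..k. lam i * (\<Sum>w | w \<in> words m n \<and> take L (drop j w) = v. A.prob {x \<in> G. orbit_word T (\<lambda>x. f (i, x)) n x = w}))"
      unfolding \<nu>_def sum_distrib_left by (rule sum.swap)
    also have "\<dots> = \<nu> L v"
      unfolding \<nu>_def by (intro sum.cong refl) (simp add: A.orbit_word_marginal[OF fi that])
    finally show ?thesis .
  qed
  show "q \<in> closure (Q_set ?D r m)"
  proof (rule closure_pointwise)
    fix \<epsilon> :: real assume \<epsilon>: "\<epsilon> > 0"
    obtain g where g: "g \<in> measurable R' (count_space {1..m})"
      "\<And>C. C \<subseteq> words m L \<Longrightarrow> \<bar>B.prob {x \<in> G'. orbit_word T' g L x \<in> C} - (\<Sum>v\<in>C. \<nu> L v)\<bar> \<le> \<epsilon>"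
      by (rule B.coloring[OF m L \<epsilon> \<nu>0 \<nu>1 marg]) (assumption | rule that)+
    have gC: "(\<lambda>v. g (snd v)) \<in> measurable (vmeasure ?D) (count_space {1..m})"
      unfolding B.vmeasure_CC[OF w(2) \<Delta>] measurable_convex_iff[OF w(2)] using g(1) by simp
    show "\<exists>p\<in>Q_set ?D r m. \<forall>c. \<bar>p c - q c\<bar> \<le> \<epsilon>"
    proof (intro bexI allI)
      let ?p = "\<lambda>c. measure (vmeasure ?D) {v \<in> space (vmeasure ?D). ball_class ?D (\<lambda>v. g (snd v)) r v = c}"
      show "?p \<in> Q_set ?D r m" unfolding Q_set_def Let_def using gC by blast
      fix c
      let ?W = "{w \<in> words m L. path_class r w = c}"
      have "?p c = (\<Sum>i=1..k'. lam' i * B.prob {x \<in> G'. orbit_word T' g L x \<in> ?W})"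
        unfolding B.measure_ball_class[OF w(2) \<Delta> gC] L_def by simp
      also have "\<dots> = B.prob {x \<in> G'. orbit_word T' g L x \<in> ?W}"
        using w(2) by (simp add: weights_def flip: sum_distrib_right)
      finally have p: "?p c = B.prob {x \<in> G'. orbit_word T' g L x \<in> ?W}" .
      have "q c = (\<Sum>v\<in>?W. \<nu> L v)"
        unfolding q A.measure_ball_class[OF w(1) \<Gamma> f] L_def by (subst \<nu>_sum) auto
      then show "\<bar>?p c - q c\<bar> \<le> \<epsilon>" using g(2)[of ?W] p by simp
    qed
  qed
qed

lemma local_global_equivalent_ergodic:
  assumes "ergodic_graph (vmeasure \<Gamma>) (edges \<Gamma>) T S G u" "ergodic_graph (vmeasure \<Delta>) (edges \<Delta>) T' S' G' u'"
    and "weights k lam" "weights k' lam'"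
  shows "local_global_equivalent (convex_combination k lam (\<lambda>_. \<Gamma>)) (convex_combination k' lam' (\<lambda>_. \<Delta>))"
  unfolding local_global_equivalent_def
  using Q_set_closure[OF assms(1,2) refl refl refl refl assms(3,4)]
    Q_set_closure[OF assms(2,1) refl refl refl refl assms(4,3)]
  by (intro allI impI subset_antisym closure_minimal) auto

section \<open>Automorphisms of convex combinations\<close>

definition fibre_map :: "(nat \<Rightarrow> nat) \<Rightarrow> (nat \<Rightarrow> 'a \<Rightarrow> 'a) \<Rightarrow> nat \<times> 'a \<Rightarrow> nat \<times> 'a" where
  "fibre_map \<sigma> s = (\<lambda>(i, x). (\<sigma> i, s i x))"

lemma fibre_map_apply [simp]: "fibre_map \<sigma> s (i, x) = (\<sigma> i, s i x)"
  by (simp add: fibre_map_def)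

context
  fixes k lam and R :: "'a measure"
  assumes w: "weights k lam"
begin

text \<open>Sets are pulled back component by component; equality of the weights of \<open>i\<close>
  and \<open>\<sigma> i\<close> lets the sum be reindexed by the permutation.\<close>

lemma fibre_map_preserves:
  assumes \<sigma>: "\<sigma> permutes {1..k}" "\<And>i. i \<in> {1..k} \<Longrightarrow> lam (\<sigma> i) = lam i"
    and s: "\<And>i. i \<in> {1..k} \<Longrightarrow> s i \<in> measurable R R" "\<And>i. i \<in> {1..k} \<Longrightarrow> distr R R (s i) = R"
  shows "fibre_map \<sigma> s \<in> measurable (convex_measure k lam (\<lambda>_. R)) (convex_measure k lam (\<lambda>_. R))"
    and "distr (convex_measure k lam (\<lambda>_. R)) (convex_measure k lam (\<lambda>_. R)) (fibre_map \<sigma> s) = convex_measure k lam (\<lambda>_. R)"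
proof -
  let ?C = "convex_measure k lam (\<lambda>_. R)"
  have \<sigma>i: "\<sigma> i \<in> {1..k}" if "i \<in> {1..k}" for i using \<sigma>(1) that by (simp only: permutes_in_image)
  show m: "fibre_map \<sigma> s \<in> measurable ?C ?C"
    unfolding measurable_convex_iff[OF w]
  proof
    fix i assume i: "i \<in> {1..k}"
    show "(\<lambda>x. fibre_map \<sigma> s (i, x)) \<in> measurable R ?C"
      using measurable_Pair_convex[OF w \<sigma>i[OF i] s(1)[OF i]] by simp
  qed
  show "distr ?C ?C (fibre_map \<sigma> s) = ?C"
  proof (rule measure_eqI)
    fix A assume "A \<in> sets (distr ?C ?C (fibre_map \<sigma> s))"
    then have A: "A \<in> sets ?C" by simp
    have Aj: "Pair j -` A \<in> sets R" if "j \<in> {1..k}" for j using A that unfolding sets_convex[OF w] by blast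
    have "emeasure (distr ?C ?C (fibre_map \<sigma> s)) A = emeasure ?C (fibre_map \<sigma> s -` A \<inter> space ?C)"
      using m A by (rule emeasure_distr)
    also have "\<dots> = (\<Sum>i=1..k. ennreal (lam i) * emeasure R (Pair i -` (fibre_map \<sigma> s -` A \<inter> space ?C)))"
      using measurable_sets[OF m A] by (rule emeasure_convex[OF w])
    also have "\<dots> = (\<Sum>i=1..k. ennreal (lam (\<sigma> i)) * emeasure R (Pair (\<sigma> i) -` A))"
    proof (rule sum.cong[OF refl])
      fix i assume i: "i \<in> {1..k}"
      have "Pair i -` (fibre_map \<sigma> s -` A \<inter> space ?C) = s i -` (Pair (\<sigma> i) -` A) \<inter> space R"
        using i by (auto simp: space_convex[OF w])
      moreover have "emeasure R (s i -` (Pair (\<sigma> i) -` A) \<inter> space R) = emeasure R (Pair (\<sigma> i) -` A)"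
        using emeasure_distr[OF s(1)[OF i] Aj[OF \<sigma>i[OF i]]] s(2)[OF i] by simp
      ultimately show "ennreal (lam i) * emeasure R (Pair i -` (fibre_map \<sigma> s -` A \<inter> space ?C)) =
          ennreal (lam (\<sigma> i)) * emeasure R (Pair (\<sigma> i) -` A)" using \<sigma>(2)[OF i] by simp
    qed
    also have "\<dots> = (\<Sum>i=1..k. ennreal (lam i) * emeasure R (Pair i -` A))"
      using sum.permute[OF \<sigma>(1), of "\<lambda>i. ennreal (lam i) * emeasure R (Pair i -` A)"] by (simp add: o_def)
    also have "\<dots> = emeasure ?C A" using A by (rule emeasure_convex[OF w, symmetric])
    finally show "emeasure (distr ?C ?C (fibre_map \<sigma> s)) A = emeasure ?C A" .
  qed simp
qed

lemma inv_mpt_fibre_map: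
  assumes \<sigma>: "\<sigma> permutes {1..k}" "\<And>i. i \<in> {1..k} \<Longrightarrow> lam (\<sigma> i) = lam i"
    and s: "\<And>i. i \<in> {1..k} \<Longrightarrow> inv_mpt R (s i)"
  shows "inv_mpt (convex_measure k lam (\<lambda>_. R)) (fibre_map \<sigma> s)"
proof -
  let ?\<tau> = "inv_into UNIV \<sigma>" and ?C = "convex_measure k lam (\<lambda>_. R)"
  have "\<forall>i\<in>{1..k}. \<exists>t. inv_mpt R t \<and> (AE x in R. t (s i x) = x) \<and> (AE x in R. s i (t x) = x)"
  proof
    fix i assume i: "i \<in> {1..k}"
    obtain t where "inv_mpt R t" "AE x in R. t (s i x) = x" "AE x in R. s i (t x) = x"
      by (rule inv_mpt_inverse[OF s[OF i]])
    then show "\<exists>t. inv_mpt R t \<and> (AE x in R. t (s i x) = x) \<and> (AE x in R. s i (t x) = x)" by blast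
  qed
  then obtain t where "\<forall>i\<in>{1..k}. inv_mpt R (t i) \<and> (AE x in R. t i (s i x) = x) \<and> (AE x in R. s i (t i x) = x)"
    by (rule bchoice[THEN exE])
  then have t: "\<And>i. i \<in> {1..k} \<Longrightarrow> inv_mpt R (t i)" "\<And>i. i \<in> {1..k} \<Longrightarrow> AE x in R. t i (s i x) = x"
      "\<And>i. i \<in> {1..k} \<Longrightarrow> AE x in R. s i (t i x) = x" by blast+
  have \<sigma>i: "\<sigma> i \<in> {1..k}" if "i \<in> {1..k}" for i using \<sigma>(1) that by (simp only: permutes_in_image)
  have \<tau>: "?\<tau> permutes {1..k}" "?\<tau> i \<in> {1..k}" "lam (?\<tau> i) = lam i" if "i \<in> {1..k}" for i
    using permutes_inv[OF \<sigma>(1)] perm_inv_in[OF \<sigma>(1) that] \<sigma>(2)[OF perm_inv_in[OF \<sigma>(1) that]]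
    by (simp_all add: permutes_inverses[OF \<sigma>(1)])
  show ?thesis
  \<comment> \<open>Component \<open>j\<close> is reached from component \<open>?\<tau> j\<close>,
    so the way back uses the inverse of the map with index \<open>?\<tau> j\<close>.\<close>
  proof (rule inv_mptI[where S="fibre_map ?\<tau> (\<lambda>i. t (?\<tau> i))"])
    show "AE v in convex_measure k lam (\<lambda>_. R). fibre_map ?\<tau> (\<lambda>i. t (?\<tau> i)) (fibre_map \<sigma> s v) = v"
      unfolding AE_convex[OF w] by (auto simp: permutes_inverses[OF \<sigma>(1)] t)
    show "AE v in convex_measure k lam (\<lambda>_. R). fibre_map \<sigma> s (fibre_map ?\<tau> (\<lambda>i. t (?\<tau> i)) v) = v"
      unfolding AE_convex[OF w] using t(3)[OF \<tau>(2)] by (auto simp: permutes_inverses[OF \<sigma>(1)])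
    show "fibre_map \<sigma> s \<in> measurable ?C ?C" "distr ?C ?C (fibre_map \<sigma> s) = ?C"
      using fibre_map_preserves[OF \<sigma>, of s] inv_mptD[OF s] by auto
    have p: "?\<tau> permutes {1..k}" by (rule permutes_inv[OF \<sigma>(1)])
    show "fibre_map ?\<tau> (\<lambda>i. t (?\<tau> i)) \<in> measurable ?C ?C" "distr ?C ?C (fibre_map ?\<tau> (\<lambda>i. t (?\<tau> i))) = ?C"
      using fibre_map_preserves[OF p \<tau>(3), of "\<lambda>i. t (?\<tau> i)"] inv_mptD[OF t(1)[OF \<tau>(2)]] by auto
  qed
qed

end

context ergodic_graph
begin

lemma inv_mpt_T: "inv_mpt R T" "inv_mpt R S"
proof -
  have 1: "AE x in R. S (T x) = x" using AE_G by eventually_elim (rule ST)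
  have 2: "AE x in R. T (S x) = x" using AE_G by eventually_elim (rule TS)
  show "inv_mpt R T" "inv_mpt R S" using inv_mptI[OF T S 1 2] inv_mptI[OF S T 2 1] by auto
qed

text \<open>The condition defining \<open>aut_pm\<close>, read on representatives.\<close>

definition pm :: "('a \<Rightarrow> 'a) \<Rightarrow> bool" where
  "pm s \<longleftrightarrow> inv_mpt R s \<and> ((AE x in R. s (T x) = T (s x)) \<or> (AE x in R. s (T x) = S (s x)))"

text \<open>The companion relation for \<open>S\<close> arises by evaluating the given one at
  \<open>S x\<close> and cancelling.\<close>

lemma pm_cases:
  assumes "pm s"
  obtains "AE x in R. s (T x) = T (s x)" "AE x in R. s (S x) = S (s x)"
    | "AE x in R. s (T x) = S (s x)" "AE x in R. s (S x) = T (s x)"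
proof -
  have s: "inv_mpt R s" using assms by (simp add: pm_def)
  note sG = inv_mpt_AE[OF s AE_G] note sS = inv_mpt_AE[OF inv_mpt_T(2)]
  from assms consider "AE x in R. s (T x) = T (s x)" | "AE x in R. s (T x) = S (s x)" by (auto simp: pm_def)
  then show ?thesis
  proof cases
    case 1
    have "AE x in R. s (S x) = S (s x)"
      using sS[OF 1] sS[OF sG] AE_G by eventually_elim (metis TS ST)
    then show ?thesis using 1 that by blast
  next
    case 2
    have "AE x in R. s (S x) = T (s x)"
      using sS[OF 2] sS[OF sG] AE_G by eventually_elim (metis TS)
    then show ?thesis using 2 that by blast
  qed
qed

lemma carrier_aut_pm: "carrier (aut_pm R T) = {aut_class R s | s. pm s}"
proof -
  have i: "AE x in R. S (T x) = x" using AE_G by eventually_elim (rule ST)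
  show ?thesis unfolding aut_pm_carrier[OF inv_mpt_T i] pm_def by auto
qed

context
  fixes k lam and \<Gamma> :: "'a graphing"
  assumes w: "weights k lam" and \<Gamma>: "vmeasure \<Gamma> = R" "edges \<Gamma> = E"
begin

abbreviation (input) "C \<equiv> convex_measure k lam (\<lambda>_. R)"
abbreviation (input) "CG \<equiv> convex_combination k lam (\<lambda>_. \<Gamma>)"
abbreviation (input) "Th \<equiv> fibre_map id (\<lambda>_. T)"
abbreviation (input) "Sh \<equiv> fibre_map id (\<lambda>_. S)"

lemma C_prob: "prob_space C"
  by (rule prob_space_convex[OF w]) (rule prob_space_axioms)

lemma inv_mpt_Th: "inv_mpt C Th" "inv_mpt C Sh"
  using inv_mpt_T by (auto intro!: inv_mpt_fibre_map[OF w] permutes_id)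

lemma AE_Gh: "AE v in C. v \<in> {1..k} \<times> G"
  unfolding AE_convex[OF w] using AE_G by simp

lemma Sh_Th: "v \<in> {1..k} \<times> G \<Longrightarrow> Sh (Th v) = v" "v \<in> {1..k} \<times> G \<Longrightarrow> Th (Sh v) = v"
  using TS ST by auto

text \<open>Freeness for two steps: the neighbours of a vertex are different, so an edge count is a
  sum over \<open>T\<close> and \<open>S\<close>.\<close>

lemma T_neq_S: "x \<in> G \<Longrightarrow> T x \<noteq> S x"
  using aperiodic[of x 2] TS[of x] by (auto simp: numeral_2_eq_2)

lemma Th_neq: "v \<in> {1..k} \<times> G \<Longrightarrow> Th v \<noteq> Sh v" "v \<in> {1..k} \<times> G \<Longrightarrow> Th (Th v) \<noteq> v"
  using T_neq_S aperiodic[of _ 2] by (auto simp: numeral_2_eq_2)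

section \<open>Edge counts and the edge measure\<close>

lemma edges_to_CG:
  assumes v: "v \<in> {1..k} \<times> G"
  shows "(of_nat (edges_to CG v B) :: ennreal) = indicator B (Th v) + indicator B (Sh v)"
proof -
  obtain i x where vx: "v = (i, x)" "i \<in> {1..k}" "x \<in> G" using v by auto
  have "{y \<in> B. (v, y) \<in> edges CG} = {y \<in> {Th v, Sh v}. y \<in> B}"
    using vx edges_G[OF vx(3)] by (auto simp: edges_CC[OF w \<Gamma>])
  moreover have "card {y \<in> {Th v, Sh v}. y \<in> B} = (if Th v \<in> B then 1 else 0) + (if Sh v \<in> B then 1 else 0)"
  proof -
    have "{y \<in> {Th v, Sh v}. y \<in> B} = (if Th v \<in> B then {Th v} else {}) \<union> (if Sh v \<in> B then {Sh v} else {})"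
      by auto
    then show ?thesis using Th_neq(1)[OF v] by auto
  qed
  ultimately show ?thesis unfolding edges_to_def by (simp add: indicator_def)
qed

lemma graph_measurable:
  assumes "f \<in> measurable C C"
  shows "(\<lambda>v. (v, f v)) \<in> measurable C (C \<Otimes>\<^sub>M C)"
  using assms by measurable

text \<open>\<open>edge_measure\<close> is a definite description. The sum of the images of
  \<open>C\<close> under the graph maps of \<open>Th\<close> and \<open>Sh\<close> has the required
  values on rectangles, and rectangles determine a measure of finite total mass, here at most
  two.\<close>

lemma edge_measure_CG:
  shows sets_edge_measure: "sets (edge_measure CG) = sets (C \<Otimes>\<^sub>M C)"
    and emeasure_edge_measure: "Z \<in> sets (C \<Otimes>\<^sub>M C) \<Longrightarrow> emeasure (edge_measure CG) Z =
      emeasure C {v \<in> space C. (v, Th v) \<in> Z} + emeasure C {v \<in> space C. (v, Sh v) \<in> Z}"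
proof -
  let ?P = "C \<Otimes>\<^sub>M C"
  note mT = inv_mptD(1)[OF inv_mpt_Th(1)] and mS = inv_mptD(1)[OF inv_mpt_Th(2)]
  have pre: "emeasure (distr C ?P (\<lambda>v. (v, f v))) Z = emeasure C {v \<in> space C. (v, f v) \<in> Z}"
    if "Z \<in> sets ?P" "f \<in> measurable C C" for Z f
    using emeasure_distr[OF graph_measurable[OF that(2)] that(1)]
    by (simp add: vimage_def Int_def conj_commute)
  define D1 where "D1 = distr C ?P (\<lambda>v. (v, Th v))"
  define D2 where "D2 = distr C ?P (\<lambda>v. (v, Sh v))"
  define H where "H = measure_of (space ?P) (sets ?P) (\<lambda>Z. emeasure D1 Z + emeasure D2 Z)"
  have sH: "sets H = sets ?P" "space H = space ?P" unfolding H_def by auto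
  have eH: "emeasure H Z = emeasure D1 Z + emeasure D2 Z" if Z: "Z \<in> sets ?P" for Z
    unfolding H_def
  proof (rule emeasure_measure_of_sigma)
    show "sigma_algebra (space ?P) (sets ?P)" by (rule sets.sigma_algebra_axioms)
    show "positive (sets ?P) (\<lambda>Z. emeasure D1 Z + emeasure D2 Z)" by (simp add: positive_def)
    show "countably_additive (sets ?P) (\<lambda>Z. emeasure D1 Z + emeasure D2 Z)"
      unfolding countably_additive_def
    proof (intro allI impI)
      fix A :: "nat \<Rightarrow> _" assume A: "range A \<subseteq> sets ?P" "disjoint_family A"
      have "(\<Sum>i. emeasure D1 (A i)) = emeasure D1 (\<Union>i. A i)" "(\<Sum>i. emeasure D2 (A i)) = emeasure D2 (\<Union>i. A i)"
        using A by (auto intro!: suminf_emeasure simp: D1_def D2_def)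
      then show "(\<Sum>i. emeasure D1 (A i) + emeasure D2 (A i)) = emeasure D1 (\<Union>i. A i) + emeasure D2 (\<Union>i. A i)"
        by (simp add: suminf_add[symmetric])
    qed
  qed (rule Z)
  have rect: "emeasure H (A \<times> B) = (\<integral>\<^sup>+x\<in>A. of_nat (edges_to CG x B) \<partial>C)"
    if A: "A \<in> sets C" and B: "B \<in> sets C" for A B
  proof -
    let ?a = "A \<inter> (Th -` B \<inter> space C)" and ?b = "A \<inter> (Sh -` B \<inter> space C)"
    have s: "?a \<in> sets C" "?b \<in> sets C" using A measurable_sets[OF mT B] measurable_sets[OF mS B] by auto
    have "(\<integral>\<^sup>+x\<in>A. of_nat (edges_to CG x B) \<partial>C) = (\<integral>\<^sup>+x. indicator ?a x + indicator ?b x \<partial>C)"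
    proof (rule nn_integral_cong_AE)
      show "AE v in C. of_nat (edges_to CG v B) * indicator A v = indicator ?a v + (indicator ?b v :: ennreal)"
        using AE_Gh AE_space
        by eventually_elim (auto simp: edges_to_CG indicator_def)
    qed
    also have "\<dots> = emeasure C ?a + emeasure C ?b"
      using s by (subst nn_integral_add) auto
    also have "?a = {v \<in> space C. (v, Th v) \<in> A \<times> B}" using sets.sets_into_space[OF A] by auto
    also have "?b = {v \<in> space C. (v, Sh v) \<in> A \<times> B}" using sets.sets_into_space[OF A] by auto
    finally show ?thesis
      using A B by (simp only: eH[OF pair_measureI[OF A B]] D1_def D2_def
        pre[OF pair_measureI[OF A B] mT] pre[OF pair_measureI[OF A B] mS])
  qed
  have "edge_measure CG = H"
    unfolding edge_measure_def Let_def vmeasure_CC[OF w \<Gamma>]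
  proof (rule the_equality)
    show "sets H = sets ?P \<and> (\<forall>A\<in>sets C. \<forall>B\<in>sets C. emeasure H (A \<times> B) = (\<integral>\<^sup>+x\<in>A. of_nat (edges_to CG x B) \<partial>C))"
      using sH rect by auto
    fix \<eta> assume \<eta>: "sets \<eta> = sets ?P \<and> (\<forall>A\<in>sets C. \<forall>B\<in>sets C. emeasure \<eta> (A \<times> B) = (\<integral>\<^sup>+x\<in>A. of_nat (edges_to CG x B) \<partial>C))"
    show "\<eta> = H"
    proof (rule measure_eqI_generator_eq[where \<Omega>="space C \<times> space C" and E="{a \<times> b | a b. a \<in> sets C \<and> b \<in> sets C}"
          and A="\<lambda>_. space C \<times> space C"])
      show "Int_stable {a \<times> b | a b. a \<in> sets C \<and> b \<in> sets C}" by (rule Int_stable_pair_measure_generator)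
      show "{a \<times> b | a b. a \<in> sets C \<and> b \<in> sets C} \<subseteq> Pow (space C \<times> space C)"
        using sets.sets_into_space by fastforce
      show "emeasure \<eta> X = emeasure H X" if "X \<in> {a \<times> b | a b. a \<in> sets C \<and> b \<in> sets C}" for X
        using that \<eta> rect by auto
      show "sets \<eta> = sigma_sets (space C \<times> space C) {a \<times> b | a b. a \<in> sets C \<and> b \<in> sets C}"
        "sets H = sigma_sets (space C \<times> space C) {a \<times> b | a b. a \<in> sets C \<and> b \<in> sets C}"
        using \<eta> sH by (auto simp: sets_pair_measure)
      have "emeasure \<eta> (space C \<times> space C) = emeasure H (space C \<times> space C)" using \<eta> rect by auto
      also have "\<dots> = emeasure D1 (space C \<times> space C) + emeasure D2 (space C \<times> space C)"
        by (rule eH) simp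
      also have "\<dots> \<le> 1 + 1"
        unfolding D1_def D2_def using pre[OF _ mT] pre[OF _ mS] prob_space.emeasure_le_1[OF C_prob]
        by (intro add_mono) auto
      finally show "emeasure \<eta> (space C \<times> space C) \<noteq> \<infinity>" by (auto simp: top_unique)
    qed auto
  qed
  then show "sets (edge_measure CG) = sets ?P"
    and "Z \<in> sets ?P \<Longrightarrow> emeasure (edge_measure CG) Z =
      emeasure C {v \<in> space C. (v, Th v) \<in> Z} + emeasure C {v \<in> space C. (v, Sh v) \<in> Z}"
    using sH eH pre[OF _ mT] pre[OF _ mS] by (auto simp: D1_def D2_def)
qed

section \<open>Automorphisms are fibre maps\<close>

lemma snd_measurable: "f \<in> measurable R N \<Longrightarrow> (\<lambda>v. f (snd v)) \<in> measurable C N"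
  unfolding measurable_convex_iff[OF w] by simp

lemma fst_measurable: "fst \<in> measurable C (count_space UNIV)"
  unfolding measurable_convex_iff[OF w] by simp

text \<open>An automorphism preserves the edge relation almost everywhere, because \<open>u\<close> exhibits the
  union of the graphs of \<open>T\<close> and \<open>S\<close> as a product measurable set of full edge measure.\<close>

lemma automorphism_edges:
  assumes \<phi>: "inv_mpt C \<phi>" "distr (edge_measure CG) (C \<Otimes>\<^sub>M C) (map_prod \<phi> \<phi>) = edge_measure CG"
  shows "AE v in C. \<phi> (Th v) = Th (\<phi> v) \<or> \<phi> (Th v) = Sh (\<phi> v)"
proof -
  let ?P = "C \<Otimes>\<^sub>M C"
  \<comment> \<open>Equality of points is tested through \<open>u\<close> and equality of indices
    between reals, so that the exceptional set lies in the uncompleted product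
    sigma-algebra.\<close>
  define Q where "Q z \<longleftrightarrow> real (fst (fst z)) = real (fst (snd z)) \<and> (u (snd (snd z)) = u (T (snd (fst z))) \<or> u (snd (snd z)) = u (S (snd (fst z))))"
    for z :: "(nat \<times> 'a) \<times> (nat \<times> 'a)"
  define Z where "Z = {z \<in> space ?P. \<not> Q z}"
  note m\<phi> = inv_mptD(1)[OF \<phi>(1)]
  have uT: "(\<lambda>x. u (T x)) \<in> borel_measurable R" "(\<lambda>x. u (S x)) \<in> borel_measurable R"
    using measurable_compose[OF T(1) u] measurable_compose[OF S(1) u] by auto
  have rf: "(\<lambda>v. real (fst v)) \<in> borel_measurable C" using fst_measurable by (rule measurable_compose) simp
  note [measurable] = m\<phi> measurable_compose[OF measurable_fst rf] measurable_compose[OF measurable_snd rf]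
    measurable_compose[OF measurable_snd snd_measurable[OF u]]
    measurable_compose[OF measurable_fst snd_measurable[OF uT(1)]] measurable_compose[OF measurable_fst snd_measurable[OF uT(2)]]
  have Z: "Z \<in> sets ?P" unfolding Z_def Q_def by measurable
  have mP: "map_prod \<phi> \<phi> \<in> measurable ?P ?P"
    unfolding map_prod_def case_prod_unfold by measurable
  have mP': "map_prod \<phi> \<phi> \<in> measurable (edge_measure CG) ?P"
    using mP measurable_cong_sets[OF sets_edge_measure refl] by blast
  \<comment> \<open>The edges themselves avoid \<open>Z\<close>; invariance of the edge measure then
    makes the preimage of \<open>Z\<close> null along the graph of \<open>Th\<close>.\<close>
  have "emeasure C {v \<in> space C. (v, Th v) \<in> Z} = 0"
    by (rule emeasure_eq_0_AE, rule AE_I2) (auto simp: Z_def Q_def)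
  moreover have "emeasure C {v \<in> space C. (v, Sh v) \<in> Z} = 0"
    by (rule emeasure_eq_0_AE, rule AE_I2) (auto simp: Z_def Q_def)
  ultimately have "emeasure (edge_measure CG) Z = 0" by (simp add: emeasure_edge_measure[OF Z])
  then have "emeasure (distr (edge_measure CG) ?P (map_prod \<phi> \<phi>)) Z = 0" by (simp only: \<phi>(2))
  then have "emeasure (edge_measure CG) (map_prod \<phi> \<phi> -` Z \<inter> space ?P) = 0"
    using emeasure_distr[OF mP' Z] sets_eq_imp_space_eq[OF sets_edge_measure] by simp
  then have z: "emeasure C {v \<in> space C. (v, Th v) \<in> map_prod \<phi> \<phi> -` Z \<inter> space ?P} = 0"
    by (simp add: emeasure_edge_measure[OF measurable_sets[OF mP Z]])
  have mT: "Th \<in> measurable C C" using inv_mptD(1)[OF inv_mpt_Th(1)] .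
  have s: "{v \<in> space C. (v, Th v) \<in> map_prod \<phi> \<phi> -` Z \<inter> space ?P} \<in> sets C"
    using measurable_sets[OF graph_measurable[OF mT] measurable_sets[OF mP Z]]
    by (simp add: vimage_def Int_def conj_commute)
  have "AE v in C. v \<notin> {v \<in> space C. (v, Th v) \<in> map_prod \<phi> \<phi> -` Z \<inter> space ?P}"
    using z s by (intro AE_not_in) (simp add: null_sets_def)
  \<comment> \<open>\<open>u\<close> separates points on \<open>G\<close> only, so the images of
    \<open>v\<close> and of \<open>Th v\<close> have to lie over \<open>G\<close> almost
    surely.\<close>
  moreover note AE_Gh inv_mpt_AE[OF \<phi>(1) AE_Gh]
    inv_mpt_AE[OF inv_mpt_Th(1) inv_mpt_AE[OF \<phi>(1) AE_Gh]] AE_space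
  ultimately show ?thesis
  proof eventually_elim
    fix v assume n: "v \<notin> {v \<in> space C. (v, Th v) \<in> map_prod \<phi> \<phi> -` Z \<inter> space ?P}"
      and g: "v \<in> {1..k} \<times> G" "\<phi> v \<in> {1..k} \<times> G" "\<phi> (Th v) \<in> {1..k} \<times> G" and sp: "v \<in> space C"
    have sp': "Th v \<in> space C" "\<phi> v \<in> space C" "\<phi> (Th v) \<in> space C"
      using measurable_space[OF mT] measurable_space[OF m\<phi>] sp by auto
    then have "Q (\<phi> v, \<phi> (Th v))" using n sp by (auto simp: Z_def space_pair_measure)
    moreover obtain i x where x: "\<phi> v = (i, x)" "x \<in> G" using g(2) by auto
    moreover obtain j y where y: "\<phi> (Th v) = (j, y)" "y \<in> G" using g(3) by auto
    ultimately have "i = j" "u y = u (T x) \<or> u y = u (S x)" by (auto simp: Q_def)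
    then have "i = j" "y = T x \<or> y = S x" using inj_onD[OF inj_u] x(2) y(2) TG SG by blast+
    then show "\<phi> (Th v) = Th (\<phi> v) \<or> \<phi> (Th v) = Sh (\<phi> v)" using x y by simp
  qed
qed

lemma automorphism_component:
  assumes \<phi>: "inv_mpt C \<phi>" "AE v in C. \<phi> (Th v) = Th (\<phi> v) \<or> \<phi> (Th v) = Sh (\<phi> v)"
  obtains \<sigma> where "\<And>i. i \<in> {1..k} \<Longrightarrow> \<sigma> i \<in> {1..k}" "\<And>i. i \<in> {1..k} \<Longrightarrow> AE x in R. fst (\<phi> (i, x)) = \<sigma> i"
proof -
  note m\<phi> = inv_mptD(1)[OF \<phi>(1)]
  have "\<forall>i\<in>{1..k}. \<exists>j. j \<in> {1..k} \<and> (AE x in R. fst (\<phi> (i, x)) = j)"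
  proof
    fix i assume i: "i \<in> {1..k}"
    have fm: "(\<lambda>x. fst (\<phi> (i, x))) \<in> measurable R (count_space UNIV)"
      using measurable_compose[OF m\<phi> fst_measurable] i unfolding measurable_convex_iff[OF w] by blast
    then have m: "(\<lambda>x. real (fst (\<phi> (i, x)))) \<in> borel_measurable R"
      by (rule measurable_compose) simp
    have "AE x in R. \<phi> (Th (i, x)) = Th (\<phi> (i, x)) \<or> \<phi> (Th (i, x)) = Sh (\<phi> (i, x))"
      using \<phi>(2) i unfolding AE_convex[OF w] by blast
    then have "AE x in R. real (fst (\<phi> (i, T x))) = real (fst (\<phi> (i, x)))"
      by eventually_elim (auto simp: fibre_map_def split: prod.splits)
    then obtain c where c: "AE x in R. real (fst (\<phi> (i, x))) = c" by (rule ergodic_constant[OF erg T(1) m])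
    have "AE x in R. \<phi> (i, x) \<in> {1..k} \<times> G"
      using inv_mpt_AE[OF \<phi>(1) AE_Gh] i unfolding AE_convex[OF w] by blast
    then have both: "AE x in R. real (fst (\<phi> (i, x))) = c \<and> fst (\<phi> (i, x)) \<in> {1..k}"
      using c by eventually_elim auto
    \<comment> \<open>The constant supplied by ergodicity is a real number; being attained, it is an
      index.\<close>
    have "\<exists>j\<in>{1..k}. real j = c"
    proof (rule ccontr)
      assume n: "\<not> (\<exists>j\<in>{1..k}. real j = c)"
      have "AE x in R. False" using both by eventually_elim (use n in blast)
      then show False by simp
    qed
    then obtain j where j: "j \<in> {1..k}" "real j = c" by blast
    have "AE x in R. fst (\<phi> (i, x)) = j" using c by eventually_elim (use j in simp)
    then show "\<exists>j. j \<in> {1..k} \<and> (AE x in R. fst (\<phi> (i, x)) = j)" using j by blast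
  qed
  then obtain \<sigma> where "\<forall>i\<in>{1..k}. \<sigma> i \<in> {1..k} \<and> (AE x in R. fst (\<phi> (i, x)) = \<sigma> i)"
    by (rule bchoice[THEN exE])
  then show ?thesis using that by blast
qed

text \<open>Both coordinates of \<open>\<phi> (\<psi> v) = v\<close> are read off on component
  \<open>j\<close>. The first involves no point, and such a statement is true once it holds almost
  everywhere on a probability space.\<close>

lemma component_inverse:
  assumes \<psi>: "inv_mpt C \<psi>" and inv: "AE v in C. \<phi> (\<psi> v) = v"
    and \<sigma>: "\<And>i. i \<in> {1..k} \<Longrightarrow> AE x in R. fst (\<phi> (i, x)) = \<sigma> i"
    and \<tau>: "\<And>i. i \<in> {1..k} \<Longrightarrow> \<tau> i \<in> {1..k}" "\<And>i. i \<in> {1..k} \<Longrightarrow> AE x in R. fst (\<psi> (i, x)) = \<tau> i"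
    and j: "j \<in> {1..k}"
  shows "\<sigma> (\<tau> j) = j" "AE y in R. snd (\<phi> (\<tau> j, snd (\<psi> (j, y)))) = y"
proof -
  have "AE v in C. fst (\<phi> v) = \<sigma> (fst v)" unfolding AE_convex[OF w] using \<sigma> by simp
  then have "AE v in C. fst (\<phi> (\<psi> v)) = \<sigma> (fst (\<psi> v))" by (rule inv_mpt_AE[OF \<psi>])
  then have "AE v in C. fst (\<phi> (\<psi> v)) = \<sigma> (fst (\<psi> v)) \<and> \<phi> (\<psi> v) = v"
    using inv by eventually_elim (rule conjI)
  then have "AE y in R. fst (\<phi> (\<psi> (j, y))) = \<sigma> (fst (\<psi> (j, y))) \<and> \<phi> (\<psi> (j, y)) = (j, y)"
    using j unfolding AE_convex[OF w] by blast
  then have *: "AE y in R. \<sigma> (\<tau> j) = j \<and> snd (\<phi> (\<tau> j, snd (\<psi> (j, y)))) = y"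
    using \<tau>(2)[OF j]
  proof eventually_elim
    fix y assume a: "fst (\<phi> (\<psi> (j, y))) = \<sigma> (fst (\<psi> (j, y))) \<and> \<phi> (\<psi> (j, y)) = (j, y)" and b: "fst (\<psi> (j, y)) = \<tau> j"
    have "\<psi> (j, y) = (\<tau> j, snd (\<psi> (j, y)))" using b by (metis prod.collapse)
    then have "\<phi> (\<tau> j, snd (\<psi> (j, y))) = (j, y)" using a by metis
    moreover have "\<sigma> (\<tau> j) = j" using a b by (metis fst_conv)
    ultimately show "\<sigma> (\<tau> j) = j \<and> snd (\<phi> (\<tau> j, snd (\<psi> (j, y)))) = y" by simp
  qed
  then show "AE y in R. snd (\<phi> (\<tau> j, snd (\<psi> (j, y)))) = y" by eventually_elim simp
  show "\<sigma> (\<tau> j) = j"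
  proof (rule ccontr)
    assume n: "\<sigma> (\<tau> j) \<noteq> j"
    have "AE y in R. False" using * by eventually_elim (use n in blast)
    then show False by simp
  qed
qed

text \<open>Up to a null set, the preimage of \<open>{\<sigma> i} \<times> B\<close> lies in
  component \<open>i\<close> alone, because \<open>\<sigma>\<close> is injective. Comparing masses
  for the whole space as \<open>B\<close> gives equality of the weights; cancelling the positive
  weight gives invariance of the measure.\<close>

lemma component_measure:
  assumes \<phi>: "inv_mpt C \<phi>"
    and \<sigma>: "\<And>i. i \<in> {1..k} \<Longrightarrow> \<sigma> i \<in> {1..k}" "\<And>i. i \<in> {1..k} \<Longrightarrow> AE x in R. fst (\<phi> (i, x)) = \<sigma> i"
    and \<sigma>_inj: "inj_on \<sigma> {1..k}" and i: "i \<in> {1..k}"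
  shows "lam (\<sigma> i) = lam i" "(\<lambda>x. snd (\<phi> (i, x))) \<in> measurable R R" "distr R R (\<lambda>x. snd (\<phi> (i, x))) = R"
proof -
  note m\<phi> = inv_mptD(1)[OF \<phi>]
  have sm: "(\<lambda>x. snd (\<phi> (l, x))) \<in> measurable R R" if "l \<in> {1..k}" for l
    using measurable_compose[OF m\<phi> snd_measurable[OF measurable_ident_sets[OF refl]]] that
    unfolding measurable_convex_iff[OF w] by blast
  then show m: "(\<lambda>x. snd (\<phi> (i, x))) \<in> measurable R R" using i by blast
  have pos: "lam l > 0" if "l \<in> {1..k}" for l using w that by (simp add: weights_def)
  have key: "lam (\<sigma> i) * prob B = lam i * prob ((\<lambda>x. snd (\<phi> (i, x))) -` B \<inter> space R)" if B: "B \<in> sets R" for B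
  proof -
    have BC: "Pair l -` ({\<sigma> i} \<times> B) = (if l = \<sigma> i then B else {})" for l by auto
    have "{\<sigma> i} \<times> B \<subseteq> (SIGMA i:{1..k}. space R)" using \<sigma>(1)[OF i] sets.sets_into_space[OF B] by blast
    then have A: "{\<sigma> i} \<times> B \<in> sets C" unfolding sets_convex[OF w] by (simp add: BC B)
    have pv: "Pair l -` (\<phi> -` ({\<sigma> i} \<times> B) \<inter> space C) \<in> sets R" if "l \<in> {1..k}" for l
      using measurable_sets[OF m\<phi> A] that unfolding sets_convex[OF w] by blast
    have "measure C ({\<sigma> i} \<times> B) = (\<Sum>l=1..k. lam l * prob (Pair l -` ({\<sigma> i} \<times> B)))"
      by (rule measure_convex[OF w prob_space_axioms A])
    also have "\<dots> = (\<Sum>l=1..k. if l = \<sigma> i then lam l * prob B else 0)"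
      by (intro sum.cong refl) (simp add: BC)
    also have "\<dots> = lam (\<sigma> i) * prob B" using \<sigma>(1)[OF i] by (subst sum.delta) auto
    finally have 1: "measure C ({\<sigma> i} \<times> B) = lam (\<sigma> i) * prob B" .
    have "measure C ({\<sigma> i} \<times> B) = measure C (\<phi> -` ({\<sigma> i} \<times> B) \<inter> space C)"
      using mpt_emeasure(2)[OF inv_mptD[OF \<phi>] A] by simp
    also have "\<dots> = (\<Sum>l=1..k. lam l * prob (Pair l -` (\<phi> -` ({\<sigma> i} \<times> B) \<inter> space C)))"
      by (rule measure_convex[OF w prob_space_axioms measurable_sets[OF m\<phi> A]])
    also have "\<dots> = (\<Sum>l=1..k. if l = i then lam l * prob ((\<lambda>x. snd (\<phi> (i, x))) -` B \<inter> space R) else 0)"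
    proof (rule sum.cong[OF refl])
      fix l assume l: "l \<in> {1..k}"
      have "prob (Pair l -` (\<phi> -` ({\<sigma> i} \<times> B) \<inter> space C)) =
          prob (if l = i then (\<lambda>x. snd (\<phi> (i, x))) -` B \<inter> space R else {})"
      proof (rule finite_measure_eq_AE)
        show "AE x in R. x \<in> Pair l -` (\<phi> -` ({\<sigma> i} \<times> B) \<inter> space C) \<longleftrightarrow>
            x \<in> (if l = i then (\<lambda>x. snd (\<phi> (i, x))) -` B \<inter> space R else {})"
          using \<sigma>(2)[OF l] AE_space
        proof eventually_elim
          fix x assume x: "fst (\<phi> (l, x)) = \<sigma> l" "x \<in> space R"
          have "\<sigma> l = \<sigma> i \<longleftrightarrow> l = i" using inj_on_eq_iff[OF \<sigma>_inj l i] .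
          moreover have "(l, x) \<in> space C" using l x by (simp add: space_convex[OF w])
          ultimately show "x \<in> Pair l -` (\<phi> -` ({\<sigma> i} \<times> B) \<inter> space C) \<longleftrightarrow>
            x \<in> (if l = i then (\<lambda>x. snd (\<phi> (i, x))) -` B \<inter> space R else {})"
            using x by (auto simp: mem_Times_iff)
        qed
      qed (use pv[OF l] measurable_sets[OF m B] in auto)
      then show "lam l * prob (Pair l -` (\<phi> -` ({\<sigma> i} \<times> B) \<inter> space C)) =
          (if l = i then lam l * prob ((\<lambda>x. snd (\<phi> (i, x))) -` B \<inter> space R) else 0)" by simp
    qed
    also have "\<dots> = lam i * prob ((\<lambda>x. snd (\<phi> (i, x))) -` B \<inter> space R)"
      using i by (subst sum.delta) auto
    finally show ?thesis using 1 by simp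
  qed
  have "(\<lambda>x. snd (\<phi> (i, x))) -` space R \<inter> space R = space R"
    using measurable_space[OF m] by auto
  then show l: "lam (\<sigma> i) = lam i" using key[of "space R"] prob_space by simp
  show "distr R R (\<lambda>x. snd (\<phi> (i, x))) = R"
  proof (rule measure_eqI)
    fix B assume "B \<in> sets (distr R R (\<lambda>x. snd (\<phi> (i, x))))"
    then have B: "B \<in> sets R" by simp
    have "prob ((\<lambda>x. snd (\<phi> (i, x))) -` B \<inter> space R) = prob B"
      using key[OF B] l pos[OF i] by simp
    then show "emeasure (distr R R (\<lambda>x. snd (\<phi> (i, x)))) B = emeasure R B"
      using emeasure_distr[OF m B] by (simp add: emeasure_eq_measure)
  qed simp
qed

text \<open>If the sign changed between \<open>v\<close> and \<open>Th v\<close>, the image of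
  \<open>Th (Th v)\<close> would be \<open>\<phi> v\<close> again, against freeness and the
  injectivity of \<open>\<phi>\<close>. So the sign is invariant under \<open>T\<close>, and
  ergodicity makes it constant on the component.\<close>

lemma component_pm:
  assumes \<phi>: "inv_mpt C \<phi>" "AE v in C. \<phi> (Th v) = Th (\<phi> v) \<or> \<phi> (Th v) = Sh (\<phi> v)"
    and s: "inv_mpt R (\<lambda>x. snd (\<phi> (i, x)))" and i: "i \<in> {1..k}"
  shows "pm (\<lambda>x. snd (\<phi> (i, x)))"
proof -
  define s where "s x = snd (\<phi> (i, x))" for x
  have ms: "s \<in> measurable R R" using inv_mptD(1)[OF s] by (simp add: s_def[abs_def])
  \<comment> \<open>The sign is encoded by an equation between real functions, which yields a
    measurable set.\<close>
  define A where "A = {x \<in> space R. u (s (T x)) = u (T (s x))}"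
  have A: "A \<in> sets R"
    using measurable_compose[OF measurable_compose[OF T(1) ms] u] measurable_compose[OF measurable_compose[OF ms T(1)] u]
    unfolding A_def by measurable
  obtain \<psi> where \<psi>: "AE v in C. \<psi> (\<phi> v) = v" by (rule inv_mpt_inverse[OF \<phi>(1)])
  let ?Q = "\<lambda>v. v \<in> {1..k} \<times> G \<and> \<phi> v \<in> {1..k} \<times> G \<and> \<psi> (\<phi> v) = v \<and> (\<phi> (Th v) = Th (\<phi> v) \<or> \<phi> (Th v) = Sh (\<phi> v))"
  note iT = inv_mpt_Th(1)
  have Q: "AE v in C. ?Q v"
    using AE_Gh inv_mpt_AE[OF \<phi>(1) AE_Gh] \<psi> \<phi>(2) by eventually_elim blast
  have "AE v in C. (\<phi> (Th (Th v)) = Th (\<phi> (Th v)) \<longleftrightarrow> \<phi> (Th v) = Th (\<phi> v)) \<and> ?Q v \<and> ?Q (Th v)"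
    using Q inv_mpt_AE[OF iT Q] inv_mpt_AE[OF iT inv_mpt_AE[OF iT Q]]
  proof eventually_elim
    fix v assume Q: "?Q v" "?Q (Th v)" "?Q (Th (Th v))"
    then have g: "v \<in> {1..k} \<times> G" "\<phi> v \<in> {1..k} \<times> G" "\<phi> (Th v) \<in> {1..k} \<times> G"
      and p: "\<psi> (\<phi> v) = v" "\<psi> (\<phi> (Th (Th v))) = Th (Th v)"
      and c: "\<phi> (Th v) = Th (\<phi> v) \<or> \<phi> (Th v) = Sh (\<phi> v)"
        "\<phi> (Th (Th v)) = Th (\<phi> (Th v)) \<or> \<phi> (Th (Th v)) = Sh (\<phi> (Th v))" by (simp_all only: simp_thms)
    have neq: "\<phi> (Th (Th v)) \<noteq> \<phi> v" using p Th_neq(2)[OF g(1)] by metis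
    note ST' = Sh_Th[OF g(2)] and ne = Th_neq(1)[OF g(2)] Th_neq(1)[OF g(3)]
    have "\<phi> (Th (Th v)) = Th (\<phi> (Th v)) \<longleftrightarrow> \<phi> (Th v) = Th (\<phi> v)"
      using c neq ST' ne by metis
    then show "(\<phi> (Th (Th v)) = Th (\<phi> (Th v)) \<longleftrightarrow> \<phi> (Th v) = Th (\<phi> v)) \<and> ?Q v \<and> ?Q (Th v)"
      using Q by (simp only: simp_thms)
  qed
  then have R: "AE x in R. (\<phi> (Th (Th (i, x))) = Th (\<phi> (Th (i, x))) \<longleftrightarrow> \<phi> (Th (i, x)) = Th (\<phi> (i, x))) \<and> ?Q (i, x) \<and> ?Q (Th (i, x))"
    using i unfolding AE_convex[OF w] by blast
  have iff: "\<phi> (Th (i, x)) = Th (\<phi> (i, x)) \<longleftrightarrow> u (s (T x)) = u (T (s x))"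
    and rel: "s (T x) = T (s x) \<or> s (T x) = S (s x)" and sG: "s x \<in> G"
    and eqT: "u (s (T x)) = u (T (s x)) \<longleftrightarrow> s (T x) = T (s x)"
    if q: "?Q (i, x)" for x
  proof -
    obtain j y where y: "\<phi> (i, x) = (j, y)" "y \<in> G" using q by auto
    then have sx: "s x = y" by (simp add: s_def)
    then show "s x \<in> G" using y by simp
    have c: "\<phi> (Th (i, x)) = (j, T y) \<or> \<phi> (Th (i, x)) = (j, S y)" using q y by simp
    then show "s (T x) = T (s x) \<or> s (T x) = S (s x)" using sx by (auto simp: s_def)
    then have G: "s (T x) \<in> G" "T (s x) \<in> G" using y sx TG SG by auto
    show e: "u (s (T x)) = u (T (s x)) \<longleftrightarrow> s (T x) = T (s x)" using inj_on_eq_iff[OF inj_u G] .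
    show "\<phi> (Th (i, x)) = Th (\<phi> (i, x)) \<longleftrightarrow> u (s (T x)) = u (T (s x))"
      unfolding e using c y sx by (auto simp: s_def)
  qed
  have "AE x in R. T x \<in> A \<longleftrightarrow> x \<in> A"
    using R AE_space
  proof eventually_elim
    fix x assume a: "(\<phi> (Th (Th (i, x))) = Th (\<phi> (Th (i, x))) \<longleftrightarrow> \<phi> (Th (i, x)) = Th (\<phi> (i, x))) \<and> ?Q (i, x) \<and> ?Q (Th (i, x))"
      and x: "x \<in> space R"
    have th: "Th (i, x) = (i, T x)" by simp
    note a' = a[unfolded th]
    note q = conjunct1[OF conjunct2[OF a']] conjunct2[OF conjunct2[OF a']]
    have "u (s (T (T x))) = u (T (s (T x))) \<longleftrightarrow> u (s (T x)) = u (T (s x))"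
      using conjunct1[OF a'] iff[of x, unfolded th, OF q(1)] iff[OF q(2)] by simp
    then show "T x \<in> A \<longleftrightarrow> x \<in> A" using x measurable_space[OF T(1)] by (simp add: A_def)
  qed
  then consider "AE x in R. x \<in> A" | "AE x in R. x \<notin> A" using ergodic_dichotomy[OF erg A] by blast
  then have "(AE x in R. s (T x) = T (s x)) \<or> (AE x in R. s (T x) = S (s x))"
  proof cases
    case 1
    have "AE x in R. s (T x) = T (s x)" using 1 R by eventually_elim (use eqT in \<open>auto simp: A_def\<close>)
    then show ?thesis by blast
  next
    case 2
    have "AE x in R. s (T x) = S (s x)" using 2 R AE_space
    proof eventually_elim
      fix x assume "x \<notin> A" "x \<in> space R"
        and a: "(\<phi> (Th (Th (i, x))) = Th (\<phi> (Th (i, x))) \<longleftrightarrow> \<phi> (Th (i, x)) = Th (\<phi> (i, x))) \<and> ?Q (i, x) \<and> ?Q (Th (i, x))"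
      then have "u (s (T x)) \<noteq> u (T (s x))" by (simp add: A_def)
      then show "s (T x) = S (s x)" using rel[of x] a by auto
    qed
    then show ?thesis by blast
  qed
  then show ?thesis using s unfolding pm_def by (simp add: s_def)
qed

lemma automorphism_fibre_map:
  assumes \<phi>: "inv_mpt C \<phi>" "distr (edge_measure CG) (C \<Otimes>\<^sub>M C) (map_prod \<phi> \<phi>) = edge_measure CG"
  obtains \<sigma> s where "\<sigma> permutes {1..k}" "\<And>i. i \<in> {1..k} \<Longrightarrow> lam (\<sigma> i) = lam i"
    "\<And>i. i \<in> {1..k} \<Longrightarrow> pm (s i)" "AE v in C. \<phi> v = fibre_map \<sigma> s v"
proof -
  note e = automorphism_edges[OF \<phi>]
  obtain \<psi> where \<psi>: "inv_mpt C \<psi>" "AE v in C. \<psi> (\<phi> v) = v" "AE v in C. \<phi> (\<psi> v) = v"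
    by (rule inv_mpt_inverse[OF \<phi>(1)])
  \<comment> \<open>\<open>\<phi>\<close> sends the two neighbours of \<open>v\<close> to different
    neighbours of \<open>\<phi> v\<close>, hence onto both of them; so the inverse preserves
    adjacency as well.\<close>
  have e': "AE v in C. \<psi> (Th v) = Th (\<psi> v) \<or> \<psi> (Th v) = Sh (\<psi> v)"
  proof -
    have 1: "AE v in C. \<phi> (Sh v) = Th (\<phi> v) \<or> \<phi> (Sh v) = Sh (\<phi> v)"
      using inv_mpt_AE[OF inv_mpt_Th(2) e]
        inv_mpt_AE[OF inv_mpt_Th(2) inv_mpt_AE[OF \<phi>(1) AE_Gh]] AE_Gh
      by eventually_elim (metis Sh_Th)
    let ?Q = "\<lambda>v. (\<phi> (Th v) = Th (\<phi> v) \<or> \<phi> (Th v) = Sh (\<phi> v)) \<and> (\<phi> (Sh v) = Th (\<phi> v) \<or> \<phi> (Sh v) = Sh (\<phi> v))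
       \<and> \<psi> (\<phi> (Th v)) = Th v \<and> \<psi> (\<phi> (Sh v)) = Sh v \<and> v \<in> {1..k} \<times> G \<and> \<phi> (Th v) \<noteq> \<phi> (Sh v)"
    have "AE v in C. ?Q v"
      using 1 e inv_mpt_AE[OF inv_mpt_Th(1) \<psi>(2)] inv_mpt_AE[OF inv_mpt_Th(2) \<psi>(2)] AE_Gh
      by eventually_elim (metis Th_neq(1))
    from inv_mpt_AE[OF \<psi>(1) this] \<psi>(3) show ?thesis
      by eventually_elim metis
  qed
  obtain \<sigma> where \<sigma>: "\<And>i. i \<in> {1..k} \<Longrightarrow> \<sigma> i \<in> {1..k}" "\<And>i. i \<in> {1..k} \<Longrightarrow> AE x in R. fst (\<phi> (i, x)) = \<sigma> i"
    using automorphism_component[OF \<phi>(1) e] by blast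
  obtain \<tau> where \<tau>: "\<And>i. i \<in> {1..k} \<Longrightarrow> \<tau> i \<in> {1..k}" "\<And>i. i \<in> {1..k} \<Longrightarrow> AE x in R. fst (\<psi> (i, x)) = \<tau> i"
    using automorphism_component[OF \<psi>(1) e'] by blast
  have st: "\<sigma> (\<tau> j) = j" "AE y in R. snd (\<phi> (\<tau> j, snd (\<psi> (j, y)))) = y" if "j \<in> {1..k}" for j
    by (rule component_inverse[where \<phi>=\<phi> and \<psi>=\<psi> and \<tau>=\<tau>]; fact \<psi> \<sigma> \<tau> that)+
  have ts: "\<tau> (\<sigma> j) = j" "AE y in R. snd (\<psi> (\<sigma> j, snd (\<phi> (j, y)))) = y" if "j \<in> {1..k}" for j
    by (rule component_inverse[where \<phi>=\<psi> and \<psi>=\<phi> and \<tau>=\<sigma>]; fact \<phi> \<psi> \<sigma> \<tau> that)+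
  have inj: "inj_on \<sigma> {1..k}" "inj_on \<tau> {1..k}" using ts(1) st(1) by (metis inj_onI)+
  \<comment> \<open>\<open>permutes\<close> demands the identity outside the index set, where
    \<open>\<sigma>\<close> is unspecified.\<close>
  define \<sigma>' where "\<sigma>' i = (if i \<in> {1..k} then \<sigma> i else i)" for i
  have "bij_betw \<sigma> {1..k} {1..k}"
    using \<sigma>(1) \<tau>(1) st(1) ts(1) by (intro bij_betw_byWitness[where f'=\<tau>]) auto
  then have "bij_betw \<sigma>' {1..k} {1..k}" by (subst bij_betw_cong[where g=\<sigma>]) (simp_all add: \<sigma>'_def)
  then have p: "\<sigma>' permutes {1..k}" by (rule bij_imp_permutes) (auto simp: \<sigma>'_def)
  let ?s = "\<lambda>i x. snd (\<phi> (i, x))" and ?t = "\<lambda>j y. snd (\<psi> (j, y))"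
  have sm: "lam (\<sigma> i) = lam i" "?s i \<in> measurable R R" "distr R R (?s i) = R" if "i \<in> {1..k}" for i
    using component_measure[OF \<phi>(1) \<sigma> inj(1) that] by blast+
  have tm: "?t i \<in> measurable R R" "distr R R (?t i) = R" if "i \<in> {1..k}" for i
    using component_measure[OF \<psi>(1) \<tau> inj(2) that] by blast+
  have si: "inv_mpt R (?s i)" if i: "i \<in> {1..k}" for i
    using inv_mptI[OF sm(2,3)[OF i] tm[OF \<sigma>(1)[OF i]] ts(2)[OF i]] st(2)[OF \<sigma>(1)[OF i]] ts(1)[OF i] by simp
  show ?thesis
  proof (rule that[of \<sigma>' ?s])
    show "\<sigma>' permutes {1..k}" by (rule p)
    show "lam (\<sigma>' i) = lam i" if "i \<in> {1..k}" for i using sm(1)[OF that] that by (simp add: \<sigma>'_def)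
    show "pm (?s i)" if "i \<in> {1..k}" for i by (rule component_pm[OF \<phi>(1) e si[OF that] that])
    show "AE v in C. \<phi> v = fibre_map \<sigma>' ?s v"
      unfolding AE_convex[OF w]
    proof
      fix i assume i: "i \<in> {1..k}"
      show "AE x in R. \<phi> (i, x) = fibre_map \<sigma>' ?s (i, x)"
        using \<sigma>(2)[OF i] by eventually_elim (use i in \<open>simp add: \<sigma>'_def prod_eq_iff\<close>)
    qed
  qed
qed

text \<open>The edge measure is a sum over the graphs of \<open>T\<close> and \<open>S\<close>. A
  component map commuting with \<open>T\<close> preserves both summands and one inverting
  \<open>T\<close> interchanges them, so the sum survives in either case; equal weights allow
  reindexing by the permutation.\<close>

lemma fibre_map_automorphism:
  assumes \<sigma>: "\<sigma> permutes {1..k}" "\<And>i. i \<in> {1..k} \<Longrightarrow> lam (\<sigma> i) = lam i"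
    and s: "\<And>i. i \<in> {1..k} \<Longrightarrow> pm (s i)"
  shows "inv_mpt C (fibre_map \<sigma> s)"
    "distr (edge_measure CG) (C \<Otimes>\<^sub>M C) (map_prod (fibre_map \<sigma> s) (fibre_map \<sigma> s)) = edge_measure CG"
proof -
  let ?P = "C \<Otimes>\<^sub>M C" and ?\<phi> = "fibre_map \<sigma> s"
  have si: "inv_mpt R (s i)" if "i \<in> {1..k}" for i using s[OF that] by (simp add: pm_def)
  show inv: "inv_mpt C ?\<phi>" by (rule inv_mpt_fibre_map[OF w \<sigma> si])
  note m\<phi> = inv_mptD(1)[OF inv]
  have \<sigma>i: "\<sigma> i \<in> {1..k}" if "i \<in> {1..k}" for i using \<sigma>(1) that by (simp only: permutes_in_image)
  have mP: "map_prod ?\<phi> ?\<phi> \<in> measurable ?P ?P"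
    using m\<phi> unfolding map_prod_def case_prod_unfold by measurable
  have mP': "map_prod ?\<phi> ?\<phi> \<in> measurable (edge_measure CG) ?P"
    using mP measurable_cong_sets[OF sets_edge_measure refl] by blast
  show "distr (edge_measure CG) ?P (map_prod ?\<phi> ?\<phi>) = edge_measure CG"
  proof (rule measure_eqI)
    show "sets (distr (edge_measure CG) ?P (map_prod ?\<phi> ?\<phi>)) = sets (edge_measure CG)"
      by (simp add: sets_edge_measure)
    fix Z assume "Z \<in> sets (distr (edge_measure CG) ?P (map_prod ?\<phi> ?\<phi>))"
    then have Z: "Z \<in> sets ?P" by simp
    have fib: "emeasure C {v \<in> space C. (v, fibre_map id (\<lambda>_. Q) v) \<in> Y} =
        (\<Sum>i=1..k. ennreal (lam i) * emeasure R {x \<in> space R. ((i, x), (i, Q x)) \<in> Y})"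
      and fibs: "\<And>i. i \<in> {1..k} \<Longrightarrow> {x \<in> space R. ((i, x), (i, Q x)) \<in> Y} \<in> sets R"
      if Q: "inv_mpt R Q" and Y: "Y \<in> sets ?P" for Q Y
    proof -
      have mQ: "fibre_map id (\<lambda>_. Q) \<in> measurable C C"
        by (rule inv_mptD(1)[OF inv_mpt_fibre_map[OF w permutes_id _ Q]]) simp
      have s: "{v \<in> space C. (v, fibre_map id (\<lambda>_. Q) v) \<in> Y} \<in> sets C"
        using measurable_sets[OF graph_measurable[OF mQ] Y] by (simp add: vimage_def Int_def conj_commute)
      have v: "Pair i -` {v \<in> space C. (v, fibre_map id (\<lambda>_. Q) v) \<in> Y} = {x \<in> space R. ((i, x), (i, Q x)) \<in> Y}"
        if "i \<in> {1..k}" for i using that by (auto simp: space_convex[OF w])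
      show "{x \<in> space R. ((i, x), (i, Q x)) \<in> Y} \<in> sets R" if "i \<in> {1..k}" for i
        using s that unfolding sets_convex[OF w] v[OF that, symmetric] by blast
      show "emeasure C {v \<in> space C. (v, fibre_map id (\<lambda>_. Q) v) \<in> Y} =
        (\<Sum>i=1..k. ennreal (lam i) * emeasure R {x \<in> space R. ((i, x), (i, Q x)) \<in> Y})"
        unfolding emeasure_convex[OF w s] by (intro sum.cong refl) (simp only: v)
    qed
    let ?Y = "map_prod ?\<phi> ?\<phi> -` Z \<inter> space ?P"
    have Y: "?Y \<in> sets ?P" by (rule measurable_sets[OF mP Z])
    let ?e = "\<lambda>Q j. emeasure R {y \<in> space R. ((j, y), (j, Q y)) \<in> Z}"
    have pull: "emeasure R {x \<in> space R. ((i, x), (i, P x)) \<in> ?Y} = ?e Q (\<sigma> i)"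
      if i: "i \<in> {1..k}" and Q: "inv_mpt R Q" "inv_mpt R P" "AE x in R. s i (P x) = Q (s i x)" for i P Q
    proof -
      have sQ: "{y \<in> space R. ((\<sigma> i, y), (\<sigma> i, Q y)) \<in> Z} \<in> sets R" using fibs[OF Q(1) Z \<sigma>i[OF i]] .
      have "emeasure R {x \<in> space R. ((i, x), (i, P x)) \<in> ?Y} =
          emeasure R (s i -` {y \<in> space R. ((\<sigma> i, y), (\<sigma> i, Q y)) \<in> Z} \<inter> space R)"
      proof (rule emeasure_eq_AE)
        show "AE x in R. x \<in> {x \<in> space R. ((i, x), (i, P x)) \<in> ?Y} \<longleftrightarrow>
            x \<in> s i -` {y \<in> space R. ((\<sigma> i, y), (\<sigma> i, Q y)) \<in> Z} \<inter> space R"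
          using Q(3)
        proof eventually_elim
          fix x assume "s i (P x) = Q (s i x)"
          then show "x \<in> {x \<in> space R. ((i, x), (i, P x)) \<in> ?Y} \<longleftrightarrow>
            x \<in> s i -` {y \<in> space R. ((\<sigma> i, y), (\<sigma> i, Q y)) \<in> Z} \<inter> space R"
            using i measurable_space[OF inv_mptD(1)[OF Q(2)]] measurable_space[OF inv_mptD(1)[OF si[OF i]]]
            by (auto simp: space_pair_measure space_convex[OF w])
        qed
      qed (use fibs[OF Q(2) Y i] measurable_sets[OF inv_mptD(1)[OF si[OF i]] sQ] in auto)
      also have "\<dots> = ?e Q (\<sigma> i)"
        using emeasure_distr[OF inv_mptD(1)[OF si[OF i]] sQ] inv_mptD(2)[OF si[OF i]] by simp
      finally show ?thesis .
    qed
    have both: "emeasure R {x \<in> space R. ((i, x), (i, T x)) \<in> ?Y} + emeasure R {x \<in> space R. ((i, x), (i, S x)) \<in> ?Y}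
        = ?e T (\<sigma> i) + ?e S (\<sigma> i)" if i: "i \<in> {1..k}" for i
      using s[OF i]
    proof (cases rule: pm_cases)
      case 1 show ?thesis using pull[OF i inv_mpt_T(1) inv_mpt_T(1) 1(1)] pull[OF i inv_mpt_T(2) inv_mpt_T(2) 1(2)] by simp
    next
      case 2 show ?thesis using pull[OF i inv_mpt_T(2) inv_mpt_T(1) 2(1)] pull[OF i inv_mpt_T(1) inv_mpt_T(2) 2(2)]
        by (simp add: add.commute)
    qed
    have "emeasure (distr (edge_measure CG) ?P (map_prod ?\<phi> ?\<phi>)) Z = emeasure (edge_measure CG) ?Y"
      using emeasure_distr[OF mP' Z] sets_eq_imp_space_eq[OF sets_edge_measure] by simp
    also have "\<dots> = (\<Sum>i=1..k. ennreal (lam i) * (emeasure R {x \<in> space R. ((i, x), (i, T x)) \<in> ?Y} + emeasure R {x \<in> space R. ((i, x), (i, S x)) \<in> ?Y}))"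
      unfolding emeasure_edge_measure[OF Y] fib[OF inv_mpt_T(1) Y] fib[OF inv_mpt_T(2) Y]
      by (simp only: sum.distrib distrib_left)
    also have "\<dots> = (\<Sum>i=1..k. ennreal (lam (\<sigma> i)) * (?e T (\<sigma> i) + ?e S (\<sigma> i)))"
      by (intro sum.cong refl) (simp only: both \<sigma>(2))
    also have "\<dots> = (\<Sum>i=1..k. ennreal (lam i) * (?e T i + ?e S i))"
      using sum.permute[OF \<sigma>(1), of "\<lambda>i. ennreal (lam i) * (?e T i + ?e S i)"] by (simp add: o_def)
    also have "\<dots> = emeasure (edge_measure CG) Z"
      unfolding emeasure_edge_measure[OF Z] fib[OF inv_mpt_T(1) Z] fib[OF inv_mpt_T(2) Z]
      by (simp only: sum.distrib distrib_left)
    finally show "emeasure (distr (edge_measure CG) ?P (map_prod ?\<phi> ?\<phi>)) Z = emeasure (edge_measure CG) Z" .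
  qed
qed

theorem wreath_iso_aut_graphing: "wreath (aut_pm R T) k lam \<cong> aut_graphing CG"
proof -
  let ?W = "wreath (aut_pm R T) k lam"
  \<comment> \<open>Classes are replaced by chosen representatives, whose identities hold almost
    everywhere.\<close>
  define rep where "rep A = (SOME s :: 'a \<Rightarrow> 'a. s \<in> A)" for A
  have rep: "pm (rep A)" "aut_class R (rep A) = A" if A: "A \<in> carrier (aut_pm R T)" for A
  proof -
    obtain s where s: "A = aut_class R s" "pm s" using A carrier_aut_pm by auto
    then have iv: "inv_mpt R s" by (simp add: pm_def)
    have "rep A \<in> A" unfolding rep_def using aut_class_self[OF iv] s(1) by (metis someI)
    then have r: "inv_mpt R (rep A)" "AE x in R. rep A x = s x" using s(1) by (auto simp: aut_class_def)
    then show c: "aut_class R (rep A) = A" using s(1) by (simp add: aut_class_eq_iff)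
    have rs: "AE x in R. rep A (T x) = s (T x)" by (rule inv_mpt_AE[OF inv_mpt_T(1) r(2)])
    from s(2) show "pm (rep A)"
    proof (cases rule: pm_cases)
      case 1
      have "AE x in R. rep A (T x) = T (rep A x)" using r(2) rs 1(1) by eventually_elim simp
      then show ?thesis using r by (simp add: pm_def)
    next
      case 2
      have "AE x in R. rep A (T x) = S (rep A x)" using r(2) rs 2(1) by eventually_elim simp
      then show ?thesis using r by (simp add: pm_def)
    qed
  qed
  have rep_inv: "inv_mpt R (rep A)" if "A \<in> carrier (aut_pm R T)" for A using rep(1)[OF that] by (simp add: pm_def)
  \<comment> \<open>Coordinate \<open>j\<close> acts on what arrives in component \<open>j\<close>,
    hence the index \<open>\<sigma> i\<close> on component \<open>i\<close>; this convention matches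
    the twist in the multiplication of the wreath product.\<close>
  define F where "F = (\<lambda>(f, \<sigma>). fibre_map \<sigma> (\<lambda>i. rep (f (\<sigma> i))))"
  have W: "\<exists>f \<sigma>. x = (f, \<sigma>) \<and> \<sigma> permutes {1..k} \<and> (\<forall>i\<in>{1..k}. lam (\<sigma> i) = lam i) \<and> f \<in> (\<Pi>\<^sub>E i\<in>{1..k}. carrier (aut_pm R T))
     \<and> (\<forall>i\<in>{1..k}. \<sigma> i \<in> {1..k}) \<and> (\<forall>i\<in>{1..k}. f (\<sigma> i) \<in> carrier (aut_pm R T))" if W: "x \<in> carrier ?W" for x
  proof -
    obtain f \<sigma> where x: "x = (f, \<sigma>)" "\<sigma> permutes {1..k}" "\<forall>i\<in>{1..k}. lam (\<sigma> i) = lam i" "f \<in> (\<Pi>\<^sub>E i\<in>{1..k}. carrier (aut_pm R T))"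
      using W unfolding wreath_carrier by blast
    then have i: "\<forall>i\<in>{1..k}. \<sigma> i \<in> {1..k}" by (simp only: permutes_in_image) blast
    then have "\<forall>i\<in>{1..k}. f (\<sigma> i) \<in> carrier (aut_pm R T)" using PiE_mem[OF x(4)] by blast
    then show ?thesis using x i by blast
  qed
  have aut: "inv_mpt C (F x)" "distr (edge_measure CG) (C \<Otimes>\<^sub>M C) (map_prod (F x) (F x)) = edge_measure CG"
    if x: "x \<in> carrier ?W" for x
  proof -
    obtain f \<sigma> where f: "x = (f, \<sigma>)" "\<sigma> permutes {1..k}" "\<And>i. i \<in> {1..k} \<Longrightarrow> lam (\<sigma> i) = lam i"
        "\<And>i. i \<in> {1..k} \<Longrightarrow> f (\<sigma> i) \<in> carrier (aut_pm R T)"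
      using W[OF x] by blast
    have "pm (rep (f (\<sigma> i)))" if "i \<in> {1..k}" for i using rep(1)[OF f(4)[OF that]] .
    from fibre_map_automorphism[OF f(2,3) this] show "inv_mpt C (F x)"
      "distr (edge_measure CG) (C \<Otimes>\<^sub>M C) (map_prod (F x) (F x)) = edge_measure CG" by (simp_all add: F_def f(1))
  qed
  show ?thesis
  proof (rule class_iso[where C=C and F=F])
    fix x y assume x: "x \<in> carrier ?W" and y: "y \<in> carrier ?W"
    obtain f \<sigma> where f: "x = (f, \<sigma>)" "\<sigma> permutes {1..k}" "\<And>i. i \<in> {1..k} \<Longrightarrow> \<sigma> i \<in> {1..k}"
        "\<And>i. i \<in> {1..k} \<Longrightarrow> f (\<sigma> i) \<in> carrier (aut_pm R T)" "f \<in> (\<Pi>\<^sub>E i\<in>{1..k}. carrier (aut_pm R T))"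
      using W[OF x] by blast
    obtain g \<tau> where g: "y = (g, \<tau>)" "\<tau> permutes {1..k}" "\<And>i. i \<in> {1..k} \<Longrightarrow> \<tau> i \<in> {1..k}"
        "\<And>i. i \<in> {1..k} \<Longrightarrow> g (\<tau> i) \<in> carrier (aut_pm R T)" "g \<in> (\<Pi>\<^sub>E i\<in>{1..k}. carrier (aut_pm R T))"
      using W[OF y] by blast
    show "AE v in C. F (x \<otimes>\<^bsub>?W\<^esub> y) v = F x (F y v)"
      unfolding AE_convex[OF w]
    proof
      fix i assume i: "i \<in> {1..k}"
      let ?A = "f (\<sigma> (\<tau> i))" and ?B = "g (\<tau> i)"
      have A: "?A \<in> carrier (aut_pm R T)" and B: "?B \<in> carrier (aut_pm R T)" using f(4) g(3,4) i by auto
      let ?AB = "?A \<otimes>\<^bsub>aut_pm R T\<^esub> ?B"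
      have AB: "?AB \<in> carrier (aut_pm R T)" using mult_closed_aut_pm[OF inv_mpt_T(1)] A B by (simp add: mult_closed_def)
      have "?AB = aut_class R (rep ?A \<circ> rep ?B)"
        using aut_class_mult[OF rep_inv[OF A] rep_inv[OF B]] by (simp add: aut_pm_mult rep(2) A B)
      then have "AE v in R. rep ?AB v = (rep ?A \<circ> rep ?B) v"
        using rep(2)[OF AB] aut_class_eq_iff[OF rep_inv[OF AB]] by metis
      then show "AE v in R. F (x \<otimes>\<^bsub>?W\<^esub> y) (i, v) = F x (F y (i, v))"
      proof eventually_elim
        fix v assume v: "rep ?AB v = (rep ?A \<circ> rep ?B) v"
        have "\<sigma> (\<tau> i) \<in> {1..k}" using f(3) g(3) i by blast
        then show "F (x \<otimes>\<^bsub>?W\<^esub> y) (i, v) = F x (F y (i, v))"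
          using v unfolding f(1) g(1) wreath_mult F_def by (simp add: permutes_inverses[OF f(2)])
      qed
    qed
    assume e: "AE v in C. F x v = F y v"
    have ei: "\<sigma> i = \<tau> i \<and> f (\<sigma> i) = g (\<sigma> i)" if i: "i \<in> {1..k}" for i
    proof -
      have e': "AE v in R. \<sigma> i = \<tau> i \<and> rep (f (\<sigma> i)) v = rep (g (\<tau> i)) v"
      proof -
        have "AE v in R. F x (i, v) = F y (i, v)" using e i unfolding AE_convex[OF w] by blast
        then show ?thesis
          by eventually_elim (unfold f(1) g(1) F_def prod.case fibre_map_apply prod.inject)
      qed
      have s: "\<sigma> i = \<tau> i"
      proof (rule ccontr)
        assume n: "\<sigma> i \<noteq> \<tau> i"
        have "AE v in R. False" using e' by eventually_elim (use n in blast)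
        then show False by simp
      qed
      have "aut_class R (rep (f (\<sigma> i))) = aut_class R (rep (g (\<tau> i)))"
        unfolding aut_class_eq_iff[OF rep_inv[OF f(4)[OF i]]] using e' by eventually_elim (rule conjunct2)
      then show ?thesis using rep(2) f(4)[OF i] g(4)[OF i] s by simp
    qed
    have "\<sigma> = \<tau>"
    proof
      fix i show "\<sigma> i = \<tau> i"
        using ei[of i] permutes_not_in[OF f(2), of i] permutes_not_in[OF g(2), of i] by (cases "i \<in> {1..k}") auto
    qed
    moreover have "f = g"
    proof (rule PiE_ext[OF f(5) g(5)])
      fix j assume j: "j \<in> {1..k}"
      then show "f j = g j" using ei[OF perm_inv_in[OF f(2) j]] by (simp add: permutes_inverses[OF f(2)])
    qed
    ultimately show "x = y" using f(1) g(1) by simp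
  next
    show "mult_closed ?W" by (rule mult_closed_wreath[OF mult_closed_aut_pm[OF inv_mpt_T(1)]])
    have carr: "carrier (aut_graphing CG) = {aut_class C \<phi> | \<phi>. inv_mpt C \<phi> \<and>
        distr (edge_measure CG) (C \<Otimes>\<^sub>M C) (map_prod \<phi> \<phi>) = edge_measure CG}"
      by (simp add: aut_graphing_def Let_def vmeasure_CC[OF w \<Gamma>])
    show "carrier (aut_graphing CG) = (\<lambda>x. aut_class C (F x)) ` carrier ?W"
      unfolding carr
    proof (intro subset_antisym subsetI)
      fix A assume "A \<in> {aut_class C \<phi> | \<phi>. inv_mpt C \<phi> \<and> distr (edge_measure CG) (C \<Otimes>\<^sub>M C) (map_prod \<phi> \<phi>) = edge_measure CG}"
      then obtain \<phi> where \<phi>: "A = aut_class C \<phi>" "inv_mpt C \<phi>" "distr (edge_measure CG) (C \<Otimes>\<^sub>M C) (map_prod \<phi> \<phi>) = edge_measure CG"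
        by blast
      obtain \<sigma> s where s: "\<sigma> permutes {1..k}" "\<And>i. i \<in> {1..k} \<Longrightarrow> lam (\<sigma> i) = lam i"
          "\<And>i. i \<in> {1..k} \<Longrightarrow> pm (s i)" "AE v in C. \<phi> v = fibre_map \<sigma> s v"
        using automorphism_fibre_map[OF \<phi>(2,3)] by blast
      \<comment> \<open>The map on a component is stored at the target of the component, so
        coordinate \<open>j\<close> is taken from the preimage of \<open>j\<close>.\<close>
      define f where "f = (\<lambda>j\<in>{1..k}. aut_class R (s (inv_into UNIV \<sigma> j)))"
      have fc: "f \<in> (\<Pi>\<^sub>E i\<in>{1..k}. carrier (aut_pm R T))"
        using s(3)[OF perm_inv_in[OF s(1)]] unfolding f_def carrier_aut_pm by auto
      then have x: "(f, \<sigma>) \<in> carrier ?W" unfolding wreath_carrier using s(1,2) by blast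
      have "AE v in C. \<phi> v = F (f, \<sigma>) v"
        unfolding AE_convex[OF w]
      proof
        fix i assume i: "i \<in> {1..k}"
        have \<sigma>i: "\<sigma> i \<in> {1..k}" using s(1) i by (simp only: permutes_in_image)
        have fi: "f (\<sigma> i) = aut_class R (s i)" using \<sigma>i by (simp add: f_def permutes_inverses[OF s(1)])
        have "AE v in R. rep (f (\<sigma> i)) v = s i v"
          using rep(2)[OF PiE_mem[OF fc \<sigma>i]] aut_class_eq_iff[OF rep_inv[OF PiE_mem[OF fc \<sigma>i]]] fi by metis
        moreover have "AE v in R. \<phi> (i, v) = (\<sigma> i, s i v)" using s(4) i unfolding AE_convex[OF w] by simp
        ultimately show "AE v in R. \<phi> (i, v) = F (f, \<sigma>) (i, v)" by eventually_elim (simp add: F_def)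
      qed
      then have "A = aut_class C (F (f, \<sigma>))" using \<phi> by (simp add: aut_class_eq_iff)
      then show "A \<in> (\<lambda>x. aut_class C (F x)) ` carrier ?W" using x by blast
    next
      fix A assume "A \<in> (\<lambda>x. aut_class C (F x)) ` carrier ?W"
      then show "A \<in> {aut_class C \<phi> | \<phi>. inv_mpt C \<phi> \<and> distr (edge_measure CG) (C \<Otimes>\<^sub>M C) (map_prod \<phi> \<phi>) = edge_measure CG}"
        using aut by blast
    qed
    show "(\<otimes>\<^bsub>aut_graphing CG\<^esub>) = (\<otimes>\<^bsub>aut_group C\<^esub>)"
      by (simp add: aut_graphing_def Let_def vmeasure_CC[OF w \<Gamma>])
  qed (rule aut(1))
qed

end

end

section \<open>Restriction to a set of full measure\<close>

text \<open>A representative may leave the conull set \<open>X\<close> at some points; fixing these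
  points gives a self-map of \<open>X\<close> without a change of class.\<close>

definition keep_in :: "'a set \<Rightarrow> ('a \<Rightarrow> 'a) \<Rightarrow> 'a \<Rightarrow> 'a" where
  "keep_in X s x = (if s x \<in> X then s x else x)"

definition extend_id :: "'a set \<Rightarrow> ('a \<Rightarrow> 'a) \<Rightarrow> 'a \<Rightarrow> 'a" where
  "extend_id X r x = (if x \<in> X then r x else x)"

context
  fixes M :: "'a measure" and X :: "'a set"
  assumes X: "X \<in> sets M" and AE_X: "AE x in M. x \<in> X"
begin

abbreviation (input) "MX \<equiv> restrict_space M X"

lemma X_space: "X \<subseteq> space M" "space MX = X"
  using sets.sets_into_space[OF X] by (auto simp: space_restrict_space)

lemma sets_MX: "A \<in> sets MX \<longleftrightarrow> A \<in> sets M \<and> A \<subseteq> X"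
  using sets_restrict_space_iff[of X M A] X X_space by (simp add: Int_absorb2 conj_commute)

lemma AE_MX: "(AE x in MX. P x) \<longleftrightarrow> (AE x in M. P x)"
proof -
  have "(AE x in MX. P x) \<longleftrightarrow> (AE x in M. x \<in> X \<longrightarrow> P x)"
    using X X_space by (intro AE_restrict_space_iff) (simp add: Int_absorb2)
  also have "\<dots> \<longleftrightarrow> (AE x in M. P x)"
  proof
    assume "AE x in M. x \<in> X \<longrightarrow> P x" then show "AE x in M. P x" using AE_X by eventually_elim simp
  next
    assume "AE x in M. P x" then show "AE x in M. x \<in> X \<longrightarrow> P x" by eventually_elim simp
  qed
  finally show ?thesis .
qed

lemma emeasure_MX: "A \<in> sets M \<Longrightarrow> A \<subseteq> X \<Longrightarrow> emeasure MX A = emeasure M A"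
  using X X_space by (intro emeasure_restrict_space) (simp_all add: Int_absorb2)

lemma prob_space_MX: "prob_space M \<Longrightarrow> prob_space MX"
proof -
  assume M: "prob_space M"
  have "emeasure MX (space MX) = emeasure M X" using emeasure_MX[OF X] X_space by simp
  also have "\<dots> = emeasure M (space M)" using AE_X X by (intro emeasure_eq_AE) auto
  finally show "prob_space MX" using prob_space.emeasure_space_1[OF M] by (intro prob_spaceI) simp
qed

lemma null_sets_MX: "A \<in> null_sets MX \<longleftrightarrow> A \<in> null_sets M \<and> A \<subseteq> X"
  using emeasure_MX by (auto simp: null_sets_def sets_MX)

lemma complete_measure_MX: "complete_measure M \<Longrightarrow> complete_measure MX"
  unfolding complete_measure_def null_sets_MX sets_MX by blast

lemma restrict_mpt:
  assumes t: "t \<in> measurable M M" "distr M M t = M" "\<And>x. x \<in> X \<Longrightarrow> t x \<in> X"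
  shows "t \<in> measurable MX MX" "distr MX MX t = MX"
proof -
  show m: "t \<in> measurable MX MX"
    using t by (intro measurable_restrict_space3) auto
  show "distr MX MX t = MX"
  proof (rule measure_eqI)
    fix A assume "A \<in> sets (distr MX MX t)"
    then have A: "A \<in> sets MX" "A \<in> sets M" "A \<subseteq> X" by (auto simp: sets_MX)
    have s: "t -` A \<inter> X \<in> sets M" using measurable_sets[OF m A(1)] X_space by (simp add: sets_MX)
    have "emeasure (distr MX MX t) A = emeasure MX (t -` A \<inter> X)"
      using emeasure_distr[OF m A(1)] X_space by simp
    also have "\<dots> = emeasure M (t -` A \<inter> X)" by (rule emeasure_MX[OF s]) simp
    also have "\<dots> = emeasure M (t -` A \<inter> space M)"
      using AE_X s measurable_sets[OF t(1) A(2)] X_space by (intro emeasure_eq_AE) auto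
    also have "\<dots> = emeasure M A" using emeasure_distr[OF t(1) A(2)] t(2) by simp
    also have "\<dots> = emeasure MX A" using emeasure_MX A by simp
    finally show "emeasure (distr MX MX t) A = emeasure MX A" .
  qed simp
qed

lemma keep_in_AE:
  assumes "s \<in> measurable M M" "distr M M s = M"
  shows "AE x in M. keep_in X s x = s x"
  using mpt_AE[OF assms AE_X] by eventually_elim (simp add: keep_in_def)

lemma keep_in_mpt:
  assumes s: "s \<in> measurable M M" "distr M M s = M"
  shows "keep_in X s \<in> measurable MX MX" "distr MX MX (keep_in X s) = MX"
proof -
  have m: "keep_in X s \<in> measurable M M"
  proof (rule measurableI)
    show "keep_in X s x \<in> space M" if "x \<in> space M" for x
      using that X_space by (auto simp: keep_in_def)
    show "keep_in X s -` A \<inter> space M \<in> sets M" if A: "A \<in> sets M" for A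
    proof -
      have "keep_in X s -` A \<inter> space M = (s -` (A \<inter> X) \<inter> space M) \<union> (A - (s -` X \<inter> space M))"
        using sets.sets_into_space[OF A] by (auto simp: keep_in_def split: if_splits)
      then show ?thesis
        by (simp only:) (intro sets.Un sets.Diff measurable_sets[OF s(1)] sets.Int A X)
    qed
  qed
  have d: "distr M M (keep_in X s) = M"
    using distr_cong_AE[OF refl refl keep_in_AE[OF s]] s m by simp
  show "keep_in X s \<in> measurable MX MX" "distr MX MX (keep_in X s) = MX"
    using restrict_mpt[OF m d] by (auto simp: keep_in_def)
qed

lemma inv_mpt_keep_in:
  assumes "inv_mpt M s"
  shows "inv_mpt MX (keep_in X s)"
proof -
  obtain t where t: "inv_mpt M t" "AE x in M. t (s x) = x" "AE x in M. s (t x) = x"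
    using inv_mpt_inverse[OF assms] by blast
  note ks = keep_in_AE[OF inv_mptD[OF assms]] and kt = keep_in_AE[OF inv_mptD[OF t(1)]]
  have "AE x in MX. keep_in X t (keep_in X s x) = x" unfolding AE_MX
    using t(2) ks inv_mpt_AE[OF assms kt] by eventually_elim simp
  moreover have "AE x in MX. keep_in X s (keep_in X t x) = x" unfolding AE_MX
    using t(3) kt inv_mpt_AE[OF t(1) ks] by eventually_elim simp
  ultimately show ?thesis
    using keep_in_mpt[OF inv_mptD[OF assms]] keep_in_mpt[OF inv_mptD[OF t(1)]] by (intro inv_mptI)
qed

lemma extend_id_AE: "AE x in M. extend_id X r x = r x"
  using AE_X by eventually_elim (simp add: extend_id_def)

lemma extend_id_mpt:
  assumes r: "r \<in> measurable MX MX" "distr MX MX r = MX"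
  shows "extend_id X r \<in> measurable M M" "distr M M (extend_id X r) = M"
proof -
  have rX: "r x \<in> X" if "x \<in> X" for x using measurable_space[OF r(1)] that X_space by simp
  have pre: "extend_id X r -` A \<inter> space M = (r -` (A \<inter> X) \<inter> X) \<union> (A \<inter> (space M - X))" for A
    using X_space rX by (auto simp: extend_id_def split: if_splits)
  have s: "r -` (A \<inter> X) \<inter> X \<in> sets M" "A \<inter> X \<in> sets MX" if "A \<in> sets M" for A
  proof -
    show AX: "A \<inter> X \<in> sets MX" using that X by (simp add: sets_MX)
    show "r -` (A \<inter> X) \<inter> X \<in> sets M" using measurable_sets[OF r(1) AX] X_space by (simp add: sets_MX)
  qed
  show m: "extend_id X r \<in> measurable M M"
  proof (rule measurableI)
    show "extend_id X r x \<in> space M" if "x \<in> space M" for x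
      using that rX X_space by (auto simp: extend_id_def)
    show "extend_id X r -` A \<inter> space M \<in> sets M" if "A \<in> sets M" for A
      unfolding pre using s[OF that] X that by auto
  qed
  show "distr M M (extend_id X r) = M"
  proof (rule measure_eqI)
    fix A assume "A \<in> sets (distr M M (extend_id X r))"
    then have A: "A \<in> sets M" by simp
    have "emeasure (distr M M (extend_id X r)) A = emeasure M (extend_id X r -` A \<inter> space M)"
      by (rule emeasure_distr[OF m A])
    also have "\<dots> = emeasure M (r -` (A \<inter> X) \<inter> X)"
      unfolding pre using AE_X s[OF A] A X by (intro emeasure_eq_AE) auto
    also have "\<dots> = emeasure MX (r -` (A \<inter> X) \<inter> space MX)"
      using emeasure_MX[OF s(1)[OF A]] X_space by simp
    also have "\<dots> = emeasure MX (A \<inter> X)" using emeasure_distr[OF r(1) s(2)[OF A]] r(2) by simp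
    also have "\<dots> = emeasure M (A \<inter> X)" using A X by (intro emeasure_MX) auto
    also have "\<dots> = emeasure M A" using AE_X A X by (intro emeasure_eq_AE) auto
    finally show "emeasure (distr M M (extend_id X r)) A = emeasure M A" .
  qed simp
qed

lemma inv_mpt_extend_id:
  assumes "inv_mpt MX r"
  shows "inv_mpt M (extend_id X r)"
proof -
  obtain t where t: "inv_mpt MX t" "AE x in MX. t (r x) = x" "AE x in MX. r (t x) = x"
    using inv_mpt_inverse[OF assms] by blast
  have rX: "r x \<in> X" "t x \<in> X" if "x \<in> X" for x
    using measurable_space[OF inv_mptD(1)[OF assms]] measurable_space[OF inv_mptD(1)[OF t(1)]] that X_space by auto
  have "AE x in M. extend_id X t (extend_id X r x) = x"
    using t(2) AE_X unfolding AE_MX by eventually_elim (simp add: extend_id_def rX)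
  moreover have "AE x in M. extend_id X r (extend_id X t x) = x"
    using t(3) AE_X unfolding AE_MX by eventually_elim (simp add: extend_id_def rX)
  ultimately show ?thesis
    using extend_id_mpt[OF inv_mptD[OF assms]] extend_id_mpt[OF inv_mptD[OF t(1)]] by (intro inv_mptI)
qed

end

text \<open>Discarding a null set changes no class. \<open>T\<close> need not map \<open>X\<close>
  into itself, so the restricted space has its own maps \<open>T1\<close> and \<open>S1\<close>,
  equal to \<open>T\<close> and \<open>S\<close> almost everywhere. Classes travel by
  \<open>keep_in\<close> in one direction and by \<open>extend_id\<close> in the other.\<close>

lemma aut_pm_restrict_iso:
  assumes X: "X \<in> sets M" and AE_X: "AE x in M. x \<in> X"
    and T: "inv_mpt M T" and S: "inv_mpt M S" "AE x in M. S (T x) = x"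
    and T1: "inv_mpt (restrict_space M X) T1" "AE x in M. T1 x = T x"
    and S1: "inv_mpt (restrict_space M X) S1" "AE x in M. S1 x = S x"
  shows "aut_pm M T \<cong> aut_pm (restrict_space M X) T1"
proof -
  let ?R = "restrict_space M X"
  have mX: "AE x in M. r x \<in> X" if "inv_mpt M r" for r by (rule inv_mpt_AE[OF that AE_X])
  have S1T1: "AE x in ?R. S1 (T1 x) = x"
  proof -
    have "AE x in M. S1 (T1 x) = x"
      using T1(2) inv_mpt_AE[OF T S1(2)] S(2) by eventually_elim simp
    then show ?thesis by (simp only: AE_MX[OF X AE_X])
  qed
  note cM = aut_pm_carrier[OF T S] and cR = aut_pm_carrier[OF T1(1) S1(1) S1T1]
  define rep where "rep A = (SOME s :: 'a \<Rightarrow> 'a. s \<in> A)" for A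
  have rep: "inv_mpt M (rep A)" "aut_class M (rep A) = A"
    "(AE x in M. rep A (T x) = T (rep A x)) \<or> (AE x in M. rep A (T x) = S (rep A x))"
    if A: "A \<in> carrier (aut_pm M T)" for A
  proof -
    obtain s where s: "A = aut_class M s" "inv_mpt M s" "(AE x in M. s (T x) = T (s x)) \<or> (AE x in M. s (T x) = S (s x))"
      using A cM by auto
    have "rep A \<in> A" unfolding rep_def using aut_class_self[OF s(2)] s(1) by (metis someI)
    then show r: "inv_mpt M (rep A)" and e: "aut_class M (rep A) = A"
      using s(1) by (auto simp: aut_class_def aut_class_eq_iff)
    have rs: "AE x in M. rep A x = s x" using e s(1) aut_class_eq_iff[OF r] by metis
    have rT: "AE x in M. rep A (T x) = s (T x)" by (rule inv_mpt_AE[OF T rs])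
    from s(3) show "(AE x in M. rep A (T x) = T (rep A x)) \<or> (AE x in M. rep A (T x) = S (rep A x))"
    proof
      assume "AE x in M. s (T x) = T (s x)"
      then have "AE x in M. rep A (T x) = T (rep A x)" using rs rT by eventually_elim simp
      then show ?thesis ..
    next
      assume "AE x in M. s (T x) = S (s x)"
      then have "AE x in M. rep A (T x) = S (rep A x)" using rs rT by eventually_elim simp
      then show ?thesis ..
    qed
  qed
  define F where "F A = keep_in X (rep A)" for A
  have F_AE: "AE x in M. F A x = rep A x" if "A \<in> carrier (aut_pm M T)" for A
    unfolding F_def by (rule keep_in_AE[OF X AE_X inv_mptD[OF rep(1)[OF that]]])
  have F_inv: "inv_mpt ?R (F A)" if "A \<in> carrier (aut_pm M T)" for A
    unfolding F_def by (rule inv_mpt_keep_in[OF X AE_X rep(1)[OF that]])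
  show ?thesis
  proof (rule class_iso[where C="?R" and F=F])
    fix A B assume A: "A \<in> carrier (aut_pm M T)" and B: "B \<in> carrier (aut_pm M T)"
    let ?AB = "A \<otimes>\<^bsub>aut_pm M T\<^esub> B"
    have AB: "?AB \<in> carrier (aut_pm M T)" using mult_closed_aut_pm[OF T] A B by (simp add: mult_closed_def)
    have "?AB = aut_class M (rep A \<circ> rep B)"
      using aut_class_mult[OF rep(1)[OF A] rep(1)[OF B]] by (simp add: aut_pm_mult rep(2) A B)
    then have "AE x in M. rep ?AB x = (rep A \<circ> rep B) x"
      using rep(2)[OF AB] aut_class_eq_iff[OF rep(1)[OF AB]] by metis
    then have "AE x in M. F ?AB x = F A (F B x)"
      using F_AE[OF AB] F_AE[OF B] inv_mpt_AE[OF rep(1)[OF B] F_AE[OF A]] by eventually_elim simp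
    then show "AE x in ?R. F ?AB x = F A (F B x)" by (simp only: AE_MX[OF X AE_X])
    assume "AE x in ?R. F A x = F B x"
    then have "AE x in M. F A x = F B x" by (simp only: AE_MX[OF X AE_X])
    then have "AE x in M. rep A x = rep B x" using F_AE[OF A] F_AE[OF B] by eventually_elim simp
    then show "A = B" using aut_class_eq_iff[OF rep(1)[OF A]] rep(2)[OF A] rep(2)[OF B] by metis
  next
    show "mult_closed (aut_pm M T)" by (rule mult_closed_aut_pm[OF T])
    show "(\<otimes>\<^bsub>aut_pm ?R T1\<^esub>) = (\<otimes>\<^bsub>aut_group ?R\<^esub>)" by (rule aut_pm_mult)
    show "carrier (aut_pm ?R T1) = (\<lambda>A. aut_class ?R (F A)) ` carrier (aut_pm M T)"
    proof (intro subset_antisym subsetI)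
      fix D assume "D \<in> carrier (aut_pm ?R T1)"
      then obtain r where r: "D = aut_class ?R r" "inv_mpt ?R r"
          "(AE x in ?R. r (T1 x) = T1 (r x)) \<or> (AE x in ?R. r (T1 x) = S1 (r x))" using cR by auto
      define s where "s = extend_id X r"
      have iv: "inv_mpt M s" unfolding s_def by (rule inv_mpt_extend_id[OF X AE_X r(2)])
      have sr: "AE x in M. s x = r x" unfolding s_def by (rule extend_id_AE[OF X AE_X])
      have rT: "AE x in M. s (T x) = r (T1 x)"
        using inv_mpt_AE[OF T sr] T1(2) by eventually_elim simp
      have sT: "AE x in M. T1 (s x) = T (s x)" "AE x in M. S1 (s x) = S (s x)"
        using inv_mpt_AE[OF iv T1(2)] inv_mpt_AE[OF iv S1(2)] by auto
      from r(3) have "(AE x in M. s (T x) = T (s x)) \<or> (AE x in M. s (T x) = S (s x))"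
        unfolding AE_MX[OF X AE_X]
      proof
        assume "AE x in M. r (T1 x) = T1 (r x)"
        then have "AE x in M. s (T x) = T (s x)" using sr rT sT(1) by eventually_elim simp
        then show ?thesis ..
      next
        assume "AE x in M. r (T1 x) = S1 (r x)"
        then have "AE x in M. s (T x) = S (s x)" using sr rT sT(2) by eventually_elim simp
        then show ?thesis ..
      qed
      then have A: "aut_class M s \<in> carrier (aut_pm M T)" using iv cM by blast
      have "AE x in M. rep (aut_class M s) x = s x"
        using rep(2)[OF A] aut_class_eq_iff[OF rep(1)[OF A]] by metis
      then have "AE x in M. F (aut_class M s) x = r x" using F_AE[OF A] sr by eventually_elim simp
      then have "AE x in ?R. F (aut_class M s) x = r x" by (simp only: AE_MX[OF X AE_X])
      then have "D = aut_class ?R (F (aut_class M s))" using r(1) aut_class_eq_iff[OF F_inv[OF A]] by metis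
      then show "D \<in> (\<lambda>A. aut_class ?R (F A)) ` carrier (aut_pm M T)" using A by blast
    next
      fix D assume "D \<in> (\<lambda>A. aut_class ?R (F A)) ` carrier (aut_pm M T)"
      then obtain A where A: "A \<in> carrier (aut_pm M T)" "D = aut_class ?R (F A)" by blast
      have a: "AE x in M. F A (T1 x) = rep A (T x)"
        using inv_mpt_AE[OF T F_AE[OF A(1)]] T1(2) by eventually_elim simp
      have b: "AE x in M. T1 (F A x) = T (rep A x)" "AE x in M. S1 (F A x) = S (rep A x)"
      proof -
        show "AE x in M. T1 (F A x) = T (rep A x)"
          using F_AE[OF A(1)] inv_mpt_AE[OF rep(1)[OF A(1)] T1(2)] by eventually_elim simp
        show "AE x in M. S1 (F A x) = S (rep A x)"
          using F_AE[OF A(1)] inv_mpt_AE[OF rep(1)[OF A(1)] S1(2)] by eventually_elim simp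
      qed
      from rep(3)[OF A(1)] have "(AE x in M. F A (T1 x) = T1 (F A x)) \<or> (AE x in M. F A (T1 x) = S1 (F A x))"
      proof
        assume "AE x in M. rep A (T x) = T (rep A x)"
        then have "AE x in M. F A (T1 x) = T1 (F A x)" using a b(1) by eventually_elim simp
        then show ?thesis ..
      next
        assume "AE x in M. rep A (T x) = S (rep A x)"
        then have "AE x in M. F A (T1 x) = S1 (F A x)" using a b(2) by eventually_elim simp
        then show ?thesis ..
      qed
      then show "D \<in> carrier (aut_pm ?R T1)"
        unfolding cR AE_MX[OF X AE_X] using A(2) F_inv[OF A(1)] by blast
    qed
  qed (rule F_inv)
qed

section \<open>Good sets of orbits\<close>

text \<open>The isomorphism with the model space is followed by an embedding of the model in the
  reals: interval points keep their value, and atoms go to negative integers, which avoids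
  collisions.\<close>

lemma standard_prob_space_code:
  assumes "standard_prob_space M"
  obtains u :: "'a \<Rightarrow> real" and X where "u \<in> borel_measurable M" "X \<in> sets M" "AE x in M. x \<in> X" "inj_on u X"
proof -
  obtain c p where "isomorphic_mod_null M (interval_with_atoms c p)"
    using assms unfolding standard_prob_space_def by blast
  then obtain X Y f g where XY: "X \<in> sets M" "Y \<in> sets (interval_with_atoms c p)" "space M - X \<in> null_sets M"
    and f: "f \<in> measurable (restrict_space M X) (restrict_space (interval_with_atoms c p) Y)"
    and gf: "\<forall>x\<in>X. g (f x) = x"
    unfolding isomorphic_mod_null_def by blast
  let ?N = "interval_with_atoms c p"
  define code :: "real + nat \<Rightarrow> real" where "code = case_sum (\<lambda>r. r) (\<lambda>n. - 1 - real n)"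
  let ?\<Omega> = "{0..c} <+> {n. p n > 0}"
  let ?A = "{A <+> B | A B. A \<in> sets lebesgue \<and> A \<subseteq> {0..c} \<and> B \<subseteq> {n. p n > 0}}"
  have sub: "?A \<subseteq> Pow ?\<Omega>" by blast
  have N: "space ?N = ?\<Omega>" "sets ?N = sigma_sets ?\<Omega> ?A"
    unfolding interval_with_atoms_def by (rule space_measure_of[OF sub], rule sets_measure_of[OF sub])
  have code: "code \<in> borel_measurable ?N"
  proof (rule measurableI)
    fix S :: "real set" assume S: "S \<in> sets borel"
    have "code -` S \<inter> space ?N = (S \<inter> {0..c}) <+> {n. p n > 0 \<and> - 1 - real n \<in> S}"
      unfolding N(1) code_def by auto
    moreover have "S \<inter> {0..c} \<in> sets lebesgue" using S by (simp add: sets_completionI_sets)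
    then have "(S \<inter> {0..c}) <+> {n. p n > 0 \<and> - 1 - real n \<in> S} \<in> ?A" by blast
    ultimately show "code -` S \<inter> space ?N \<in> sets ?N" unfolding N(2) by (simp only: sigma_sets.Basic)
  qed simp
  have inj: "inj_on code ?\<Omega>" unfolding code_def by (auto simp: inj_on_def)
  have fY: "f x \<in> Y" if "x \<in> X" for x
    using measurable_space[OF f, of x] that XY sets.sets_into_space[OF XY(1)] by (auto simp: space_restrict_space)
  have fm: "(\<lambda>x. code (f x)) \<in> borel_measurable (restrict_space M X)"
    using measurable_compose[OF f measurable_restrict_space1[OF code]] .
  show ?thesis
  proof (rule that[of "\<lambda>x. if x \<in> X then code (f x) else 0" X])
    show "(\<lambda>x. if x \<in> X then code (f x) else 0) \<in> borel_measurable M"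
      using fm XY(1) by (subst measurable_restrict_space_iff[symmetric]) auto
    show "X \<in> sets M" by fact
    show "AE x in M. x \<in> X" using AE_not_in[OF XY(3)] AE_space by eventually_elim simp
    have Y\<Omega>: "Y \<subseteq> ?\<Omega>" using sets.sets_into_space[OF XY(2)] N(1) by simp
    show "inj_on (\<lambda>x. if x \<in> X then code (f x) else 0) X"
    proof (rule inj_onI)
      fix x y assume xy: "x \<in> X" "y \<in> X" "(if x \<in> X then code (f x) else 0) = (if y \<in> X then code (f y) else 0)"
      then have "f x = f y" using inj_onD[OF inj] Y\<Omega> fY by (metis subsetD)
      then show "x = y" using gf xy by metis
    qed
  qed
qed

text \<open>The \<open>n\<close>-periodic points form an invariant set, null or conull. If it is
  conull, the least value of \<open>u\<close> along an orbit is an invariant function, hence a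
  constant, attained by \<open>u\<close> at a single point; almost every point then lies on the
  finite orbit of that point, and the space has finitely many atoms.\<close>

lemma good_set:
  assumes sys: "ergodic_system M T" and S: "inv_mpt M S" "AE x in M. S (T x) = x" "AE x in M. T (S x) = x"
    and u: "u \<in> borel_measurable M" "AE x in M. x \<in> X" "inj_on (u :: 'a \<Rightarrow> real) X"
    and N: "N \<in> null_sets M"
  obtains G where "G \<in> sets M" "AE x in M. x \<in> G" "G \<inter> N = {}" "G \<subseteq> X"
    "\<forall>x\<in>G. T x \<in> G \<and> S x \<in> G \<and> S (T x) = x \<and> T (S x) = x \<and> (\<forall>n>0. (T ^^ n) x \<noteq> x)"
proof -
  from sys have T: "inv_mpt M T" and erg: "ergodic M T" and fin: "\<not> finitely_many_atoms M" and M: "prob_space M"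
    by (auto simp: ergodic_system_def standard_prob_space_def)
  interpret prob_space M by (rule M)
  note mT = mpt_funpow[OF inv_mptD[OF T]] and mS = mpt_funpow[OF inv_mptD[OF S(1)]]
  have "AE x in M. S (T x) = x \<and> T (S x) = x \<and> x \<in> X \<and> x \<notin> N"
    using S(2,3) u(2) AE_not_in[OF N] by eventually_elim blast
  then obtain N1 where N1: "{x \<in> space M. \<not> (S (T x) = x \<and> T (S x) = x \<and> x \<in> X \<and> x \<notin> N)} \<subseteq> N1" "N1 \<in> null_sets M"
    unfolding eventually_ae_filter by blast
  \<comment> \<open>Removing the null set together with its iterated preimages in both directions
    leaves an invariant set.\<close>
  define G1 where "G1 = {x \<in> space M. \<forall>n. (T ^^ n) x \<notin> N1 \<and> (S ^^ n) x \<notin> N1}"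
  have G1_sets: "G1 \<in> sets M"
  proof -
    have "G1 = space M - (\<Union>n. ((T ^^ n) -` N1 \<inter> space M) \<union> ((S ^^ n) -` N1 \<inter> space M))"
      unfolding G1_def by auto
    then show ?thesis using N1(2) measurable_sets[OF mT(1)] measurable_sets[OF mS(1)] by auto
  qed
  have G1_AE: "AE x in M. x \<in> G1"
  proof -
    have "AE x in M. (T ^^ n) x \<notin> N1 \<and> (S ^^ n) x \<notin> N1" for n
      using mpt_AE[OF mT AE_not_in[OF N1(2)]] mpt_AE[OF mS AE_not_in[OF N1(2)]] by eventually_elim blast
    then have "AE x in M. \<forall>n. (T ^^ n) x \<notin> N1 \<and> (S ^^ n) x \<notin> N1"
      unfolding AE_all_countable by blast
    then show ?thesis using AE_space by eventually_elim (simp add: G1_def)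
  qed
  have G1: "x \<in> space M" "S (T x) = x" "T (S x) = x" "x \<in> X" "x \<notin> N" if "x \<in> G1" for x
  proof -
    show "x \<in> space M" using that by (simp add: G1_def)
    have "(T ^^ 0) x \<notin> N1" using that unfolding G1_def by blast
    then show "S (T x) = x" "T (S x) = x" "x \<in> X" "x \<notin> N" using N1(1) \<open>x \<in> space M\<close> by auto
  qed
  have TG1: "T x \<in> G1" if x: "x \<in> G1" for x
  proof -
    have "(T ^^ n) (T x) \<notin> N1" for n using x unfolding G1_def by (metis (mono_tags, lifting) funpow_Suc_right mem_Collect_eq o_apply)
    moreover have "(S ^^ n) (T x) \<notin> N1" for n
    proof (cases n)
      case 0
      have "(T ^^ 1) x \<notin> N1" using x unfolding G1_def by blast
      then show ?thesis using 0 by simp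
    next
      case (Suc l)
      have "(S ^^ Suc l) (T x) = (S ^^ l) x" using G1(2)[OF x] by (simp add: funpow_swap1)
      then show ?thesis using x Suc unfolding G1_def by simp
    qed
    moreover have "T x \<in> space M" using measurable_space[OF inv_mptD(1)[OF T]] G1(1)[OF x] by simp
    ultimately show ?thesis by (simp add: G1_def)
  qed
  have SG1: "S x \<in> G1" if x: "x \<in> G1" for x
  proof -
    have "(S ^^ n) (S x) \<notin> N1" for n using x unfolding G1_def by (metis (mono_tags, lifting) funpow_Suc_right mem_Collect_eq o_apply)
    moreover have "(T ^^ n) (S x) \<notin> N1" for n
    proof (cases n)
      case 0
      have "(S ^^ 1) x \<notin> N1" using x unfolding G1_def by blast
      then show ?thesis using 0 by simp
    next
      case (Suc l)
      have "(T ^^ Suc l) (S x) = (T ^^ l) x" using G1(3)[OF x] by (simp add: funpow_swap1)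
      then show ?thesis using x Suc unfolding G1_def by simp
    qed
    moreover have "S x \<in> space M" using measurable_space[OF inv_mptD(1)[OF S(1)]] G1(1)[OF x] by simp
    ultimately show ?thesis by (simp add: G1_def)
  qed
  have TnG1: "(T ^^ n) x \<in> G1" if "x \<in> G1" for x n using that by (induction n) (auto simp: TG1)
  have inj: "x = y" if "x \<in> G1" "y \<in> G1" "u x = u y" for x y using inj_onD[OF u(3)] that G1(4) by blast
  have um: "(\<lambda>x. u ((T ^^ n) x)) \<in> borel_measurable M" for n by (rule measurable_compose[OF mT(1) u(1)])
  have Tper: "(T ^^ n) (T x) = T x \<longleftrightarrow> (T ^^ n) x = x" if x: "x \<in> G1" for x n
  proof -
    have "(T ^^ n) (T x) = T ((T ^^ n) x)" by (simp add: funpow_swap1)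
    then show ?thesis using G1(2)[OF x] G1(2)[OF TnG1[OF x]] by metis
  qed
  have aper: "AE x in M. (T ^^ n) x \<noteq> x" if n: "n > 0" for n
  proof -
    define A where "A = {x \<in> space M. u ((T ^^ n) x) = u x}"
    have A: "A \<in> sets M" unfolding A_def using um u(1) by measurable
    have AG: "x \<in> A \<longleftrightarrow> (T ^^ n) x = x" if "x \<in> G1" for x
      using inj[OF TnG1[OF that] that] G1(1)[OF that] by (auto simp: A_def)
    have "AE x in M. T x \<in> A \<longleftrightarrow> x \<in> A"
      using G1_AE by eventually_elim (simp add: AG TG1 Tper)
    then consider "AE x in M. x \<in> A" | "AE x in M. x \<notin> A" using ergodic_dichotomy[OF erg A] by blast
    then show ?thesis
    proof cases
      case 2 then show ?thesis using G1_AE by eventually_elim (simp add: AG)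
    next
      case 1
      then have per: "AE x in M. (T ^^ n) x = x \<and> x \<in> G1" using G1_AE by eventually_elim (simp add: AG)
      define v where "v x = Min ((\<lambda>j. u ((T ^^ j) x)) ` {..<n})" for x
      have vm: "v \<in> borel_measurable M" unfolding v_def using um by (intro borel_measurable_Min) auto
      have "AE x in M. v (T x) = v x"
        using per
      proof eventually_elim
        fix x assume x: "(T ^^ n) x = x \<and> x \<in> G1"
        \<comment> \<open>Applying \<open>T\<close> rotates the orbit of a periodic point, so the
          set of values is unchanged.\<close>
        have "(\<lambda>j. u ((T ^^ j) (T x))) ` {..<n} = (\<lambda>j. u ((T ^^ j) x)) ` Suc ` {..<n}"
          by (simp add: image_image funpow_swap1)
        also have "Suc ` {..<n} = insert n {1..<n}" using n unfolding image_Suc_lessThan by auto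
        also have "(\<lambda>j. u ((T ^^ j) x)) ` insert n {1..<n} = (\<lambda>j. u ((T ^^ j) x)) ` insert 0 {1..<n}"
          using x by simp
        also have "insert 0 {1..<n} = {..<n}" using n by auto
        finally show "v (T x) = v x" unfolding v_def by simp
      qed
      then obtain c where c: "AE x in M. v x = c"
        by (rule ergodic_constant[OF erg inv_mptD(1)[OF T] vm])
      have ex: "AE x in M. \<exists>j<n. u ((T ^^ j) x) = c \<and> (T ^^ n) x = x \<and> x \<in> G1"
        using c per
      proof eventually_elim
        fix x assume x: "v x = c" "(T ^^ n) x = x \<and> x \<in> G1"
        have "v x \<in> (\<lambda>j. u ((T ^^ j) x)) ` {..<n}" unfolding v_def using n by (intro Min_in) auto
        then show "\<exists>j<n. u ((T ^^ j) x) = c \<and> (T ^^ n) x = x \<and> x \<in> G1" using x by auto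
      qed
      have "\<exists>y\<in>G1. u y = c"
      proof (rule ccontr)
        assume n: "\<not> (\<exists>y\<in>G1. u y = c)"
        have "AE x in M. False" using ex by eventually_elim (use n TnG1 in blast)
        then show False by simp
      qed
      then obtain y where y: "y \<in> G1" "u y = c" by blast
      have "AE x in M. x \<in> (\<lambda>i. (T ^^ i) y) ` {..n}"
        using ex
      proof eventually_elim
        fix x assume "\<exists>j<n. u ((T ^^ j) x) = c \<and> (T ^^ n) x = x \<and> x \<in> G1"
        then obtain j where j: "j < n" "u ((T ^^ j) x) = c" "(T ^^ n) x = x" "x \<in> G1" by blast
        have "(T ^^ j) x = y" using inj[OF TnG1[OF j(4)] y(1)] j y by simp
        \<comment> \<open>The remaining \<open>n - j\<close> steps complete the period and lead from
          \<open>y\<close> back to \<open>x\<close>.\<close>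
        then have "(T ^^ (n - j)) y = (T ^^ (n - j + j)) x" by (simp add: funpow_add)
        then have "x = (T ^^ (n - j)) y" using j by simp
        then show "x \<in> (\<lambda>i. (T ^^ i) y) ` {..n}" by auto
      qed
      then have "finitely_many_atoms M" unfolding finitely_many_atoms_def by (intro exI conjI) auto
      then show ?thesis using fin by simp
    qed
  qed
  define G where "G = {x \<in> G1. \<forall>n>0. (T ^^ n) x \<noteq> x}"
  have nu: "(T ^^ n) x = x \<longleftrightarrow> u ((T ^^ n) x) = u x" if "x \<in> G1" for x n
    using inj[OF TnG1[OF that] that] by auto
  have "G = G1 \<inter> (\<Inter>n\<in>{0<..}. {x \<in> space M. u ((T ^^ n) x) \<noteq> u x})"
    unfolding G_def using nu G1(1) by fastforce
  moreover have "{x \<in> space M. u ((T ^^ n) x) \<noteq> u x} \<in> sets M" for n using um u(1) by measurable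
  then have "(\<Inter>n\<in>{0<..}. {x \<in> space M. u ((T ^^ n) x) \<noteq> u x}) \<in> sets M"
    by (intro sets.countable_INT') (auto intro: exI[of _ 1])
  ultimately have Gs: "G \<in> sets M" using G1_sets by auto
  have "AE x in M. \<forall>n. n > 0 \<longrightarrow> (T ^^ n) x \<noteq> x" unfolding AE_all_countable using aper by auto
  then have GAE: "AE x in M. x \<in> G" using G1_AE by eventually_elim (simp add: G_def)
  show ?thesis
  proof (rule that[of G])
    have TG: "T x \<in> G" if "x \<in> G" for x using that TG1 Tper by (auto simp: G_def)
    have SG: "S x \<in> G" if x: "x \<in> G" for x
    proof -
      have g: "x \<in> G1" "S x \<in> G1" using x SG1 by (auto simp: G_def)
      have "(T ^^ n) (S x) \<noteq> S x" if "n > 0" for n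
        using Tper[OF g(2), of n] x that G1(3)[OF g(1)] by (auto simp: G_def)
      then show ?thesis using g by (simp add: G_def)
    qed
    have GG1: "x \<in> G1" if "x \<in> G" for x using that by (simp add: G_def)
    show "G \<in> sets M" by (rule Gs)
    show "AE x in M. x \<in> G" by (rule GAE)
    show "G \<inter> N = {}" "G \<subseteq> X" using G1(4,5)[OF GG1] by blast+
    have "(T ^^ n) x \<noteq> x" if "x \<in> G" "n > 0" for x n using that by (simp add: G_def)
    then show "\<forall>x\<in>G. T x \<in> G \<and> S x \<in> G \<and> S (T x) = x \<and> T (S x) = x \<and> (\<forall>n>0. (T ^^ n) x \<noteq> x)"
      using TG SG G1(2,3)[OF GG1] by blast
  qed
qed

text \<open>\<open>T\<close> and \<open>S\<close> need not preserve \<open>X\<close>. Making them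
  the identity off \<open>G\<close>, which lies inside \<open>X\<close>, changes them on a null set
  and yields self-maps of \<open>X\<close>.\<close>

lemma ergodic_graph_restrict:
  assumes M: "prob_space M" "complete_measure M" and erg: "ergodic M T"
    and T: "inv_mpt M T" and S: "inv_mpt M S" "AE x in M. S (T x) = x"
    and X: "X \<in> sets M" and G: "G \<in> sets M" "AE x in M. x \<in> G" "G \<subseteq> X"
    and G_maps: "\<And>x. x \<in> G \<Longrightarrow> T x \<in> G" "\<And>x. x \<in> G \<Longrightarrow> S x \<in> G"
      "\<And>x. x \<in> G \<Longrightarrow> S (T x) = x" "\<And>x. x \<in> G \<Longrightarrow> T (S x) = x"
      "\<And>x n. x \<in> G \<Longrightarrow> n > 0 \<Longrightarrow> (T ^^ n) x \<noteq> x"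
    and u: "u \<in> borel_measurable M" "inj_on (u :: 'a \<Rightarrow> real) G"
    and E: "\<And>x. x \<in> G \<Longrightarrow> E `` {x} = {T x, S x}"
  obtains T1 where "ergodic_graph (restrict_space M X) E T1 (extend_id G S) G u"
    "\<And>x. x \<in> G \<Longrightarrow> T1 x = T x" "aut_pm M T \<cong> aut_pm (restrict_space M X) T1"
proof -
  let ?R = "restrict_space M X"
  have AE_X: "AE x in M. x \<in> X" using G(2) by eventually_elim (use G(3) in blast)
  note R = AE_MX[OF X AE_X] sets_MX[OF X AE_X] X_space[OF X AE_X]
  have ext: "inv_mpt M (extend_id G s)" "AE x in M. extend_id G s x = s x"
    "extend_id G s \<in> measurable ?R ?R" "distr ?R ?R (extend_id G s) = ?R"
    if s: "inv_mpt M s" "\<And>x. x \<in> G \<Longrightarrow> s x \<in> G" for s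
  proof -
    show e: "AE x in M. extend_id G s x = s x" by (rule extend_id_AE[OF G(1,2)])
    have "extend_id G s \<in> measurable M M"
    proof (rule measurableI)
      show "extend_id G s x \<in> space M" if "x \<in> space M" for x
        using that measurable_space[OF inv_mptD(1)[OF s(1)]] by (auto simp: extend_id_def)
      fix A assume A: "A \<in> sets M"
      have "extend_id G s -` A \<inter> space M = ((s -` A \<inter> space M) \<inter> G) \<union> (A - G)"
        using sets.sets_into_space[OF A] sets.sets_into_space[OF G(1)] by (auto simp: extend_id_def split: if_splits)
      then show "extend_id G s -` A \<inter> space M \<in> sets M"
        by (simp only:) (intro sets.Un sets.Diff measurable_sets[OF inv_mptD(1)[OF s(1)]] sets.Int A G)
    qed
    then show i: "inv_mpt M (extend_id G s)" by (rule inv_mpt_cong_AE[OF s(1) _ e])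
    have "extend_id G s x \<in> X" if "x \<in> X" for x using that s(2) G(3) by (auto simp: extend_id_def)
    then show "extend_id G s \<in> measurable ?R ?R" "distr ?R ?R (extend_id G s) = ?R"
      using restrict_mpt[OF X AE_X inv_mptD[OF i]] by auto
  qed
  let ?T = "extend_id G T" and ?S = "extend_id G S"
  have eT: "AE x in M. ?T x = T x" by (rule ext(2)[OF T]) (rule G_maps(1))
  have eS: "AE x in M. ?S x = S x" by (rule ext(2)[OF S(1)]) (rule G_maps(2))
  have Tn: "(?T ^^ n) x = (T ^^ n) x \<and> (T ^^ n) x \<in> G" if "x \<in> G" for x n
    using that G_maps(1) by (induction n) (auto simp: extend_id_def)
  have eg: "ergodic_graph ?R E ?T ?S G u"
    unfolding ergodic_graph_def ergodic_graph_axioms_def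
  proof (intro conjI allI impI)
    show "prob_space ?R" by (rule prob_space_MX[OF X AE_X M(1)])
    show "complete_measure ?R" by (rule complete_measure_MX[OF X AE_X M(2)])
    show "?T \<in> measurable ?R ?R" "distr ?R ?R ?T = ?R" using ext(3,4)[OF T G_maps(1)] by auto
    show "?S \<in> measurable ?R ?R" "distr ?R ?R ?S = ?R" using ext(3,4)[OF S(1) G_maps(2)] by auto
    show "G \<in> sets ?R" using G R by simp
    show "AE x in ?R. x \<in> G" unfolding R(1) by (rule G(2))
    show "u \<in> borel_measurable ?R" using u(1) by (rule measurable_restrict_space1)
    show "inj_on u G" by fact
    show "(?T ^^ n) x \<noteq> x" if "x \<in> G" "0 < n" for x n using Tn[OF that(1)] G_maps(5)[OF that] by simp
    show "ergodic ?R ?T"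
      unfolding ergodic_def
    proof (intro ballI impI)
      fix A assume A: "A \<in> sets ?R" "AE x in ?R. (?T x \<in> A) = (x \<in> A)"
      have "AE x in M. T x \<in> A \<longleftrightarrow> x \<in> A"
        using A(2) eT unfolding R(1) by eventually_elim simp
      then have "measure M A = 0 \<or> measure M A = 1" using erg A(1) R(2) unfolding ergodic_def by blast
      then show "measure ?R A = 0 \<or> measure ?R A = 1"
        using emeasure_MX[OF X AE_X] A(1) R(2) by (simp add: measure_def)
    qed
  qed (use G_maps E in \<open>auto simp: extend_id_def\<close>)
  interpret A: ergodic_graph ?R E ?T ?S G u by (rule eg)
  show ?thesis
  proof (rule that[OF eg])
    show "?T x = T x" if "x \<in> G" for x using that by (simp add: extend_id_def)
    show "aut_pm M T \<cong> aut_pm ?R ?T"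
      by (rule aut_pm_restrict_iso[OF X AE_X T S A.inv_mpt_T(1) eT A.inv_mpt_T(2) eS])
  qed
qed

text \<open>The isomorphism with the model space is cut down to the part lying in \<open>G\<close>,
  which is still conull on both sides.\<close>

lemma standard_prob_space_restrict:
  assumes M: "standard_prob_space M" and G: "G \<in> sets M" "AE x in M. x \<in> G"
  shows "standard_prob_space (restrict_space M G)"
proof -
  let ?R = "restrict_space M G"
  obtain c p where "isomorphic_mod_null M (interval_with_atoms c p)"
    using M unfolding standard_prob_space_def by blast
  then obtain X Y f g where X: "X \<in> sets M" and Y: "Y \<in> sets (interval_with_atoms c p)" and Xn: "space M - X \<in> null_sets M"
    and Yn: "space (interval_with_atoms c p) - Y \<in> null_sets (interval_with_atoms c p)"
    and f: "f \<in> measurable (restrict_space M X) (restrict_space (interval_with_atoms c p) Y)"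
    and g: "g \<in> measurable (restrict_space (interval_with_atoms c p) Y) (restrict_space M X)"
    and gf: "\<forall>x\<in>X. g (f x) = x" and fg: "\<forall>y\<in>Y. f (g y) = y"
    and d: "distr (restrict_space M X) (restrict_space (interval_with_atoms c p) Y) f = restrict_space (interval_with_atoms c p) Y"
    unfolding isomorphic_mod_null_def by blast
  define N where "N = interval_with_atoms c p"
  note [folded N_def] = Y Yn f g d
  note Y = \<open>Y \<in> sets N\<close> and Yn = \<open>space N - Y \<in> null_sets N\<close> and f = \<open>f \<in> measurable (restrict_space M X) (restrict_space N Y)\<close>
    and g = \<open>g \<in> measurable (restrict_space N Y) (restrict_space M X)\<close>
    and d = \<open>distr (restrict_space M X) (restrict_space N Y) f = restrict_space N Y\<close>
  have AE_X: "AE x in M. x \<in> X" using AE_not_in[OF Xn] AE_space by eventually_elim simp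
  have AE_Y: "AE x in N. x \<in> Y" using AE_not_in[OF Yn] AE_space by eventually_elim simp
  note sX = X_space[OF X AE_X] and sY = X_space[OF Y AE_Y] and stX = sets_MX[OF X AE_X] and stY = sets_MX[OF Y AE_Y]
  have fY: "f x \<in> Y" if "x \<in> X" for x using measurable_space[OF f] that sX sY by simp
  have gX: "g y \<in> X" if "y \<in> Y" for y using measurable_space[OF g] that sX sY by simp
  define X' where "X' = X \<inter> G"
  \<comment> \<open>The image of \<open>X'\<close> under \<open>f\<close>, written as a preimage
    under the inverse \<open>g\<close> so that its measurability is immediate.\<close>
  define Y' where "Y' = g -` (X \<inter> G) \<inter> Y"
  have X': "X' \<in> sets M" "X' \<subseteq> X" "X' \<subseteq> G" using X G by (auto simp: X'_def)
  have XG: "X \<inter> G \<in> sets (restrict_space M X)" using stX X G by simp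
  have Y': "Y' \<in> sets N" "Y' \<subseteq> Y" using measurable_sets[OF g XG] sY stY by (auto simp: Y'_def)
  have fpre: "f -` Y' \<inter> X = X'" using fY gf by (auto simp: Y'_def X'_def)
  have push: "emeasure N A = emeasure M (f -` A \<inter> X)" if A: "A \<in> sets N" "A \<subseteq> Y" for A
  proof -
    have A': "A \<in> sets (restrict_space N Y)" using A stY by simp
    have s: "f -` A \<inter> X \<in> sets M" using measurable_sets[OF f A'] sX stX by simp
    have "emeasure N A = emeasure (restrict_space N Y) A" using emeasure_MX[OF Y AE_Y A] by simp
    also have "\<dots> = emeasure (restrict_space M X) (f -` A \<inter> X)"
      using emeasure_distr[OF f A'] d sX by simp
    also have "\<dots> = emeasure M (f -` A \<inter> X)" by (rule emeasure_MX[OF X AE_X s]) simp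
    finally show ?thesis .
  qed
  have AE_Y': "AE y in N. y \<in> Y'"
  proof -
    have "emeasure N (Y - Y') = emeasure M (f -` (Y - Y') \<inter> X)" using Y Y' by (intro push) auto
    also have "f -` (Y - Y') \<inter> X = X - X'" using fpre fY by auto
    also have "emeasure M (X - X') = 0"
    proof -
      have "AE x in M. x \<notin> X - X'" using G(2) by eventually_elim (simp add: X'_def)
      then show ?thesis using AE_iff_null_sets[of "X - X'" M] X X'(1) by auto
    qed
    finally have "Y - Y' \<in> null_sets N" using Y Y' by (intro null_setsI) auto
    from AE_not_in[OF this] AE_Y show ?thesis by eventually_elim simp
  qed
  have spR: "space ?R = G" using X_space[OF G(1,2)] by simp
  have RX: "restrict_space ?R X' = restrict_space M X'" "restrict_space (restrict_space M X) X' = restrict_space M X'"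
    "restrict_space (restrict_space N Y) Y' = restrict_space N Y'"
    using X X' G Y Y' by (simp_all add: restrict_restrict_space sets.Int_space_eq2 Int_absorb1 Int_absorb2)
  have mf: "f \<in> measurable (restrict_space ?R X') (restrict_space N Y')"
    unfolding RX(1) RX(2,3)[symmetric] using fpre by (intro measurable_restrict_space3[OF f]) auto
  have mg: "g \<in> measurable (restrict_space N Y') (restrict_space ?R X')"
    unfolding RX(1) RX(2,3)[symmetric] by (intro measurable_restrict_space3[OF g]) (auto simp: X'_def Y'_def)
  have AE_X': "AE x in M. x \<in> X'" using AE_X G(2) by eventually_elim (simp add: X'_def)
  have "isomorphic_mod_null ?R N"
    unfolding isomorphic_mod_null_def
  proof (intro bexI exI conjI ballI)
    show "X' \<in> sets ?R" using X' sets_MX[OF G(1,2)] by simp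
    then show "space ?R - X' \<in> null_sets ?R"
    proof -
      have "AE x in M. x \<notin> G - X'" using AE_X' by eventually_elim simp
      then have "G - X' \<in> null_sets M" using AE_iff_null_sets[of "G - X'" M] G(1) X'(1) by auto
      then show ?thesis unfolding null_sets_MX[OF G] spR by auto
    qed
    show "space N - Y' \<in> null_sets N"
    proof -
      have "AE x in N. x \<notin> space N - Y'" using AE_Y' by eventually_elim simp
      then show ?thesis using AE_iff_null_sets[of "space N - Y'" N] Y'(1) by auto
    qed
    show "distr (restrict_space ?R X') (restrict_space N Y') f = restrict_space N Y'"
    proof (rule measure_eqI)
      fix A assume "A \<in> sets (distr (restrict_space ?R X') (restrict_space N Y') f)"
      then have A: "A \<in> sets (restrict_space N Y')" by simp
      then have A': "A \<in> sets N" "A \<subseteq> Y'" using sets_MX[OF Y'(1) AE_Y'] by auto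
      have sp: "space (restrict_space ?R X') = X'" unfolding RX(1) using X_space[OF X'(1) AE_X'] by simp
      have pre: "emeasure (distr (restrict_space ?R X') (restrict_space N Y') f) A = emeasure (restrict_space M X') (f -` A \<inter> X')"
        using emeasure_distr[OF mf A] sp RX(1) by simp
      have fX: "f -` A \<inter> X' = f -` A \<inter> X" using fpre A'(2) X'(2) by auto
      have "f -` A \<inter> X' \<in> sets (restrict_space ?R X')" using measurable_sets[OF mf A] sp by simp
      then have fs: "f -` A \<inter> X \<subseteq> X'" "f -` A \<inter> X \<in> sets M"
        unfolding RX(1) sets_MX[OF X'(1) AE_X'] fX by auto
      have "emeasure (distr (restrict_space ?R X') (restrict_space N Y') f) A = emeasure (restrict_space M X') (f -` A \<inter> X)"
        using pre fX by simp
      also have "emeasure (restrict_space M X') (f -` A \<inter> X) = emeasure M (f -` A \<inter> X)"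
      proof (rule emeasure_MX[OF X'(1) AE_X'])
        show "f -` A \<inter> X \<in> sets M" "f -` A \<inter> X \<subseteq> X'"
          using fs(2) fpre A'(2) by auto
      qed
      also have "\<dots> = emeasure N A" using A' Y'(2) by (intro push[symmetric]) auto
      also have "\<dots> = emeasure (restrict_space N Y') A" using emeasure_MX[OF Y'(1) AE_Y' A'] by simp
      finally show "emeasure (distr (restrict_space ?R X') (restrict_space N Y') f) A = emeasure (restrict_space N Y') A" .
    qed simp
  qed (use Y' mf mg gf fg X' in auto)
  moreover have "prob_space ?R" "complete_measure ?R"
    using M prob_space_MX[OF G] complete_measure_MX[OF G] by (auto simp: standard_prob_space_def)
  ultimately show ?thesis unfolding standard_prob_space_def N_def by blast
qed

text \<open>Edges from \<open>A\<close> to \<open>B\<close> run along \<open>T\<close> or along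
  \<open>S\<close>. Those along \<open>T\<close>, read backwards, are the edges from
  \<open>B\<close> to \<open>A\<close> along \<open>S\<close>, and \<open>S\<close> preserves the
  measure; this gives the symmetry of the counting integrals.\<close>

lemma (in ergodic_graph) is_graphing_full:
  assumes \<Gamma>: "vmeasure \<Gamma> = R" "edges \<Gamma> = E" and R: "space R = G" "E \<subseteq> G \<times> G" "standard_prob_space R"
  shows "is_graphing \<Gamma>"
proof -
  have TSE: "(x, y) \<in> E \<longleftrightarrow> y = T x \<or> y = S x" if "x \<in> G" for x y using edges_G[OF that] by auto
  have ne: "T x \<noteq> S x" if "x \<in> G" for x
    using aperiodic[of x 2] that TS[of x] by (auto simp: numeral_2_eq_2)
  have card: "edges_to \<Gamma> x B = (if T x \<in> B then if S x \<in> B then 2 else 1 else if S x \<in> B then 1 else 0)"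
    if "x \<in> G" for x B
  proof -
    have "{y \<in> B. (x, y) \<in> E} = {y. y = T x \<and> T x \<in> B \<or> y = S x \<and> S x \<in> B}" using TSE[OF that] by auto
    also have "\<dots> = (if T x \<in> B then {T x} else {}) \<union> (if S x \<in> B then {S x} else {})" by auto
    finally show ?thesis unfolding edges_to_def \<Gamma> using ne[OF that] by simp
  qed
  have em: "(\<integral>\<^sup>+x\<in>A. of_nat (edges_to \<Gamma> x B) \<partial>R) =
      emeasure R (A \<inter> (T -` B \<inter> space R)) + emeasure R (A \<inter> (S -` B \<inter> space R))"
    and ms: "A \<inter> (T -` B \<inter> space R) \<in> sets R" "A \<inter> (S -` B \<inter> space R) \<in> sets R"
    if A: "A \<in> sets R" and B: "B \<in> sets R" for A B
  proof -
    show s: "A \<inter> (T -` B \<inter> space R) \<in> sets R" "A \<inter> (S -` B \<inter> space R) \<in> sets R"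
      using A measurable_sets[OF T(1) B] measurable_sets[OF S(1) B] by auto
    have "(\<integral>\<^sup>+x\<in>A. of_nat (edges_to \<Gamma> x B) \<partial>R) =
        (\<integral>\<^sup>+x. indicator (A \<inter> (T -` B \<inter> space R)) x + indicator (A \<inter> (S -` B \<inter> space R)) x \<partial>R)"
      by (intro nn_integral_cong) (auto simp: card R(1) indicator_def)
    also have "\<dots> = emeasure R (A \<inter> (T -` B \<inter> space R)) + emeasure R (A \<inter> (S -` B \<inter> space R))"
      using s by (subst nn_integral_add) auto
    finally show "(\<integral>\<^sup>+x\<in>A. of_nat (edges_to \<Gamma> x B) \<partial>R) =
      emeasure R (A \<inter> (T -` B \<inter> space R)) + emeasure R (A \<inter> (S -` B \<inter> space R))" .
  qed
  have swap: "emeasure R (A \<inter> (T -` B \<inter> space R)) = emeasure R (B \<inter> (S -` A \<inter> space R))"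
    if A: "A \<in> sets R" and B: "B \<in> sets R" for A B
  proof -
    have "emeasure R (A \<inter> (T -` B \<inter> space R)) = emeasure R (S -` (A \<inter> (T -` B \<inter> space R)) \<inter> space R)"
      using emeasure_distr[OF S(1) ms(1)[OF A B]] S(2) by simp
    also have "S -` (A \<inter> (T -` B \<inter> space R)) \<inter> space R = B \<inter> (S -` A \<inter> space R)"
      using sets.sets_into_space[OF B] by (auto simp: R(1) TS SG)
    finally show ?thesis .
  qed
  \<comment> \<open>The edge set enters the uncompleted product sigma-algebra through equations
    between values of \<open>u\<close>.\<close>
  have Em: "E \<in> sets (R \<Otimes>\<^sub>M R)"
  proof -
    have "E = {z \<in> space (R \<Otimes>\<^sub>M R). u (snd z) = u (T (fst z)) \<or> u (snd z) = u (S (fst z))}"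
    proof (intro subset_antisym subsetI)
      fix z assume "z \<in> E"
      then show "z \<in> {z \<in> space (R \<Otimes>\<^sub>M R). u (snd z) = u (T (fst z)) \<or> u (snd z) = u (S (fst z))}"
        using R(2) TSE by (cases z) (auto simp: space_pair_measure R(1))
    next
      fix z assume "z \<in> {z \<in> space (R \<Otimes>\<^sub>M R). u (snd z) = u (T (fst z)) \<or> u (snd z) = u (S (fst z))}"
      then show "z \<in> E"
        using TSE inj_onD[OF inj_u] TG SG by (cases z) (auto simp: space_pair_measure R(1))
    qed
    moreover note [measurable] = u T(1) S(1)
    have "{z \<in> space (R \<Otimes>\<^sub>M R). u (snd z) = u (T (fst z)) \<or> u (snd z) = u (S (fst z))} \<in> sets (R \<Otimes>\<^sub>M R)" by measurable
    ultimately show ?thesis by simp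
  qed
  show ?thesis
    unfolding is_graphing_def Let_def \<Gamma>
  proof (intro conjI ballI)
    show "sym E" using R(2) TSE TS ST by (intro symI) (metis SG TG mem_Sigma_iff subsetD)
    show "irrefl E"
    proof (rule irreflI)
      fix x show "(x, x) \<notin> E"
      proof
        assume e: "(x, x) \<in> E"
        then have x: "x \<in> G" using R(2) by auto
        then have "T x = x" using TSE[OF x] e TS[OF x] by metis
        then show False using aperiodic[OF x, of 1] by simp
      qed
    qed
    show "\<exists>D. \<forall>x\<in>space R. finite (E `` {x}) \<and> card (E `` {x}) \<le> D"
      using edges_G by (intro exI[of _ 2]) (auto simp: R(1) card_insert_if)
    show "(\<lambda>x. edges_to \<Gamma> x B) \<in> measurable R (count_space UNIV)" if B: "B \<in> sets R" for B
    proof -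
      note [measurable] = T(1) S(1) B
      have "(\<lambda>x. if T x \<in> B then if S x \<in> B then 2 else 1 else if S x \<in> B then 1 else (0::nat)) \<in> measurable R (count_space UNIV)"
        by measurable
      then show ?thesis by (subst measurable_cong[where g="\<lambda>x. if T x \<in> B then if S x \<in> B then 2 else 1 else if S x \<in> B then 1 else 0"])
        (simp_all add: card R(1))
    qed
    show "(\<integral>\<^sup>+x\<in>A. of_nat (edges_to \<Gamma> x B) \<partial>R) = (\<integral>\<^sup>+y\<in>B. of_nat (edges_to \<Gamma> y A) \<partial>R)"
      if "A \<in> sets R" "B \<in> sets R" for A B
      using em[OF that] em[OF that(2,1)] swap[OF that] swap[OF that(2,1)] by (simp add: add.commute)
  qed (use R Em in auto)
qed

section \<open>From ergodic systems to graphings of free orbits\<close>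

lemma ergodic_system_inverse:
  assumes "ergodic_system M T"
  obtains S and u :: "'a \<Rightarrow> real" and X where "inv_mpt M S" "AE x in M. S (T x) = x" "AE x in M. T (S x) = x"
    "u \<in> borel_measurable M" "AE x in M. x \<in> X" "inj_on u X"
proof -
  obtain S where "inv_mpt M S" "AE x in M. S (T x) = x" "AE x in M. T (S x) = x"
    using inv_mpt_inverse assms unfolding ergodic_system_def by blast
  moreover obtain u :: "'a \<Rightarrow> real" and X where "u \<in> borel_measurable M" "X \<in> sets M" "AE x in M. x \<in> X" "inj_on u X"
    using standard_prob_space_code assms unfolding ergodic_system_def by blast
  ultimately show ?thesis using that by blast
qed

text \<open>The good set itself serves as vertex set: there each vertex has exactly the neighbours
  \<open>T x\<close> and \<open>S x\<close>.\<close>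

lemma admissible_exists:
  assumes sys: "ergodic_system M T"
  shows "\<exists>X. admissible M T X"
proof -
  obtain S u X where S: "inv_mpt M S" "AE x in M. S (T x) = x" "AE x in M. T (S x) = x"
    and u: "u \<in> borel_measurable M" "AE x in M. x \<in> X" "inj_on (u :: 'a \<Rightarrow> real) X"
    by (rule ergodic_system_inverse[OF sys])
  have N: "{} \<in> null_sets M" by simp
  obtain G where G0: "G \<in> sets M" "AE x in M. x \<in> G" "G \<inter> {} = {}" "G \<subseteq> X"
    "\<forall>x\<in>G. T x \<in> G \<and> S x \<in> G \<and> S (T x) = x \<and> T (S x) = x \<and> (\<forall>n>0. (T ^^ n) x \<noteq> x)"
    by (rule good_set[OF sys S u N])
  have G5: "T x \<in> G" "S x \<in> G" "S (T x) = x" "T (S x) = x" if "x \<in> G" for x using G0(5) that by blast+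
  have G9: "(T ^^ n) x \<noteq> x" if "x \<in> G" "n > 0" for x n using G0(5) that by blast
  note G = G0(1-4) G5 G9
  have M: "prob_space M" "complete_measure M" "standard_prob_space M" "ergodic M T" "inv_mpt M T"
    using sys by (auto simp: ergodic_system_def standard_prob_space_def)
  let ?\<Gamma> = "cycle_graphing M T G"
  have E: "edges ?\<Gamma> `` {x} = {T x, S x}" if "x \<in> G" for x
    using that G(5-8) by (auto simp: cycle_graphing_def)
  obtain T1 where T1: "ergodic_graph (restrict_space M G) (edges ?\<Gamma>) T1 (extend_id G S) G u"
    by (rule ergodic_graph_restrict[OF M(1,2,4,5) S(1,2) G(1) G(1,2) order_refl G(5-9) u(1) inj_on_subset[OF u(3) G(4)] E])
  have "is_graphing ?\<Gamma>"
  proof (rule ergodic_graph.is_graphing_full[OF T1])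
    show "space (restrict_space M G) = G" using X_space[OF G(1,2)] by simp
    show "standard_prob_space (restrict_space M G)" by (rule standard_prob_space_restrict[OF M(3) G(1,2)])
  qed (auto simp: cycle_graphing_def)
  moreover have "space M - G \<in> null_sets M"
  proof -
    have "AE x in M. x \<notin> space M - G" using G(2) by eventually_elim simp
    then show ?thesis using AE_iff_null_sets[of "space M - G" M] G(1) by auto
  qed
  ultimately show ?thesis using G(1) unfolding admissible_def by blast
qed

text \<open>By the symmetry of the edge measure, almost no vertex has an edge into a given null set.\<close>

lemma admissible_ergodic_graph:
  assumes sys: "ergodic_system M T" and adm: "admissible M T X"
  obtains T1 S1 G u where "ergodic_graph (vmeasure (cycle_graphing M T X)) (edges (cycle_graphing M T X)) T1 S1 G u"
    "aut_pm M T \<cong> aut_pm (vmeasure (cycle_graphing M T X)) T1"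
proof -
  let ?\<Gamma> = "cycle_graphing M T X" and ?R = "restrict_space M X"
  have X: "X \<in> sets M" and Xn: "space M - X \<in> null_sets M" and gr: "is_graphing ?\<Gamma>"
    using adm by (auto simp: admissible_def)
  have AE_X: "AE x in M. x \<in> X" using AE_not_in[OF Xn] AE_space by eventually_elim simp
  note R = AE_MX[OF X AE_X] sets_MX[OF X AE_X] X_space[OF X AE_X]
  have v: "vmeasure ?\<Gamma> = ?R" by (simp add: cycle_graphing_def)
  obtain S u Y where S: "inv_mpt M S" "AE x in M. S (T x) = x" "AE x in M. T (S x) = x"
    and u: "u \<in> borel_measurable M" "AE x in M. x \<in> Y" "inj_on (u :: 'a \<Rightarrow> real) Y"
    by (rule ergodic_system_inverse[OF sys])
  \<comment> \<open>A vertex \<open>y\<close> with \<open>T y = x\<close> different from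
    \<open>S x\<close> can only be a point at which \<open>S\<close> fails to undo \<open>T\<close>;
    such points are collected in \<open>N1\<close>.\<close>
  obtain N1 where N1: "{x \<in> space M. \<not> S (T x) = x} \<subseteq> N1" "N1 \<in> null_sets M"
    using S(2) unfolding eventually_ae_filter by blast
  let ?B = "N1 \<inter> X"
  have Bn: "?B \<in> null_sets ?R" unfolding null_sets_MX[OF X AE_X] using null_set_Int2[OF N1(2) X] by simp
  then have B: "?B \<in> sets ?R" by auto
  have "(\<integral>\<^sup>+x\<in>X. of_nat (edges_to ?\<Gamma> x ?B) \<partial>?R) = (\<integral>\<^sup>+y\<in>?B. of_nat (edges_to ?\<Gamma> y X) \<partial>?R)"
    using gr B X R unfolding is_graphing_def Let_def v by simp
  also have "\<dots> = (\<integral>\<^sup>+y. 0 \<partial>?R)"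
    using AE_not_in[OF Bn] by (intro nn_integral_cong_AE) (auto elim!: eventually_mono)
  finally have z: "(\<integral>\<^sup>+x\<in>X. of_nat (edges_to ?\<Gamma> x ?B) \<partial>?R) = 0" by simp
  have "(\<lambda>x. edges_to ?\<Gamma> x ?B) \<in> measurable ?R (count_space UNIV)"
    using gr B unfolding is_graphing_def Let_def v by blast
  then have "(\<lambda>x. of_nat (edges_to ?\<Gamma> x ?B) :: ennreal) \<in> borel_measurable ?R"
    by (rule measurable_compose) simp
  then have m: "(\<lambda>x. of_nat (edges_to ?\<Gamma> x ?B) * indicator X x :: ennreal) \<in> borel_measurable ?R"
    using X R(2)[of X] by (intro borel_measurable_times_ennreal borel_measurable_indicator) simp_all
  from z have "AE x in ?R. of_nat (edges_to ?\<Gamma> x ?B) * indicator X x = (0 :: ennreal)"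
    unfolding nn_integral_0_iff_AE[OF m] .
  then have "AE x in M. x \<in> X \<and> edges_to ?\<Gamma> x ?B = 0"
    using AE_X unfolding R(1) by eventually_elim simp
  then obtain N2 where N2: "{x \<in> space M. \<not> (x \<in> X \<and> edges_to ?\<Gamma> x ?B = 0)} \<subseteq> N2" "N2 \<in> null_sets M"
    unfolding eventually_ae_filter by blast
  \<comment> \<open>Vertices with an edge into \<open>N1\<close> form a null set, which the good set
    avoids.\<close>
  obtain G where G0: "G \<in> sets M" "AE x in M. x \<in> G" "G \<inter> N2 = {}" "G \<subseteq> Y"
    "\<forall>x\<in>G. T x \<in> G \<and> S x \<in> G \<and> S (T x) = x \<and> T (S x) = x \<and> (\<forall>n>0. (T ^^ n) x \<noteq> x)"
    by (rule good_set[OF sys S u N2(2)])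
  have G5: "T x \<in> G" "S x \<in> G" "S (T x) = x" "T (S x) = x" if "x \<in> G" for x using G0(5) that by blast+
  have G9: "(T ^^ n) x \<noteq> x" if "x \<in> G" "n > 0" for x n using G0(5) that by blast
  note G = G0(1-4) G5 G9
  have GX: "x \<in> X" "edges_to ?\<Gamma> x ?B = 0" if "x \<in> G" for x
    using that G(3) N2(1) sets.sets_into_space[OF G(1)] by blast+
  have E: "edges ?\<Gamma> `` {x} = {T x, S x}" if x: "x \<in> G" for x
  proof (intro subset_antisym subsetI)
    fix y assume "y \<in> {T x, S x}"
    then show "y \<in> edges ?\<Gamma> `` {x}" using x GX(1) G(5,6,8) by (auto simp: cycle_graphing_def)
  next
    fix y assume y: "y \<in> edges ?\<Gamma> `` {x}"
    then have yX: "y \<in> X" and c: "y = T x \<or> x = T y" by (auto simp: cycle_graphing_def)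
    \<comment> \<open>A vanishing \<open>card\<close> means an empty set for finite sets only; the
      degree bound supplies finiteness.\<close>
    have "finite (edges ?\<Gamma> `` {x})" using gr GX(1)[OF x] R(4) unfolding is_graphing_def Let_def v by blast
    then have "finite {y \<in> ?B. (x, y) \<in> edges ?\<Gamma>}" by (rule finite_subset[rotated]) auto
    then have "{y \<in> ?B. (x, y) \<in> edges ?\<Gamma>} = {}" using GX(2)[OF x] unfolding edges_to_def by simp
    then have "y \<notin> N1" using y yX by auto
    then have "S (T y) = y" using N1(1) yX R(3) by auto
    then show "y \<in> {T x, S x}" using c by auto
  qed
  have M: "prob_space M" "complete_measure M" "ergodic M T" "inv_mpt M T"
    using sys by (auto simp: ergodic_system_def standard_prob_space_def)
  have GX': "G \<subseteq> X" using GX(1) by blast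
  obtain T1 where "ergodic_graph ?R (edges ?\<Gamma>) T1 (extend_id G S) G u" "aut_pm M T \<cong> aut_pm ?R T1"
    by (rule ergodic_graph_restrict[OF M S(1,2) X G(1,2) GX' G(5-9) u(1) inj_on_subset[OF u(3) G(4)] E])
  then show ?thesis using that v by metis
qed

theorem cycle_graphings:
  assumes "ergodic_system M T" "weights k lam" "admissible M T X"
  shows "aut_graphing (convex_combination k lam (\<lambda>_. cycle_graphing M T X)) \<cong> wreath (aut_pm M T) k lam"
proof -
  let ?\<Gamma> = "cycle_graphing M T X"
  obtain T1 S1 G u where eg: "ergodic_graph (vmeasure ?\<Gamma>) (edges ?\<Gamma>) T1 S1 G u"
    and i: "aut_pm M T \<cong> aut_pm (vmeasure ?\<Gamma>) T1"
    by (rule admissible_ergodic_graph[OF assms(1,3)])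
  have "wreath (aut_pm M T) k lam \<cong> wreath (aut_pm (vmeasure ?\<Gamma>) T1) k lam" by (rule wreath_cong[OF i])
  also have "\<dots> \<cong> aut_graphing (convex_combination k lam (\<lambda>_. ?\<Gamma>))"
    by (rule ergodic_graph.wreath_iso_aut_graphing[OF eg assms(2) refl refl])
  finally have "wreath (aut_pm M T) k lam \<cong> aut_graphing (convex_combination k lam (\<lambda>_. ?\<Gamma>))" .
  moreover have "mult_closed (wreath (aut_pm M T) k lam)"
    using assms(1) by (intro mult_closed_wreath mult_closed_aut_pm) (simp add: ergodic_system_def)
  ultimately show ?thesis by (rule iso_sym_closed[rotated])
qed

theorem cycle_graphings_equivalent:
  assumes "ergodic_system M T" "weights k lam" "admissible M T X"
    and "ergodic_system M' T'" "weights k' lam'" "admissible M' T' X'"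
  shows "local_global_equivalent (convex_combination k lam (\<lambda>_. cycle_graphing M T X))
     (convex_combination k' lam' (\<lambda>_. cycle_graphing M' T' X'))"
proof -
  obtain T1 S1 G u where A: "ergodic_graph (vmeasure (cycle_graphing M T X)) (edges (cycle_graphing M T X)) T1 S1 G u"
    by (rule admissible_ergodic_graph[OF assms(1,3)])
  obtain T2 S2 G' u' where B: "ergodic_graph (vmeasure (cycle_graphing M' T' X')) (edges (cycle_graphing M' T' X')) T2 S2 G' u'"
    by (rule admissible_ergodic_graph[OF assms(4,6)])
  show ?thesis by (rule local_global_equivalent_ergodic[OF A B assms(2,5)])
qed

section \<open>Compact monothetic groups\<close>

text \<open>Finite nets of radius \<open>1 / (n + 1)\<close> for all \<open>n\<close> give countably
  many balls. A ball that contains \<open>x\<close> and has radius below \<open>r / 2\<close> stays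
  within distance \<open>r\<close> of \<open>x\<close>.\<close>

lemma second_countable_compact_metrizable:
  assumes "compact_space X" "metrizable_space X"
  shows "second_countable X"
proof -
  obtain M d where "Metric_space M d" and X: "X = Metric_space.mtopology M d"
    using assms(2) unfolding metrizable_space_def by blast
  then interpret Metric_space M d by simp
  have "mtotally_bounded M"
    using assms(1) unfolding X compact_space_def by (intro compactin_imp_mtotally_bounded) simp
  then have "\<forall>n. \<exists>K. finite K \<and> K \<subseteq> M \<and> M \<subseteq> (\<Union>x\<in>K. mball x (inverse (real (Suc n))))"
    unfolding mtotally_bounded_def by simp
  then obtain K where K: "\<And>n. finite (K n)" "\<And>n. K n \<subseteq> M" "\<And>n. M \<subseteq> (\<Union>x\<in>K n. mball x (inverse (real (Suc n))))"
    by metis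
  show ?thesis
    unfolding second_countable_def
  proof (intro exI[of _ "\<Union>n. (\<lambda>x. mball x (inverse (real (Suc n)))) ` K n"] conjI allI impI)
    show "countable (\<Union>n. (\<lambda>x. mball x (inverse (real (Suc n)))) ` K n)"
      using K(1) by (intro countable_UN countable_image) (auto intro: countable_finite)
    show "\<forall>V\<in>(\<Union>n. (\<lambda>x. mball x (inverse (real (Suc n)))) ` K n). openin X V"
      unfolding X by auto
    fix U x assume Ux: "openin X U \<and> x \<in> U"
    then have xM: "x \<in> M" using openin_subset[of X U] unfolding X by auto
    obtain r where r: "r > 0" "mball x r \<subseteq> U" using Ux unfolding X openin_mtopology by blast
    obtain n where n: "inverse (real (Suc n)) < r / 2" using reals_Archimedean[of "r / 2"] r by auto
    obtain c where c: "c \<in> K n" "x \<in> mball c (inverse (real (Suc n)))" using K(3) xM by blast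
    have "mball c (inverse (real (Suc n))) \<subseteq> mball x r"
    proof
      fix y assume y: "y \<in> mball c (inverse (real (Suc n)))"
      have "d x y \<le> d x c + d c y" using c y xM by (intro triangle) auto
      also have "\<dots> < r" using c y n by (simp add: commute)
      finally show "y \<in> mball x r" using y xM by auto
    qed
    then show "\<exists>V\<in>(\<Union>n. (\<lambda>x. mball x (inverse (real (Suc n)))) ` K n). x \<in> V \<and> V \<subseteq> U"
      using c r by blast
  qed
qed

text \<open>In base three with digits \<open>0\<close> and \<open>1\<close> the tail contributes at
  most \<open>1 / 2\<close>, less than a change of the leading digit, so the digits can be
  recovered; in base two different digit sequences may have equal sums.\<close>

lemma ternary_sum:
  fixes P :: "nat \<Rightarrow> bool"
  defines "s \<equiv> \<lambda>P. \<Sum>n. of_bool (P n) * (1 / 3) ^ n :: real"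
  shows "summable (\<lambda>n. of_bool (P n) * (1 / 3) ^ n :: real)" "s P = of_bool (P 0) + s (\<lambda>n. P (Suc n)) / 3"
    "0 \<le> s P" "s P \<le> 3 / 2"
proof -
  have g: "summable (\<lambda>n. (1 / 3) ^ n :: real)" by (intro summable_geometric) simp
  have sm: "summable (\<lambda>n. of_bool (P n) * (1 / 3) ^ n :: real)" for P
    by (rule summable_comparison_test'[OF g, of 0]) simp
  then show "summable (\<lambda>n. of_bool (P n) * (1 / 3) ^ n :: real)" .
  have "s P = of_bool (P 0) + (\<Sum>n. of_bool (P (Suc n)) * (1 / 3) ^ Suc n)"
    unfolding s_def using suminf_split_head[OF sm[of P]] by simp
  also have "(\<Sum>n. of_bool (P (Suc n)) * (1 / 3) ^ Suc n) = s (\<lambda>n. P (Suc n)) / 3"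
    unfolding s_def using suminf_divide[OF sm[of "\<lambda>n. P (Suc n)"], of 3] by simp
  finally show "s P = of_bool (P 0) + s (\<lambda>n. P (Suc n)) / 3" .
  show "0 \<le> s P" unfolding s_def by (intro suminf_nonneg sm) simp
  have "s P \<le> (\<Sum>n. (1 / 3) ^ n)" unfolding s_def by (intro suminf_le sm g) simp
  also have "\<dots> = 3 / 2" by (subst suminf_geometric) auto
  finally show "s P \<le> 3 / 2" .
qed

lemma ternary_sum_inj:
  assumes "(\<Sum>n. of_bool (P n) * (1 / 3) ^ n :: real) = (\<Sum>n. of_bool (Q n) * (1 / 3) ^ n)"
  shows "P n = Q n"
  using assms
proof (induction n arbitrary: P Q)
  case 0
  show ?case
    using 0 ternary_sum(2-4)[of P] ternary_sum(2-4)[of Q] ternary_sum(3,4)[of "\<lambda>n. P (Suc n)"] ternary_sum(3,4)[of "\<lambda>n. Q (Suc n)"]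
    by (cases "P 0"; cases "Q 0") auto
next
  case (Suc n)
  have "P 0 = Q 0"
    using Suc.prems ternary_sum(2-4)[of P] ternary_sum(2-4)[of Q] ternary_sum(3,4)[of "\<lambda>n. P (Suc n)"] ternary_sum(3,4)[of "\<lambda>n. Q (Suc n)"]
    by (cases "P 0"; cases "Q 0") auto
  then show ?case
    using Suc.prems ternary_sum(2)[of P] ternary_sum(2)[of Q] by (intro Suc.IH) simp
qed

section \<open>Topology and Borel structure of monothetic groups\<close>

locale monothetic = group G for G :: "'g monoid" (structure) +
  fixes \<tau> :: "'g topology" and \<mu> :: "'g measure" and a :: 'g
  assumes data: "monothetic_data G \<tau> \<mu> a"
begin

lemma top [simp]: "topspace \<tau> = carrier G"
  and compact: "compact_space \<tau>" and metrizable: "metrizable_space \<tau>"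
  and cont_mult: "continuous_map (prod_topology \<tau> \<tau>) \<tau> (\<lambda>(x, y). x \<otimes> y)"
  and cont_inv: "continuous_map \<tau> \<tau> (\<lambda>x. inv x)"
  and infinite_G: "infinite (carrier G)"
  and prob: "prob_space \<mu>" and space_mu: "space \<mu> = carrier G"
  and sets_mu: "sets \<mu> = sigma_sets (carrier G) {U. openin \<tau> U}"
  and mu_invariant: "g \<in> carrier G \<Longrightarrow> distr \<mu> \<mu> (\<lambda>x. g \<otimes> x) = \<mu>"
  and a [simp]: "a \<in> carrier G" and dense: "\<tau> closure_of (range (\<lambda>n::int. a [^] n)) = carrier G"
  using data unfolding monothetic_data_def compact_metrizable_group_def haar_prob_def topological_generator_def
  by auto

lemma Hausdorff: "Hausdorff_space \<tau>"
  using metrizable by (rule metrizable_imp_Hausdorff_space)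

lemma cont_mult': "continuous_map X \<tau> f \<Longrightarrow> continuous_map X \<tau> g \<Longrightarrow> continuous_map X \<tau> (\<lambda>x. f x \<otimes> g x)"
  using continuous_map_compose[OF continuous_map_pairedI cont_mult, of X f g] by (simp add: o_def)

lemma cont_left: "g \<in> carrier G \<Longrightarrow> continuous_map \<tau> \<tau> (\<lambda>x. g \<otimes> x)"
  by (rule cont_mult') auto

lemma cont_right: "g \<in> carrier G \<Longrightarrow> continuous_map \<tau> \<tau> (\<lambda>x. x \<otimes> g)"
  by (rule cont_mult') auto

lemma dense_induct:
  assumes "closedin \<tau> {x \<in> carrier G. P x}" "\<And>n::int. P (a [^] n)" "g \<in> carrier G"
  shows "P g"
  using forall_in_closure_of[of g \<tau> "range (\<lambda>n::int. a [^] n)" P] assms dense by auto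

text \<open>Density of the powers is used twice: elements commute with powers of \<open>a\<close>,
  and then with arbitrary elements.\<close>

lemma commute: "x \<in> carrier G \<Longrightarrow> y \<in> carrier G \<Longrightarrow> x \<otimes> y = y \<otimes> x"
proof -
  have closed: "closedin \<tau> {x \<in> carrier G. x \<otimes> y = y \<otimes> x}" if "y \<in> carrier G" for y
    using closedin_continuous_maps_eq[OF Hausdorff cont_right[OF that] cont_left[OF that]] by simp
  have pow: "a [^] n \<otimes> a [^] m = a [^] m \<otimes> a [^] n" for n m :: int
    by (simp add: int_pow_mult[symmetric] add.commute)
  have 1: "x \<otimes> a [^] m = a [^] m \<otimes> x" if "x \<in> carrier G" for m :: int and x
    by (rule dense_induct[OF closed _ that]) (auto simp: pow)
  assume x: "x \<in> carrier G" and y: "y \<in> carrier G"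
  show "x \<otimes> y = y \<otimes> x"
    by (rule dense_induct[OF closed[OF y] _ x]) (simp add: 1[OF y])
qed

lemma comm_group_G: "comm_group G"
  using commute by (intro group_comm_groupI) auto

text \<open>A relation \<open>a [^] n = \<one>\<close> would make the set of powers finite, hence
  closed, hence all of the infinite group.\<close>

lemma powers_distinct:
  assumes "n > 0" shows "a [^] (n::nat) \<noteq> \<one>"
proof
  assume n: "a [^] n = \<one>"
  have "a [^] (m::int) \<in> (\<lambda>i. a [^] (i::int)) ` {0..<int n}" for m
  proof -
    have "a [^] m = a [^] (int n * (m div int n)) \<otimes> a [^] (m mod int n)"
      using int_pow_mult[OF a, of "int n * (m div int n)" "m mod int n"] by simp
    also have "\<dots> = (a [^] int n) [^] (m div int n) \<otimes> a [^] (m mod int n)"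
      by (simp add: int_pow_pow)
    also have "\<dots> = a [^] (m mod int n)" using n by (simp add: int_pow_int int_pow_one)
    finally have "a [^] m = a [^] (m mod int n)" .
    moreover have "m mod int n \<in> {0..<int n}" using assms by simp
    ultimately show ?thesis by (rule image_eqI)
  qed
  then have sub: "range (\<lambda>m::int. a [^] m) \<subseteq> (\<lambda>i. a [^] (i::int)) ` {0..<int n}" by (rule image_subsetI)
  have fin: "finite (range (\<lambda>m::int. a [^] m))" by (rule finite_subset[OF sub]) simp
  have "closedin \<tau> (range (\<lambda>m::int. a [^] m))"
    using fin Hausdorff_imp_t1_space[OF Hausdorff] unfolding t1_space_closedin_finite
    by (simp add: image_subset_iff)
  then have "carrier G = range (\<lambda>m::int. a [^] m)" using dense closure_of_eq by metis
  then show False using fin infinite_G by simp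
qed

lemma openin_sets: "openin \<tau> U \<Longrightarrow> U \<in> sets \<mu>"
  unfolding sets_mu by blast

lemma closedin_sets: "closedin \<tau> F \<Longrightarrow> F \<in> sets \<mu>"
proof -
  assume F: "closedin \<tau> F"
  then have "carrier G - F \<in> sets \<mu>" by (intro openin_sets) (simp add: closedin_def)
  then have "space \<mu> - (carrier G - F) \<in> sets \<mu>" by (intro sets.compl_sets)
  also have "space \<mu> - (carrier G - F) = F" using closedin_subset[OF F] space_mu by auto
  finally show ?thesis .
qed

lemma measurable_mu_I:
  assumes "\<And>x. x \<in> space N \<Longrightarrow> f x \<in> carrier G" "\<And>U. openin \<tau> U \<Longrightarrow> f -` U \<inter> space N \<in> sets N"
  shows "f \<in> measurable N \<mu>"
  by (rule measurable_sigma_sets[OF sets_mu]) (use assms openin_subset in \<open>fastforce+\<close>)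

lemma continuous_measurable: "continuous_map \<tau> \<tau> f \<Longrightarrow> f \<in> measurable \<mu> \<mu>"
proof (rule measurable_mu_I)
  assume f: "continuous_map \<tau> \<tau> f"
  show "f x \<in> carrier G" if "x \<in> space \<mu>" for x
    using that continuous_map_image_subset_topspace[OF f] space_mu by auto
  fix U assume "openin \<tau> U"
  then have "openin \<tau> {x \<in> topspace \<tau>. f x \<in> U}" by (rule openin_continuous_map_preimage[OF f])
  also have "{x \<in> topspace \<tau>. f x \<in> U} = f -` U \<inter> space \<mu>" using space_mu by auto
  finally show "f -` U \<inter> space \<mu> \<in> sets \<mu>" by (rule openin_sets)
qed

lemma left_measurable: "g \<in> carrier G \<Longrightarrow> (\<lambda>x. g \<otimes> x) \<in> measurable \<mu> \<mu>"
  by (intro continuous_measurable cont_left)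

lemma inv_measurable: "(\<lambda>x. inv x) \<in> measurable \<mu> \<mu>"
  by (intro continuous_measurable cont_inv)

lemma second_countable: "second_countable \<tau>"
  using compact metrizable by (rule second_countable_compact_metrizable)

text \<open>By continuity the preimage of an open set is open in the product topology; a countable
  base writes it as a countable union of open rectangles, which places it in the product
  sigma-algebra.\<close>

lemma mult_measurable: "(\<lambda>(x, y). x \<otimes> y) \<in> measurable (\<mu> \<Otimes>\<^sub>M \<mu>) \<mu>"
proof (rule measurable_mu_I)
  show "(case z of (x, y) \<Rightarrow> x \<otimes> y) \<in> carrier G" if "z \<in> space (\<mu> \<Otimes>\<^sub>M \<mu>)" for z
    using that by (auto simp: space_pair_measure space_mu)
  fix U assume U: "openin \<tau> U"
  obtain \<B> where B0: "countable \<B>" "\<forall>V\<in>\<B>. openin \<tau> V"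
      "\<forall>U x. openin \<tau> U \<and> x \<in> U \<longrightarrow> (\<exists>V\<in>\<B>. x \<in> V \<and> V \<subseteq> U)"
    using second_countable unfolding second_countable_def by (elim exE conjE)
  have B: "countable \<B>" "\<And>V. V \<in> \<B> \<Longrightarrow> openin \<tau> V"
      "\<And>U x. openin \<tau> U \<Longrightarrow> x \<in> U \<Longrightarrow> \<exists>V\<in>\<B>. x \<in> V \<and> V \<subseteq> U"
    using B0 by simp_all
  let ?W = "(\<lambda>(x, y). x \<otimes> y) -` U \<inter> space (\<mu> \<Otimes>\<^sub>M \<mu>)"
  have "?W = {z \<in> topspace (prod_topology \<tau> \<tau>). (\<lambda>(x, y). x \<otimes> y) z \<in> U}"
    by (auto simp: space_pair_measure space_mu)
  then have W: "openin (prod_topology \<tau> \<tau>) ?W" using openin_continuous_map_preimage[OF cont_mult U] by simp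
  define \<C> where "\<C> = {z \<in> \<B> \<times> \<B>. fst z \<times> snd z \<subseteq> ?W}"
  have "?W = (\<Union>z\<in>\<C>. fst z \<times> snd z)"
  proof (intro subset_antisym subsetI)
    fix z assume z: "z \<in> ?W"
    obtain x y where xy: "z = (x, y)" by (cases z)
    obtain A1 A2 where A: "openin \<tau> A1" "openin \<tau> A2" "x \<in> A1" "y \<in> A2" "A1 \<times> A2 \<subseteq> ?W"
      using W[unfolded openin_prod_topology_alt, rule_format, OF z[unfolded xy]] by (elim exE conjE)
    obtain V1 where V1: "V1 \<in> \<B>" "x \<in> V1" "V1 \<subseteq> A1" using B(3)[OF A(1,3)] by (elim bexE conjE)
    obtain V2 where V2: "V2 \<in> \<B>" "y \<in> V2" "V2 \<subseteq> A2" using B(3)[OF A(2,4)] by (elim bexE conjE)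
    have "V1 \<times> V2 \<subseteq> ?W" using Sigma_mono[OF V1(3) V2(3)] A(5) by (rule subset_trans)
    then have "(V1, V2) \<in> \<C>" using V1(1) V2(1) by (simp only: \<C>_def mem_Collect_eq mem_Times_iff fst_conv snd_conv simp_thms)
    moreover have "z \<in> fst (V1, V2) \<times> snd (V1, V2)" using V1 V2 by (simp add: xy)
    ultimately show "z \<in> (\<Union>z\<in>\<C>. fst z \<times> snd z)" by blast
  next
    fix z assume "z \<in> (\<Union>z\<in>\<C>. fst z \<times> snd z)"
    then obtain c where "c \<in> \<C>" "z \<in> fst c \<times> snd c" by (rule UN_E)
    then show "z \<in> ?W" unfolding \<C>_def by (metis (mono_tags, lifting) mem_Collect_eq subsetD)
  qed
  also have "\<dots> \<in> sets (\<mu> \<Otimes>\<^sub>M \<mu>)"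
  proof (rule sets.countable_UN'')
    show "countable \<C>" unfolding \<C>_def using B(1) by (intro countable_Collect countable_SIGMA)
    show "fst z \<times> snd z \<in> sets (\<mu> \<Otimes>\<^sub>M \<mu>)" if "z \<in> \<C>" for z
      using that B(2) openin_sets unfolding \<C>_def by auto
  qed
  finally show "?W \<in> sets (\<mu> \<Otimes>\<^sub>M \<mu>)" .
qed

text \<open>A point is determined by the members of a countable base that contain it; these yes-no
  answers become the ternary digits of \<open>u\<close>.\<close>

lemma code:
  obtains u :: "'g \<Rightarrow> real" where "u \<in> borel_measurable \<mu>" "inj_on u (carrier G)"
proof -
  obtain \<B> where B0: "countable \<B>" "\<forall>V\<in>\<B>. openin \<tau> V"
      "\<forall>U x. openin \<tau> U \<and> x \<in> U \<longrightarrow> (\<exists>V\<in>\<B>. x \<in> V \<and> V \<subseteq> U)"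
    using second_countable unfolding second_countable_def by (elim exE conjE)
  have B: "countable \<B>" "\<And>V. V \<in> \<B> \<Longrightarrow> openin \<tau> V"
      "\<And>U x. openin \<tau> U \<Longrightarrow> x \<in> U \<Longrightarrow> \<exists>V\<in>\<B>. x \<in> V \<and> V \<subseteq> U"
    using B0 by simp_all
  have "\<B> \<noteq> {}" using B(3)[of "carrier G" a] openin_topspace[of \<tau>] by auto
  define b where "b = from_nat_into \<B>"
  have b: "range b = \<B>" unfolding b_def using B(1) \<open>\<B> \<noteq> {}\<close> by (intro range_from_nat_into)
  define u where "u x = (\<Sum>n. of_bool (x \<in> b n) * (1 / 3) ^ n :: real)" for x
  have bs: "b n \<in> sets \<mu>" for n using b B(2) openin_sets by blast
  have "u \<in> borel_measurable \<mu>"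
  proof -
    have "(\<lambda>x. \<Sum>n. indicator (b n) x * (1 / 3) ^ n :: real) \<in> borel_measurable \<mu>"
      using bs by (intro borel_measurable_suminf borel_measurable_times borel_measurable_const borel_measurable_indicator) auto
    then show ?thesis unfolding u_def[abs_def] by (simp add: indicator_def)
  qed
  moreover have "inj_on u (carrier G)"
  proof (rule inj_onI, rule ccontr)
    fix x y assume xy: "x \<in> carrier G" "y \<in> carrier G" "u x = u y" "x \<noteq> y"
    obtain U where U: "openin \<tau> U" "x \<in> U" "y \<notin> U"
      using Hausdorff_imp_t1_space[OF Hausdorff] xy unfolding t1_space_def by auto
    obtain V where V: "V \<in> \<B>" "x \<in> V" "V \<subseteq> U" using B(3)[OF U(1,2)] by blast
    then obtain n where n: "b n = V" using b by blast
    have "x \<in> b n \<longleftrightarrow> y \<in> b n"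
      using xy(3) unfolding u_def by (rule ternary_sum_inj[of "\<lambda>n. x \<in> b n" "\<lambda>n. y \<in> b n"])
    then show False using n V U by auto
  qed
  ultimately show ?thesis by (rule that)
qed

subsection \<open>Unique ergodicity\<close>

lemma translation_preimage: "g \<in> carrier G \<Longrightarrow> (\<lambda>x. g \<otimes> x) -` A \<inter> carrier G = {x \<in> carrier G. g \<otimes> x \<in> A}"
  by auto

text \<open>Carries invariance under \<open>a\<close> over to all its powers, negative ones
  included.\<close>

lemma invariant_subgroup:
  assumes \<nu>: "sets \<nu> = sets \<mu>"
  shows "subgroup {g \<in> carrier G. distr \<nu> \<nu> (\<lambda>x. g \<otimes> x) = \<nu>} G"
proof -
  have sp: "space \<nu> = carrier G" using sets_eq_imp_space_eq[OF \<nu>] space_mu by simp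
  have m: "(\<lambda>x. g \<otimes> x) \<in> measurable \<nu> \<nu>" if "g \<in> carrier G" for g
    using left_measurable[OF that] \<nu> by (simp cong: measurable_cong_sets)
  have comp: "distr (distr \<nu> \<nu> (\<lambda>x. h \<otimes> x)) \<nu> (\<lambda>x. g \<otimes> x) = distr \<nu> \<nu> (\<lambda>x. g \<otimes> h \<otimes> x)"
    if "g \<in> carrier G" "h \<in> carrier G" for g h
  proof -
    have "distr (distr \<nu> \<nu> (\<lambda>x. h \<otimes> x)) \<nu> (\<lambda>x. g \<otimes> x) = distr \<nu> \<nu> ((\<lambda>x. g \<otimes> x) \<circ> (\<lambda>x. h \<otimes> x))"
      using m that by (intro distr_distr) auto
    also have "\<dots> = distr \<nu> \<nu> (\<lambda>x. g \<otimes> h \<otimes> x)"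
      using that by (intro distr_cong) (auto simp: sp m_assoc)
    finally show ?thesis .
  qed
  have one: "distr \<nu> \<nu> (\<lambda>x. \<one> \<otimes> x) = \<nu>"
  proof -
    have "distr \<nu> \<nu> (\<lambda>x. \<one> \<otimes> x) = distr \<nu> \<nu> (\<lambda>x. x)" by (intro distr_cong) (auto simp: sp)
    then show ?thesis by (simp add: distr_id2)
  qed
  show ?thesis
  proof (rule subgroupI)
    show "{g \<in> carrier G. distr \<nu> \<nu> (\<lambda>x. g \<otimes> x) = \<nu>} \<noteq> {}" using one by auto
    fix g assume g: "g \<in> {g \<in> carrier G. distr \<nu> \<nu> (\<lambda>x. g \<otimes> x) = \<nu>}"
    then have "distr \<nu> \<nu> (\<lambda>x. inv g \<otimes> x) = distr (distr \<nu> \<nu> (\<lambda>x. g \<otimes> x)) \<nu> (\<lambda>x. inv g \<otimes> x)" by simp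
    also have "\<dots> = \<nu>" using g comp[of "inv g" g] one by simp
    finally show "inv g \<in> {g \<in> carrier G. distr \<nu> \<nu> (\<lambda>x. g \<otimes> x) = \<nu>}" using g by simp
    fix h assume h: "h \<in> {g \<in> carrier G. distr \<nu> \<nu> (\<lambda>x. g \<otimes> x) = \<nu>}"
    show "g \<otimes> h \<in> {g \<in> carrier G. distr \<nu> \<nu> (\<lambda>x. g \<otimes> x) = \<nu>}"
      using g h comp[of g h] by simp
  qed auto
qed

text \<open>If \<open>a\<close> preserves \<open>\<nu>\<close> and \<open>a [^] n\<^sub>k\<close> tends to \<open>g\<close>, then \<open>{x. g \<otimes> x \<in> F}\<close> contains the limes
  superior of the sets \<open>{x. a [^] n\<^sub>k \<otimes> x \<in> F}\<close> for every closed \<open>F\<close>.\<close>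

lemma invariant_closed_le:
  assumes \<nu>: "sets \<nu> = sets \<mu>" "finite_measure \<nu>" "distr \<nu> \<nu> (\<lambda>x. a \<otimes> x) = \<nu>"
    and g: "g \<in> carrier G" and F: "closedin \<tau> F"
  shows "measure \<nu> F \<le> measure \<nu> {x \<in> carrier G. g \<otimes> x \<in> F}"
proof -
  interpret N: finite_measure \<nu> by fact
  have sp: "space \<nu> = carrier G" using sets_eq_imp_space_eq[OF \<nu>(1)] space_mu by simp
  have m: "(\<lambda>x. h \<otimes> x) \<in> measurable \<nu> \<nu>" if "h \<in> carrier G" for h
    using left_measurable[OF that] \<nu>(1) by (simp cong: measurable_cong_sets)
  have Fs: "F \<in> sets \<nu>" using closedin_sets[OF F] \<nu>(1) by simp
  have pw: "distr \<nu> \<nu> (\<lambda>x. a [^] (n::int) \<otimes> x) = \<nu>" for n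
    using subgroup_int_pow_closed[OF invariant_subgroup[OF \<nu>(1)], of a n] \<nu>(3) by simp
  have pre: "measure \<nu> {x \<in> carrier G. h \<otimes> x \<in> F} = measure \<nu> F"
    if "h \<in> carrier G" "distr \<nu> \<nu> (\<lambda>x. h \<otimes> x) = \<nu>" for h
    using measure_distr[OF m[OF that(1)] Fs] that(2) sp translation_preimage[OF that(1)] by simp
  \<comment> \<open>A metric provides a sequence of powers tending to \<open>g\<close>; continuity
    of the measure along decreasing sets calls for a sequence.\<close>
  obtain M d where Md: "Metric_space M d" and \<tau>: "\<tau> = Metric_space.mtopology M d"
    using metrizable unfolding metrizable_space_def by blast
  have "g \<in> \<tau> closure_of (range (\<lambda>n::int. a [^] n))" using g dense by simp
  then obtain \<sigma> where \<sigma>: "range \<sigma> \<subseteq> range (\<lambda>n::int. a [^] n)" "limitin \<tau> \<sigma> g sequentially"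
    unfolding \<tau> Metric_space.closure_of_sequentially[OF Md] by blast
  have \<sigma>c: "\<sigma> k \<in> carrier G" "measure \<nu> {x \<in> carrier G. \<sigma> k \<otimes> x \<in> F} = measure \<nu> F" for k
  proof -
    obtain n :: int where n: "\<sigma> k = a [^] n" using \<sigma>(1) by blast
    then show "\<sigma> k \<in> carrier G" by simp
    show "measure \<nu> {x \<in> carrier G. \<sigma> k \<otimes> x \<in> F} = measure \<nu> F" unfolding n by (rule pre) (simp_all add: pw)
  qed
  define A where "A N = (\<Union>k\<in>{N..}. {x \<in> carrier G. \<sigma> k \<otimes> x \<in> F})" for N
  have s: "{x \<in> carrier G. h \<otimes> x \<in> F} \<in> sets \<nu>" if "h \<in> carrier G" for h
    using measurable_sets[OF m[OF that] Fs] sp translation_preimage[OF that] by simp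
  have A: "A N \<in> sets \<nu>" for N unfolding A_def using s \<sigma>c(1) by (intro sets.countable_UN'') auto
  have "decseq A" unfolding decseq_def A_def by fastforce
  then have lim: "(\<lambda>N. measure \<nu> (A N)) \<longlonglongrightarrow> measure \<nu> (\<Inter>N. A N)"
    using A by (intro N.finite_Lim_measure_decseq) auto
  have "measure \<nu> F \<le> measure \<nu> (A N)" for N
  proof -
    have "measure \<nu> F = measure \<nu> {x \<in> carrier G. \<sigma> N \<otimes> x \<in> F}" using \<sigma>c(2) by simp
    also have "\<dots> \<le> measure \<nu> (A N)" using A by (intro N.finite_measure_mono) (auto simp: A_def)
    finally show ?thesis .
  qed
  then have "measure \<nu> F \<le> measure \<nu> (\<Inter>N. A N)" by (intro LIMSEQ_le_const[OF lim]) auto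
  also have "\<dots> \<le> measure \<nu> {x \<in> carrier G. g \<otimes> x \<in> F}"
  proof (rule N.finite_measure_mono[OF _ s[OF g]], rule subsetI)
    fix x assume x: "x \<in> (\<Inter>N. A N)"
    then have xc: "x \<in> carrier G" unfolding A_def by blast
    have "g \<otimes> x \<in> F"
    proof (rule ccontr)
      assume n: "g \<otimes> x \<notin> F"
      have "limitin \<tau> ((\<lambda>y. y \<otimes> x) \<circ> \<sigma>) (g \<otimes> x) sequentially"
        using continuous_map_limit[OF cont_right[OF xc] \<sigma>(2)] by simp
      moreover have "openin \<tau> (carrier G - F)" using F by (simp add: closedin_def)
      ultimately have "\<forall>\<^sub>F k in sequentially. ((\<lambda>y. y \<otimes> x) \<circ> \<sigma>) k \<in> carrier G - F"
        by (rule limitinD) (use n g xc in simp)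
      then obtain K where K: "\<And>k. k \<ge> K \<Longrightarrow> \<sigma> k \<otimes> x \<notin> F" unfolding eventually_sequentially by auto
      then have "x \<notin> A K" unfolding A_def by auto
      then show False using x by blast
    qed
    then show "x \<in> {x \<in> carrier G. g \<otimes> x \<in> F}" using xc by simp
  qed
  finally show ?thesis .
qed

lemma measure_eq_closed:
  assumes "sets \<nu> = sets \<mu>" "sets \<nu>' = sets \<mu>" "finite_measure \<nu>" "finite_measure \<nu>'"
    and "\<And>F. closedin \<tau> F \<Longrightarrow> measure \<nu> F = measure \<nu>' F"
  shows "\<nu> = \<nu>'"
proof (rule measure_eqI_generator_eq[where \<Omega>="carrier G" and E="{F. closedin \<tau> F}" and A="\<lambda>_. carrier G"])
  show "Int_stable {F. closedin \<tau> F}" by (auto simp: Int_stable_def)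
  show "{F. closedin \<tau> F} \<subseteq> Pow (carrier G)" using closedin_subset by fastforce
  have "sigma_sets (carrier G) {F. closedin \<tau> F} = sigma_sets (carrier G) {U. openin \<tau> U}"
  proof (rule sigma_sets_eqI)
    fix F assume "F \<in> {F. closedin \<tau> F}"
    then have F: "closedin \<tau> F" by simp
    then have "carrier G - (carrier G - F) \<in> sigma_sets (carrier G) {U. openin \<tau> U}"
      by (intro sigma_sets.Compl sigma_sets.Basic) (simp add: closedin_def)
    then show "F \<in> sigma_sets (carrier G) {U. openin \<tau> U}"
      using closedin_subset[OF F] by (simp add: double_diff)
  next
    fix U assume "U \<in> {U. openin \<tau> U}"
    then have U: "openin \<tau> U" by simp
    then have "carrier G - (carrier G - U) \<in> sigma_sets (carrier G) {F. closedin \<tau> F}"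
      using closedin_diff[OF closedin_topspace U] by (intro sigma_sets.Compl sigma_sets.Basic) simp
    then show "U \<in> sigma_sets (carrier G) {F. closedin \<tau> F}"
      using openin_subset[OF U] by (simp add: double_diff)
  qed
  then show "sets \<nu> = sigma_sets (carrier G) {F. closedin \<tau> F}" "sets \<nu>' = sigma_sets (carrier G) {F. closedin \<tau> F}"
    using assms(1,2) sets_mu by auto
  show "emeasure \<nu> X = emeasure \<nu>' X" if "X \<in> {F. closedin \<tau> F}" for X
    using assms(3-5) that by (simp add: finite_measure.emeasure_eq_measure)
  show "range (\<lambda>_. carrier G) \<subseteq> {F. closedin \<tau> F}" using closedin_topspace[of \<tau>] by simp
  show "emeasure \<nu> (carrier G) \<noteq> \<infinity>" for i :: nat using assms(3) by (simp add: finite_measure.emeasure_eq_measure)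
qed auto

text \<open>The inequality for closed sets, applied to \<open>g\<close> and to its inverse, becomes
  an equality.\<close>

lemma invariant_all:
  assumes \<nu>: "sets \<nu> = sets \<mu>" "finite_measure \<nu>" "distr \<nu> \<nu> (\<lambda>x. a \<otimes> x) = \<nu>" and g: "g \<in> carrier G"
  shows "distr \<nu> \<nu> (\<lambda>x. g \<otimes> x) = \<nu>"
proof (rule measure_eq_closed)
  have sp: "space \<nu> = carrier G" using sets_eq_imp_space_eq[OF \<nu>(1)] space_mu by simp
  have m: "(\<lambda>x. g \<otimes> x) \<in> measurable \<nu> \<nu>"
    using left_measurable[OF g] \<nu>(1) by (simp cong: measurable_cong_sets)
  show "finite_measure (distr \<nu> \<nu> (\<lambda>x. g \<otimes> x))" using \<nu>(2) m by (rule finite_measure.finite_measure_distr)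
  fix F assume F: "closedin \<tau> F"
  let ?gF = "{x \<in> carrier G. g \<otimes> x \<in> F}"
  have gF: "closedin \<tau> ?gF" using closedin_continuous_map_preimage[OF cont_left[OF g] F] by simp
  have "measure \<nu> ?gF \<le> measure \<nu> {x \<in> carrier G. inv g \<otimes> x \<in> ?gF}"
    by (rule invariant_closed_le[OF \<nu> _ gF]) (simp add: g)
  also have "{x \<in> carrier G. inv g \<otimes> x \<in> ?gF} = F"
    using closedin_subset[OF F] g by (auto simp: m_assoc[symmetric])
  finally have "measure \<nu> ?gF = measure \<nu> F" using invariant_closed_le[OF \<nu> g F] by simp
  moreover have "F \<in> sets \<nu>" using closedin_sets[OF F] \<nu>(1) by simp
  ultimately show "measure (distr \<nu> \<nu> (\<lambda>x. g \<otimes> x)) F = measure \<nu> F"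
    using measure_distr[OF m] sp translation_preimage[OF g] by simp
qed (use \<nu> in simp_all)

text \<open>The product measure of the pairs whose product lies in \<open>B\<close> is computed by
  slices in both orders. Each slice is a translate of \<open>B\<close>, in the second order by
  commutativity; one computation gives the measure of \<open>B\<close> under \<open>\<nu>\<close>,
  the other under \<open>\<mu>\<close>.\<close>

lemma haar_unique:
  assumes \<nu>: "sets \<nu> = sets \<mu>" "prob_space \<nu>" "distr \<nu> \<nu> (\<lambda>x. a \<otimes> x) = \<nu>"
  shows "\<nu> = \<mu>"
proof (rule measure_eqI)
  interpret N: prob_space \<nu> by fact
  interpret M: prob_space \<mu> by (rule prob)
  interpret P: pair_sigma_finite \<mu> \<nu> ..
  have sp: "space \<nu> = carrier G" using sets_eq_imp_space_eq[OF \<nu>(1)] space_mu by simp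
  fix B assume B: "B \<in> sets \<nu>"
  then have B': "B \<in> sets \<mu>" using \<nu>(1) by simp
  let ?Z = "(\<lambda>(x, y). x \<otimes> y) -` B \<inter> space (\<mu> \<Otimes>\<^sub>M \<nu>)"
  have mm: "(\<lambda>(x, y). x \<otimes> y) \<in> measurable (\<mu> \<Otimes>\<^sub>M \<nu>) \<mu>"
    using mult_measurable measurable_cong_sets[OF sets_pair_measure_cong[OF refl \<nu>(1)] refl] by blast
  have Z: "?Z \<in> sets (\<mu> \<Otimes>\<^sub>M \<nu>)" by (rule measurable_sets[OF mm B'])
  have pre: "emeasure M {x \<in> carrier G. g \<otimes> x \<in> B} = emeasure M B"
    if M: "sets M = sets \<mu>" "distr M M (\<lambda>x. g \<otimes> x) = M" and g: "g \<in> carrier G" for M g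
  proof -
    have m: "(\<lambda>x. g \<otimes> x) \<in> measurable M M" using left_measurable[OF g] M(1) by (simp cong: measurable_cong_sets)
    have "space M = carrier G" using sets_eq_imp_space_eq[OF M(1)] space_mu by simp
    then show ?thesis
      using emeasure_distr[OF m, of B] B' M translation_preimage[OF g] by simp
  qed
  have "emeasure (\<mu> \<Otimes>\<^sub>M \<nu>) ?Z = (\<integral>\<^sup>+x. emeasure \<nu> (Pair x -` ?Z) \<partial>\<mu>)" by (rule N.emeasure_pair_measure_alt[OF Z])
  also have "\<dots> = (\<integral>\<^sup>+x. emeasure \<nu> B \<partial>\<mu>)"
  proof (rule nn_integral_cong)
    fix x assume "x \<in> space \<mu>"
    then have x: "x \<in> carrier G" using space_mu by simp
    have "Pair x -` ?Z = {y \<in> carrier G. x \<otimes> y \<in> B}" using x by (auto simp: space_pair_measure space_mu sp)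
    then show "emeasure \<nu> (Pair x -` ?Z) = emeasure \<nu> B"
      using pre[OF \<nu>(1) invariant_all[OF \<nu>(1) N.finite_measure_axioms \<nu>(3) x] x] by simp
  qed
  also have "\<dots> = emeasure \<nu> B" by (simp add: M.emeasure_space_1)
  finally have 1: "emeasure (\<mu> \<Otimes>\<^sub>M \<nu>) ?Z = emeasure \<nu> B" .
  have "emeasure (\<mu> \<Otimes>\<^sub>M \<nu>) ?Z = (\<integral>\<^sup>+y. emeasure \<mu> ((\<lambda>x. (x, y)) -` ?Z) \<partial>\<nu>)" by (rule P.emeasure_pair_measure_alt2[OF Z])
  also have "\<dots> = (\<integral>\<^sup>+y. emeasure \<mu> B \<partial>\<nu>)"
  proof (rule nn_integral_cong)
    fix y assume "y \<in> space \<nu>"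
    then have y: "y \<in> carrier G" using sp by simp
    have "(\<lambda>x. (x, y)) -` ?Z = {x \<in> carrier G. y \<otimes> x \<in> B}"
      using y commute by (auto simp: space_pair_measure space_mu sp)
    then show "emeasure \<mu> ((\<lambda>x. (x, y)) -` ?Z) = emeasure \<mu> B"
      using pre[OF refl mu_invariant[OF y] y] by simp
  qed
  also have "\<dots> = emeasure \<mu> B" by (simp add: N.emeasure_space_1)
  finally show "emeasure \<nu> B = emeasure \<mu> B" using 1 by simp
qed (rule \<nu>(1))

text \<open>The image of \<open>\<mu>\<close> under inversion is invariant under \<open>a\<close>,
  since translating an inverse by \<open>a\<close> amounts to inverting a translate by the inverse
  of \<open>a\<close>; uniqueness applies.\<close>

lemma inv_preserves: "distr \<mu> \<mu> (\<lambda>x. inv x) = \<mu>"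
proof (rule haar_unique)
  show "prob_space (distr \<mu> \<mu> (\<lambda>x. inv x))" using prob inv_measurable by (rule prob_space.prob_space_distr)
  have "distr (distr \<mu> \<mu> (\<lambda>x. inv x)) (distr \<mu> \<mu> (\<lambda>x. inv x)) (\<lambda>x. a \<otimes> x) = distr (distr \<mu> \<mu> (\<lambda>x. inv x)) \<mu> (\<lambda>x. a \<otimes> x)"
    by (rule distr_cong) auto
  also have "\<dots> = distr \<mu> \<mu> ((\<lambda>x. a \<otimes> x) \<circ> (\<lambda>x. inv x))"
    by (rule distr_distr[OF left_measurable[OF a] inv_measurable])
  also have "\<dots> = distr \<mu> \<mu> ((\<lambda>x. inv x) \<circ> (\<lambda>x. inv a \<otimes> x))"
    by (rule distr_cong) (auto simp: space_mu inv_mult_group commute)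
  also have "\<dots> = distr (distr \<mu> \<mu> (\<lambda>x. inv a \<otimes> x)) \<mu> (\<lambda>x. inv x)"
    by (rule distr_distr[symmetric, OF inv_measurable left_measurable]) simp
  also have "\<dots> = distr \<mu> \<mu> (\<lambda>x. inv x)" by (simp add: mu_invariant)
  finally show "distr (distr \<mu> \<mu> (\<lambda>x. inv x)) (distr \<mu> \<mu> (\<lambda>x. inv x)) (\<lambda>x. a \<otimes> x) = distr \<mu> \<mu> (\<lambda>x. inv x)" .
qed simp

text \<open>For an invariant set of positive measure the normalised restriction of
  \<open>\<mu>\<close> is invariant under \<open>a\<close>, hence equal to \<open>\<mu>\<close>, so
  the set has full measure.\<close>

lemma ergodic_mu: "ergodic \<mu> (\<lambda>x. a \<otimes> x)"
  unfolding ergodic_def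
proof (intro ballI impI)
  interpret M: prob_space \<mu> by (rule prob)
  fix A assume A: "A \<in> sets \<mu>" "AE x in \<mu>. (a \<otimes> x \<in> A) = (x \<in> A)"
  show "measure \<mu> A = 0 \<or> measure \<mu> A = 1"
  proof (cases "measure \<mu> A = 0")
    case False
    then have eA: "emeasure \<mu> A \<noteq> 0" "emeasure \<mu> A \<noteq> \<infinity>" by (auto simp: M.emeasure_eq_measure)
    let ?\<nu> = "uniform_measure \<mu> A"
    have m: "(\<lambda>x. a \<otimes> x) \<in> measurable \<mu> \<mu>" by (rule left_measurable[OF a])
    have "?\<nu> = \<mu>"
    proof (rule haar_unique)
      show "prob_space ?\<nu>" using eA by (rule prob_space_uniform_measure)
      show "distr ?\<nu> ?\<nu> (\<lambda>x. a \<otimes> x) = ?\<nu>"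
      proof (rule measure_eqI)
        fix B assume "B \<in> sets (distr ?\<nu> ?\<nu> (\<lambda>x. a \<otimes> x))"
        then have B: "B \<in> sets \<mu>" by simp
        have mu: "(\<lambda>x. a \<otimes> x) \<in> measurable ?\<nu> ?\<nu>" using m by (simp cong: measurable_cong_sets)
        let ?p = "(\<lambda>x. a \<otimes> x) -` B \<inter> space \<mu>"
        have p: "?p \<in> sets \<mu>" by (rule measurable_sets[OF m B])
        have "emeasure \<mu> (A \<inter> ?p) = emeasure \<mu> ((\<lambda>x. a \<otimes> x) -` (A \<inter> B) \<inter> space \<mu>)"
        proof (rule emeasure_eq_AE)
          show "AE x in \<mu>. x \<in> A \<inter> ?p \<longleftrightarrow> x \<in> (\<lambda>x. a \<otimes> x) -` (A \<inter> B) \<inter> space \<mu>"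
            using A(2) by eventually_elim auto
          show "(\<lambda>x. a \<otimes> x) -` (A \<inter> B) \<inter> space \<mu> \<in> sets \<mu>" using A B by (intro measurable_sets[OF m]) auto
        qed (use A p in auto)
        also have "\<dots> = emeasure \<mu> (A \<inter> B)"
          using emeasure_distr[OF m, of "A \<inter> B"] A B mu_invariant[OF a] by simp
        finally have "emeasure \<mu> (A \<inter> ?p) = emeasure \<mu> (A \<inter> B)" .
        then show "emeasure (distr ?\<nu> ?\<nu> (\<lambda>x. a \<otimes> x)) B = emeasure ?\<nu> B"
          using emeasure_distr[OF mu, of B] A B p by simp
      qed simp
    qed simp
    then have "emeasure \<mu> A = emeasure ?\<nu> A" by simp
    also have "\<dots> = 1"
      using A eA ennreal_divide_self[of "emeasure \<mu> A"] by (simp add: less_top[symmetric])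
    finally show ?thesis by (simp add: M.emeasure_eq_measure)
  qed simp
qed

end

section \<open>Completions and the extension by inversion\<close>

lemma restrict_space_full: "restrict_space M (space M) = M"
  by (intro measure_eqI) (auto simp: sets_restrict_space_iff emeasure_restrict_space intro: sets.sets_into_space[THEN subsetD])

lemma completion_mpt:
  assumes t: "t \<in> measurable M M" "distr M M t = M"
  shows "t \<in> measurable (completion M) (completion M)" "distr (completion M) (completion M) t = completion M"
proof -
  have t': "t \<in> measurable (completion M) M" using t(1) by (rule measurable_completion)
  have d: "distr (completion M) M t = M" using distr_completion[OF t(1)] t(2) by simp
  have n: "null_sets (distr (completion M) M t) = null_sets M" by (simp only: d)
  show "t \<in> measurable (completion M) (completion M)"
    by (rule complete_measure.measurable_completion2[OF _ t']) (simp_all add: n completion.complete_measure_axioms)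
  show "distr (completion M) (completion M) t = completion M"
    using complete_measure.completion_distr_eq[OF completion.complete_measure_axioms t' n] d by simp
qed

lemma prob_space_completion: "prob_space M \<Longrightarrow> prob_space (completion M)"
  by (intro prob_spaceI) (simp add: prob_space.emeasure_space_1)

text \<open>A set of the completion agrees almost everywhere with its main part, which inherits the
  invariance.\<close>

lemma ergodic_completion:
  assumes erg: "ergodic M T" and T: "T \<in> measurable M M" "distr M M T = M"
  shows "ergodic (completion M) T"
  unfolding ergodic_def
proof (intro ballI impI)
  fix A assume A: "A \<in> sets (completion M)" "AE x in completion M. (T x \<in> A) = (x \<in> A)"
  let ?B = "main_part M A"
  have B: "AE x in M. x \<in> ?B \<longleftrightarrow> x \<in> A" by (rule AE_in_main_part[OF A(1)])
  have A2: "AE x in M. (T x \<in> A) = (x \<in> A)" using A(2) by (simp only: AE_completion_iff)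
  have "AE x in M. T x \<in> ?B \<longleftrightarrow> x \<in> ?B"
    using A2 B mpt_AE[OF T B] by eventually_elim simp
  then have "measure M ?B = 0 \<or> measure M ?B = 1"
    using erg main_part_sets[OF A(1)] unfolding ergodic_def by blast
  moreover have "emeasure (completion M) A = emeasure (completion M) ?B"
    using B A(1) main_part_sets[OF A(1)] by (intro emeasure_eq_AE) (auto simp: AE_completion_iff)
  ultimately show "measure (completion M) A = 0 \<or> measure (completion M) A = 1"
    using main_part_sets[OF A(1)] by (simp add: measure_def)
qed

lemma integer_mod_2:
  "carrier (integer_mod_group 2) = {0, 1}" "x \<otimes>\<^bsub>integer_mod_group 2\<^esub> y = (x + y) mod 2" "\<one>\<^bsub>integer_mod_group 2\<^esub> = 0"
  by (auto simp: integer_mod_group_def)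

lemma inversion_extension_carrier: "carrier (inversion_extension G) = carrier G \<times> {0, 1}"
  by (simp add: inversion_extension_def semidirect_product_def integer_mod_2)

lemma inversion_extension_mult:
  "(g, e) \<otimes>\<^bsub>inversion_extension G\<^esub> (h, e') = (g \<otimes>\<^bsub>G\<^esub> (if e = 0 then h else inv\<^bsub>G\<^esub> h), (e + e') mod 2)"
  by (simp add: inversion_extension_def semidirect_product_def integer_mod_2)

lemma inversion_extension_one: "\<one>\<^bsub>inversion_extension G\<^esub> = (\<one>\<^bsub>G\<^esub>, 0)"
  by (simp add: inversion_extension_def semidirect_product_def integer_mod_2)

lemma group_inversion_extension:
  fixes G :: "'g monoid" (structure)
  assumes "comm_group G"
  shows "group (inversion_extension G)"
proof (rule groupI)
  interpret comm_group G by fact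
  let ?D = "inversion_extension G"
  show "\<one>\<^bsub>?D\<^esub> \<in> carrier ?D" by (simp add: inversion_extension_one inversion_extension_carrier)
  fix x assume x: "x \<in> carrier ?D"
  obtain g e where xe: "x = (g, e)" "g \<in> carrier G" "e = 0 \<or> e = 1" using x by (auto simp: inversion_extension_carrier)
  show "\<one>\<^bsub>?D\<^esub> \<otimes>\<^bsub>?D\<^esub> x = x" using xe by (auto simp: inversion_extension_one inversion_extension_mult)
  show "\<exists>y\<in>carrier ?D. y \<otimes>\<^bsub>?D\<^esub> x = \<one>\<^bsub>?D\<^esub>"
  proof (intro bexI)
    \<comment> \<open>Elements with sign \<open>1\<close> are their own inverses.\<close>
    show "(if e = 0 then inv g else g, e) \<otimes>\<^bsub>?D\<^esub> x = \<one>\<^bsub>?D\<^esub>"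
      using xe by (auto simp: inversion_extension_one inversion_extension_mult)
    show "(if e = 0 then inv g else g, e) \<in> carrier ?D" using xe by (auto simp: inversion_extension_carrier)
  qed
  fix y assume y: "y \<in> carrier ?D"
  obtain h e' where ye: "y = (h, e')" "h \<in> carrier G" "e' = 0 \<or> e' = 1" using y by (auto simp: inversion_extension_carrier)
  show "x \<otimes>\<^bsub>?D\<^esub> y \<in> carrier ?D" using xe ye by (auto simp: inversion_extension_carrier inversion_extension_mult)
  fix z assume z: "z \<in> carrier ?D"
  obtain l e'' where ze: "z = (l, e'')" "l \<in> carrier G" "e'' = 0 \<or> e'' = 1" using z by (auto simp: inversion_extension_carrier)
  show "x \<otimes>\<^bsub>?D\<^esub> y \<otimes>\<^bsub>?D\<^esub> z = x \<otimes>\<^bsub>?D\<^esub> (y \<otimes>\<^bsub>?D\<^esub> z)"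
    using xe ye ze by (auto simp: inversion_extension_mult m_assoc inv_mult)
qed

section \<open>Automorphisms that commute with a translation up to sign\<close>

context monothetic
begin

sublocale comm_group G by (rule comm_group_G)

abbreviation (input) "cmu \<equiv> completion \<mu>"

lemma vmeasure_group_graphing: "vmeasure (group_graphing G \<mu> a) = cmu"
  unfolding group_graphing_def cycle_graphing_def using restrict_space_full[of cmu] by (simp add: space_mu)

lemma left_cmu: "g \<in> carrier G \<Longrightarrow> (\<lambda>x. g \<otimes> x) \<in> measurable cmu cmu"
    "g \<in> carrier G \<Longrightarrow> distr cmu cmu (\<lambda>x. g \<otimes> x) = cmu"
  using completion_mpt[OF left_measurable mu_invariant] by auto

lemma inv_mpt_left: "g \<in> carrier G \<Longrightarrow> inv_mpt cmu (\<lambda>x. g \<otimes> x)"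
  by (rule inv_mptI[where S="\<lambda>x. inv g \<otimes> x"])
    (auto simp: left_cmu m_assoc[symmetric] space_mu intro!: AE_I2)

lemma inv_mpt_inv: "inv_mpt cmu (\<lambda>x. inv x)"
  by (rule inv_mptI[where S="\<lambda>x. inv x"])
    (auto simp: completion_mpt[OF inv_measurable inv_preserves] space_mu intro!: AE_I2)

lemma power_left: "x \<in> carrier G \<Longrightarrow> ((\<lambda>x. a \<otimes> x) ^^ n) x = a [^] n \<otimes> x"
proof (induction n)
  case (Suc n)
  then show ?case by (simp add: m_assoc m_lcomm)
qed simp

text \<open>The translation by \<open>a\<close> is free everywhere, so the whole group serves as
  good set, and a countable base supplies the separating function.\<close>

lemma ergodic_graph_group:
  obtains u where "ergodic_graph (vmeasure (group_graphing G \<mu> a)) (edges (group_graphing G \<mu> a))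
    (\<lambda>x. a \<otimes> x) (\<lambda>x. inv a \<otimes> x) (carrier G) u"
proof -
  obtain u :: "'g \<Rightarrow> real" where u: "u \<in> borel_measurable \<mu>" "inj_on u (carrier G)" by (rule code)
  have "ergodic_graph cmu (edges (group_graphing G \<mu> a)) (\<lambda>x. a \<otimes> x) (\<lambda>x. inv a \<otimes> x) (carrier G) u"
    unfolding ergodic_graph_def ergodic_graph_axioms_def
  proof (intro conjI allI impI)
    show "prob_space cmu" using prob by (rule prob_space_completion)
    show "complete_measure cmu" by (rule completion.complete_measure_axioms)
    show "carrier G \<in> sets cmu" using sets.top[of cmu] by (simp add: space_mu)
    show "AE x in cmu. x \<in> carrier G" by (rule AE_I2) (simp add: space_mu)
    show "u \<in> borel_measurable cmu" using u(1) by (rule measurable_completion)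
    show "inj_on u (carrier G)" by fact
    show "ergodic cmu (\<lambda>x. a \<otimes> x)" by (rule ergodic_completion[OF ergodic_mu left_measurable mu_invariant]) simp_all
    show "((\<lambda>x. a \<otimes> x) ^^ n) x \<noteq> x" if "x \<in> carrier G" "0 < n" for x n
      using power_left[OF that(1)] powers_distinct[OF that(2)] that(1) by (simp add: r_cancel_one)
    show "edges (group_graphing G \<mu> a) `` {x} = {a \<otimes> x, inv a \<otimes> x}" if x: "x \<in> carrier G" for x
    proof -
      have "x = a \<otimes> y \<longleftrightarrow> y = inv a \<otimes> x" if "y \<in> carrier G" for y
        using that x by (metis a inv_closed inv_solve_left)
      then show ?thesis using x by (auto simp: group_graphing_def cycle_graphing_def)
    qed
  qed (use left_cmu in \<open>auto simp: m_assoc[symmetric]\<close>)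
  then show ?thesis using that by (simp add: vmeasure_group_graphing)
qed

text \<open>Applied with inversion as \<open>f\<close> if \<open>s\<close> commutes with the
  translation, and with the identity as \<open>f\<close> if \<open>s\<close> inverts it. The
  injection \<open>u\<close> turns the group-valued invariant into a real one.\<close>

lemma intertwiner_constant:
  fixes s f :: "'g \<Rightarrow> 'g"
  assumes s: "s \<in> measurable cmu cmu" and f: "f \<in> measurable \<mu> \<mu>"
    and inv: "AE x in cmu. f (a \<otimes> x) \<otimes> s (a \<otimes> x) = f x \<otimes> s x"
  obtains g where "g \<in> carrier G" "AE x in cmu. f x \<otimes> s x = g"
proof -
  obtain u0 where "ergodic_graph (vmeasure (group_graphing G \<mu> a)) (edges (group_graphing G \<mu> a))
    (\<lambda>x. a \<otimes> x) (\<lambda>x. inv a \<otimes> x) (carrier G) u0" by (rule ergodic_graph_group)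
  then interpret E: ergodic_graph cmu "edges (group_graphing G \<mu> a)" "\<lambda>x. a \<otimes> x" "\<lambda>x. inv a \<otimes> x" "carrier G" u0
    by (simp add: vmeasure_group_graphing)
  obtain u :: "'g \<Rightarrow> real" where u: "u \<in> borel_measurable \<mu>" "inj_on u (carrier G)" by (rule code)
  have idm: "(\<lambda>x. x) \<in> measurable cmu \<mu>" by (rule measurable_completion) simp
  have sm: "s \<in> measurable cmu \<mu>" using measurable_compose[OF s idm] .
  have fm: "f \<in> measurable cmu \<mu>" using f by (rule measurable_completion)
  have pm: "(\<lambda>x. (f x, s x)) \<in> measurable cmu (\<mu> \<Otimes>\<^sub>M \<mu>)" using fm sm by measurable
  have m: "(\<lambda>x. u (f x \<otimes> s x)) \<in> borel_measurable cmu"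
    using measurable_compose[OF measurable_compose[OF pm mult_measurable] u(1)] by simp
  have "AE x in cmu. u (f (a \<otimes> x) \<otimes> s (a \<otimes> x)) = u (f x \<otimes> s x)" using inv by eventually_elim simp
  then obtain c where c: "AE x in cmu. u (f x \<otimes> s x) = c" by (rule E.ergodic_constant[OF E.erg E.T(1) m])
  have cl: "f x \<otimes> s x \<in> carrier G" if "x \<in> carrier G" for x
    using measurable_space[OF f] measurable_space[OF s] that by (simp add: space_mu)
  have "\<exists>x\<in>carrier G. u (f x \<otimes> s x) = c"
  proof (rule ccontr)
    assume n: "\<not> (\<exists>x\<in>carrier G. u (f x \<otimes> s x) = c)"
    have "AE x in cmu. False" using c E.AE_G by eventually_elim (use n in blast)
    then show False by simp
  qed
  then obtain x0 where x0: "x0 \<in> carrier G" "u (f x0 \<otimes> s x0) = c" by blast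
  have "AE x in cmu. f x \<otimes> s x = f x0 \<otimes> s x0"
    using c E.AE_G
  proof eventually_elim
    fix x assume "u (f x \<otimes> s x) = c" "x \<in> carrier G"
    then show "f x \<otimes> s x = f x0 \<otimes> s x0" using x0 cl by (intro inj_onD[OF u(2)]) simp_all
  qed
  then show ?thesis using that cl[OF x0(1)] by blast
qed

definition affine :: "'g \<times> int \<Rightarrow> 'g \<Rightarrow> 'g" where
  "affine = (\<lambda>(g, e) x. g \<otimes> (if e = 0 then x else inv x))"

lemma inversion_extension_iso_aut_pm: "inversion_extension G \<cong> aut_pm cmu (\<lambda>x. a \<otimes> x)"
proof -
  let ?D = "inversion_extension G" and ?T = "\<lambda>x. a \<otimes> x" and ?S = "\<lambda>x. inv a \<otimes> x"
  have D: "\<exists>g e. w = (g, e) \<and> g \<in> carrier G \<and> (e = 0 \<or> e = 1)" if "w \<in> carrier ?D" for w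
    using that by (auto simp: inversion_extension_carrier)
  have AEG: "AE x in cmu. x \<in> carrier G" by (rule AE_I2) (simp add: space_mu)
  have inv_aff: "inv_mpt cmu (affine w)" if "w \<in> carrier ?D" for w
  proof -
    obtain g e where w: "w = (g, e)" "g \<in> carrier G" "e = 0 \<or> e = 1" using D[OF \<open>w \<in> carrier ?D\<close>] by blast
    have "(\<lambda>x. g \<otimes> x) \<circ> (\<lambda>x. inv x) = (\<lambda>x. g \<otimes> inv x)" by (simp add: o_def)
    then show ?thesis
      using inv_mpt_left[OF w(2)] inv_mpt_comp[OF inv_mpt_left[OF w(2)] inv_mpt_inv] w(3)
      by (auto simp: affine_def w(1))
  qed
  have ST: "AE x in cmu. ?S (?T x) = x" using AEG by eventually_elim (simp add: m_assoc[symmetric])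
  have iT: "inv_mpt cmu ?T" "inv_mpt cmu ?S" using inv_mpt_left by auto
  note carr = aut_pm_carrier[OF iT ST]
  interpret P: prob_space cmu using prob by (rule prob_space_completion)
  show ?thesis
  proof (rule class_iso[where C=cmu and F=affine])
    fix v w assume v: "v \<in> carrier ?D" and w: "w \<in> carrier ?D"
    obtain g e where v': "v = (g, e)" "g \<in> carrier G" "e = 0 \<or> e = 1" using D[OF v] by blast
    obtain h e' where w': "w = (h, e')" "h \<in> carrier G" "e' = 0 \<or> e' = 1" using D[OF w] by blast
    show "AE x in cmu. affine (v \<otimes>\<^bsub>?D\<^esub> w) x = affine v (affine w x)"
      using AEG
    proof eventually_elim
      fix x assume x: "x \<in> carrier G"
      from v'(3) w'(3) show "affine (v \<otimes>\<^bsub>?D\<^esub> w) x = affine v (affine w x)"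
        using x v'(2) w'(2) by (auto simp: v'(1) w'(1) inversion_extension_mult affine_def m_assoc inv_mult)
    qed
    assume e: "AE x in cmu. affine v x = affine w x"
    \<comment> \<open>A translation and a reflection may agree at one point; a second point, the
      translate of the first, tells them apart.\<close>
    have ee: "AE x in cmu. affine v x = affine w x \<and> affine v (?T x) = affine w (?T x) \<and> x \<in> carrier G"
      using e inv_mpt_AE[OF iT(1) e] AEG by eventually_elim blast
    have "\<exists>x\<in>carrier G. affine v x = affine w x \<and> affine v (?T x) = affine w (?T x)"
    proof (rule ccontr)
      assume n: "\<not> (\<exists>x\<in>carrier G. affine v x = affine w x \<and> affine v (?T x) = affine w (?T x))"
      have "AE x in cmu. False" using ee by eventually_elim (use n in blast)
      then show False by simp
    qed
    then obtain x where x: "x \<in> carrier G" "affine v x = affine w x" "affine v (?T x) = affine w (?T x)" by blast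
    have square: "a \<otimes> a \<noteq> \<one>" using powers_distinct[of 2] by (simp add: numeral_2_eq_2)
    \<comment> \<open>Agreement at \<open>x\<close> and at \<open>a \<otimes> x\<close> would force
      \<open>a = inv a\<close>, against \<open>a \<otimes> a \<noteq> \<one>\<close>.\<close>
    have mixed: False if gh: "g' \<in> carrier G" "h' \<in> carrier G" "g' \<otimes> x = h' \<otimes> inv x" "g' \<otimes> (a \<otimes> x) = h' \<otimes> inv (a \<otimes> x)" for g' h'
    proof -
      have "a \<otimes> (h' \<otimes> inv x) = g' \<otimes> (a \<otimes> x)" using gh x(1) by (metis a m_lcomm)
      also have "\<dots> = inv a \<otimes> (h' \<otimes> inv x)" using gh x(1) by (simp add: inv_mult m_lcomm)
      finally have "a = inv a" using gh x(1) by (simp add: right_cancel)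
      then show False using square by (metis a r_inv)
    qed
    show "v = w"
      using v'(3)
    proof
      assume v0: "e = 0"
      from w'(3) show ?thesis
      proof
        assume "e' = 0"
        then show ?thesis using v0 x v' w' by (simp add: affine_def)
      next
        assume "e' = 1"
        then show ?thesis using mixed[of g h] v0 x v' w' by (simp add: affine_def)
      qed
    next
      assume v1: "e = 1"
      from w'(3) show ?thesis
      proof
        assume "e' = 0"
        then show ?thesis using mixed[of h g] v1 x v' w' by (simp add: affine_def)
      next
        assume "e' = 1"
        then show ?thesis using v1 x v' w' by (simp add: affine_def)
      qed
    qed
  next
    interpret D: group ?D by (rule group_inversion_extension[OF comm_group_G])
    show "mult_closed ?D" by (simp add: mult_closed_def)
    show "(\<otimes>\<^bsub>aut_pm cmu ?T\<^esub>) = (\<otimes>\<^bsub>aut_group cmu\<^esub>)" by (rule aut_pm_mult)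
    show "carrier (aut_pm cmu ?T) = (\<lambda>w. aut_class cmu (affine w)) ` carrier ?D"
    proof (intro subset_antisym subsetI)
      fix A assume "A \<in> carrier (aut_pm cmu ?T)"
      then obtain s where s: "A = aut_class cmu s" "inv_mpt cmu s"
        "(AE x in cmu. s (?T x) = ?T (s x)) \<or> (AE x in cmu. s (?T x) = ?S (s x))" using carr by auto
      have sG: "AE x in cmu. s x \<in> carrier G" using AEG inv_mpt_AE[OF s(2)] by blast
      from s(3) obtain w where "w \<in> carrier ?D" "AE x in cmu. s x = affine w x"
      proof
        assume c: "AE x in cmu. s (?T x) = ?T (s x)"
        \<comment> \<open>The quotient of \<open>s x\<close> by \<open>x\<close> is invariant, so
          \<open>s\<close> is a translation.\<close>
        have "AE x in cmu. inv (a \<otimes> x) \<otimes> s (a \<otimes> x) = inv x \<otimes> s x"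
          using c AEG sG
        proof eventually_elim
          fix x assume x: "s (a \<otimes> x) = a \<otimes> s x" "x \<in> carrier G" "s x \<in> carrier G"
          have c: "inv a \<otimes> (a \<otimes> s x) = s x" using x by (simp add: m_assoc[symmetric])
          have "(inv a \<otimes> inv x) \<otimes> (a \<otimes> s x) = (inv x \<otimes> inv a) \<otimes> (a \<otimes> s x)"
            using m_comm[of "inv a" "inv x"] x by simp
          also have "\<dots> = inv x \<otimes> (inv a \<otimes> (a \<otimes> s x))" using x by (intro m_assoc) simp_all
          also note c
          finally show "inv (a \<otimes> x) \<otimes> s (a \<otimes> x) = inv x \<otimes> s x"
            unfolding x(1) inv_mult[OF a x(2)] .
        qed
        then obtain g where g: "g \<in> carrier G" "AE x in cmu. inv x \<otimes> s x = g"
          by (rule intertwiner_constant[OF inv_mptD(1)[OF s(2)] inv_measurable])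
        have "AE x in cmu. s x = affine (g, 0) x"
          using g(2) AEG sG by eventually_elim (auto simp: affine_def m_comm m_assoc[symmetric])
        then show ?thesis using g(1) by (intro that[of "(g, 0)"]) (simp_all add: inversion_extension_carrier)
      next
        assume c: "AE x in cmu. s (?T x) = ?S (s x)"
        \<comment> \<open>Here the product of \<open>x\<close> and \<open>s x\<close> is invariant,
          so \<open>s\<close> is a reflection.\<close>
        have "AE x in cmu. (a \<otimes> x) \<otimes> s (a \<otimes> x) = x \<otimes> s x"
          using c AEG sG
        proof eventually_elim
          fix x assume x: "s (a \<otimes> x) = inv a \<otimes> s x" "x \<in> carrier G" "s x \<in> carrier G"
          have c: "a \<otimes> (inv a \<otimes> s x) = s x" using x by (simp add: m_assoc[symmetric])
          have "(a \<otimes> x) \<otimes> (inv a \<otimes> s x) = (x \<otimes> a) \<otimes> (inv a \<otimes> s x)"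
            using m_comm[of a x] x by simp
          also have "\<dots> = x \<otimes> (a \<otimes> (inv a \<otimes> s x))" using x by (intro m_assoc) simp_all
          also note c
          finally show "(a \<otimes> x) \<otimes> s (a \<otimes> x) = x \<otimes> s x" unfolding x(1) .
        qed
        then obtain g where g: "g \<in> carrier G" "AE x in cmu. x \<otimes> s x = g"
          by (rule intertwiner_constant[OF inv_mptD(1)[OF s(2)] measurable_ident_sets[OF refl]])
        have "AE x in cmu. s x = affine (g, 1) x"
          using g(2) AEG sG by eventually_elim (auto simp: affine_def m_comm m_assoc[symmetric])
        then show ?thesis using g(1) by (intro that[of "(g, 1)"]) (simp_all add: inversion_extension_carrier)
      qed
      then show "A \<in> (\<lambda>w. aut_class cmu (affine w)) ` carrier ?D"
        using s aut_class_eq_iff[OF s(2)] by blast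
    next
      fix A assume "A \<in> (\<lambda>w. aut_class cmu (affine w)) ` carrier ?D"
      then obtain w where w: "w \<in> carrier ?D" "A = aut_class cmu (affine w)" by blast
      obtain g e where w': "w = (g, e)" "g \<in> carrier G" "e = 0 \<or> e = 1" using D[OF w(1)] by blast
      from w'(3) have "(AE x in cmu. affine w (?T x) = ?T (affine w x)) \<or> (AE x in cmu. affine w (?T x) = ?S (affine w x))"
      proof
        assume "e = 0"
        then have "AE x in cmu. affine w (?T x) = ?T (affine w x)"
          using AEG w' by (auto simp: affine_def m_lcomm)
        then show ?thesis ..
      next
        assume "e = 1"
        then have "AE x in cmu. affine w (?T x) = ?S (affine w x)"
          using AEG w' by (auto simp: affine_def m_lcomm inv_mult)
        then show ?thesis ..
      qed
      then show "A \<in> carrier (aut_pm cmu ?T)" unfolding carr using w(2) inv_aff[OF w(1)] by blast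
    qed
  qed (rule inv_aff)
qed

theorem wreath_iso_group_graphing:
  assumes "weights k lam"
  shows "wreath (inversion_extension G) k lam \<cong> aut_graphing (convex_combination k lam (\<lambda>_. group_graphing G \<mu> a))"
proof -
  obtain u where E: "ergodic_graph (vmeasure (group_graphing G \<mu> a)) (edges (group_graphing G \<mu> a))
    (\<lambda>x. a \<otimes> x) (\<lambda>x. inv a \<otimes> x) (carrier G) u" by (rule ergodic_graph_group)
  have "wreath (inversion_extension G) k lam \<cong> wreath (aut_pm cmu (\<lambda>x. a \<otimes> x)) k lam"
    by (rule wreath_cong[OF inversion_extension_iso_aut_pm])
  also have "\<dots> \<cong> aut_graphing (convex_combination k lam (\<lambda>_. group_graphing G \<mu> a))"
    using ergodic_graph.wreath_iso_aut_graphing[OF E assms refl refl] by (simp only: vmeasure_group_graphing)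
  finally show ?thesis .
qed

lemma group_wreath_inversion_extension: "group (wreath (inversion_extension G) k lam)"
  by (rule group_wreath[OF group_inversion_extension[OF comm_group_G]])

theorem group_graphing_iso_wreath:
  assumes "weights k lam"
  shows "aut_graphing (convex_combination k lam (\<lambda>_. group_graphing G \<mu> a)) \<cong> wreath (inversion_extension G) k lam"
  by (rule group.iso_sym[OF group_wreath_inversion_extension wreath_iso_group_graphing[OF assms]])

end

lemma monotheticI: "monothetic_data G \<tau> \<mu> a \<Longrightarrow> monothetic G \<tau> \<mu> a"
  by (simp add: monothetic_def monothetic_axioms_def) (simp add: monothetic_data_def compact_metrizable_group_def)

section \<open>The identity component\<close>

context monothetic
begin

lemma closedin_powers: "closedin \<tau> ((\<lambda>h. h [^] (n::nat)) ` carrier G)"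
proof -
  have "continuous_map \<tau> \<tau> (\<lambda>h. h [^] n)"
  proof (induction n)
    case (Suc n)
    then show ?case using cont_mult'[OF Suc continuous_map_id[unfolded id_def]] by simp
  qed simp
  then have "compactin \<tau> ((\<lambda>h. h [^] n) ` topspace \<tau>)"
    using compact by (intro image_compactin) (auto simp: compact_space_def)
  then show ?thesis using compactin_imp_closedin[OF Hausdorff] by simp
qed

text \<open>The closed subgroup of \<open>n\<close>-th powers has finite index, because its translates by the powers
  of the generator with exponents less than \<open>n\<close> contain a dense set. So it is open.\<close>

lemma openin_powers:
  assumes "n > 0"
  shows "openin \<tau> ((\<lambda>h. h [^] (n::nat)) ` carrier G)"
proof -
  define P where "P = (\<lambda>h. h [^] n) ` carrier G"
  have PI: "h [^] n \<in> P" if "h \<in> carrier G" for h using that by (simp add: P_def)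
  have PE: "\<exists>h\<in>carrier G. x = h [^] n" if "x \<in> P" for x using that by (auto simp: P_def)
  have Pcl: "closedin \<tau> P" unfolding P_def by (rule closedin_powers)
  have P1: "\<one> \<in> P" using PI[of \<one>] by simp
  have Pm: "x \<otimes> y \<in> P" if xy: "x \<in> P" "y \<in> P" for x y
  proof -
    obtain g h where "g \<in> carrier G" "h \<in> carrier G" "x = g [^] n" "y = h [^] n" using PE[OF xy(1)] PE[OF xy(2)] by (elim bexE)
    then show ?thesis using PI[of "g \<otimes> h"] by (simp add: nat_pow_distrib)
  qed
  have Pi: "inv x \<in> P" if x: "x \<in> P" for x
  proof -
    obtain g where "g \<in> carrier G" "x = g [^] n" using PE[OF x] by (elim bexE)
    then show ?thesis using PI[of "inv g"] by (simp add: nat_pow_inv)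
  qed
  have Pc: "P \<subseteq> carrier G" using closedin_subset[OF Pcl] by simp
  \<comment> \<open>The translates of \<open>P\<close> other than \<open>P\<close> itself; some of
    them may coincide, but there are finitely many, so their union is closed.\<close>
  define U where "U = (\<Union>i\<in>{i. i < n \<and> a [^] i \<notin> P}. (\<lambda>x. a [^] i \<otimes> x) ` P)"
  have cl: "closedin \<tau> ((\<lambda>x. a [^] i \<otimes> x) ` P)" for i :: nat
  proof -
    have "compactin \<tau> P" using closedin_compact_space[OF compact Pcl] .
    then show ?thesis using compactin_imp_closedin[OF Hausdorff image_compactin[OF _ cont_left]] by simp
  qed
  have Ucl: "closedin \<tau> U" unfolding U_def by (intro closedin_Union) (auto intro: cl)
  have "P \<inter> U = {}"
  proof (rule ccontr)
    assume "P \<inter> U \<noteq> {}"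
    then obtain x and i :: nat where ix: "a [^] i \<notin> P" "x \<in> P" "a [^] i \<otimes> x \<in> P"
      unfolding U_def by blast
    have "a [^] i \<otimes> x \<otimes> inv x \<in> P" by (intro Pm Pi ix)
    moreover have "a [^] i \<otimes> x \<otimes> inv x = a [^] i"
      using subsetD[OF Pc ix(2)] by (simp add: m_assoc)
    ultimately show False using ix(1) by simp
  qed
  moreover have "x \<in> P \<union> U" if x: "x \<in> carrier G" for x
  proof (rule dense_induct[OF _ _ x])
    have "{x \<in> carrier G. x \<in> P \<union> U} = P \<union> U"
      using Pc closedin_subset[OF Ucl] by auto
    then show "closedin \<tau> {x \<in> carrier G. x \<in> P \<union> U}"
      using closedin_Un[OF Pcl Ucl] by simp
    fix m :: int
    \<comment> \<open>Division with remainder by \<open>n\<close>: the quotient contributes an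
      \<open>n\<close>-th power, so each power of \<open>a\<close> lies in a translate of
      \<open>P\<close> with exponent below \<open>n\<close>.\<close>
    define i where "i = nat (m mod int n)"
    have i: "i < n" "m = int i + m div int n * int n" using assms by (auto simp: i_def nat_less_iff)
    have p: "(a [^] (m div int n)) [^] n \<in> P" by (rule PI) simp
    have "a [^] m = a [^] i \<otimes> (a [^] (m div int n)) [^] n"
    proof -
      have "a [^] m = a [^] int i \<otimes> a [^] (m div int n * int n)"
        by (subst i(2)) (simp add: int_pow_mult)
      also have "a [^] (m div int n * int n) = (a [^] (m div int n)) [^] int n"
        by (simp add: int_pow_pow)
      finally show ?thesis by (simp add: int_pow_int)
    qed
    then show "a [^] m \<in> P \<union> U"
    proof (cases "a [^] i \<in> P")
      case False
      then have "(\<lambda>x. a [^] i \<otimes> x) ((a [^] (m div int n)) [^] n) \<in> U" unfolding U_def using i(1) p by blast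
      then show ?thesis using \<open>a [^] m = _\<close> by simp
    qed (use Pm p in simp)
  qed
  ultimately have "P = carrier G - U" using Pc by blast
  then show ?thesis using openin_diff[OF openin_topspace[of \<tau>] Ucl] by (simp add: P_def)
qed

text \<open>For \<open>x\<close> in this set, \<open>{x} \<times> C\<close> lies in the open set of
  pairs with product in \<open>C\<close>; \<open>C\<close> is compact, and the tube lemma gives a
  neighbourhood of \<open>x\<close> with the same property.\<close>

lemma openin_stabilizer:
  assumes "closedin \<tau> C" "openin \<tau> C"
  shows "openin \<tau> {x \<in> carrier G. \<forall>c\<in>C. x \<otimes> c \<in> C}"
proof (subst openin_subopen, intro ballI)
  fix x assume x: "x \<in> {x \<in> carrier G. \<forall>c\<in>C. x \<otimes> c \<in> C}"
  have CG: "C \<subseteq> carrier G" using openin_subset[OF assms(2)] by simp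
  let ?W = "{z \<in> topspace (prod_topology \<tau> \<tau>). (\<lambda>(x, y). x \<otimes> y) z \<in> C}"
  have W: "openin (prod_topology \<tau> \<tau>) ?W" by (rule openin_continuous_map_preimage[OF cont_mult assms(2)])
  have "{x} \<times> C \<subseteq> ?W" using x CG by auto
  then obtain U V where UV: "openin \<tau> U" "x \<in> U" "C \<subseteq> V" "U \<times> V \<subseteq> ?W"
    using tube_lemma_right[OF W closedin_compact_space[OF compact assms(1)], of x] x by auto
  have "u \<otimes> c \<in> C" if "u \<in> U" "c \<in> C" for u c
    using subsetD[OF UV(4), of "(u, c)"] that UV(3) by auto
  then have "U \<subseteq> {x \<in> carrier G. \<forall>c\<in>C. x \<otimes> c \<in> C}" using openin_subset[OF UV(1)] by auto
  then show "\<exists>T. openin \<tau> T \<and> x \<in> T \<and> T \<subseteq> {x \<in> carrier G. \<forall>c\<in>C. x \<otimes> c \<in> C}" using UV by blast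
qed

text \<open>The elements that, like their inverses, map \<open>C\<close> into itself form an open
  subgroup; applying them to \<open>\<one> \<in> C\<close> shows that they lie in
  \<open>C\<close>.\<close>

lemma open_subgroup_in_clopen:
  assumes C: "closedin \<tau> C" "openin \<tau> C" "\<one> \<in> C"
  obtains H where "subgroup H G" "openin \<tau> H" "H \<subseteq> C"
proof
  let ?V = "{x \<in> carrier G. \<forall>c\<in>C. x \<otimes> c \<in> C}"
  let ?H = "?V \<inter> {x \<in> carrier G. inv x \<in> ?V}"
  have CG: "\<And>c. c \<in> C \<Longrightarrow> c \<in> carrier G" using openin_subset[OF C(2)] by auto
  have V: "openin \<tau> ?V" by (rule openin_stabilizer[OF C(1,2)])
  show "openin \<tau> ?H"
    using openin_continuous_map_preimage[OF cont_inv V] by (intro openin_Int V) simp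
  have Vm: "x \<otimes> y \<in> ?V" if "x \<in> ?V" "y \<in> ?V" for x y
    using that CG by (auto simp: m_assoc)
  show "subgroup ?H G"
  proof
    show "?H \<subseteq> carrier G" by blast
    show "\<one> \<in> ?H" using CG by auto
    show "inv x \<in> ?H" if "x \<in> ?H" for x using that by auto
    fix x y assume xy: "x \<in> ?H" "y \<in> ?H"
    then have "inv x \<otimes> inv y \<in> ?V" by (intro Vm) auto
    moreover have "inv (x \<otimes> y) = inv x \<otimes> inv y" using xy by (intro inv_mult) auto
    moreover have "x \<otimes> y \<in> ?V" using xy by (intro Vm) auto
    ultimately show "x \<otimes> y \<in> ?H" by auto
  qed
  show "?H \<subseteq> C"
  proof
    fix x assume "x \<in> ?H"
    then have "x \<in> carrier G" "x \<otimes> \<one> \<in> C" using C(3) by auto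
    then show "x \<in> C" by simp
  qed
qed

text \<open>By compactness the powers of \<open>a\<close> lie in finitely many cosets of
  \<open>H\<close>, so two of them share a coset and some positive power of \<open>a\<close> lies in
  \<open>H\<close>. Density puts every \<open>y\<close> in the coset of a power of \<open>a\<close>,
  and the same exponent works for \<open>y\<close>.\<close>

lemma open_subgroup_exponent:
  assumes H: "subgroup H G" "openin \<tau> H"
  obtains n :: nat where "n > 0" "\<And>y. y \<in> carrier G \<Longrightarrow> y [^] n \<in> H"
proof -
  interpret H: subgroup H G by fact
  have coset: "\<exists>m::int. inv g \<otimes> a [^] m \<in> H" if g: "g \<in> carrier G" for g
  proof -
    let ?U = "{x \<in> topspace \<tau>. inv g \<otimes> x \<in> H}"
    have "openin \<tau> ?U" using g by (intro openin_continuous_map_preimage[OF cont_left H(2)]) simp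
    moreover have "g \<in> ?U" using g by simp
    moreover have "g \<in> \<tau> closure_of (range (\<lambda>n::int. a [^] n))" using dense g by simp
    ultimately obtain y where "y \<in> range (\<lambda>n::int. a [^] n)" "y \<in> ?U" unfolding in_closure_of by meson
    then show ?thesis by (elim imageE) auto
  qed
  define c where "c m = {x \<in> topspace \<tau>. inv (a [^] m) \<otimes> x \<in> H}" for m :: int
  have cH: "inv (a [^] m) \<otimes> x \<in> H" if "x \<in> c m" for x m using that by (simp add: c_def)
  have op: "openin \<tau> (c m)" for m
    unfolding c_def by (intro openin_continuous_map_preimage[OF cont_left H(2)]) simp
  have "topspace \<tau> \<subseteq> \<Union>(range c)"
  proof
    fix g assume "g \<in> topspace \<tau>"
    then have g: "g \<in> carrier G" by simp
    obtain m :: int where "inv g \<otimes> a [^] m \<in> H" using coset[OF g] by blast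
    then have "inv (inv g \<otimes> a [^] m) \<in> H" by (rule H.m_inv_closed)
    then have "g \<in> c m" using g unfolding c_def by (simp add: inv_mult_group)
    then show "g \<in> \<Union>(range c)" by blast
  qed
  moreover have "\<And>U. U \<in> range c \<Longrightarrow> openin \<tau> U" using op by blast
  ultimately obtain \<F> where "finite \<F>" "\<F> \<subseteq> range c" "topspace \<tau> \<subseteq> \<Union>\<F>"
    using compact unfolding compact_space_alt by metis
  then obtain F where F: "finite F" "topspace \<tau> \<subseteq> (\<Union>m\<in>F. c m)"
    by (metis finite_subset_image)
  have "\<exists>m. m \<in> F \<and> inv (a [^] m) \<otimes> a [^] n \<in> H" for n :: nat
    using subsetD[OF F(2), of "a [^] n"] cH by auto
  \<comment> \<open>\<open>r n\<close> labels a coset containing \<open>a [^] n\<close>; with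
    finitely many labels two exponents collide.\<close>
  then obtain r where r: "\<And>n::nat. r n \<in> F" "\<And>n. inv (a [^] r n) \<otimes> a [^] n \<in> H" by metis
  have "\<not> inj_on r (UNIV :: nat set)"
    using finite_subset[OF _ F(1), of "range r"] r(1) finite_imageD[of r UNIV] by auto
  then obtain p q where "r p = r q" "p \<noteq> q" unfolding inj_on_def by auto
  then obtain p q where pq: "r p = r q" "p < q" by (metis linorder_neqE_nat)
  have "inv (inv (a [^] r p) \<otimes> a [^] p) \<otimes> (inv (a [^] r q) \<otimes> a [^] q) \<in> H"
    by (intro H.m_closed H.m_inv_closed r(2))
  also have "inv (inv (a [^] r p) \<otimes> a [^] p) \<otimes> (inv (a [^] r q) \<otimes> a [^] q) = inv (a [^] p) \<otimes> a [^] q"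
    unfolding pq(1) by (simp add: inv_mult_group m_assoc) (simp add: m_assoc[symmetric])
  also have "a [^] q = a [^] p \<otimes> a [^] (q - p)" using pq(2) by (simp add: nat_pow_mult)
  also have "inv (a [^] p) \<otimes> (a [^] p \<otimes> a [^] (q - p)) = a [^] (q - p)"
    by (simp add: m_assoc[symmetric])
  finally have aH: "a [^] (q - p) \<in> H" .
  have powH: "x [^] k \<in> H" if "x \<in> H" for x and k :: nat
    by (induction k) (use that in auto)
  have "y [^] (q - p) \<in> H" if y: "y \<in> carrier G" for y
  proof -
    obtain m :: int where m: "inv y \<otimes> a [^] m \<in> H" using coset[OF y] by blast
    have "(a [^] m) [^] (q - p) = (a [^] (q - p)) [^] m"
      by (simp add: int_pow_pow mult.commute flip: int_pow_int)
    then have "(inv y \<otimes> a [^] m) [^] (q - p) = inv (y [^] (q - p)) \<otimes> (a [^] (q - p)) [^] m"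
      using y by (simp add: nat_pow_distrib nat_pow_inv)
    moreover have "(a [^] (q - p)) [^] m \<in> H"
      by (rule subgroup_int_pow_closed[OF H(1) aH])
    ultimately have "inv (y [^] (q - p)) \<otimes> (a [^] (q - p)) [^] m \<otimes> inv ((a [^] (q - p)) [^] m) \<in> H"
      using powH[OF m] H.m_inv_closed H.m_closed by metis
    then have "inv (y [^] (q - p)) \<in> H" using y by (simp add: m_assoc)
    then have "inv (inv (y [^] (q - p))) \<in> H" by (rule H.m_inv_closed)
    then show ?thesis using y by simp
  qed
  then show ?thesis using that[of "q - p"] pq(2) by simp
qed

text \<open>The \<open>n\<close>-th powers form a clopen set containing \<open>\<one>\<close>, so
  the component consists of \<open>n\<close>-th powers for every \<open>n\<close>. Conversely a
  clopen set around \<open>\<one>\<close> contains an open subgroup into which some power map sends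
  the whole group, so it contains all infinitely divisible elements; in a compact Hausdorff space
  the intersection of these clopen sets is the component.\<close>

lemma identity_component_divisible:
  "connected_component_of_set \<tau> \<one> = {g \<in> carrier G. \<forall>n::nat. n \<ge> 1 \<longrightarrow> (\<exists>h\<in>carrier G. h [^] n = g)}"
proof (intro subset_antisym subsetI CollectI conjI allI impI)
  fix g assume g: "g \<in> connected_component_of_set \<tau> \<one>"
  show "g \<in> carrier G" using g connected_component_of_subset_topspace[of \<tau> \<one>] by auto
  fix n :: nat assume "n \<ge> 1"
  let ?P = "(\<lambda>h. h [^] n) ` carrier G"
  have "connected_component_of_set \<tau> \<one> \<subseteq> ?P \<or> disjnt (connected_component_of_set \<tau> \<one>) ?P"
    using \<open>n \<ge> 1\<close>
    by (intro connectedin_clopen_cases[OF connectedin_connected_component_of closedin_powers openin_powers]) simp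
  moreover have "\<one> \<in> ?P" by (rule image_eqI[of _ _ \<one>]) simp_all
  moreover have "\<one> \<in> connected_component_of_set \<tau> \<one>" by (simp add: connected_component_of_refl)
  ultimately have "g \<in> ?P" using g unfolding disjnt_iff by blast
  then show "\<exists>h\<in>carrier G. h [^] n = g" by blast
next
  fix g assume g: "g \<in> {g \<in> carrier G. \<forall>n::nat. n \<ge> 1 \<longrightarrow> (\<exists>h\<in>carrier G. h [^] n = g)}"
  have "g \<in> C" if C: "\<one> \<in> C" "closedin \<tau> C" "openin \<tau> C" for C
  proof -
    obtain H where H: "subgroup H G" "openin \<tau> H" "H \<subseteq> C"
      using open_subgroup_in_clopen[OF C(2,3,1)] by blast
    obtain n :: nat where n: "n > 0" "\<And>y. y \<in> carrier G \<Longrightarrow> y [^] n \<in> H"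
      using open_subgroup_exponent[OF H(1,2)] by blast
    obtain h where "h \<in> carrier G" "h [^] n = g" using g n(1) by (auto simp: Suc_le_eq)
    then show ?thesis using n(2) H(3) by blast
  qed
  then have "quasi_component_of \<tau> \<one> g" using g by (simp add: quasi_component_of)
  then show "connected_component_of \<tau> \<one> g"
    using quasi_eq_connected_component_of[of \<tau> \<one>] compact Hausdorff by simp
qed

end

section \<open>Divisible elements\<close>

text \<open>Roots are sought in the whole group, not among the divisible elements. The carrier thus
  depends on the multiplication alone and is transported by abstract isomorphisms.\<close>

definition divisible_part :: "('a, 'x) monoid_scheme \<Rightarrow> ('a, 'x) monoid_scheme" where
  "divisible_part G =
     G\<lparr>carrier := {g \<in> carrier G. \<forall>n::nat. n \<ge> 1 \<longrightarrow> (\<exists>h\<in>carrier G. h [^]\<^bsub>G\<^esub> n = g)}\<rparr>"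

lemma divisible_part_mult [simp]: "(\<otimes>\<^bsub>divisible_part G\<^esub>) = (\<otimes>\<^bsub>G\<^esub>)"
  by (simp add: divisible_part_def)

lemma divisible_part_iso:
  assumes "group G" "group H" "G \<cong> H"
  shows "divisible_part G \<cong> divisible_part H"
proof -
  obtain f where f: "f \<in> hom G H" "bij_betw f (carrier G) (carrier H)"
    using assms(3) by (auto simp: is_iso_def Group.iso_def)
  have pow: "f (x [^]\<^bsub>G\<^esub> n) = f x [^]\<^bsub>H\<^esub> n" if "x \<in> carrier G" for x and n :: nat
    using f that assms by (intro hom_nat_pow)
  have im: "f ` carrier G = carrier H" and inj: "inj_on f (carrier G)" using f(2) by (auto simp: bij_betw_def)
  have pc: "x [^]\<^bsub>G\<^esub> n \<in> carrier G" if "x \<in> carrier G" for x and n :: nat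
    using assms(1) that by (intro monoid.nat_pow_closed) (auto simp: group_def)
  have iff: "(\<exists>h\<in>carrier H. h [^]\<^bsub>H\<^esub> n = f g) \<longleftrightarrow> (\<exists>h\<in>carrier G. h [^]\<^bsub>G\<^esub> n = g)"
    if g: "g \<in> carrier G" for g and n :: nat
  proof -
    have "(\<exists>h\<in>carrier H. h [^]\<^bsub>H\<^esub> n = f g) \<longleftrightarrow> (\<exists>h\<in>carrier G. f h [^]\<^bsub>H\<^esub> n = f g)"
      unfolding im[symmetric] by simp
    also have "\<dots> \<longleftrightarrow> (\<exists>h\<in>carrier G. h [^]\<^bsub>G\<^esub> n = g)"
      using inj_on_eq_iff[OF inj pc g] by (intro bex_cong refl) (simp add: pow[symmetric])
    finally show ?thesis .
  qed
  show ?thesis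
  proof (rule is_isoI, unfold iso_iff, intro conjI)
    show "f ` carrier (divisible_part G) = carrier (divisible_part H)"
      unfolding divisible_part_def using iff by (auto simp: im[symmetric])
    then show "f \<in> hom (divisible_part G) (divisible_part H)"
      using f(1) by (auto simp: hom_def divisible_part_def)
    show "inj_on f (carrier (divisible_part G))"
      by (rule inj_on_subset[OF inj]) (auto simp: divisible_part_def)
  qed
qed

lemma wreath_pow_snd:
  assumes "x \<in> carrier (wreath H k lam)"
  shows "snd (x [^]\<^bsub>wreath H k lam\<^esub> (n::nat)) = snd x [^]\<^bsub>sym_group k\<^esub> n"
proof (induction n)
  case (Suc n)
  have "snd (y \<otimes>\<^bsub>wreath H k lam\<^esub> x) = snd y \<circ> snd x" for y
    by (cases x, cases y) (simp add: wreath_mult)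
  then show ?case using Suc by (simp add: sym_group_def)
qed (simp add: wreath_one sym_group_def)

definition base_embedding :: "nat \<Rightarrow> (nat \<Rightarrow> 'a) \<Rightarrow> (nat \<Rightarrow> 'a \<times> int) \<times> (nat \<Rightarrow> nat)" where
  "base_embedding k f = (\<lambda>i\<in>{1..k}. (f i, 0), id)"

lemma base_embedding_eq: "base_embedding k f = base_embedding k g \<longleftrightarrow> (\<forall>i\<in>{1..k}. f i = g i)"
  unfolding base_embedding_def prod.inject fun_eq_iff by (auto simp: restrict_def)

context
  fixes G :: "'a monoid" (structure)
  assumes comm_group_G: "comm_group G"
begin

interpretation comm_group G by (rule comm_group_G)

lemma base_embedding_closed:
  assumes "\<And>i. i \<in> {1..k} \<Longrightarrow> f i \<in> carrier G"
  shows "base_embedding k f \<in> carrier (wreath (inversion_extension G) k lam)"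
  unfolding base_embedding_def wreath_carrier inversion_extension_carrier
  using assms by (intro SigmaI) (auto simp: permutes_id)

lemma base_embedding_mult:
  "base_embedding k f \<otimes>\<^bsub>wreath (inversion_extension G) k lam\<^esub> base_embedding k g
    = base_embedding k (\<lambda>i. f i \<otimes> g i)"
  unfolding base_embedding_def wreath_mult
  by (auto simp: inversion_extension_mult inv_id fun_eq_iff)

lemma base_embedding_pow:
  "base_embedding k f [^]\<^bsub>wreath (inversion_extension G) k lam\<^esub> (n::nat) = base_embedding k (\<lambda>i. f i [^] n)"
proof (induction n)
  case 0
  show ?case by (simp add: wreath_one base_embedding_def inversion_extension_one)
next
  case (Suc n)
  then show ?case by (simp add: base_embedding_mult)
qed

text \<open>The exponent \<open>fact k\<close> is the order of the symmetric group and removes the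
  permutation. The factor two removes the signs, as squares in the inversion extension have sign
  \<open>0\<close>.\<close>

lemma power_in_base:
  assumes y: "y \<in> carrier (wreath (inversion_extension G) k lam)"
  obtains f where "\<And>i. i \<in> {1..k} \<Longrightarrow> f i \<in> carrier G"
    "y [^]\<^bsub>wreath (inversion_extension G) k lam\<^esub> (fact k * 2 :: nat) = base_embedding k f"
proof -
  let ?W = "wreath (inversion_extension G) k lam"
  interpret W: group ?W by (intro group_wreath group_inversion_extension comm_group_axioms)
  interpret S: group "sym_group k" by (rule sym_group_is_group)
  have yS: "snd y \<in> carrier (sym_group k)" using y by (auto simp: wreath_carrier sym_group_def)
  define z where "z = y [^]\<^bsub>?W\<^esub> (fact k :: nat)"
  have "snd z = id"
    using S.pow_order_eq_1[OF yS] by (simp add: z_def wreath_pow_snd[OF y] order_def sym_group_card_carrier)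
      (simp add: sym_group_def)
  moreover have zW: "z \<in> carrier ?W" unfolding z_def using y by simp
  ultimately obtain f where z: "z = (f, id)" and f: "f \<in> (\<Pi>\<^sub>E i\<in>{1..k}. carrier (inversion_extension G))"
    unfolding wreath_carrier by (cases z) auto
  define g where "g i = fst (f i \<otimes>\<^bsub>inversion_extension G\<^esub> f i)" for i
  have c: "f i \<otimes>\<^bsub>inversion_extension G\<^esub> f i = (g i, 0)" "g i \<in> carrier G" if i: "i \<in> {1..k}" for i
  proof -
    obtain h e where h: "f i = (h, e)" "h \<in> carrier G" "e = 0 \<or> e = 1"
      using PiE_mem[OF f i] unfolding inversion_extension_carrier by (cases "f i") auto
    show "f i \<otimes>\<^bsub>inversion_extension G\<^esub> f i = (g i, 0)" "g i \<in> carrier G"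
      unfolding g_def h(1) using h(2,3) by (auto simp: inversion_extension_mult)
  qed
  have "y [^]\<^bsub>?W\<^esub> (fact k * 2 :: nat) = z \<otimes>\<^bsub>?W\<^esub> z"
    using y zW by (simp add: z_def W.nat_pow_mult mult_2_right)
  also have "\<dots> = base_embedding k g"
    using c by (auto simp: z wreath_mult base_embedding_def inv_id fun_eq_iff)
  finally show ?thesis using that[of g] c(2) by simp
qed

text \<open>Roots of base elements can be taken in each coordinate. Conversely, a root of order
  \<open>fact k * 2 * n\<close> exhibits a divisible element as the \<open>n\<close>-th power of a
  base element, for every \<open>n\<close>.\<close>

lemma divisible_part_wreath:
  "group_power (divisible_part G) k \<cong> divisible_part (wreath (inversion_extension G) k lam)"
proof (rule is_isoI, unfold iso_iff, intro conjI)
  let ?W = "wreath (inversion_extension G) k lam" and ?b = "base_embedding k"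
  interpret W: group ?W by (intro group_wreath group_inversion_extension comm_group_axioms)
  let ?D = "divisible_part G"
  have carr: "carrier (group_power ?D k) = (\<Pi>\<^sub>E i\<in>{1..k}. carrier ?D)" by (simp add: group_power_def)
  show im: "?b ` carrier (group_power ?D k) = carrier (divisible_part ?W)"
  proof (intro subset_antisym subsetI)
    fix x assume "x \<in> ?b ` carrier (group_power ?D k)"
    then obtain f where x: "x = ?b f" and f: "f \<in> (\<Pi>\<^sub>E i\<in>{1..k}. carrier ?D)" unfolding carr by (elim imageE)
    have fG: "f i \<in> carrier G" "\<forall>n::nat. n \<ge> 1 \<longrightarrow> (\<exists>h\<in>carrier G. h [^] n = f i)" if "i \<in> {1..k}" for i
      using PiE_mem[OF f that] by (simp_all add: divisible_part_def)
    have "\<exists>y\<in>carrier ?W. y [^]\<^bsub>?W\<^esub> n = x" if "n \<ge> 1" for n :: nat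
    proof -
      have "\<forall>i\<in>{1..k}. \<exists>h\<in>carrier G. h [^] n = f i" using fG(2) that by blast
      then obtain h where h: "\<forall>i\<in>{1..k}. h i \<in> carrier G \<and> h i [^] n = f i" by metis
      have "?b h [^]\<^bsub>?W\<^esub> n = x" unfolding x base_embedding_pow base_embedding_eq using h by blast
      then show ?thesis using base_embedding_closed[of k h lam] h by blast
    qed
    then show "x \<in> carrier (divisible_part ?W)"
      using base_embedding_closed[of k f lam] fG(1) by (simp add: divisible_part_def x)
  next
    fix x assume "x \<in> carrier (divisible_part ?W)"
    then have x: "\<And>n::nat. n \<ge> 1 \<Longrightarrow> \<exists>y\<in>carrier ?W. y [^]\<^bsub>?W\<^esub> n = x" by (simp add: divisible_part_def)
    have ex: "\<exists>f. (\<forall>i\<in>{1..k}. f i \<in> carrier G) \<and> x = ?b (\<lambda>i. f i [^] n)" if n: "n \<ge> 1" for n :: nat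
    proof -
      obtain y where y: "y \<in> carrier ?W" "y [^]\<^bsub>?W\<^esub> (fact k * 2 * n) = x"
        using x[of "fact k * 2 * n"] n by auto
      obtain f where f: "\<And>i. i \<in> {1..k} \<Longrightarrow> f i \<in> carrier G" "y [^]\<^bsub>?W\<^esub> (fact k * 2 :: nat) = ?b f"
        using power_in_base[OF y(1)] by blast
      have "x = ?b f [^]\<^bsub>?W\<^esub> n" using y by (simp add: W.nat_pow_pow flip: f(2))
      then show ?thesis unfolding base_embedding_pow using f(1) by blast
    qed
    \<comment> \<open>The case \<open>n = 1\<close> places \<open>x\<close> itself in the base; its
      coordinates are then compared with those of the roots for each \<open>n\<close>.\<close>
    from ex[of 1] obtain f where f: "\<forall>i\<in>{1..k}. f i \<in> carrier G" "x = ?b (\<lambda>i. f i [^] (1::nat))" by auto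
    then have xf: "x = ?b f" by (simp add: base_embedding_eq)
    have "f i \<in> carrier ?D" if i: "i \<in> {1..k}" for i
    proof -
      have "\<exists>h\<in>carrier G. h [^] n = f i" if n: "n \<ge> 1" for n :: nat
      proof -
        obtain h where h: "\<forall>i\<in>{1..k}. h i \<in> carrier G" "x = ?b (\<lambda>i. h i [^] n)" using ex[OF n] by blast
        have "\<forall>i\<in>{1..k}. f i = h i [^] n" using h(2) unfolding xf base_embedding_eq .
        then show ?thesis using h(1) i by auto
      qed
      then show ?thesis using f(1) i by (simp add: divisible_part_def)
    qed
    then have "restrict f {1..k} \<in> carrier (group_power ?D k)" unfolding carr by auto
    moreover have "x = ?b (restrict f {1..k})" unfolding xf base_embedding_eq by simp
    ultimately show "x \<in> ?b ` carrier (group_power ?D k)" by (intro image_eqI)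
  qed
  show "?b \<in> hom (group_power ?D k) (divisible_part ?W)"
    unfolding hom_def
  proof (intro CollectI conjI ballI funcsetI)
    show "?b f \<in> carrier (divisible_part ?W)" if "f \<in> carrier (group_power ?D k)" for f
      using that unfolding im[symmetric] by (rule imageI)
    show "?b (f \<otimes>\<^bsub>group_power ?D k\<^esub> g) = ?b f \<otimes>\<^bsub>divisible_part ?W\<^esub> ?b g" for f g
      unfolding divisible_part_mult base_embedding_mult base_embedding_eq by (simp add: group_power_def)
  qed
  show "inj_on ?b (carrier (group_power ?D k))"
    by (intro inj_onI, unfold carr base_embedding_eq) (auto intro: PiE_ext)
qed

end

lemma (in monothetic) identity_component_eq_divisible_part: "identity_component G \<tau> = divisible_part G"
  by (simp add: identity_component_def divisible_part_def identity_component_divisible)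

lemma mult_closed_group_power: "mult_closed H \<Longrightarrow> mult_closed (group_power H k)"
  by (auto simp: mult_closed_def group_power_def PiE_iff)

lemma (in comm_group) mult_closed_divisible_part: "mult_closed (divisible_part G)"
  unfolding mult_closed_def
proof (intro ballI)
  fix x y assume xy: "x \<in> carrier (divisible_part G)" "y \<in> carrier (divisible_part G)"
  have "\<exists>h\<in>carrier G. h [^] n = x \<otimes> y" if "n \<ge> 1" for n :: nat
  proof -
    have "\<exists>g\<in>carrier G. g [^] n = x" "\<exists>h\<in>carrier G. h [^] n = y"
      using xy that by (simp_all add: divisible_part_def)
    then obtain g h where "g \<in> carrier G" "g [^] n = x" "h \<in> carrier G" "h [^] n = y" by (elim bexE)
    then show ?thesis using nat_pow_distrib[of g h n] by (intro bexI[of _ "g \<otimes> h"]) simp_all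
  qed
  then show "x \<otimes>\<^bsub>divisible_part G\<^esub> y \<in> carrier (divisible_part G)"
    using xy by (simp add: divisible_part_def)
qed

lemma identity_components_iso:
  assumes G: "monothetic_data G \<tau> \<mu> a" "weights k lam"
    and G': "monothetic_data G' \<tau>' \<mu>' a'" "weights k' lam'"
    and iso: "aut_graphing (convex_combination k lam (\<lambda>_. group_graphing G \<mu> a)) \<cong>
      aut_graphing (convex_combination k' lam' (\<lambda>_. group_graphing G' \<mu>' a'))"
  shows "group_power (identity_component G \<tau>) k \<cong> group_power (identity_component G' \<tau>') k'"
proof -
  interpret G: monothetic G \<tau> \<mu> a by (rule monotheticI[OF G(1)])
  interpret G': monothetic G' \<tau>' \<mu>' a' by (rule monotheticI[OF G'(1)])
  let ?W = "wreath (inversion_extension G) k lam" and ?W' = "wreath (inversion_extension G') k' lam'"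
  have "?W \<cong> ?W'"
    using G.wreath_iso_group_graphing[OF G(2)] iso G'.group_graphing_iso_wreath[OF G'(2)]
    by (blast intro: iso_trans)
  then have D: "divisible_part ?W \<cong> divisible_part ?W'"
    by (intro divisible_part_iso G.group_wreath_inversion_extension G'.group_wreath_inversion_extension)
  have "group_power (divisible_part G) k \<cong> divisible_part ?W" by (rule divisible_part_wreath[OF G.comm_group_G])
  also note D
  also have "divisible_part ?W' \<cong> group_power (divisible_part G') k'"
    by (intro iso_sym_closed[OF _ divisible_part_wreath[OF G'.comm_group_G]]) (rule mult_closed_group_power[OF G'.mult_closed_divisible_part])
  finally show ?thesis by (simp only: G.identity_component_eq_divisible_part G'.identity_component_eq_divisible_part)
qed

section \<open>Tori\<close>

lemma comm_group_circle: "comm_group circle_group"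
proof (rule comm_groupI)
  fix x assume "x \<in> carrier circle_group"
  then show "\<exists>y\<in>carrier circle_group. y \<otimes>\<^bsub>circle_group\<^esub> x = \<one>\<^bsub>circle_group\<^esub>"
    by (intro bexI[of _ "inverse x"]) (auto simp: circle_group_def norm_inverse intro!: left_inverse)
qed (auto simp: circle_group_def norm_mult)

lemma group_circle: "group circle_group"
  using comm_group_circle by (rule comm_group.axioms)

lemma inv_circle: "x \<in> carrier circle_group \<Longrightarrow> inv\<^bsub>circle_group\<^esub> x = inverse x"
  by (intro group.inv_equality group_circle) (auto simp: circle_group_def norm_inverse intro!: left_inverse)

lemma group_torus: "group (torus_group d)"
  by (simp add: torus_group_def group_circle)

lemma topspace_torus: "topspace (torus_topology d) = carrier (torus_group d)"
  by (simp add: torus_topology_def torus_group_def circle_group_def)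

lemma continuous_map_torus:
  "continuous_map X (torus_topology d) f \<longleftrightarrow>
    f \<in> topspace X \<rightarrow> extensional {..<d} \<and> (\<forall>i<d. continuous_map X (top_of_set (sphere 0 1)) (\<lambda>x. f x i))"
  unfolding torus_topology_def continuous_map_componentwise by (auto simp: image_subset_iff Pi_iff)

lemma continuous_map_torus_coordinate:
  "i < d \<Longrightarrow> continuous_map (torus_topology d) (top_of_set (sphere 0 1)) (\<lambda>x. x i)"
  unfolding torus_topology_def by (rule continuous_map_product_projection) simp

lemma compact_metrizable_group_torus: "compact_metrizable_group (torus_group d) (torus_topology d)"
  unfolding compact_metrizable_group_def
proof (intro conjI group_torus topspace_torus)
  show "compact_space (torus_topology d)"
    unfolding torus_topology_def by (simp add: compact_space_product_topology compact_space_subtopology compactin_euclidean_iff)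
  show "metrizable_space (torus_topology d)"
    unfolding torus_topology_def metrizable_space_product_topology
    by (intro disjI2 conjI ballI metrizable_space_subtopology metrizable_space_euclidean countable_finite) auto
  have cm: "continuous_map X (top_of_set (sphere 0 1)) (\<lambda>z. f z * g z)"
    if "continuous_map X (top_of_set (sphere 0 1)) f" "continuous_map X (top_of_set (sphere 0 1)) g"
    for X and f g :: "_ \<Rightarrow> complex"
  proof -
    have "continuous_map X euclidean (\<lambda>z. f z * g z)"
      using that[THEN continuous_map_into_fulltopology] by (simp add: continuous_map_atin tendsto_mult)
    then show ?thesis
      using that unfolding continuous_map_in_subtopology by (auto simp: norm_mult image_subset_iff Pi_iff)
  qed
  have ci: "continuous_map X (top_of_set (sphere 0 1)) (\<lambda>z. inverse (f z))"
    if "continuous_map X (top_of_set (sphere 0 1)) f" for X and f :: "_ \<Rightarrow> complex"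
  proof -
    have f: "f \<in> topspace X \<rightarrow> sphere 0 1" using that by (auto simp: continuous_map_in_subtopology)
    then have "f x \<noteq> 0" if "x \<in> topspace X" for x using funcset_mem[OF f that] by auto
    then have "continuous_map X euclidean (\<lambda>z. inverse (f z))"
      using that[THEN continuous_map_into_fulltopology] by (simp add: continuous_map_atin tendsto_inverse)
    then show ?thesis
      using f unfolding continuous_map_in_subtopology by (auto simp: norm_inverse image_subset_iff Pi_iff)
  qed
  show "continuous_map (prod_topology (torus_topology d) (torus_topology d)) (torus_topology d)
    (\<lambda>(x, y). x \<otimes>\<^bsub>torus_group d\<^esub> y)"
    unfolding continuous_map_torus
  proof (intro conjI allI impI)
    fix i assume i: "i < d"
    have "continuous_map (prod_topology (torus_topology d) (torus_topology d)) (top_of_set (sphere 0 1))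
      (\<lambda>z. fst z i * snd z i)"
      using continuous_map_compose[OF continuous_map_fst continuous_map_torus_coordinate[OF i]]
        continuous_map_compose[OF continuous_map_snd continuous_map_torus_coordinate[OF i]]
      by (intro cm) (simp_all add: o_def)
    then show "continuous_map (prod_topology (torus_topology d) (torus_topology d)) (top_of_set (sphere 0 1))
      (\<lambda>z. (case z of (x, y) \<Rightarrow> x \<otimes>\<^bsub>torus_group d\<^esub> y) i)"
      using i by (simp add: case_prod_unfold torus_group_def circle_group_def)
  qed (auto simp: torus_group_def)
  show "continuous_map (torus_topology d) (torus_topology d) (\<lambda>x. inv\<^bsub>torus_group d\<^esub> x)"
  proof (rule continuous_map_eq)
    show "continuous_map (torus_topology d) (torus_topology d) (\<lambda>x. \<lambda>i\<in>{..<d}. inverse (x i))"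
      unfolding continuous_map_torus using ci[OF continuous_map_torus_coordinate] by auto
    fix x assume "x \<in> topspace (torus_topology d)"
    then have x: "x \<in> (\<Pi>\<^sub>E i\<in>{..<d}. carrier circle_group)" unfolding topspace_torus by (simp add: torus_group_def)
    then show "(\<lambda>i\<in>{..<d}. inverse (x i)) = inv\<^bsub>torus_group d\<^esub> x"
      unfolding torus_group_def using inv_product_group[OF x group_circle] PiE_mem[OF x]
      by (simp add: restrict_def inv_circle fun_eq_iff)
  qed
qed

text \<open>A coordinate maps the torus onto the circle, which is connected and has two different
  points, so it cannot be finite.\<close>

lemma infinite_torus: "d \<ge> 1 \<Longrightarrow> infinite (carrier (torus_group d))"
proof
  assume d: "d \<ge> 1" and f: "finite (carrier (torus_group d))"
  have "(\<lambda>x. x 0) ` carrier (torus_group d) = sphere 0 1"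
  proof (intro subset_antisym subsetI)
    fix z :: complex assume z: "z \<in> sphere 0 1"
    then have "(\<lambda>i\<in>{..<d}. z) \<in> carrier (torus_group d)" by (auto simp: torus_group_def circle_group_def)
    then show "z \<in> (\<lambda>x. x 0) ` carrier (torus_group d)"
      using d by (intro image_eqI[of _ _ "\<lambda>i\<in>{..<d}. z"]) simp_all
  qed (use d in \<open>force simp: torus_group_def circle_group_def\<close>)
  then have "finite (sphere (0::complex) 1)" using f by (metis finite_imageI)
  moreover have "connected (sphere (0::complex) 1)" by (rule connected_sphere) simp
  ultimately obtain z where "sphere 0 1 \<subseteq> {z :: complex}" by (metis connected_finite_iff_sing empty_subsetI order_refl)
  then show False using subsetD[of "sphere 0 1" "{z}" 1] subsetD[of "sphere 0 1" "{z}" "-1"] by simp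
qed

lemma identity_component_torus: "identity_component (torus_group d) (torus_topology d) = torus_group d"
proof -
  have "connected (sphere (0::complex) 1)" by (rule connected_sphere) simp
  then have "connected_space (torus_topology d)"
    unfolding torus_topology_def connected_space_product_topology by (simp add: connectedin_def flip: connectedin_iff_connected)
  moreover have "\<one>\<^bsub>torus_group d\<^esub> \<in> topspace (torus_topology d)"
    unfolding topspace_torus using group_torus by (simp add: group_def)
  ultimately have "connected_component_of_set (torus_topology d) \<one>\<^bsub>torus_group d\<^esub> = carrier (torus_group d)"
    using connected_component_of_subset_topspace[of "torus_topology d" "\<one>\<^bsub>torus_group d\<^esub>"]
    by (auto simp: connected_space_iff_connected_component topspace_torus)
  then show ?thesis by (simp add: identity_component_def)
qed

text \<open>The identity is included, so that the count is multiplicative over products.\<close>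

definition involutions :: "('a, 'x) monoid_scheme \<Rightarrow> 'a set" where
  "involutions G = {x \<in> carrier G. x \<otimes>\<^bsub>G\<^esub> x = \<one>\<^bsub>G\<^esub>}"

lemma card_involutions_iso:
  assumes "group G" "group H" "G \<cong> H"
  shows "card (involutions G) = card (involutions H)"
proof -
  obtain f where f: "f \<in> hom G H" "bij_betw f (carrier G) (carrier H)"
    using assms(3) by (auto simp: is_iso_def Group.iso_def)
  have one: "f \<one>\<^bsub>G\<^esub> = \<one>\<^bsub>H\<^esub>" using hom_one[OF f(1) assms(1,2)] .
  have im: "f ` carrier G = carrier H" and inj: "inj_on f (carrier G)" using f(2) by (auto simp: bij_betw_def)
  have iff: "f x \<otimes>\<^bsub>H\<^esub> f x = \<one>\<^bsub>H\<^esub> \<longleftrightarrow> x \<otimes>\<^bsub>G\<^esub> x = \<one>\<^bsub>G\<^esub>" if x: "x \<in> carrier G" for x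
  proof -
    interpret G: group G by fact
    have "f x \<otimes>\<^bsub>H\<^esub> f x = f (x \<otimes>\<^bsub>G\<^esub> x)" using f(1) x by (simp add: hom_mult)
    then show ?thesis using inj_on_eq_iff[OF inj, of "x \<otimes>\<^bsub>G\<^esub> x" "\<one>\<^bsub>G\<^esub>"] x one by simp
  qed
  have "f ` involutions G = involutions H"
    unfolding involutions_def using iff by (auto simp: im[symmetric])
  moreover have "inj_on f (involutions G)"
    by (rule inj_on_subset[OF inj]) (auto simp: involutions_def)
  ultimately show ?thesis by (metis card_image)
qed

lemma involutions_product_group:
  "involutions (product_group I G) = (\<Pi>\<^sub>E i\<in>I. involutions (G i))"
  by (auto simp: involutions_def PiE_iff extensional_def fun_eq_iff restrict_def)

lemma card_involutions_torus_power:
  "card (involutions (group_power (torus_group d) k)) = (2 ^ d) ^ k"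
proof -
  have "involutions circle_group = {1, -1}"
    by (auto simp: involutions_def circle_group_def square_eq_1_iff)
  then show ?thesis
    by (simp add: group_power_def torus_group_def involutions_product_group card_PiE numeral_2_eq_2)
qed

text \<open>The equation \<open>x \<otimes> x = \<one>\<close> has \<open>2 ^ (d * k)\<close>
  solutions in the power, and for \<open>d \<ge> 1\<close> this number determines
  \<open>k\<close>.\<close>

lemma torus_powers_not_iso:
  assumes "d \<ge> 1" "k \<noteq> k'"
  shows "\<not> group_power (torus_group d) k \<cong> group_power (torus_group d) k'"
proof
  assume "group_power (torus_group d) k \<cong> group_power (torus_group d) k'"
  then have "((2::nat) ^ d) ^ k = (2 ^ d) ^ k'"
    using card_involutions_iso[of "group_power (torus_group d) k" "group_power (torus_group d) k'"]
    by (simp add: card_involutions_torus_power) (simp add: group_power_def group_torus)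
  then show False using assms by (simp add: power_inject_exp flip: power_mult)
qed

lemma local_global_equivalent_group_graphings:
  assumes G: "monothetic_data G \<tau> \<mu> a" "weights k lam"
    and G': "monothetic_data G' \<tau>' \<mu>' a'" "weights k' lam'"
  shows "local_global_equivalent (convex_combination k lam (\<lambda>_. group_graphing G \<mu> a))
    (convex_combination k' lam' (\<lambda>_. group_graphing G' \<mu>' a'))"
proof -
  interpret G: monothetic G \<tau> \<mu> a by (rule monotheticI[OF G(1)])
  interpret G': monothetic G' \<tau>' \<mu>' a' by (rule monotheticI[OF G'(1)])
  obtain u where E: "ergodic_graph (vmeasure (group_graphing G \<mu> a)) (edges (group_graphing G \<mu> a))
    (\<lambda>x. a \<otimes>\<^bsub>G\<^esub> x) (\<lambda>x. inv\<^bsub>G\<^esub> a \<otimes>\<^bsub>G\<^esub> x) (carrier G) u" by (rule G.ergodic_graph_group)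
  obtain u' where E': "ergodic_graph (vmeasure (group_graphing G' \<mu>' a')) (edges (group_graphing G' \<mu>' a'))
    (\<lambda>x. a' \<otimes>\<^bsub>G'\<^esub> x) (\<lambda>x. inv\<^bsub>G'\<^esub> a' \<otimes>\<^bsub>G'\<^esub> x) (carrier G') u'" by (rule G'.ergodic_graph_group)
  show ?thesis by (rule local_global_equivalent_ergodic[OF E E' G(2) G'(2)])
qed

theorem theorem1p7:
  shows
   "((\<forall>(M :: 'a measure) T k lam (M' :: 'b measure) T' k' lam' X X'.
        ergodic_system M T \<and> weights k lam \<and> admissible M T X \<and>
        ergodic_system M' T' \<and> weights k' lam' \<and> admissible M' T' X' \<longrightarrow>
        local_global_equivalent
          (convex_combination k lam (\<lambda>_. cycle_graphing M T X))
          (convex_combination k' lam' (\<lambda>_. cycle_graphing M' T' X'))) \<and>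
     (\<forall>(M :: 'a measure) T k lam.
        ergodic_system M T \<and> weights k lam \<longrightarrow>
        (\<exists>X. admissible M T X) \<and>
        (\<forall>X. admissible M T X \<longrightarrow>
          aut_graphing (convex_combination k lam (\<lambda>_. cycle_graphing M T X))
            \<cong> wreath (aut_pm M T) k lam)))
    \<and>
    ((\<forall>(G :: 'g monoid) \<tau> \<mu> a k lam (G' :: 'h monoid) \<tau>' \<mu>' a' k' lam'.
        monothetic_data G \<tau> \<mu> a \<and> weights k lam \<and>
        monothetic_data G' \<tau>' \<mu>' a' \<and> weights k' lam' \<longrightarrow>
        local_global_equivalent
          (convex_combination k lam (\<lambda>_. group_graphing G \<mu> a))
          (convex_combination k' lam' (\<lambda>_. group_graphing G' \<mu>' a'))) \<and>
     (\<forall>(G :: 'g monoid) \<tau> \<mu> a k lam.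
        monothetic_data G \<tau> \<mu> a \<and> weights k lam \<longrightarrow>
        comm_group G \<and>
        aut_graphing (convex_combination k lam (\<lambda>_. group_graphing G \<mu> a))
          \<cong> wreath (inversion_extension G) k lam))
    \<and>
    ((\<forall>(G :: 'g monoid) \<tau> \<mu> a k lam (G' :: 'h monoid) \<tau>' \<mu>' a' k' lam'.
        monothetic_data G \<tau> \<mu> a \<and> weights k lam \<and>
        monothetic_data G' \<tau>' \<mu>' a' \<and> weights k' lam' \<and>
        \<not> (group_power (identity_component G \<tau>) k \<cong>
           group_power (identity_component G' \<tau>') k') \<longrightarrow>
        \<not> (aut_graphing (convex_combination k lam (\<lambda>_. group_graphing G \<mu> a)) \<cong>
           aut_graphing (convex_combination k' lam' (\<lambda>_. group_graphing G' \<mu>' a')))) \<and>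
     (\<forall>d k k'. d \<ge> 1 \<and> k \<ge> 1 \<and> k' \<ge> 1 \<and> k \<noteq> k' \<longrightarrow>
        \<not> (group_power (identity_component (torus_group d) (torus_topology d)) k \<cong>
           group_power (identity_component (torus_group d) (torus_topology d)) k')) \<and>
     (\<forall>d \<mu> a a' k lam k' lam'.
        d \<ge> 1 \<and> haar_prob (torus_group d) (torus_topology d) \<mu> \<and>
        topological_generator (torus_group d) (torus_topology d) a \<and>
        topological_generator (torus_group d) (torus_topology d) a' \<and>
        weights k lam \<and> weights k' lam' \<and> k \<noteq> k' \<longrightarrow>
        \<not> (aut_graphing (convex_combination k lam (\<lambda>_. group_graphing (torus_group d) \<mu> a)) \<cong>
           aut_graphing (convex_combination k' lam' (\<lambda>_. group_graphing (torus_group d) \<mu> a')))))"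
proof (intro conjI allI impI, goal_cases)
  case 1
  then show ?case using cycle_graphings_equivalent by blast
next
  case 2
  then show ?case using admissible_exists by blast
next
  case 3
  then show ?case using cycle_graphings by blast
next
  case 4
  then show ?case by (elim conjE) (rule local_global_equivalent_group_graphings)
next
  case 5
  then show ?case by (elim conjE) (rule monothetic.comm_group_G[OF monotheticI])
next
  case 6
  then show ?case by (elim conjE) (rule monothetic.group_graphing_iso_wreath[OF monotheticI])
next
  case 7
  then show ?case by (metis identity_components_iso)
next
  case 8
  then show ?case using torus_powers_not_iso by (simp add: identity_component_torus)
next
  case (9 d \<mu> a a' k lam k' lam')
  then have "monothetic_data (torus_group d) (torus_topology d) \<mu> a" "monothetic_data (torus_group d) (torus_topology d) \<mu> a'"
    unfolding monothetic_data_def using compact_metrizable_group_torus infinite_torus by blast+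
  then show ?case
    using 9 torus_powers_not_iso identity_components_iso identity_component_torus by metis
qed

end
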